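(* Work in ZFC and assume that every real is an element of a countable transitive model of ZFC. Then the potentialist system $\mathcal{C}$ of countable transitive models of ZFC provides a potentialist account of $H_{\omega_1}$ (the hereditarily countable sets). Every world $W\in\mathcal{C}$ obeys $$\mathrm{S4.2}=\mathrm{Val}_{\mathcal{C}}(W,\mathcal{L}_{\in,W})\subseteq\mathrm{Val}_{\mathcal{C}}(W,\mathcal{L}_\in)\subseteq\mathrm{S5}.$$ Some worlds $W\in\mathcal{C}$ have $\mathrm{S4.2}=\mathrm{Val}_{\mathcal{C}}(W,\mathcal{L}_{\in,W})=\mathrm{Val}_{\mathcal{C}}(W,\mathcal{L}_\in)$. And for any particular countable language $\mathcal{L}^+$ extending $\mathcal{L}_\in$ (interpreted in every world of $\mathcal{C}$), some world $W\in\mathcal{C}$ has $\mathrm{Val}_{\mathcal{C}}(W,\mathcal{L}^+)=\mathrm{S5}$.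
   Context: $\mathcal{C}$ is the potentialist system whose worlds are the countable transitive models of ZFC, with $W$ accessing $U$ iff $W\subseteq U$; $\Diamond\varphi$ at $W$ means $\varphi$ holds at some accessible world, $\Box\varphi$ at all; quantifiers range over the current world. A potentialist system provides a potentialist account of a structure $N$ if every world is a substructure of $N$ and every world accesses, for each individual $a$ of $N$, some world containing $a$. $\mathcal{L}_\in$ is the language of set theory, subscript $W$ allows parameters from $W$; $\mathrm{Val}_{\mathcal{C}}(W,\mathcal{L}')$ is the set of propositional modal formulas all of whose substitution instances by $\mathcal{L}'$-sentences are true at $W$. *)

theory Defs
  imports "HOL-Library.Countable_Set_Type"
begin

section \<open>The hereditarily countable sets\<close>

text \<open>The initial algebra of the countable powerset functor: every element is determined by the
  countable set of its members, and membership is well-founded. So the type is a copy of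
  \<open>H_{\<omega>_1}\<close>, with equality being extensional.\<close>

datatype hc = HC (members: "hc cset")

definition elts :: "hc \<Rightarrow> hc set" where
  "elts x = rcset (members x)"

definition hmem :: "hc \<Rightarrow> hc \<Rightarrow> bool" where
  "hmem x y \<longleftrightarrow> x \<in> elts y"

lemma hc_extensional: "x = y \<longleftrightarrow> (\<forall>z. hmem z x \<longleftrightarrow> hmem z y)"
  by (metis elts_def hmem_def hc.expand rcset_inject subsetI subset_antisym)

lemma hc_collect: "countable A \<Longrightarrow> \<exists>x. elts x = A"
  by (metis elts_def hc.sel mem_Collect_eq rcset_cases cset.acset_inverse)

text \<open>The von Neumann natural numbers.\<close>

primrec hc_nat :: "nat \<Rightarrow> hc" where
  "hc_nat 0 = HC cempty"
| "hc_nat (Suc n) = HC (cinsert (hc_nat n) (members (hc_nat n)))"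

text \<open>Reals in the sense of set theory: subsets of \<open>\<omega>\<close>.\<close>

definition is_real :: "hc \<Rightarrow> bool" where
  "is_real x \<longleftrightarrow> elts x \<subseteq> range hc_nat"


section \<open>First-order languages extending the language of set theory\<close>

text \<open>Membership and equality are always present; \<open>'f\<close> and \<open>'r\<close> are further function and
  relation symbols. A symbol is used with the arity prescribed by a signature
  \<open>Fs :: ('f \<times> nat) set\<close>, \<open>Rs :: ('r \<times> nat) set\<close>; both empty gives the language of set theory.\<close>

datatype 'f trm = Var nat | Fun 'f "'f trm list"

datatype ('f, 'r) fm =
    Eq "'f trm" "'f trm"
  | Mem "'f trm" "'f trm"
  | Rel 'r "'f trm list"
  | Neg "('f, 'r) fm"
  | Conj "('f, 'r) fm" "('f, 'r) fm"
  | Forall nat "('f, 'r) fm"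

abbreviation Disj :: "('f, 'r) fm \<Rightarrow> ('f, 'r) fm \<Rightarrow> ('f, 'r) fm" where
  "Disj p q \<equiv> Neg (Conj (Neg p) (Neg q))"

abbreviation Impl :: "('f, 'r) fm \<Rightarrow> ('f, 'r) fm \<Rightarrow> ('f, 'r) fm" where
  "Impl p q \<equiv> Neg (Conj p (Neg q))"

abbreviation Iff :: "('f, 'r) fm \<Rightarrow> ('f, 'r) fm \<Rightarrow> ('f, 'r) fm" where
  "Iff p q \<equiv> Conj (Impl p q) (Impl q p)"

abbreviation Exists :: "nat \<Rightarrow> ('f, 'r) fm \<Rightarrow> ('f, 'r) fm" where
  "Exists n p \<equiv> Neg (Forall n (Neg p))"

primrec vars_trm :: "'f trm \<Rightarrow> nat set" where
  "vars_trm (Var n) = {n}"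
| "vars_trm (Fun f ts) = \<Union> (set (map vars_trm ts))"

primrec fv :: "('f, 'r) fm \<Rightarrow> nat set" where
  "fv (Eq s t) = vars_trm s \<union> vars_trm t"
| "fv (Mem s t) = vars_trm s \<union> vars_trm t"
| "fv (Rel r ts) = \<Union> (set (map vars_trm ts))"
| "fv (Neg p) = fv p"
| "fv (Conj p q) = fv p \<union> fv q"
| "fv (Forall n p) = fv p - {n}"

fun wf_trm :: "('f \<times> nat) set \<Rightarrow> 'f trm \<Rightarrow> bool" where
  "wf_trm Fs (Var n) \<longleftrightarrow> True"
| "wf_trm Fs (Fun f ts) \<longleftrightarrow> (f, length ts) \<in> Fs \<and> (\<forall>t\<in>set ts. wf_trm Fs t)"

primrec wf_fm :: "('f \<times> nat) set \<Rightarrow> ('r \<times> nat) set \<Rightarrow> ('f, 'r) fm \<Rightarrow> bool" where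
  "wf_fm Fs Rs (Eq s t) \<longleftrightarrow> wf_trm Fs s \<and> wf_trm Fs t"
| "wf_fm Fs Rs (Mem s t) \<longleftrightarrow> wf_trm Fs s \<and> wf_trm Fs t"
| "wf_fm Fs Rs (Rel r ts) \<longleftrightarrow> (r, length ts) \<in> Rs \<and> (\<forall>t\<in>set ts. wf_trm Fs t)"
| "wf_fm Fs Rs (Neg p) \<longleftrightarrow> wf_fm Fs Rs p"
| "wf_fm Fs Rs (Conj p q) \<longleftrightarrow> wf_fm Fs Rs p \<and> wf_fm Fs Rs q"
| "wf_fm Fs Rs (Forall n p) \<longleftrightarrow> wf_fm Fs Rs p"

definition sentences :: "('f \<times> nat) set \<Rightarrow> ('r \<times> nat) set \<Rightarrow> ('f, 'r) fm set" where
  "sentences Fs Rs = {p. wf_fm Fs Rs p \<and> fv p = {}}"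

record ('a, 'f, 'r) struc =
  carrier :: "'a set"
  mem_int :: "'a \<Rightarrow> 'a \<Rightarrow> bool"
  fun_int :: "'f \<Rightarrow> 'a list \<Rightarrow> 'a"
  rel_int :: "'r \<Rightarrow> 'a list \<Rightarrow> bool"

primrec trm_val :: "('a, 'f, 'r) struc \<Rightarrow> (nat \<Rightarrow> 'a) \<Rightarrow> 'f trm \<Rightarrow> 'a" where
  "trm_val M e (Var n) = e n"
| "trm_val M e (Fun f ts) = fun_int M f (map (trm_val M e) ts)"

primrec sat :: "('a, 'f, 'r) struc \<Rightarrow> (nat \<Rightarrow> 'a) \<Rightarrow> ('f, 'r) fm \<Rightarrow> bool" where
  "sat M e (Eq s t) \<longleftrightarrow> trm_val M e s = trm_val M e t"
| "sat M e (Mem s t) \<longleftrightarrow> mem_int M (trm_val M e s) (trm_val M e t)"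
| "sat M e (Rel r ts) \<longleftrightarrow> rel_int M r (map (trm_val M e) ts)"
| "sat M e (Neg p) \<longleftrightarrow> \<not> sat M e p"
| "sat M e (Conj p q) \<longleftrightarrow> sat M e p \<and> sat M e q"
| "sat M e (Forall n p) \<longleftrightarrow> (\<forall>a\<in>carrier M. sat M (e(n := a)) p)"

text \<open>Truth of the universal closure; used only for structures with nonempty carrier.\<close>

definition models :: "('a, 'f, 'r) struc \<Rightarrow> ('f, 'r) fm \<Rightarrow> bool" where
  "models M p \<longleftrightarrow> (\<forall>e. range e \<subseteq> carrier M \<longrightarrow> sat M e p)"

text \<open>Substructure with respect to the language of set theory.\<close>

definition substructure :: "('a, 'f, 'r) struc \<Rightarrow> ('a, 'f, 'r) struc \<Rightarrow> bool" where
  "substructure M N \<longleftrightarrow> carrier M \<subseteq> carrier N \<and>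
     (\<forall>a\<in>carrier M. \<forall>b\<in>carrier M. mem_int M a b \<longleftrightarrow> mem_int N a b)"


section \<open>ZFC\<close>

text \<open>The type parameters \<open>unit\<close> are dummies: the formulas below use the empty signature.\<close>

type_synonym set_fm = "(unit, unit) fm"

abbreviation vmem :: "nat \<Rightarrow> nat \<Rightarrow> set_fm" where "vmem i j \<equiv> Mem (Var i) (Var j)"
abbreviation veq :: "nat \<Rightarrow> nat \<Rightarrow> set_fm" where "veq i j \<equiv> Eq (Var i) (Var j)"

definition ax_ext :: set_fm where
  "ax_ext = Forall 0 (Forall 1 (Impl (Forall 2 (Iff (vmem 2 0) (vmem 2 1))) (veq 0 1)))"

definition ax_found :: set_fm where
  "ax_found = Forall 0 (Impl (Exists 1 (vmem 1 0))
     (Exists 1 (Conj (vmem 1 0) (Neg (Exists 2 (Conj (vmem 2 0) (vmem 2 1)))))))"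

definition ax_pair :: set_fm where
  "ax_pair = Forall 0 (Forall 1 (Exists 2 (Forall 3 (Iff (vmem 3 2) (Disj (veq 3 0) (veq 3 1))))))"

definition ax_union :: set_fm where
  "ax_union = Forall 0 (Exists 1 (Forall 2 (Iff (vmem 2 1) (Exists 3 (Conj (vmem 3 0) (vmem 2 3))))))"

definition ax_power :: set_fm where
  "ax_power = Forall 0 (Exists 1 (Forall 2 (Iff (vmem 2 1) (Forall 3 (Impl (vmem 3 2) (vmem 3 0))))))"

definition ax_inf :: set_fm where
  "ax_inf = Exists 0 (Conj (Exists 1 (Conj (vmem 1 0) (Forall 2 (Neg (vmem 2 1)))))
     (Forall 1 (Impl (vmem 1 0)
       (Exists 2 (Conj (vmem 2 0) (Forall 3 (Iff (vmem 3 2) (Disj (vmem 3 1) (veq 3 1)))))))))"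

text \<open>Choice: a family of nonempty, pairwise disjoint sets has a transversal.\<close>

definition ax_choice :: set_fm where
  "ax_choice = Forall 0 (Impl
     (Conj (Forall 1 (Impl (vmem 1 0) (Exists 2 (vmem 2 1))))
       (Forall 1 (Forall 2 (Impl
          (Conj (Conj (vmem 1 0) (vmem 2 0)) (Exists 3 (Conj (vmem 3 1) (vmem 3 2)))) (veq 1 2)))))
     (Exists 3 (Forall 1 (Impl (vmem 1 0)
       (Exists 4 (Forall 2 (Iff (Conj (vmem 2 1) (vmem 2 3)) (veq 2 4))))))))"

text \<open>In the two schemata, \<open>p\<close> may contain further free variables as parameters. Separation is for
  \<open>p(x\<^sub>0)\<close>; replacement is for \<open>p(x\<^sub>0, x\<^sub>1)\<close>, with \<open>\<exists>!x\<^sub>1. p\<close> expressed as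
  \<open>\<exists>x\<^sub>3. \<forall>x\<^sub>1. p \<longleftrightarrow> x\<^sub>1 = x\<^sub>3\<close>.\<close>

definition ax_sep :: "set_fm \<Rightarrow> set_fm" where
  "ax_sep p = Forall 2 (Exists 1 (Forall 0 (Iff (vmem 0 1) (Conj (vmem 0 2) p))))"

definition ax_repl :: "set_fm \<Rightarrow> set_fm" where
  "ax_repl p = Forall 2 (Impl
     (Forall 0 (Impl (vmem 0 2) (Exists 3 (Forall 1 (Iff p (veq 1 3))))))
     (Exists 4 (Forall 1 (Iff (vmem 1 4) (Exists 0 (Conj (vmem 0 2) p))))))"

definition ZFC :: "set_fm set" where
  "ZFC = {ax_ext, ax_found, ax_pair, ax_union, ax_power, ax_inf, ax_choice}
     \<union> {ax_sep p | p. wf_fm {} {} p \<and> 1 \<notin> fv p}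
     \<union> {ax_repl p | p. wf_fm {} {} p \<and> 3 \<notin> fv p \<and> 4 \<notin> fv p}"


section \<open>Propositional modal logic\<close>

text \<open>Propositional modal formulas are those of type \<open>nat modal\<close>; the substitution instance of
  \<open>\<phi>\<close> under \<open>\<sigma> :: nat \<Rightarrow> ('f, 'r) fm\<close> is \<open>map_modal \<sigma> \<phi>\<close>.\<close>

datatype 'p modal = Atom 'p | Falsity | Imp "'p modal" "'p modal" | Box "'p modal"

abbreviation Dia :: "'p modal \<Rightarrow> 'p modal" where
  "Dia p \<equiv> Imp (Box (Imp p Falsity)) Falsity"

text \<open>Propositional tautologies; boxed subformulas count as atoms.\<close>

definition tautology :: "'p modal \<Rightarrow> bool" where
  "tautology p \<longleftrightarrow> (\<forall>v :: 'p modal \<Rightarrow> bool.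
     \<not> v Falsity \<and> (\<forall>q r. v (Imp q r) \<longleftrightarrow> (v q \<longrightarrow> v r)) \<longrightarrow> v p)"

inductive_set normal_logic :: "nat modal set \<Rightarrow> nat modal set" for A :: "nat modal set" where
  ax: "p \<in> A \<Longrightarrow> p \<in> normal_logic A"
| taut: "tautology p \<Longrightarrow> p \<in> normal_logic A"
| K: "Imp (Box (Imp p q)) (Imp (Box p) (Box q)) \<in> normal_logic A"
| mp: "Imp p q \<in> normal_logic A \<Longrightarrow> p \<in> normal_logic A \<Longrightarrow> q \<in> normal_logic A"
| nec: "p \<in> normal_logic A \<Longrightarrow> Box p \<in> normal_logic A"

definition S4_axioms :: "nat modal set" where
  "S4_axioms = {Imp (Box p) p | p. True} \<union> {Imp (Box p) (Box (Box p)) | p. True}"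

definition S42 :: "nat modal set" where
  "S42 = normal_logic (S4_axioms \<union> {Imp (Dia (Box p)) (Box (Dia p)) | p. True})"

definition S5 :: "nat modal set" where
  "S5 = normal_logic (S4_axioms \<union> {Imp (Dia (Box p)) p | p. True})"


section \<open>Potentialist systems\<close>

text \<open>Worlds are indexed, so that the same worlds and accessibility relation can be considered with
  respect to several languages.\<close>

record ('w, 'a, 'f, 'r) psystem =
  worlds :: "'w set"
  acc :: "'w \<Rightarrow> 'w \<Rightarrow> bool"
  str :: "'w \<Rightarrow> ('a, 'f, 'r) struc"

definition potentialist_system :: "('w, 'a, 'f, 'r) psystem \<Rightarrow> bool" where
  "potentialist_system S \<longleftrightarrow>
     (\<forall>W\<in>worlds S. acc S W W) \<and>
     (\<forall>W\<in>worlds S. \<forall>U\<in>worlds S. \<forall>V\<in>worlds S. acc S W U \<longrightarrow> acc S U V \<longrightarrow> acc S W V) \<and>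
     (\<forall>W\<in>worlds S. \<forall>U\<in>worlds S. acc S W U \<longrightarrow> substructure (str S W) (str S U))"

definition potentialist_account :: "('w, 'a, 'f, 'r) psystem \<Rightarrow> ('a, 'f, 'r) struc \<Rightarrow> bool" where
  "potentialist_account S N \<longleftrightarrow>
     (\<forall>W\<in>worlds S. substructure (str S W) N) \<and>
     (\<forall>W\<in>worlds S. \<forall>a\<in>carrier N. \<exists>U\<in>worlds S. acc S W U \<and> a \<in> carrier (str S U))"

primrec modal_true :: "('w, 'a, 'f, 'r) psystem \<Rightarrow> 'w \<Rightarrow> ('f, 'r) fm modal \<Rightarrow> bool" where
  "modal_true S W (Atom s) \<longleftrightarrow> models (str S W) s"
| "modal_true S W Falsity \<longleftrightarrow> False"
| "modal_true S W (Imp p q) \<longleftrightarrow> (modal_true S W p \<longrightarrow> modal_true S W q)"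
| "modal_true S W (Box p) \<longleftrightarrow> (\<forall>U\<in>worlds S. acc S W U \<longrightarrow> modal_true S U p)"

definition Val :: "('w, 'a, 'f, 'r) psystem \<Rightarrow> 'w \<Rightarrow> ('f, 'r) fm set \<Rightarrow> nat modal set" where
  "Val S W L = {p. \<forall>\<sigma>. (\<forall>n. \<sigma> n \<in> L) \<longrightarrow> modal_true S W (map_modal \<sigma> p)}"


section \<open>The countable transitive models of ZFC\<close>

definition eps_struc ::
    "('f \<Rightarrow> hc list \<Rightarrow> hc) \<Rightarrow> ('r \<Rightarrow> hc list \<Rightarrow> bool) \<Rightarrow> hc set \<Rightarrow> (hc, 'f, 'r) struc" where
  "eps_struc F R W = \<lparr>carrier = W, mem_int = hmem, fun_int = F, rel_int = R\<rparr>"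

text \<open>Dummy interpretations, for signatures without function or without relation symbols.\<close>

definition no_fun :: "unit \<Rightarrow> hc list \<Rightarrow> hc" where "no_fun f as = HC cempty"
definition no_rel :: "unit \<Rightarrow> hc list \<Rightarrow> bool" where "no_rel r as = False"

definition ctms :: "hc set set" where
  "ctms = {W. W \<noteq> {} \<and> countable W \<and> (\<forall>x\<in>W. elts x \<subseteq> W) \<and>
     (\<forall>p\<in>ZFC. models (eps_struc no_fun no_rel W) p)}"

text \<open>The system of countable transitive models of ZFC, each world \<open>W\<close> carrying interpretations
  \<open>F W\<close>, \<open>R W\<close> of additional symbols.\<close>

definition ctm_system :: "(hc set \<Rightarrow> 'f \<Rightarrow> hc list \<Rightarrow> hc) \<Rightarrow> (hc set \<Rightarrow> 'r \<Rightarrow> hc list \<Rightarrow> bool) \<Rightarrow>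
    (hc set, hc, 'f, 'r) psystem" where
  "ctm_system F R = \<lparr>worlds = ctms, acc = (\<subseteq>), str = (\<lambda>W. eps_struc (F W) (R W) W)\<rparr>"

definition interpreted_in_ctms ::
    "('f \<times> nat) set \<Rightarrow> (hc set \<Rightarrow> 'f \<Rightarrow> hc list \<Rightarrow> hc) \<Rightarrow> bool" where
  "interpreted_in_ctms Fs F \<longleftrightarrow>
     (\<forall>W\<in>ctms. \<forall>(f, n)\<in>Fs. \<forall>as. length as = n \<and> set as \<subseteq> W \<longrightarrow> F W f as \<in> W)"

definition C_sys :: "(hc set, hc, unit, unit) psystem" where
  "C_sys = ctm_system (\<lambda>_. no_fun) (\<lambda>_. no_rel)"

definition H_omega1 :: "(hc, unit, unit) struc" where
  "H_omega1 = eps_struc no_fun no_rel UNIV"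

definition Val_set :: "hc set \<Rightarrow> nat modal set" where
  "Val_set W = Val C_sys W (sentences {} {})"

text \<open>Parameters from \<open>W\<close> are constant symbols that denote themselves; only worlds accessible from
  \<open>W\<close>, and hence containing them, are relevant for validity at \<open>W\<close>.\<close>

definition Val_param :: "hc set \<Rightarrow> nat modal set" where
  "Val_param W = Val (ctm_system (\<lambda>_ a _. a) (\<lambda>_. no_rel)) W (sentences {(a, 0) | a. a \<in> W} {})"

lemma C_sys_potentialist: "potentialist_system C_sys"
  unfolding potentialist_system_def C_sys_def ctm_system_def substructure_def eps_struc_def
  by auto

end

theory Submission
  imports Defs "HOL-Library.Multiset"
begin

text \<open>
  Any countable family of worlds has a common extension, because it is coded by a real; so the system
  is directed and S4.2 is valid. A formula outside S4.2 fails on a finite preorder with a least point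
  and a greatest cluster, and one outside S5 on a finite cluster; to refute it at a world it suffices
  to label the extensions definably by frame points, so that the labels reachable in the system are
  exactly those reachable in the frame.

  The labels come from levels \<open>X n \<subset> Y n \<subset> Z n\<close>, iterated closures under power set in some \<open>N\<close>. Level
  \<open>n\<close> is pushed in \<open>U\<close> if \<open>U\<close> maps \<open>Y n\<close> onto \<open>Z n\<close>. Partial functions from \<open>Y n\<close> to \<open>Z n\<close> of size
  at most \<open>X n\<close> force exactly this, without affecting the other levels. For levels of \<open>W\<close> itself, given
  as a parameter, the label is the largest pushed level modulo the size of the frame. Once this fails
  to move along the frame, a dial takes over and moves freely in the greatest cluster: the least
  pushed level of \<open>L[x]\<close>, where the real \<open>x\<close> constructs all reals. It can be set at will, since every
  world extends to some \<open>L[x]\<close> in which \<open>x\<close> codes a world, and then any one level can be collapsed.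

  Parameters are avoided at a world of the form \<open>L\<^sub>\<alpha>\<close> with \<open>\<alpha>\<close> least: as long as an extension \<open>U\<close> has
  no \<open>L\<^sub>\<beta>\<close> that is a world, \<open>L\<close> of \<open>U\<close> has the same levels, and having one is irrevocable. Finally, a
  countable language has countably many modal assertions; deciding them one after the other along
  a chain, by making them necessary whenever possible, leads to a world where S5 is valid.
\<close>

text \<open>Worlds satisfy the axioms only as a set of formulas, so every set formed inside a world
  needs a defining formula. A calculus of uniformly definable predicates and functions
  (\<open>dfn\<close>, \<open>dfun\<close>) supplies these. One formula serves a whole class of
  worlds, and this is also what turns a label into a sentence. Each level has three sets because its
  collapse must be invisible elsewhere. Forcing with conditions of size at most \<open>X n\<close>
  adds no functions on sets of that size, so lower levels see nothing. There are at most
  \<open>Fn U (X n) (Z n)\<close> conditions, fewer than \<open>X (Suc n)\<close>, so higher levels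
  see nothing. And \<open>Y n\<close>, being larger than \<open>X n\<close>, is never exhausted by a
  condition. An arbitrary extension may destroy these gaps, or push levels in an order that follows
  no path of the frame. Such damage is irrevocable, which is why it can be read as having passed to
  the greatest cluster. The dial there does not rely on intact levels of \<open>W\<close>: it
  computes new ones from the \<open>L[x]\<close> of the current world.\<close>

abbreviation (input) iff_ascii (infixr "<->" 25) where "A <-> B == A = (B::bool)"

section \<open>Coding of sets and first-order syntax\<close>

section \<open>Hereditarily countable sets\<close>

definition hset :: "hc set => hc" where
 "hset A = HC (acset A)"

lemma elts_hset [simp]: "countable A ==> elts (hset A) = A"
 by (simp add: hset_def elts_def acset_inverse)

lemma countable_elts [simp]: "countable (elts x)"
 unfolding elts_def using rcset by auto

lemma hset_elts [simp]: "hset (elts x) = x"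
 by (simp add: hset_def elts_def rcset_inverse)

lemma elts_inject: "elts x = elts y <-> x = y"
 by (metis hset_elts)

lemma elts_eqI: "(!!z. z : elts x <-> z : elts y) ==> x = y"
 using elts_inject by blast

lemma countable_sub_elts: "A \<subseteq> elts x ==> countable A"
 using countable_elts countable_subset by blast

lemma hc_induct [case_names step]:
 assumes "!!x. (!!y. y : elts x ==> P y) ==> P x"
 shows "P x"
proof (induction x)
 case (HC c)
 then show ?case
  by (rule assms) (simp add: elts_def)
qed

lemma wf_elts: "wf {(x, y). x : elts y}"
proof (rule wfUNIVI)
 fix P x
 assume *: "ALL x. (ALL y. (y, x) : {(x, y). x : elts y} --> P y) --> P x"
 show "P x" by (induction x rule: hc_induct) (use * in auto)
qed

lemma mem_irrefl: "x ~: elts x"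
 using wf_not_refl[OF wf_elts] by auto

lemma mem_not_sym: "x : elts y ==> y ~: elts x"
 using wf_not_sym[OF wf_elts] by auto

text \<open>Foundation as an elimination rule. On ordinals membership is the order, so this also
  picks least ordinals.\<close>

lemma hmin:
 assumes "Q x"
 obtains m where "Q m" "!!y. y : elts m ==> \<not> Q y"
proof -
 have "EX m. Q m & (ALL y : elts m. \<not> Q y)"
  using wf_elts[unfolded wf_eq_minimal, rule_format, of x "Collect Q"] assms by auto
 then show ?thesis using that by blast
qed

definition hempty :: hc where "hempty = hset {}"
definition upair :: "hc => hc => hc" where "upair x y = hset {x, y}"
definition opair :: "hc => hc => hc" where "opair x y = upair (upair x x) (upair x y)"
definition hunion :: "hc => hc" where "hunion x = hset (\<Union> (elts ` elts x))"
definition hun :: "hc => hc => hc" where "hun x y = hset (elts x \<union> elts y)"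
definition hsuc :: "hc => hc" where "hsuc x = hset (insert x (elts x))"
definition omega :: hc where "omega = hset (range hc_nat)"

lemma elts_hempty [simp]: "elts hempty = {}"
 by (simp add: hempty_def)

lemma HC_cempty: "HC cempty = hempty"
 by (simp add: hempty_def hset_def bot_cset_def)

lemma elts_upair [simp]: "elts (upair x y) = {x, y}"
 by (simp add: upair_def)

lemma elts_hunion [simp]: "elts (hunion x) = \<Union> (elts ` elts x)"
 by (simp add: hunion_def)

lemma elts_hun [simp]: "elts (hun x y) = elts x \<union> elts y"
 by (simp add: hun_def)

lemma elts_hsuc [simp]: "elts (hsuc x) = insert x (elts x)"
 by (simp add: hsuc_def)

lemma elts_omega [simp]: "elts omega = range hc_nat"
 by (simp add: omega_def)

lemma upair_inject: "upair x y = upair u v <-> {x, y} = {u, v}"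
 by (metis elts_inject elts_upair)

lemma opair_inject [simp]: "opair x y = opair u v <-> x = u & y = v"
 by (auto simp: opair_def upair_inject doubleton_eq_iff)

lemma elts_opair: "elts (opair x y) = {upair x x, upair x y}"
 by (simp add: opair_def)

lemma hc_nat_0: "hc_nat 0 = hempty"
 by (simp add: HC_cempty)

lemma hc_nat_Suc: "hc_nat (Suc n) = hsuc (hc_nat n)"
 by (rule elts_eqI) (auto simp: elts_def cinsert.rep_eq hsuc_def hset_def acset_inverse rcset)

declare hc_nat.simps [simp del]
lemmas hc_nat_simps [simp] = hc_nat_0 hc_nat_Suc

lemma elts_hc_nat: "elts (hc_nat n) = hc_nat ` {..<n}"
 by (induction n) (auto simp: lessThan_Suc)

lemma hc_nat_less: "hc_nat m : elts (hc_nat n) <-> m < n"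
proof
 assume "hc_nat m : elts (hc_nat n)"
 then have "\<not> n \<le> m"
  by (metis (no_types, lifting) elts_hc_nat image_eqI lessThan_iff mem_irrefl mem_not_sym nat_less_le)
 then show "m < n" by simp
qed (simp add: elts_hc_nat)

lemma hc_nat_inject [simp]: "hc_nat m = hc_nat n <-> m = n"
 by (metis hc_nat_less mem_irrefl nat_neq_iff)

definition htrans :: "hc => bool" where
 "htrans x <-> (ALL y:elts x. elts y \<subseteq> elts x)"

lemma htransD: "htrans x ==> y : elts x ==> z : elts y ==> z : elts x"
 unfolding htrans_def by blast

section \<open>Syntax\<close>

abbreviation \<S> :: "hc set => (hc, unit, unit) struc" where
 "\<S> \<equiv> eps_struc no_fun no_rel"

lemma eps_struc_simps [simp]:
 "carrier (eps_struc F R M) = M" "mem_int (eps_struc F R M) = hmem"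
 "fun_int (eps_struc F R M) = F" "rel_int (eps_struc F R M) = R"
 by (simp_all add: eps_struc_def)

lemma trm_val_cong: "(!!i. i : vars_trm t ==> e i = e' i) ==> trm_val M e t = trm_val M e' t"
proof (induction t)
 case (Fun f ts)
 then have "map (trm_val M e) ts = map (trm_val M e') ts" by (intro map_cong) auto
 then show ?case by (simp del: map_eq_conv)
qed simp

lemma sat_cong: "(!!i. i : fv p ==> e i = e' i) ==> sat M e p <-> sat M e' p"
proof (induction p arbitrary: e e')
 case (Eq s t)
 then have "trm_val M e s = trm_val M e' s" "trm_val M e t = trm_val M e' t" by (auto intro: trm_val_cong)
 then show ?case by simp
next
 case (Mem s t)
 then have "trm_val M e s = trm_val M e' s" "trm_val M e t = trm_val M e' t" by (auto intro: trm_val_cong)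
 then show ?case by simp
next
 case (Rel r ts)
 then have "map (trm_val M e) ts = map (trm_val M e') ts" by (intro map_cong refl trm_val_cong) auto
 then show ?case by (simp del: map_eq_conv)
next
 case (Neg p)
 have "sat M e p = sat M e' p" by (rule Neg.IH) (use Neg.prems in auto)
 then show ?case by simp
next
 case (Conj p q)
 have "sat M e p = sat M e' p" by (rule Conj.IH) (use Conj.prems in auto)
 moreover have "sat M e q = sat M e' q" by (rule Conj.IH) (use Conj.prems in auto)
 ultimately show ?case by simp
next
 case (Forall n p)
 have "sat M (e(n := a)) p = sat M (e'(n := a)) p" for a
  by (rule Forall.IH) (use Forall.prems in auto)
 then show ?case by simp
qed

lemma fv_finite: "finite (fv p)"
proof -
 have "finite (vars_trm t)" for t :: "'a trm" by (induction t) auto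
 then show ?thesis by (induction p) auto
qed

lemma sat_Exists: "sat M e (Exists n p) <-> (EX a:carrier M. sat M (e(n := a)) p)"
 by simp

lemma sat_Iff: "sat M e (Iff p q) <-> (sat M e p <-> sat M e q)"
 by auto

lemma sat_Impl: "sat M e (Impl p q) <-> (sat M e p --> sat M e q)"
 by auto

lemma sat_Disj: "sat M e (Disj p q) <-> (sat M e p \<or> sat M e q)"
 by auto

lemmas sat_conn = sat_Exists sat_Iff sat_Impl sat_Disj sat.simps(1,2,6)

primrec ren_trm :: "(nat => nat) => 'f trm => 'f trm" where
 "ren_trm f (Var n) = Var (f n)"
| "ren_trm f (Fun g ts) = Fun g (map (ren_trm f) ts)"

text \<open>Bound variables are renamed together with the free ones. For injective \<open>f\<close>
  nothing can be captured, and an assignment is simply composed with \<open>f\<close>.\<close>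

primrec ren :: "(nat => nat) => ('f, 'r) fm => ('f, 'r) fm" where
 "ren f (Eq s t) = Eq (ren_trm f s) (ren_trm f t)"
| "ren f (Mem s t) = Mem (ren_trm f s) (ren_trm f t)"
| "ren f (Rel r ts) = Rel r (map (ren_trm f) ts)"
| "ren f (Neg p) = Neg (ren f p)"
| "ren f (Conj p q) = Conj (ren f p) (ren f q)"
| "ren f (Forall n p) = Forall (f n) (ren f p)"

lemma trm_val_ren: "trm_val M e (ren_trm f t) = trm_val M (e \<circ> f) t"
proof (induction t)
 case (Fun g ts)
 then have "map (trm_val M e \<circ> ren_trm f) ts = map (trm_val M (e \<circ> f)) ts" by (intro map_cong) (auto simp del: comp_apply simp add: comp_apply[of "trm_val M e"])
 then show ?case by (simp del: map_eq_conv comp_apply)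
qed simp

lemma sat_ren: "inj f ==> sat M e (ren f p) <-> sat M (e \<circ> f) p"
proof (induction p arbitrary: e)
 case (Rel r ts)
 have "map (trm_val M e \<circ> ren_trm f) ts = map (trm_val M (e \<circ> f)) ts" by (simp add: trm_val_ren)
 then show ?case by (simp del: map_eq_conv comp_apply)
next
 case (Forall n p)
 then have "e(f n := a) \<circ> f = (e \<circ> f)(n := a)" for a by (auto simp: inj_eq)
 then show ?case using Forall by (simp del: fun_upd_apply comp_apply)
qed (simp_all add: trm_val_ren)

lemma wf_ren_trm: "wf_trm Fs (ren_trm f t) <-> wf_trm Fs t"
 by (induction t) auto

lemma wf_ren: "wf_fm Fs Rs (ren f p) <-> wf_fm Fs Rs p"
 by (induction p) (auto simp: wf_ren_trm)

lemma vars_ren_trm: "vars_trm (ren_trm f t) = f ` vars_trm t"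
 by (induction t) auto

lemma fv_ren: "inj f ==> fv (ren f p) = f ` fv p"
proof (induction p)
 case (Rel r ts) then show ?case by (auto simp: vars_ren_trm)
next
 case (Forall n p) then show ?case by (simp add: image_set_diff)
qed (simp_all add: vars_ren_trm image_Un)

primrec bv :: "('f, 'r) fm => nat set" where
 "bv (Eq s t) = {}"
| "bv (Mem s t) = {}"
| "bv (Rel r ts) = {}"
| "bv (Neg p) = bv p"
| "bv (Conj p q) = bv p \<union> bv q"
| "bv (Forall n p) = insert n (bv p)"

lemma bv_ren: "bv (ren f p) = f ` bv p"
 by (induction p) auto

section \<open>Definability in transitive models of ZF, and recursion\<close>

section \<open>Countable transitive models of ZF\<close>

text \<open>ZF without choice. Constructible and generic worlds are first shown to satisfy ZF,
  because the calculus of definability must be available in them when choice is verified.\<close>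

definition zfm :: "hc set set" where
 "zfm = {W. W ~= {} & countable W & (ALL x:W. elts x \<subseteq> W) &
   (ALL p:{ax_ext, ax_found, ax_pair, ax_union, ax_power, ax_inf}
    \<union> {ax_sep p | p. wf_fm {} {} p & 1 ~: fv p}
    \<union> {ax_repl p | p. wf_fm {} {} p & 3 ~: fv p & 4 ~: fv p}. models (\<S> W) p)}"

lemma ctms_zfm: "W : ctms <-> W : zfm & models (\<S> W) ax_choice"
 unfolding ctms_def zfm_def ZFC_def by auto

lemma hmem_elts: "hmem x y <-> x : elts y"
 by (simp add: hmem_def)

lemma modelsD: "models (\<S> M) p ==> range e \<subseteq> M ==> sat (\<S> M) e p"
 by (simp add: models_def)

definition pow :: "hc set => hc => hc" where
 "pow N x = hset {y : N. elts y \<subseteq> elts x}"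

context
 fixes M assumes M: "M : zfm"
begin

lemma zfm_trans: "x : M ==> y : elts x ==> y : M"
 using M unfolding zfm_def by blast

lemma zfm_countable: "countable M"
 using M unfolding zfm_def by blast

lemma zfm_nonempty: "EX a. a : M"
 using M unfolding zfm_def by blast

lemma zfm_sat: "p : {ax_ext, ax_found, ax_pair, ax_union, ax_power, ax_inf}
    \<union> {ax_sep p | p. wf_fm {} {} p & 1 ~: fv p}
    \<union> {ax_repl p | p. wf_fm {} {} p & 3 ~: fv p & 4 ~: fv p} ==> models (\<S> M) p"
 using M unfolding zfm_def by blast

text \<open>Turns the witness of an existence axiom into the actual set: all its members lie in
  \<open>M\<close> by transitivity, so agreement on \<open>M\<close> is equality.\<close>

lemma zfm_in: "x : M ==> (!!z. z : M ==> z : elts x <-> z : A) ==> A \<subseteq> M ==> hset A : M"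
 by (metis elts_eqI elts_hset hset_elts subsetD subset_antisym subsetI zfm_trans)

lemma zfm_upair: "x : M ==> y : M ==> upair x y : M"
proof -
 assume *: "x : M" "y : M"
 have "sat (\<S> M) (%_. x) ax_pair" by (rule modelsD[OF zfm_sat]) (use * in auto)
 then have "EX z:M. ALL a:M. a : elts z <-> a = x \<or> a = y"
  using * by (simp add: ax_pair_def hmem_elts) metis
 then show ?thesis unfolding upair_def using * by (metis empty_subsetI insert_iff insert_subset singletonD zfm_in)
qed

lemma zfm_union: "x : M ==> hunion x : M"
proof -
 assume *: "x : M"
 have "sat (\<S> M) (%_. x) ax_union" by (rule modelsD[OF zfm_sat]) (use * in auto)
 then have "EX z:M. ALL a:M. a : elts z <-> (EX b:M. b : elts x & a : elts b)"
  using * by (simp add: ax_union_def hmem_elts) metis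
 then obtain z where z: "z : M" "!!a. a : M ==> a : elts z <-> (EX b:M. b : elts x & a : elts b)" by blast
 show ?thesis unfolding hunion_def by (rule zfm_in[OF z(1)]) (use * z(2) zfm_trans in blast)+
qed


lemma zfm_pow: "x : M ==> pow M x : M"
proof -
 assume *: "x : M"
 have "sat (\<S> M) (%_. x) ax_power" by (rule modelsD[OF zfm_sat]) (use * in auto)
 then have "EX z:M. ALL a:M. a : elts z <-> (ALL b:M. b : elts a --> b : elts x)"
  using * by (simp add: ax_power_def hmem_elts) metis
 then obtain z where z: "z : M" "!!a. a : M ==> a : elts z <-> (ALL b:M. b : elts a --> b : elts x)" by blast
 show ?thesis unfolding pow_def by (rule zfm_in[OF z(1)]) (use * z(2) zfm_trans in blast)+
qed

lemma zfm_sep_fm: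
 assumes q: "wf_fm {} {} q" "fv q \<inter> {..4} = {}" and v: "v > 4" and x: "x : M"
  and e: "!!i. i : fv q - {v} ==> e i : M"
 shows "hset {a : elts x. sat (\<S> M) (e(v := a)) q} : M"
proof -
 \<comment> \<open>Binding \<open>v\<close> and equating it with variable 0, the one that
   \<open>ax_sep\<close> separates on, does the work of a substitution.\<close>
 define Q where "Q = Exists v (Conj (veq v 0) q)"
 let ?q = Q
 \<comment> \<open>\<open>models\<close> ranges over assignments with all values in
   \<open>M\<close>. Entries outside \<open>M\<close> cannot belong to free variables of
   \<open>q\<close> other than \<open>v\<close>, so they may be replaced by
   \<open>x\<close>.\<close>
 let ?e = "%i. if e i : M then e i else x"
 have nn: "1 ~: fv ?q" "wf_fm {} {} ?q" using q v by (auto simp: Q_def)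
 then have "models (\<S> M) (ax_sep ?q)" by (intro zfm_sat) blast
 moreover have "range ?e \<subseteq> M" using x by auto
 ultimately have "sat (\<S> M) ?e (ax_sep ?q)" by (rule modelsD)
 then have "EX y:M. ALL a:M. a : elts y <-> a : elts x & sat (\<S> M) (?e(2 := x, 1 := y, 0 := a)) ?q"
  using x unfolding ax_sep_def sat_conn by (simp only: sat.simps(5)) (simp add: hmem_elts)
 then obtain y where y: "y : M" and 1: "!!a. a : M ==> a : elts y <-> a : elts x &
   sat (\<S> M) (?e(2 := x, 1 := y, 0 := a)) ?q"
  by blast
 have 2: "sat (\<S> M) (?e(2 := x, 1 := y, 0 := a)) ?q <-> sat (\<S> M) (e(v := a)) q" if "a : M" for a
 proof -
  have "sat (\<S> M) (?e(2 := x, 1 := y, 0 := a)) ?q <-> sat (\<S> M) (?e(2 := x, 1 := y, 0 := a, v := a)) q"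
   unfolding Q_def sat_Exists using v that by simp
  also have "\<dots> <-> sat (\<S> M) (e(v := a)) q"
   by (rule sat_cong) (use q e in auto)
  finally show ?thesis .
 qed
 show ?thesis by (rule zfm_in[OF y]) (use 1 2 x zfm_trans in auto)
qed

lemma zfm_repl_fm:
 assumes q: "wf_fm {} {} q" "fv q \<inter> {..4} = {}" and v: "v > 4" "u > 4" "u ~= v" and x: "x : M"
  and e: "!!i. i : fv q - {v, u} ==> e i : M"
  and f: "!!a b. a : elts x ==> b : M ==> sat (\<S> M) (e(v := a, u := b)) q <-> b = f a"
  and fM: "!!a. a : elts x ==> f a : M"
 shows "hset (f ` elts x) : M"
proof -
 define Q where "Q = Exists v (Exists u (Conj (Conj (veq v 0) (veq u 1)) q))"
 let ?q = Q
 define e' where "e' = (%i. if e i : M then e i else x)"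
 let ?e = e'
 have nn: "3 ~: fv ?q" "4 ~: fv ?q" "wf_fm {} {} ?q" using q v by (auto simp: Q_def)
 then have "models (\<S> M) (ax_repl ?q)" by (intro zfm_sat) blast
 moreover have "range ?e \<subseteq> M" using x by (auto simp: e'_def)
 ultimately have s: "sat (\<S> M) ?e (ax_repl ?q)" by (rule modelsD)
 have 2: "sat (\<S> M) (?e(2 := x, 0 := a, 3 := c, 1 := b)) ?q <-> b = f a"
  "sat (\<S> M) (?e(2 := x, 4 := c, 1 := b, 0 := a)) ?q <-> b = f a"
  if "a : elts x" "b : M" for a b c
 proof -
  have aM: "a : M" using that x zfm_trans by auto
  have "sat (\<S> M) (?e(2 := x, 0 := a, 3 := c, 1 := b)) ?q <->
    sat (\<S> M) (?e(2 := x, 0 := a, 3 := c, 1 := b, v := a, u := b)) q"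
   unfolding Q_def sat_Exists using v that aM by simp
  also have "\<dots> <-> sat (\<S> M) (e(v := a, u := b)) q"
   by (rule sat_cong) (use q e v in \<open>auto simp: e'_def\<close>)
  finally show "sat (\<S> M) (?e(2 := x, 0 := a, 3 := c, 1 := b)) ?q <-> b = f a"
   using f that by simp
  have "sat (\<S> M) (?e(2 := x, 4 := c, 1 := b, 0 := a)) ?q <->
    sat (\<S> M) (?e(2 := x, 4 := c, 1 := b, 0 := a, v := a, u := b)) q"
   unfolding Q_def sat_Exists using v that aM by simp
  also have "\<dots> <-> sat (\<S> M) (e(v := a, u := b)) q"
   by (rule sat_cong) (use q e v in \<open>auto simp: e'_def\<close>)
  finally show "sat (\<S> M) (?e(2 := x, 4 := c, 1 := b, 0 := a)) ?q <-> b = f a"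
   using f that by simp
 qed
 have "EX c:M. ALL b:M. sat (\<S> M) (?e(2 := x, 0 := a, 3 := c, 1 := b)) ?q <-> b = c" if "a : elts x" for a
  by (rule bexI[of _ "f a"]) (use 2(1) fM that in auto)
 then have "ALL a:M. a : elts x --> (EX c:M. ALL b:M. sat (\<S> M) (?e(2 := x, 0 := a, 3 := c, 1 := b)) ?q <-> b = c)"
  by blast
 moreover note s x
 ultimately have "EX y:M. ALL b:M. b : elts y <-> (EX a:M. a : elts x & sat (\<S> M) (?e(2 := x, 4 := y, 1 := b, 0 := a)) ?q)"
  unfolding ax_repl_def sat_conn by (simp only: sat.simps(5) sat_conn) (simp add: hmem_elts)
 then obtain y where y: "y : M" and "!!b. b : M ==> b : elts y <->
   (EX a:M. a : elts x & sat (\<S> M) (?e(2 := x, 4 := y, 1 := b, 0 := a)) ?q)"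
  by blast
 then have "!!b. b : M ==> b : elts y <-> b : f ` elts x"
  using 2(2) zfm_trans[OF x] by auto
 then show ?thesis using y fM by (intro zfm_in[OF y]) auto
qed

end

section \<open>Uniform definability over a class of models\<close>

named_theorems dfi

text \<open>In the formulas defining a predicate uniformly over \<open>K\<close>, the arguments sit at the even variables
 \<open>vn i\<close>, all elements of \<open>C\<close> are available as parameters at the odd variables \<open>pn j\<close>, and the variables
 below 5 are left to the axiom schemes.\<close>

definition vn :: "nat => nat" where "vn i = 2 * i + 6"
definition pn :: "nat => nat" where "pn j = 2 * j + 5"

lemma vn_simps [simp]: "vn i = vn j <-> i = j" "vn i ~= pn j" "pn j ~= vn i" "4 < vn i" "4 < pn j"
 unfolding vn_def pn_def by presburger+

locale zfmodels =
 fixes K :: "hc set set" and C :: "hc set"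
 assumes K_zfm: "M : K ==> M : zfm" and C_sub: "M : K ==> C \<subseteq> M" and C_countable: "countable C"
begin

definition mix :: "(nat => hc) => nat => hc" where
 "mix e i = (if i < 5 then hempty else if even i then e ((i - 6) div 2)
   else from_nat_into C ((i - 5) div 2))"

definition vok :: "nat => nat set" where
 "vok n = vn ` {..<n} \<union> (if C = {} then {} else range pn)"

text \<open>A predicate on worlds and assignments stands for the formula, which stays hidden behind
  an existential quantifier. That one formula works for all of \<open>K\<close> at once is what
  later gives a single sentence per label.\<close>

definition dfn :: "nat => (hc set => (nat => hc) => bool) => bool" where
 "dfn n P <-> (EX p. wf_fm {} {} p & fv p \<subseteq> vok n & bv p \<subseteq> range vn &
   (ALL M:K. ALL e. range e \<subseteq> M --> (sat (\<S> M) (mix e) p <-> P M e)))"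

lemma dfnI:
 "wf_fm {} {} p ==> fv p \<subseteq> vok n ==> bv p \<subseteq> range vn ==>
  (!!M e. M : K ==> range e \<subseteq> M ==> sat (\<S> M) (mix e) p <-> P M e) ==> dfn n P"
 unfolding dfn_def by blast

lemma dfnE:
 assumes "dfn n P"
 obtains p where "wf_fm {} {} p" "fv p \<subseteq> vok n" "bv p \<subseteq> range vn"
  "!!M e. M : K ==> range e \<subseteq> M ==> sat (\<S> M) (mix e) p <-> P M e"
 using assms unfolding dfn_def by blast

lemma mix_vn [simp]: "mix e (vn i) = e i"
 by (simp add: mix_def vn_def)

lemma mix_pn: "mix e (pn j) = from_nat_into C j"
 by (simp add: mix_def pn_def)

lemma mix_upd: "mix (e(n := a)) = (mix e)(vn n := a)"
proof
 fix i show "mix (e(n := a)) i = ((mix e)(vn n := a)) i"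
  by (cases "i < 5"; cases "even i") (auto simp: mix_def vn_def elim!: evenE)
qed

lemma vok_mono: "n \<le> m ==> vok n \<subseteq> vok m"
 unfolding vok_def by auto

lemma vok_low: "vok n \<inter> {..4} = {}"
 unfolding vok_def vn_def pn_def by auto

lemma mix_vok: "M : K ==> range e \<subseteq> M ==> i : vok n ==> mix e i : M"
proof -
 assume *: "M : K" "range e \<subseteq> M" "i : vok n"
 consider j where "i = vn j" | j where "i = pn j" "C ~= {}"
  using *(3) unfolding vok_def by (auto split: if_split_asm)
 then show ?thesis
  by cases (use * C_sub[OF *(1)] from_nat_into[of C] mix_vn mix_pn in auto)
qed

lemma mix_agree: "(!!i. i < n ==> e i = e' i) ==> i : vok n ==> mix e i = mix e' i"
proof -
 assume *: "!!i. i < n ==> e i = e' i" "i : vok n"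
 consider j where "i = vn j" "j < n" | j where "i = pn j"
  using *(2) unfolding vok_def by (auto split: if_split_asm)
 then show ?thesis by cases (simp_all add: * mix_pn)
qed

lemma range_upd: "range e \<subseteq> M ==> a : M ==> range (e(n := a)) \<subseteq> M"
 by auto

lemma dfn_cong:
 assumes "dfn n P" and "!!M e. M : K ==> range e \<subseteq> M ==> P M e = P' M e"
 shows "dfn n P'"
 using assms unfolding dfn_def by (metis (no_types, lifting))

lemma dfn_mono: "dfn n P ==> n \<le> m ==> dfn m P"
 unfolding dfn_def using vok_mono by (meson subset_trans)

lemma dfn_agree:
 assumes "dfn n P" "M : K" "range e \<subseteq> M" "range e' \<subseteq> M" "!!i. i < n ==> e i = e' i"
 shows "P M e = P M e'"
proof -
 obtain p where p: "wf_fm {} {} p" "fv p \<subseteq> vok n"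
  "!!M e. M : K ==> range e \<subseteq> M ==> sat (\<S> M) (mix e) p <-> P M e"
  using assms(1) unfolding dfn_def by blast
 have "sat (\<S> M) (mix e) p = sat (\<S> M) (mix e') p"
  by (rule sat_cong) (use mix_agree assms(5) p(2) in blast)
 then show ?thesis using p(3) assms by auto
qed

lemma dfn_not [dfi]:
 assumes "dfn n P" shows "dfn n (%M e. \<not> P M e)"
proof -
 obtain p where p: "wf_fm {} {} p" "fv p \<subseteq> vok n" "bv p \<subseteq> range vn"
  "!!M e. M : K ==> range e \<subseteq> M ==> sat (\<S> M) (mix e) p <-> P M e"
  using assms unfolding dfn_def by blast
 show ?thesis by (rule dfnI[of "Neg p"]) (use p in auto)
qed

lemma dfn_conj [dfi]:
 assumes "dfn n P" "dfn n Q" shows "dfn n (%M e. P M e & Q M e)"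
proof -
 obtain p where p: "wf_fm {} {} p" "fv p \<subseteq> vok n" "bv p \<subseteq> range vn"
  "!!M e. M : K ==> range e \<subseteq> M ==> sat (\<S> M) (mix e) p <-> P M e"
  using assms(1) unfolding dfn_def by blast
 obtain q where q: "wf_fm {} {} q" "fv q \<subseteq> vok n" "bv q \<subseteq> range vn"
  "!!M e. M : K ==> range e \<subseteq> M ==> sat (\<S> M) (mix e) q <-> Q M e"
  using assms(2) unfolding dfn_def by blast
 show ?thesis by (rule dfnI[of "Conj p q"]) (use p q in auto)
qed

lemma dfn_disj [dfi]: "dfn n P ==> dfn n Q ==> dfn n (%M e. P M e \<or> Q M e)"
proof -
 assume *: "dfn n P" "dfn n Q"
 have "dfn n (%M e. \<not> (\<not> P M e & \<not> Q M e))" by (intro dfn_not dfn_conj *)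
 then show ?thesis by simp
qed

lemma dfn_imp [dfi]: "dfn n P ==> dfn n Q ==> dfn n (%M e. P M e --> Q M e)"
proof -
 assume *: "dfn n P" "dfn n Q"
 have "dfn n (%M e. \<not> P M e \<or> Q M e)" by (intro dfn_not dfn_disj *)
 then show ?thesis by simp
qed

lemma dfn_iff [dfi]: "dfn n P ==> dfn n Q ==> dfn n (%M e. P M e <-> Q M e)"
proof -
 assume *: "dfn n P" "dfn n Q"
 have "dfn n (%M e. (P M e --> Q M e) & (Q M e --> P M e))" by (intro dfn_conj dfn_imp *)
 then show ?thesis by (rule dfn_cong) blast
qed

text \<open>The number of arguments drops only if the quantified slot is the last one. Quantifying
  an inner slot frees it as a scratch variable, which is how a predicate is moved from one slot to
  another.\<close>

lemma dfn_all_at: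
 assumes "dfn (Suc m) P" "i \<le> m" "i = m \<or> n = Suc m" "m \<le> n"
 shows "dfn n (%M e. ALL a:M. P M (e(i := a)))"
proof -
 obtain p where p: "wf_fm {} {} p" "fv p \<subseteq> vok (Suc m)" "bv p \<subseteq> range vn"
  "!!M e. M : K ==> range e \<subseteq> M ==> sat (\<S> M) (mix e) p <-> P M e"
  using assms(1) unfolding dfn_def by blast
 have "fv p - {vn i} \<subseteq> vok n"
 proof
  fix x assume x: "x : fv p - {vn i}"
  then have "x : vok (Suc m)" using p(2) by blast
  then consider j where "x = vn j" "j < Suc m" | j where "x = pn j" "C ~= {}"
   unfolding vok_def by (auto split: if_split_asm)
  then show "x : vok n"
  proof cases
   case (1 j)
   then have "j < n" using x assms(2-4) by (cases "j = m") auto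
   then show ?thesis unfolding vok_def 1 by blast
  qed (simp add: vok_def)
 qed
 then show ?thesis
  using p(1,3) p(4)[OF _ range_upd] by (intro dfnI[of "Forall (vn i) p"]) (simp_all add: mix_upd[symmetric])
qed

lemma dfn_all: "dfn (Suc n) P ==> dfn n (%M e. ALL a:M. P M (e(n := a)))"
 by (rule dfn_all_at) auto

lemma dfn_ex: "dfn (Suc n) P ==> dfn n (%M e. EX a:M. P M (e(n := a)))"
 using dfn_not[OF dfn_all[OF dfn_not]] by simp

lemma dfn_ex_at: "dfn (Suc m) P ==> i \<le> m ==> dfn (Suc m) (%M e. EX a:M. P M (e(i := a)))"
 using dfn_not[OF dfn_all_at[OF dfn_not, of m P i "Suc m"]] by simp

lemma dfn_eq_var: "i < n ==> j < n ==> dfn n (%M e. e i = e j)"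
 by (rule dfnI[of "veq (vn i) (vn j)"]) (auto simp: vok_def)

lemma dfn_mem_var: "i < n ==> j < n ==> dfn n (%M e. e i : elts (e j))"
 by (rule dfnI[of "vmem (vn i) (vn j)"]) (auto simp: vok_def hmem_elts)

lemma dfn_eq_const: "i < n ==> c : C ==> dfn n (%M e. e i = c)"
 by (rule dfnI[of "veq (vn i) (pn (to_nat_on C c))"])
  (auto simp: vok_def mix_pn from_nat_into_to_nat_on[OF C_countable])

lemma dfn_bool [dfi]: "dfn n (%M e. b)"
proof -
 have "dfn (Suc n) (%M e. e n = e n)" by (rule dfn_eq_var) auto
 from dfn_all[OF this] have 1: "dfn n (%M e. True)" by simp
 show ?thesis using 1 dfn_not[OF 1] by (cases b) auto
qed

lemma dfn_shift:
 assumes "dfn k P" shows "dfn (n + k) (%M e. P M (%i. e (i + n)))"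
proof -
 obtain p where p: "wf_fm {} {} p" "fv p \<subseteq> vok k" "bv p \<subseteq> range vn"
  "!!M e. M : K ==> range e \<subseteq> M ==> sat (\<S> M) (mix e) p <-> P M e"
  using assms unfolding dfn_def by blast
 define f where "f i = (if i < 5 \<or> odd i then i else i + 2 * n)" for i
 have f: "inj f" unfolding inj_def f_def by presburger
 have fvn: "f (vn i) = vn (i + n)" "f (pn i) = pn i" for i
  unfolding f_def vn_def pn_def by auto
 have m: "mix e \<circ> f = mix (%i. e (i + n))" for e
 proof
  fix i show "(mix e \<circ> f) i = mix (%i. e (i + n)) i"
  proof (cases "i < 5 \<or> odd i")
   case True then show ?thesis by (auto simp: f_def mix_def)
  next
   case False
   then have "i = vn ((i - 6) div 2)" unfolding vn_def by presburger
   then obtain j where "i = vn j" by blast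
   then show ?thesis by (simp add: fvn)
  qed
 qed
 have "f ` vok k \<subseteq> vok (n + k)"
  unfolding vok_def by (auto simp: fvn split: if_splits)
 then have 1: "fv (ren f p) \<subseteq> vok (n + k)" using p(2) fv_ren[OF f, of p] by blast
 have 2: "bv (ren f p) \<subseteq> range vn" using p(3) by (auto simp: bv_ren) (metis fvn(1) rangeE rangeI subsetD)
 show ?thesis
  by (rule dfnI[of "ren f p"]) (use p 1 2 in \<open>auto simp: sat_ren[OF f] m wf_ren image_subset_iff\<close>)
qed

text \<open>Values must stay in \<open>M\<close>: composition is expressed by a quantifier over
  \<open>M\<close>, which has to find the intermediate value.\<close>

definition dfun :: "nat => (hc set => (nat => hc) => hc) => bool" where
 "dfun n t <-> (ALL M:K. ALL e. range e \<subseteq> M --> t M e : M) &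
   (ALL M:K. ALL e e'. range e \<subseteq> M --> range e' \<subseteq> M --> (ALL i<n. e i = e' i) --> t M e = t M e') &
   dfn (Suc n) (%M e. e n = t M e)"

lemma dfun_in: "dfun n t ==> M : K ==> range e \<subseteq> M ==> t M e : M"
 unfolding dfun_def by blast

lemma dfun_graph: "dfun n t ==> dfn (Suc n) (%M e. e n = t M e)"
 unfolding dfun_def by blast

lemma dfun_agree: "dfun n t ==> M : K ==> range e \<subseteq> M ==> range e' \<subseteq> M ==>
  (!!i. i < n ==> e i = e' i) ==> t M e = t M e'"
 unfolding dfun_def by blast

lemma dfun_upd: "dfun n t ==> M : K ==> range e \<subseteq> M ==> b : M ==> n \<le> i ==> t M (e(i := b)) = t M e"
 by (rule dfun_agree) auto

lemma dfunI:
 assumes "!!M e. M : K ==> range e \<subseteq> M ==> t M e : M" "dfn (Suc n) (%M e. e n = t M e)"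
  "!!M (e :: nat => hc) e'. M : K ==> range e \<subseteq> M ==> range e' \<subseteq> M ==> ALL i<n. e i = e' i ==> t M e = t M e'"
 shows "dfun n t"
 using assms unfolding dfun_def by blast

lemma dfun_var [dfi]: "i < n ==> dfun n (%M e. e i)"
 by (rule dfunI) (auto intro: dfn_eq_var)

lemma dfun_const [dfi]: "c : C ==> dfun n (%M e. c)"
 by (rule dfunI) (use C_sub in \<open>auto intro: dfn_eq_const\<close>)

lemma dfun_mono:
 assumes t: "dfun n t" and "n \<le> m" shows "dfun m t"
proof (cases "n = m")
 case False
 then have nm: "n < m" using assms by simp
 have "dfn (Suc m) (%M e. e n = e m & e n = t M e)"
  using nm by (intro dfn_conj dfn_eq_var dfn_mono[OF dfun_graph[OF t]]) auto
 from dfn_ex_at[OF this, of n] nm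
 have "dfn (Suc m) (%M e. EX a:M. a = e m & a = t M (e(n := a)))" by simp
 then have "dfn (Suc m) (%M e. e m = t M e)"
  by (rule dfn_cong) (use dfun_upd[OF t] dfun_in[OF t] in auto)
 then show ?thesis
  by (intro dfunI dfun_in[OF t]) (use nm in \<open>auto intro!: dfun_agree[OF t]\<close>)
qed (use assms in simp)

text \<open>Slot \<open>n\<close> holds the value of \<open>t\<close>. Premise \<open>s\<close> says
  that the slot enters \<open>\<Phi>\<close> only through the last argument, so overwriting it is
  harmless. All later rules with a bound variable carry a premise of this shape, normally closed by
  simplification.\<close>

lemma dfn_sub:
 assumes P: "dfn (Suc n) (%M e. \<Phi> M e (e n))" and t: "dfun n t"
  and s: "!!M e a b. M : K ==> range e \<subseteq> M ==> a : M ==> b : M ==> \<Phi> M (e(n := b)) a = \<Phi> M e a"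
 shows "dfn n (%M e. \<Phi> M e (t M e))"
proof -
 have "dfn n (%M e. EX a:M. a = t M (e(n := a)) & \<Phi> M (e(n := a)) a)"
  using dfn_ex[OF dfn_conj[OF dfun_graph[OF t] P]] by simp
 then show ?thesis
  by (rule dfn_cong) (use dfun_upd[OF t] dfun_in[OF t] s in auto)
qed

lemma dfn_comp1:
 assumes "dfn 1 (%M e. R M (e 0))" "dfun n s"
 shows "dfn n (%M e. R M (s M e))"
 by (rule dfn_sub[of n "%M e. R M"]) (use dfn_shift[OF assms(1), of n] assms(2) in simp_all)

lemma dfn_comp2:
 assumes R: "dfn 2 (%M e. R M (e 0) (e 1))" and s: "dfun n s" and t: "dfun n t"
 shows "dfn n (%M e. R M (s M e) (t M e))"
proof -
 have "dfn (Suc n) (%M e. R M (e n) (t M e))"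
  by (rule dfn_sub[of "Suc n" "%M e. R M (e n)"])
   (use dfn_shift[OF R, of n] dfun_mono[OF t, of "Suc n"] in simp_all)
 then show ?thesis
  by (rule dfn_sub[of n "%M e a. R M a (t M e)", OF _ s]) (simp add: dfun_upd[OF t])
qed

lemma dfn_comp3:
 assumes R: "dfn 3 (%M e. R M (e 0) (e 1) (e 2))" and s: "dfun n s" and t: "dfun n t" and u: "dfun n u"
 shows "dfn n (%M e. R M (s M e) (t M e) (u M e))"
proof -
 have "dfn (Suc (Suc n)) (%M e. R M (e n) (e (Suc n)) (u M e))"
  by (rule dfn_sub[of "Suc (Suc n)" "%M e. R M (e n) (e (Suc n))"])
   (use dfn_shift[OF R, of n] dfun_mono[OF u, of "Suc (Suc n)"] in \<open>simp_all add: eval_nat_numeral\<close>)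
 then have "dfn (Suc n) (%M e. R M (e n) (t M e) (u M e))"
  by (rule dfn_sub[of "Suc n" "%M e a. R M (e n) a (u M e)"])
   (use dfun_mono[OF t, of "Suc n"] in \<open>simp_all add: dfun_upd[OF u]\<close>)
 then show ?thesis
  by (rule dfn_sub[of n "%M e a. R M a (t M e) (u M e)", OF _ s]) (simp add: dfun_upd[OF t] dfun_upd[OF u])
qed

lemma dfn_comp4:
 assumes R: "dfn 4 (%M e. R M (e 0) (e 1) (e 2) (e 3))" and s: "dfun n s" and t: "dfun n t" and u: "dfun n u"
  and v: "dfun n v"
 shows "dfn n (%M e. R M (s M e) (t M e) (u M e) (v M e))"
proof -
 have "dfn (Suc (Suc (Suc n))) (%M e. R M (e n) (e (Suc n)) (e (Suc (Suc n))) (v M e))"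
  by (rule dfn_sub[of "Suc (Suc (Suc n))" "%M e. R M (e n) (e (Suc n)) (e (Suc (Suc n)))"])
   (use dfn_shift[OF R, of n] dfun_mono[OF v, of "Suc (Suc (Suc n))"] in \<open>simp_all add: eval_nat_numeral\<close>)
 then have "dfn (Suc (Suc n)) (%M e. R M (e n) (e (Suc n)) (u M e) (v M e))"
  by (rule dfn_sub[of "Suc (Suc n)" "%M e a. R M (e n) (e (Suc n)) a (v M e)"])
   (use dfun_mono[OF u, of "Suc (Suc n)"] in \<open>simp_all add: dfun_upd[OF v]\<close>)
 then have "dfn (Suc n) (%M e. R M (e n) (t M e) (u M e) (v M e))"
  by (rule dfn_sub[of "Suc n" "%M e a. R M (e n) a (u M e) (v M e)"])
   (use dfun_mono[OF t, of "Suc n"] in \<open>simp_all add: dfun_upd[OF u] dfun_upd[OF v]\<close>)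
 then show ?thesis
  by (rule dfn_sub[of n "%M e a. R M a (t M e) (u M e) (v M e)", OF _ s])
   (simp add: dfun_upd[OF t] dfun_upd[OF u] dfun_upd[OF v])
qed

lemma dfun_comp1:
 assumes F: "dfun 1 (%M e. F M (e 0))" and s: "dfun n s"
 shows "dfun n (%M e. F M (s M e))"
proof (rule dfunI)
 fix M and e :: "nat => hc" assume M: "M : K" "range e \<subseteq> M"
 show "F M (s M e) : M"
  using dfun_in[OF F M(1), of "%_. s M e"] dfun_in[OF s M] by auto
next
 have "dfn 2 (%M e. e 1 = F M (e 0))" using dfun_graph[OF F] by (simp add: eval_nat_numeral)
 from dfn_comp2[where R = "%M x y. y = F M x", OF this dfun_mono[OF s, of "Suc n"] dfun_var[of n]]
 show "dfn (Suc n) (%M e. e n = F M (s M e))" by simp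
next
 fix M and e e' :: "nat => hc" assume *: "M : K" "range e \<subseteq> M" "range e' \<subseteq> M" "ALL i<n. e i = e' i"
 have "s M e = s M e'" by (rule dfun_agree[OF s]) (use * in auto)
 then show "F M (s M e) = F M (s M e')" by simp
qed

lemma dfun_comp2:
 assumes F: "dfun 2 (%M e. F M (e 0) (e 1))" and s: "dfun n s" and t: "dfun n t"
 shows "dfun n (%M e. F M (s M e) (t M e))"
proof (rule dfunI)
 fix M and e :: "nat => hc" assume M: "M : K" "range e \<subseteq> M"
 show "F M (s M e) (t M e) : M"
  using dfun_in[OF F M(1), of "%i. if i = 0 then s M e else t M e"] dfun_in[OF s M] dfun_in[OF t M] by auto
next
 have "dfn 3 (%M e. e 2 = F M (e 0) (e 1))" using dfun_graph[OF F] by (simp add: eval_nat_numeral)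
 from dfn_comp3[where R = "%M x y z. z = F M x y", OF this dfun_mono[OF s, of "Suc n"] dfun_mono[OF t, of "Suc n"] dfun_var[of n]]
 show "dfn (Suc n) (%M e. e n = F M (s M e) (t M e))" by simp
next
 fix M and e e' :: "nat => hc" assume *: "M : K" "range e \<subseteq> M" "range e' \<subseteq> M" "ALL i<n. e i = e' i"
 have "s M e = s M e'" by (rule dfun_agree[OF s]) (use * in auto)
 moreover have "t M e = t M e'" by (rule dfun_agree[OF t]) (use * in auto)
 ultimately show "F M (s M e) (t M e) = F M (s M e') (t M e')" by simp
qed

lemma dfun_comp3:
 assumes F: "dfun 3 (%M e. F M (e 0) (e 1) (e 2))" and s: "dfun n s" and t: "dfun n t" and u: "dfun n u"
 shows "dfun n (%M e. F M (s M e) (t M e) (u M e))"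
proof (rule dfunI)
 fix M and e :: "nat => hc" assume M: "M : K" "range e \<subseteq> M"
 show "F M (s M e) (t M e) (u M e) : M"
  using dfun_in[OF F M(1), of "%i. if i = 0 then s M e else if i = 1 then t M e else u M e"]
   dfun_in[OF s M] dfun_in[OF t M] dfun_in[OF u M] by auto
next
 have "dfn 4 (%M e. e 3 = F M (e 0) (e 1) (e 2))" using dfun_graph[OF F] by (simp add: eval_nat_numeral)
 from dfn_comp4[where R = "%M x y z w. w = F M x y z", OF this dfun_mono[OF s, of "Suc n"] dfun_mono[OF t, of "Suc n"]
   dfun_mono[OF u, of "Suc n"] dfun_var[of n]]
 show "dfn (Suc n) (%M e. e n = F M (s M e) (t M e) (u M e))" by simp
next
 fix M and e e' :: "nat => hc" assume *: "M : K" "range e \<subseteq> M" "range e' \<subseteq> M" "ALL i<n. e i = e' i"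
 have "s M e = s M e'" by (rule dfun_agree[OF s]) (use * in auto)
 moreover have "t M e = t M e'" by (rule dfun_agree[OF t]) (use * in auto)
 moreover have "u M e = u M e'" by (rule dfun_agree[OF u]) (use * in auto)
 ultimately show "F M (s M e) (t M e) (u M e) = F M (s M e') (t M e') (u M e')" by simp
qed

lemma dfn_eq [dfi]: "dfun n s ==> dfun n t ==> dfn n (%M e. s M e = t M e)"
 by (rule dfn_comp2[where R = "%M x y. x = y"]) (auto intro: dfn_eq_var)

lemma dfn_mem [dfi]: "dfun n s ==> dfun n t ==> dfn n (%M e. s M e : elts (t M e))"
 by (rule dfn_comp2[where R = "%M x y. x : elts y"]) (auto intro: dfn_mem_var)

lemma dfn_Bex [dfi]:
 assumes "dfn (Suc n) (%M e. \<Phi> M e (e n))"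
  and s: "!!M e a b. M : K ==> range e \<subseteq> M ==> a : M ==> b : M ==> \<Phi> M (e(n := b)) a = \<Phi> M e a"
 shows "dfn n (%M e. EX a:M. \<Phi> M e a)"
 by (rule dfn_cong[OF dfn_ex[OF assms(1)]]) (use s in auto)

lemma dfn_Ball [dfi]:
 assumes "dfn (Suc n) (%M e. \<Phi> M e (e n))"
  and s: "!!M e a b. M : K ==> range e \<subseteq> M ==> a : M ==> b : M ==> \<Phi> M (e(n := b)) a = \<Phi> M e a"
 shows "dfn n (%M e. ALL a:M. \<Phi> M e a)"
 by (rule dfn_cong[OF dfn_all[OF assms(1)]]) (use s in auto)

lemma K_trans: "M : K ==> x : M ==> y : elts x ==> y : M"
 using K_zfm zfm_trans by blast

lemma K_ext: "M : K ==> x : M ==> y : M ==> x = y <-> (ALL a:M. a : elts x <-> a : elts y)"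
 using K_trans by (metis elts_eqI)

lemma rng: "range e \<subseteq> M ==> e i : M"
 by auto

lemma dfn_Bex_elts [dfi]:
 assumes t: "dfun n t" and P: "dfn (Suc n) (%M e. \<Phi> M e (e n))"
  and s: "!!M e a b. M : K ==> range e \<subseteq> M ==> a : M ==> b : M ==> \<Phi> M (e(n := b)) a = \<Phi> M e a"
 shows "dfn n (%M e. EX a:elts (t M e). \<Phi> M e a)"
proof -
 have "dfn n (%M e. EX a:M. a : elts (t M e) & \<Phi> M e a)"
  by (intro dfn_Bex dfn_conj P dfn_mem dfun_var dfun_mono[OF t]) (simp_all add: s dfun_upd[OF t])
 then show ?thesis by (rule dfn_cong) (use K_trans dfun_in[OF t] in blast)
qed

lemma dfn_Ball_elts [dfi]:
 assumes t: "dfun n t" and P: "dfn (Suc n) (%M e. \<Phi> M e (e n))"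
  and s: "!!M e a b. M : K ==> range e \<subseteq> M ==> a : M ==> b : M ==> \<Phi> M (e(n := b)) a = \<Phi> M e a"
 shows "dfn n (%M e. ALL a:elts (t M e). \<Phi> M e a)"
proof -
 have "dfn n (%M e. \<not> (EX a:elts (t M e). \<not> \<Phi> M e a))"
  by (intro dfn_not dfn_Bex_elts t P) (simp add: s)
 then show ?thesis by simp
qed

lemma dfn_lift:
 assumes P: "dfn (Suc n) (%M e. \<Phi> M e (e n))" and nm: "n \<le> m"
  and s: "!!M e a b. M : K ==> range e \<subseteq> M ==> a : M ==> b : M ==> \<Phi> M (e(n := b)) a = \<Phi> M e a"
 shows "dfn (Suc m) (%M e. \<Phi> M e (e m))"
proof (cases "n = m")
 case False
 have "dfn (Suc m) (%M e. e n = e m & \<Phi> M e (e n))"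
  using nm by (intro dfn_conj dfn_eq_var dfn_mono[OF P]) auto
 from dfn_ex_at[OF this nm] False
 have "dfn (Suc m) (%M e. EX b:M. b = e m & \<Phi> M (e(n := b)) b)" by simp
 then show ?thesis by (rule dfn_cong) (use s in auto)
qed (use P in simp)

lemma dfn_indep:
 assumes P: "dfn (Suc n) (%M e. \<Phi> M e (e n))" and nm: "n < m"
  and s: "!!M e a b. M : K ==> range e \<subseteq> M ==> a : M ==> b : M ==> \<Phi> M (e(n := b)) a = \<Phi> M e a"
  and *: "M : K" "range e \<subseteq> M" "a : M" "b : M"
 shows "\<Phi> M (e(m := b)) a = \<Phi> M e a"
proof -
 have "\<Phi> M (e(m := b, n := a)) ((e(m := b, n := a)) n) = \<Phi> M (e(n := a)) ((e(n := a)) n)"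
  by (rule dfn_agree[OF P *(1)]) (use * nm range_upd in auto)
 then show ?thesis using s[OF *(1) range_upd[OF *(2,4)]] s[OF *(1,2)] * by simp
qed

text \<open>The formula behind \<open>\<Phi>\<close> is the one to which separation is applied in
  each world. Comprehension thus becomes a term former, to be nested freely in definitions.\<close>

lemma dfun_sep [dfi]:
 assumes t: "dfun n t" and P: "dfn (Suc n) (%M e. \<Phi> M e (e n))"
  and s: "!!M e a b. M : K ==> range e \<subseteq> M ==> a : M ==> b : M ==> \<Phi> M (e(n := b)) a = \<Phi> M e a"
 shows "dfun n (%M e. hset {a : elts (t M e). \<Phi> M e a})"
proof -
 obtain p where p: "wf_fm {} {} p" "fv p \<subseteq> vok (Suc n)"
  "!!M e. M : K ==> range e \<subseteq> M ==> sat (\<S> M) (mix e) p <-> \<Phi> M e (e n)"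
  using P unfolding dfn_def by blast
 have cl: "hset {a : elts (t M e). \<Phi> M e a} : M" if M: "M : K" "range e \<subseteq> M" for M e
 proof -
 have "{a : elts (t M e). \<Phi> M e a} = {a : elts (t M e). sat (\<S> M) ((mix e)(vn n := a)) p}"
  using M p(3)[OF M(1) range_upd[OF M(2)]] s[OF M] K_trans[OF M(1) dfun_in[OF t M]]
  by (auto simp: mix_upd)
 also have "hset \<dots> : M"
  by (rule zfm_sep_fm[OF K_zfm[OF M(1)] p(1)])
   (use p(2) vok_low[of "Suc n"] dfun_in[OF t M] mix_vok[OF M] in auto)
 finally show ?thesis .
 qed
 have ind: "\<Phi> M (e(m := b)) a = \<Phi> M e a"
  if "n < m" "M : K" "range e \<subseteq> M" "a : M" "b : M" for M e a b m
  by (rule dfn_indep[of n \<Phi>]) (use P s that in auto)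
 have L: "dfn (Suc (Suc n)) (%M e. \<Phi> M e (e (Suc n)))"
  by (rule dfn_lift[of n \<Phi>]) (use P s in auto)
 have "dfn (Suc n) (%M e. ALL a:M. a : elts (e n) <-> a : elts (t M e) & \<Phi> M e a)"
  by (intro dfn_Ball dfn_iff dfn_conj dfn_mem dfun_var dfun_mono[OF t] L)
   (simp_all add: s dfun_upd[OF t] ind)
 then have gr: "dfn (Suc n) (%M e. e n = hset {a : elts (t M e). \<Phi> M e a})"
 proof (rule dfn_cong)
  fix M and e :: "nat => hc" assume M: "M : K" "range e \<subseteq> M"
  have "elts (hset {a : elts (t M e). \<Phi> M e a}) = {a : elts (t M e). \<Phi> M e a}"
   by (intro elts_hset countable_sub_elts) auto
  then show "(ALL a:M. (a : elts (e n)) = (a : elts (t M e) & \<Phi> M e a)) = (e n = hset {a : elts (t M e). \<Phi> M e a})"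
   using K_ext[OF M(1) rng[OF M(2), of n] cl[OF M]] by simp
 qed
 {
 fix M and e e' :: "nat => hc" assume *: "M : K" "range e \<subseteq> M" "range e' \<subseteq> M" "ALL i<n. e i = e' i"
 have "t M e = t M e'" by (rule dfun_agree[OF t]) (use * in auto)
 moreover have "\<Phi> M e a = \<Phi> M e' a" if "a : elts (t M e)" for a
 proof -
  have a: "a : M" using that K_trans dfun_in[OF t] * by blast
  have "\<Phi> M (e(n := a)) ((e(n := a)) n) = \<Phi> M (e'(n := a)) ((e'(n := a)) n)"
   by (rule dfn_agree[OF P]) (use * a range_upd in \<open>auto simp: less_Suc_eq\<close>)
  then show ?thesis using s * a by simp
 qed
 ultimately have "hset {a : elts (t M e). \<Phi> M e a} = hset {a : elts (t M e'). \<Phi> M e' a}"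
  by (intro arg_cong[of _ _ hset] Collect_cong) metis
 }
 note ag = this
 show ?thesis by (rule dfunI[OF cl gr ag])
qed

lemma dfun_repl [dfi]:
 assumes t: "dfun n t" and F: "dfun (Suc n) (%M e. F M e (e n))"
  and s: "!!M e a b. M : K ==> range e \<subseteq> M ==> a : M ==> b : M ==> F M (e(n := b)) a = F M e a"
 shows "dfun n (%M e. hset ((%a. F M e a) ` elts (t M e)))"
proof -
 have FM: "F M e a : M" if "M : K" "range e \<subseteq> M" "a : M" for M e a
  using dfun_in[OF F that(1) range_upd[OF that(2,3)], of n] s[OF that(1,2) that(3) that(3)] by simp
 obtain p where p: "wf_fm {} {} p" "fv p \<subseteq> vok (Suc (Suc n))"
  "!!M e. M : K ==> range e \<subseteq> M ==> sat (\<S> M) (mix e) p <-> e (Suc n) = F M e (e n)"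
  using dfun_graph[OF F] unfolding dfn_def by blast
 have ind: "F M (e(Suc n := b)) a = F M e a"
  if *: "M : K" "range e \<subseteq> M" "a : M" "b : M" for M e a b
 proof -
  have "F M (e(Suc n := b, n := a)) ((e(Suc n := b, n := a)) n) = F M (e(n := a)) ((e(n := a)) n)"
   by (rule dfun_agree[OF F that(1)]) (use * range_upd in auto)
  then show ?thesis using s[OF *(1) range_upd[OF *(2,4)]] s[OF *(1,2)] * by simp
 qed
 {
  fix M and e :: "nat => hc" assume M: "M : K" "range e \<subseteq> M"
  have "hset ((%a. F M e a) ` elts (t M e)) : M"
  proof (rule zfm_repl_fm[OF K_zfm[OF M(1)] p(1)])
   fix a b assume ab: "a : elts (t M e)" "b : M"
   then have a: "a : M" using K_trans dfun_in[OF t] M by blast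
   show "sat (\<S> M) ((mix e)(vn n := a, vn (Suc n) := b)) p <-> b = F M e a"
    using p(3)[OF M(1) range_upd[OF range_upd[OF M(2) a] ab(2)]]
     ind[OF M(1) range_upd[OF M(2) a] a ab(2)] s[OF M a a]
    by (simp add: mix_upd)
  next
   fix a assume "a : elts (t M e)"
   then have a: "a : M" using K_trans dfun_in[OF t] M by blast
   show "F M e a : M" using FM[OF M a] .
  qed (use p(2) vok_low[of "Suc (Suc n)"] dfun_in[OF t M] mix_vok[OF M] K_trans[OF M(1)] FM[OF M] in auto)
 }
 note cl = this
 have G: "dfn (Suc (Suc (Suc n))) (%M e. e (Suc n) = F M e (e (Suc (Suc n))))"
 proof -
  have "dfn (Suc (Suc (Suc n))) (%M e. e n = e (Suc (Suc n)) & e (Suc n) = F M e (e n))"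
   by (intro dfn_conj dfn_eq_var dfn_mono[OF dfun_graph[OF F]]) auto
  from dfn_ex_at[OF this, of n]
  have "dfn (Suc (Suc (Suc n))) (%M e. EX b:M. b = e (Suc (Suc n)) & e (Suc n) = F M (e(n := b)) b)" by simp
  then show ?thesis by (rule dfn_cong) (use s in auto)
 qed
 have ind2: "F M (e(Suc (Suc n) := b)) a = F M e a"
  if *: "M : K" "range e \<subseteq> M" "a : M" "b : M" for M e a b
 proof -
  have "F M (e(Suc (Suc n) := b, n := a)) ((e(Suc (Suc n) := b, n := a)) n) = F M (e(n := a)) ((e(n := a)) n)"
   by (rule dfun_agree[OF F that(1)]) (use * range_upd in auto)
  then show ?thesis using s[OF *(1) range_upd[OF *(2,4)]] s[OF *(1,2)] * by simp
 qed
 have "dfn (Suc n) (%M e. ALL b:M. b : elts (e n) <-> (EX a:elts (t M e). b = F M e a))"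
  by (intro dfn_Ball dfn_iff dfn_Bex_elts dfn_mem dfun_var dfun_mono[OF t] G)
   (simp_all add: s dfun_upd[OF t] ind ind2, metis K_trans dfun_in[OF t] ind)
 then have gr: "dfn (Suc n) (%M e. e n = hset ((%a. F M e a) ` elts (t M e)))"
 proof (rule dfn_cong)
  fix M and e :: "nat => hc" assume M: "M : K" "range e \<subseteq> M"
  have "F M e a : M" if "a : elts (t M e)" for a using FM[OF M] K_trans[OF M(1) dfun_in[OF t M] that] by blast
  then show "(ALL b:M. (b : elts (e n)) = (EX a:elts (t M e). b = F M e a)) =
    (e n = hset (F M e ` elts (t M e)))"
   using K_ext[OF M(1) rng[OF M(2), of n] cl[OF M]] by (auto simp: image_iff)
 qed
 {
 fix M and e e' :: "nat => hc" assume *: "M : K" "range e \<subseteq> M" "range e' \<subseteq> M" "ALL i<n. e i = e' i"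
 have "t M e = t M e'" by (rule dfun_agree[OF t]) (use * in auto)
 moreover have "F M e a = F M e' a" if "a : elts (t M e)" for a
 proof -
  have a: "a : M" using that K_trans dfun_in[OF t] * by blast
  have "F M (e(n := a)) ((e(n := a)) n) = F M (e'(n := a)) ((e'(n := a)) n)"
   by (rule dfun_agree[OF F]) (use * a range_upd in \<open>auto simp: less_Suc_eq\<close>)
  then show ?thesis using s * a by simp
 qed
 ultimately have "hset (F M e ` elts (t M e)) = hset (F M e' ` elts (t M e'))"
  by (intro arg_cong[of _ _ hset] image_cong) simp_all
 }
 note ag = this
 show ?thesis by (rule dfunI[OF cl gr ag])
qed

lemma dfun_if [dfi]:
 assumes P: "dfn n P" and s: "dfun n s" and t: "dfun n t"
 shows "dfun n (%M e. if P M e then s M e else t M e)"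
proof (rule dfunI)
 have "dfn (Suc n) (%M e. (P M e --> e n = s M e) & (\<not> P M e --> e n = t M e))"
  by (intro dfn_conj dfn_imp dfn_not dfn_mono[OF P] dfun_graph s t) auto
 then show "dfn (Suc n) (%M e. e n = (if P M e then s M e else t M e))"
  by (rule dfn_cong) auto
next
 fix M and e e' :: "nat => hc" assume *: "M : K" "range e \<subseteq> M" "range e' \<subseteq> M" "ALL i<n. e i = e' i"
 have "P M e = P M e'" by (rule dfn_agree[OF P]) (use * in auto)
 moreover have "s M e = s M e'" by (rule dfun_agree[OF s]) (use * in auto)
 moreover have "t M e = t M e'" by (rule dfun_agree[OF t]) (use * in auto)
 ultimately show "(if P M e then s M e else t M e) = (if P M e' then s M e' else t M e')" by simp
qed (use dfun_in[OF s] dfun_in[OF t] in auto)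

lemma dfun_class:
 assumes "!!M e. M : K ==> range e \<subseteq> M ==> t M e : M"
  and P: "dfn (Suc n) (%M e. \<Phi> M e (e n))"
  and s: "!!M e a b. M : K ==> range e \<subseteq> M ==> a : M ==> b : M ==> \<Phi> M (e(n := b)) a = \<Phi> M e a"
  and eq: "!!M e a. M : K ==> range e \<subseteq> M ==> a : M ==> a = t M e <-> \<Phi> M e a"
 shows "dfun n t"
proof (rule dfunI)
 show "dfn (Suc n) (%M e. e n = t M e)"
  by (rule dfn_cong[OF P]) (use eq in \<open>auto simp: image_subset_iff\<close>)
 fix M and e e' :: "nat => hc" assume *: "M : K" "range e \<subseteq> M" "range e' \<subseteq> M" "ALL i<n. e i = e' i"
 let ?a = "t M e"
 have a: "?a : M" using assms(1) * by blast
 have "\<Phi> M (e(n := ?a)) ((e(n := ?a)) n) = \<Phi> M (e'(n := ?a)) ((e'(n := ?a)) n)"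
  by (rule dfn_agree[OF P]) (use * a range_upd in \<open>auto simp: less_Suc_eq\<close>)
 then have "\<Phi> M e ?a = \<Phi> M e' ?a" using s[OF *(1)] a * by simp
 then show "t M e = t M e'" using eq[OF *(1,2) a] eq[OF *(1,3) a] by blast
qed (use assms in auto)

section \<open>Basic set operations\<close>

lemma dfn_subset [dfi]: "dfun n s ==> dfun n t ==> dfn n (%M e. elts (s M e) \<subseteq> elts (t M e))"
proof (rule dfn_comp2[where R = "%M x y. elts x \<subseteq> elts y"])
 have "dfn 2 (%M e. ALL a:elts (e 0). a : elts (e 1))" by (intro dfi) simp_all
 then show "dfn 2 (%M e. elts (e 0) \<subseteq> elts (e 1))" by (simp add: subset_iff Ball_def)
qed

lemma dfun_upair [dfi]: "dfun n s ==> dfun n t ==> dfun n (%M e. upair (s M e) (t M e))"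
proof (rule dfun_comp2[where F = "%M. upair"])
 have "dfn 3 (%M e. ALL a:M. a : elts (e 2) <-> a = e 0 \<or> a = e 1)" by (intro dfi) simp_all
 then have "dfn 3 (%M e. e 2 = upair (e 0) (e 1))"
  by (rule dfn_cong) (auto simp: K_ext zfm_upair[OF K_zfm] rng)
 then show "dfun 2 (%M e. upair (e 0) (e 1))"
  by (intro dfunI) (auto simp: eval_nat_numeral intro!: zfm_upair K_zfm)
qed

lemma dfun_opair [dfi]: "dfun n s ==> dfun n t ==> dfun n (%M e. opair (s M e) (t M e))"
 unfolding opair_def by (intro dfi)

lemma dfun_hunion [dfi]: "dfun n s ==> dfun n (%M e. hunion (s M e))"
proof (rule dfun_comp1[where F = "%M. hunion"])
 have "dfn 2 (%M e. ALL a:M. a : elts (e 1) <-> (EX b:elts (e 0). a : elts b))" by (intro dfi) simp_all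
 then have "dfn 2 (%M e. e 1 = hunion (e 0))"
  by (rule dfn_cong) (auto simp: K_ext zfm_union[OF K_zfm] rng)
 then show "dfun 1 (%M e. hunion (e 0))"
  by (intro dfunI) (auto simp: eval_nat_numeral intro!: zfm_union K_zfm)
qed

lemma dfun_pow [dfi]: "dfun n s ==> dfun n (%M e. pow M (s M e))"
proof (rule dfun_comp1[where F = pow])
 have "dfn 2 (%M e. ALL a:M. a : elts (e 1) <-> elts a \<subseteq> elts (e 0))" by (intro dfi) simp_all
 then have "dfn 2 (%M e. e 1 = pow M (e 0))"
 proof (rule dfn_cong)
  fix M and e :: "nat => hc" assume M: "M : K" "range e \<subseteq> M"
  have "countable M" using K_zfm M zfm_countable by blast
  then have "elts (pow M (e 0)) = {y : M. elts y \<subseteq> elts (e 0)}"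
   unfolding pow_def by (intro elts_hset) (auto intro: countable_subset)
  then show "(ALL a:M. (a : elts (e 1)) = (elts a \<subseteq> elts (e 0))) = (e 1 = pow M (e 0))"
   using M by (auto simp: K_ext zfm_pow[OF K_zfm] rng)
 qed
 then show "dfun 1 (%M e. pow M (e 0))"
  by (intro dfunI) (auto simp: eval_nat_numeral intro!: zfm_pow K_zfm)
qed

lemma hun_alt: "hun x y = hunion (upair x y)"
 by (rule elts_eqI) auto

lemma hsuc_alt: "hsuc x = hun x (upair x x)"
 by (rule elts_eqI) auto

lemma dfun_hun [dfi]: "dfun n s ==> dfun n t ==> dfun n (%M e. hun (s M e) (t M e))"
 unfolding hun_alt by (intro dfi)

lemma dfun_hsuc [dfi]: "dfun n s ==> dfun n (%M e. hsuc (s M e))"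
 unfolding hsuc_alt by (intro dfi)

text \<open>A minimal element of a transitive class has no members at all.\<close>

lemma zfm_hempty: "M : zfm ==> hempty : M"
 using zfm_nonempty hmin[of "%x. x : M"] by (metis elts_eqI elts_hempty empty_iff zfm_trans)

lemma dfun_hempty [dfi]: "dfun n (%M e. hempty)"
proof (rule dfun_class[where \<Phi> = "%M e a. ALL b:elts a. False"])
 show "dfn (Suc n) (%M e. ALL b:elts (e n). False)" by (intro dfi) simp_all
qed (auto intro: zfm_hempty K_zfm elts_eqI)

lemma dfun_hc_nat [dfi]: "dfun n (%M e. hc_nat k)"
 by (induction k) (auto intro: dfi)

end

lemma zfm_zfmodels: "M : zfm ==> zfmodels {M} M"
 by unfold_locales (auto simp: zfm_countable)

section \<open>Pairs, functions and natural numbers\<close>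

text \<open>The quantifiers are bounded by the field of \<open>f\<close>, so the rules of the
  calculus apply and the meaning does not depend on the world. \<open>f\<close> may also have
  members that are not pairs.\<close>

definition fnl :: "hc => bool" where
 "fnl f <-> (ALL p:elts f. ALL q:elts f. ALL x:elts (hunion (hunion f)). ALL y:elts (hunion (hunion f)).
   ALL y':elts (hunion (hunion f)). p = opair x y --> q = opair x y' --> y = y')"

text \<open>The union over all values is the value itself for functional \<open>f\<close>, and
  \<open>hempty\<close> off the domain; this makes application total.\<close>

definition app :: "hc => hc => hc" where
 "app f x = hunion (hset {y : elts (hunion (hunion f)). opair x y : elts f})"

definition lam :: "hc => (hc => hc) => hc" where
 "lam d F = hset ((%a. opair a (F a)) ` elts d)"

definition hfst :: "hc => hc" where
 "hfst p = hunion (hset {x : elts (hunion p). EX y:elts (hunion p). p = opair x y})"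

definition hsnd :: "hc => hc" where
 "hsnd p = hunion (hset {y : elts (hunion p). EX x:elts (hunion p). p = opair x y})"

definition times :: "hc => hc => hc" where
 "times x y = hunion (hset ((%a. hset ((%b. opair a b) ` elts y)) ` elts x))"

definition hdom :: "hc => hc" where
 "hdom f = hset {x : elts (hunion (hunion f)). EX y:elts (hunion (hunion f)). opair x y : elts f}"

lemma countable_Collect_elts [simp]: "countable {a : elts x. P a}"
 by (rule countable_sub_elts) auto

lemma opair_field: "opair x y : elts f ==> x : elts (hunion (hunion f)) & y : elts (hunion (hunion f))"
proof -
 assume h: "opair x y : elts f"
 then have "upair x y : elts (hunion f)" by (auto simp: elts_opair intro!: bexI[of _ "opair x y"])
 then show ?thesis by (auto simp del: elts_hunion simp add: elts_hunion[of "hunion f"] intro!: bexI[of _ "upair x y"])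
qed

lemma fnl_iff: "fnl f <-> (ALL x y y'. opair x y : elts f --> opair x y' : elts f --> y = y')"
 unfolding fnl_def using opair_field by (metis (no_types, opaque_lifting))

lemma app_eq: "fnl f ==> opair x y : elts f ==> app f x = y"
proof -
 assume *: "fnl f" "opair x y : elts f"
 then have "{y : elts (hunion (hunion f)). opair x y : elts f} = {y}"
  using opair_field[OF *(2)] unfolding fnl_iff by blast
 then show ?thesis unfolding app_def by (intro elts_eqI) (simp del: elts_hunion add: elts_hunion[of "hset {y}"])
qed

lemma app_none: "(!!y. opair x y ~: elts f) ==> app f x = hempty"
 unfolding app_def by (intro elts_eqI) simp

lemma elts_lam [simp]: "elts (lam d F) = (%a. opair a (F a)) ` elts d"
 by (simp add: lam_def)

lemma fnl_lam [simp]: "fnl (lam d F)"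
 by (auto simp: fnl_iff)

lemma app_lam [simp]: "a : elts d ==> app (lam d F) a = F a"
 by (rule app_eq) auto

lemma lam_cong: "(!!a. a : elts d ==> F a = F' a) ==> lam d F = lam d F'"
 unfolding lam_def by (intro arg_cong[of _ _ hset] image_cong) auto

lemma elts_hunion_opair: "elts (hunion (opair x y)) = {x, y}"
 by (auto simp: elts_opair)

lemma hfst_opair [simp]: "hfst (opair x y) = x"
proof -
 have "{a : elts (hunion (opair x y)). EX b:elts (hunion (opair x y)). opair x y = opair a b} = {x}"
  unfolding elts_hunion_opair by auto
 then show ?thesis unfolding hfst_def by (intro elts_eqI) simp
qed

lemma hsnd_opair [simp]: "hsnd (opair x y) = y"
proof -
 have "{b : elts (hunion (opair x y)). EX a:elts (hunion (opair x y)). opair x y = opair a b} = {y}"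
  unfolding elts_hunion_opair by auto
 then show ?thesis unfolding hsnd_def by (intro elts_eqI) simp
qed

lemma elts_times [simp]: "elts (times x y) = {opair a b | a b. a : elts x & b : elts y}"
 unfolding times_def by auto

lemma elts_hdom: "elts (hdom f) = {x. EX y. opair x y : elts f}"
proof -
 have "{x. EX y. opair x y : elts f} = {x : elts (hunion (hunion f)). EX y:elts (hunion (hunion f)). opair x y : elts f}"
  using opair_field[of _ _ f] by blast
 then show ?thesis unfolding hdom_def by (simp only: elts_hset countable_Collect_elts)
qed

text \<open>Definite description with default \<open>hempty\<close>. It turns a uniquely determined
  object into a term, to which replacement can then be applied through images.\<close>

definition theM :: "hc set => (hc => bool) => hc" where
 "theM M Q = (if EX a:M. Q a & (ALL b:M. Q b --> b = a) then (THE a. a : M & Q a) else hempty)"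

lemma theM_eq: "a : M ==> Q a ==> (!!b. b : M ==> Q b ==> b = a) ==> theM M Q = a"
proof -
 assume *: "a : M" "Q a" "!!b. b : M ==> Q b ==> b = a"
 then have c: "EX a:M. Q a & (ALL b:M. Q b --> b = a)" by blast
 have "(THE a. a : M & Q a) = a" by (rule the_equality) (use * in blast)+
 then show ?thesis unfolding theM_def if_P[OF c] .
qed

lemma theM_iff:
 "(a = theM M Q) <-> (Q a & (ALL b:M. Q b --> b = a)) \<or>
   (a = hempty & \<not> (EX c:M. Q c & (ALL b:M. Q b --> b = c)))" if "a : M"
proof (cases "EX c:M. Q c & (ALL b:M. Q b --> b = c)")
 case True
 then obtain c where c: "c : M" "Q c" "!!b. b : M ==> Q b ==> b = c" by blast
 then have "theM M Q = c" by (rule theM_eq)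
 then show ?thesis using c that by metis
next
 case False
 then have "theM M Q = hempty" unfolding theM_def by (rule if_not_P)
 then show ?thesis using False that by metis
qed

lemma theM_in: "hempty : M ==> theM M Q : M"
proof (cases "EX c:M. Q c & (ALL b:M. Q b --> b = c)")
 case True
 then obtain c where c: "c : M" "Q c" "!!b. b : M ==> Q b ==> b = c" by blast
 then have "theM M Q = c" by (rule theM_eq)
 then show ?thesis using c by metis
next
 case False
 then have "theM M Q = hempty" unfolding theM_def by (rule if_not_P)
 then show "hempty : M ==> theM M Q : M" by simp
qed

text \<open>A bounded description of the natural numbers: ordinals such that they and all their
  members are zero or successors. It is available before \<open>omega\<close> is known to be an
  element of the world.\<close>

definition isnat :: "hc => bool" where
 "isnat x <-> htrans x & (ALL y:elts x. htrans y) & (ALL y:elts (hsuc x). y = hempty \<or> (EX z:elts x. y = hsuc z))"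

lemma htrans_hc_nat: "htrans (hc_nat n)"
 unfolding htrans_def by (auto simp: elts_hc_nat)

lemma isnat_iff: "isnat x <-> x : range hc_nat"
proof
 assume "x : range hc_nat"
 then obtain n where x: "x = hc_nat n" by blast
 have "hc_nat m = hempty \<or> (EX z:elts (hc_nat n). hc_nat m = hsuc z)" if "m \<le> n" for m
  using that by (cases m) (auto simp: elts_hc_nat)
 then show "isnat x" unfolding isnat_def x
  by (auto simp: htrans_hc_nat elts_hc_nat simp del: hc_nat_simps)
next
 show "isnat x ==> x : range hc_nat"
 proof (induction x rule: hc_induct)
  case (step x)
  then have t: "htrans x" "!!y. y : elts x ==> htrans y"
   and s: "!!y. y : elts (hsuc x) ==> y = hempty \<or> (EX z:elts x. y = hsuc z)" unfolding isnat_def by auto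
  consider "x = hempty" | z where "z : elts x" "x = hsuc z" using s[of x] by auto
  then show ?case
  proof cases
   case 1 then show ?thesis by (metis hc_nat_0 rangeI)
  next
   case (2 z)
   have "y = hempty \<or> (EX w:elts z. y = hsuc w)" if "y : elts (hsuc z)" for y
   proof -
    have "y : elts (hsuc x)" using that 2 by simp
    from s[OF this] consider "y = hempty" | w where "w : elts x" "y = hsuc w" by blast
    then show ?thesis
    proof cases
     case (2 w)
     then have "w : elts y" by simp
     then have "w : elts z" using that t(2)[OF \<open>z : elts x\<close>] htransD by auto
     then show ?thesis using 2 by auto
    qed simp
   qed
   then have "isnat z" unfolding isnat_def using 2 t by auto
   then have "z : range hc_nat" using step.IH[OF 2(1)] by blast
   then show ?thesis using 2 by (metis hc_nat_Suc rangeE rangeI)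
  qed
 qed
qed

context zfmodels
begin

lemma dfun_cong: "dfun n t ==> (!!M e. M : K ==> range e \<subseteq> M ==> t M e = t' M e) ==> dfun n t'"
proof (rule dfunI)
 assume t: "dfun n t" and eq: "!!M e. M : K ==> range e \<subseteq> M ==> t M e = t' M e"
 show "t' M e : M" if "M : K" "range e \<subseteq> M" for M e using dfun_in[OF t that] eq[OF that] by simp
 show "dfn (Suc n) (%M e. e n = t' M e)" by (rule dfn_cong[OF dfun_graph[OF t]]) (simp add: eq)
 fix M and e e' :: "nat => hc" assume *: "M : K" "range e \<subseteq> M" "range e' \<subseteq> M" "ALL i<n. e i = e' i"
 have "t M e = t M e'" by (rule dfun_agree[OF t]) (use * in auto)
 then show "t' M e = t' M e'" using eq * by simp
qed

lemma dfn_htrans [dfi]: "dfun n s ==> dfn n (%M e. htrans (s M e))"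
proof (rule dfn_comp1[where R = "%M. htrans"])
 show "dfn 1 (%M e. htrans (e 0))" unfolding htrans_def by (intro dfi) simp_all
qed

lemma dfn_fnl [dfi]: "dfun n s ==> dfn n (%M e. fnl (s M e))"
proof (rule dfn_comp1[where R = "%M. fnl"])
 show "dfn 1 (%M e. fnl (e 0))" unfolding fnl_def by (intro dfi) simp_all
qed

lemma dfun_app [dfi]: "dfun n s ==> dfun n t ==> dfun n (%M e. app (s M e) (t M e))"
proof (rule dfun_comp2[where F = "%M. app"])
 show "dfun 2 (%M e. app (e 0) (e 1))" unfolding app_def by (intro dfi) simp_all
qed

lemma dfun_hfst [dfi]: "dfun n s ==> dfun n (%M e. hfst (s M e))"
proof (rule dfun_comp1[where F = "%M. hfst"])
 show "dfun 1 (%M e. hfst (e 0))" unfolding hfst_def by (intro dfi) simp_all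
qed

lemma dfun_hsnd [dfi]: "dfun n s ==> dfun n (%M e. hsnd (s M e))"
proof (rule dfun_comp1[where F = "%M. hsnd"])
 show "dfun 1 (%M e. hsnd (e 0))" unfolding hsnd_def by (intro dfi) simp_all
qed

lemma dfun_times [dfi]: "dfun n s ==> dfun n t ==> dfun n (%M e. times (s M e) (t M e))"
proof (rule dfun_comp2[where F = "%M. times"])
 show "dfun 2 (%M e. times (e 0) (e 1))" unfolding times_def by (intro dfi) simp_all
qed

lemma dfun_hdom [dfi]: "dfun n s ==> dfun n (%M e. hdom (s M e))"
proof (rule dfun_comp1[where F = "%M. hdom"])
 show "dfun 1 (%M e. hdom (e 0))" unfolding hdom_def by (intro dfi) simp_all
qed

lemma dfun_lam [dfi]:
 assumes "dfun n t" and "dfun (Suc n) (%M e. F M e (e n))"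
  and "!!M e a b. M : K ==> range e \<subseteq> M ==> a : M ==> b : M ==> F M (e(n := b)) a = F M e a"
 shows "dfun n (%M e. lam (t M e) (%a. F M e a))"
 unfolding lam_def by (intro dfi assms) (simp_all add: assms(3))

lemma dfun_theM [dfi]:
 assumes P: "dfn (Suc n) (%M e. \<Phi> M e (e n))"
  and s: "!!M e a b. M : K ==> range e \<subseteq> M ==> a : M ==> b : M ==> \<Phi> M (e(n := b)) a = \<Phi> M e a"
 shows "dfun n (%M e. theM M (%a. \<Phi> M e a))"
proof (rule dfun_class[where \<Phi> = "%M e a. (\<Phi> M e a & (ALL b:M. \<Phi> M e b --> b = a)) \<or>
   (a = hempty & \<not> (EX c:M. \<Phi> M e c & (ALL b:M. \<Phi> M e b --> b = c)))"])
 have ind: "\<Phi> M (e(m := b)) a = \<Phi> M e a"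
  if "n < m" "M : K" "range e \<subseteq> M" "a : M" "b : M" for M e a b m
  by (rule dfn_indep[of n \<Phi>]) (use P s that in auto)
 have L: "dfn (Suc m) (%M e. \<Phi> M e (e m))" if "n \<le> m" for m
  by (rule dfn_lift[of n \<Phi>]) (use P s that in auto)
 have L': "dfn (Suc (Suc (Suc n))) (%M e. \<Phi> M e (e (Suc n)))"
  by (rule dfn_mono[OF L]) auto
 show "dfn (Suc n) (%M e. (\<Phi> M e (e n) & (ALL b:M. \<Phi> M e b --> b = (e n))) \<or>
   (e n = hempty & \<not> (EX c:M. \<Phi> M e c & (ALL b:M. \<Phi> M e b --> b = c))))"
  by (intro dfn_disj dfn_conj dfn_not dfn_imp dfn_Ball dfn_Bex dfn_eq dfun_var dfun_hempty P L[of "Suc n"] L[of "Suc (Suc n)"] L')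
   (simp_all add: s ind)
qed (simp_all add: s theM_in zfm_hempty K_zfm, simp_all add: theM_iff)

lemma dfn_isnat: "dfun n s ==> dfn n (%M e. isnat (s M e))"
proof (rule dfn_comp1[where R = "%M. isnat"])
 show "dfn 1 (%M e. isnat (e 0))" unfolding isnat_def by (intro dfi) simp_all
qed

end

text \<open>Infinity only provides some inductive set \<open>I\<close>. It contains every natural
  number, and \<open>isnat\<close> separates \<open>omega\<close> from it.\<close>

lemma zfm_omega:
 assumes M: "M : zfm" shows "omega : M"
proof -
 interpret D: zfmodels "{M}" M using M by (rule zfm_zfmodels)
 obtain a where "a : M" using zfm_nonempty[OF M] by blast
 then have "sat (\<S> M) (%_. a) ax_inf" by (intro modelsD[OF zfm_sat[OF M]]) auto
 then obtain I where I: "I : M"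
  and A: "sat (\<S> M) ((%_. a)(0 := I)) (Exists 1 (Conj (vmem 1 0) (Forall 2 (Neg (vmem 2 1)))))"
  and B: "sat (\<S> M) ((%_. a)(0 := I)) (Forall 1 (Impl (vmem 1 0)
    (Exists 2 (Conj (vmem 2 0) (Forall 3 (Iff (vmem 3 2) (Disj (vmem 3 1) (veq 3 1))))))))"
  unfolding ax_inf_def sat_Exists[of _ _ 0] sat.simps(5)[of _ _ "Exists 1 _"] eps_struc_simps by blast
 have Z: "EX z:M. z : elts I & (ALL b:M. b ~: elts z)"
  using A unfolding sat_Exists by (simp add: hmem_elts)
 have S: "EX s:M. s : elts I & (ALL b:M. b : elts s <-> b : elts n \<or> b = n)" if n: "n : M" "n : elts I" for n
 proof -
  have "sat (\<S> M) ((%_. a)(0 := I, 1 := n)) (Exists 2 (Conj (vmem 2 0) (Forall 3 (Iff (vmem 3 2) (Disj (vmem 3 1) (veq 3 1))))))"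
   using B n unfolding sat.simps(6) sat_Impl eps_struc_simps by (simp add: hmem_elts del: sat.simps(4-6))
  then obtain s where s: "s : M" "sat (\<S> M) ((%_. a)(0 := I, 1 := n, 2 := s)) (vmem 2 0)"
   "sat (\<S> M) ((%_. a)(0 := I, 1 := n, 2 := s)) (Forall 3 (Iff (vmem 3 2) (Disj (vmem 3 1) (veq 3 1))))"
   unfolding sat_Exists sat.simps(5)[of _ _ "vmem 2 0"] eps_struc_simps by blast
  have "ALL b:M. b : elts s <-> b : elts n \<or> b = n"
   using s(3) unfolding sat.simps(6) sat_Iff sat_Disj eps_struc_simps by (simp add: hmem_elts)
  then show ?thesis using s(1,2) by (intro bexI[of _ s]) (auto simp: hmem_elts)
 qed
 have "hc_nat n : elts I & hc_nat n : M" for n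
 proof (induction n)
  case 0
  obtain z where z: "z : M" "z : elts I" "ALL b:M. b ~: elts z" using Z by blast
  then have "z = hempty" using D.K_ext[of M z hempty] D.zfm_hempty[OF M] by simp
  then show ?case using z by simp
 next
  case (Suc n)
  then obtain s where s: "s : M" "s : elts I" "ALL b:M. b : elts s <-> b : elts (hc_nat n) \<or> b = hc_nat n"
   using S by blast
  moreover have "hsuc (hc_nat n) : M"
   using D.dfun_in[OF D.dfun_hc_nat[of 0 "Suc n"], of M "%_. a"] \<open>a : M\<close> by auto
  ultimately have "s = hsuc (hc_nat n)" using D.K_ext[of M s "hsuc (hc_nat n)"] by auto
  then show ?case using s by simp
 qed
 then have "omega = hset {n : elts I. isnat n}"
  by (intro elts_eqI) (auto simp: isnat_iff)
 moreover have "D.dfun 0 (%M e. hset {n : elts I. isnat n})"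
  using I by (intro dfi D.dfn_isnat) simp_all
 ultimately show ?thesis using D.dfun_in[of 0 _ M "%_. a"] \<open>a : M\<close> by auto
qed

context zfmodels
begin

lemma dfun_omega [dfi]: "dfun n (%M e. omega)"
proof (rule dfun_class[where \<Phi> = "%M e a. ALL b:M. b : elts a <-> isnat b"])
 show "dfn (Suc n) (%M e. ALL b:M. b : elts (e n) <-> isnat b)"
  by (intro dfi dfn_isnat) simp_all
 fix M a assume "M : K" "a : M"
 then show "(a = omega) = (ALL b:M. b : elts a <-> isnat b)"
  using zfm_omega[OF K_zfm] by (subst K_ext) (auto simp: isnat_iff)
qed (use zfm_omega[OF K_zfm] in auto)

end

section \<open>Transitive closure and recursion\<close>

inductive_set tcs :: "hc => hc set" for x where
 "y : elts x ==> y : tcs x"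
| "y : tcs x ==> z : elts y ==> z : tcs x"

lemma tcs_mono: "y : elts x ==> z : tcs y ==> z : tcs x"
proof -
 assume y: "y : elts x"
 assume "z : tcs y"
 then show ?thesis by induction (use y tcs.intros in blast)+
qed

lemma tcs_eq: "tcs x = elts x \<union> (\<Union>y\<in>elts x. tcs y)"
proof -
 have "z : tcs x ==> z : elts x \<union> (\<Union>y\<in>elts x. tcs y)" for z
  by (induction z rule: tcs.induct) (auto intro: tcs.intros)
 then show ?thesis using tcs_mono tcs.intros by blast
qed

lemma countable_tcs [simp]: "countable (tcs x)"
proof (induction x rule: hc_induct)
 case (step x)
 show ?case by (subst tcs_eq) (use step in auto)
qed

definition tc :: "hc => hc" where "tc x = hset (tcs x)"

lemma elts_tc: "elts (tc x) = elts x \<union> (\<Union>y\<in>elts x. elts (tc y))"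
 using tcs_eq[of x] by (simp add: tc_def)

lemma htrans_tc: "htrans (tc x)"
 unfolding htrans_def tc_def by (auto intro: tcs.intros)

lemma tc_sub: "elts x \<subseteq> elts (tc x)"
 by (subst elts_tc) auto

lemma tc_least: "elts x \<subseteq> elts t ==> htrans t ==> elts (tc x) \<subseteq> elts t"
proof
 fix z assume *: "elts x \<subseteq> elts t" "htrans t" "z : elts (tc x)"
 then have "z : tcs x" by (simp add: tc_def)
 then show "z : elts t" by (induction rule: tcs.induct) (use * htransD in blast)+
qed

lemma tc_trans: "y : elts (tc x) ==> elts (tc y) \<subseteq> elts (tc x)"
 using htrans_tc[of x] unfolding htrans_def by (intro tc_least htrans_tc) auto

lemma wf_tc: "wf {(y, x). y : elts (tc x)}"
proof -
 have "{(y, x). y : elts (tc x)} \<subseteq> {(x, y). x : elts y}\<^sup>+"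
 proof clarify
  fix y x assume "y : elts (tc x)"
  then have "y : tcs x" by (simp add: tc_def)
  then show "(y, x) : {(x, y). x : elts y}\<^sup>+"
   by (induction rule: tcs.induct) (auto intro: trancl_into_trancl2)
 qed
 then show ?thesis using wf_trancl[OF wf_elts] wf_subset by blast
qed

context zfmodels
begin

definition istc :: "hc set => hc => hc => bool" where
 "istc M x t <-> htrans t & elts x \<subseteq> elts t & (ALL u:M. htrans u --> elts x \<subseteq> elts u --> elts t \<subseteq> elts u)"

lemma istc_tc: "tc x : M ==> istc M x t ==> t = tc x"
 unfolding istc_def using tc_least htrans_tc tc_sub by (metis elts_inject subset_antisym)

lemma tc_istc: "istc M x (tc x)"
 unfolding istc_def using tc_least htrans_tc tc_sub by blast

lemma dfn_istc: "dfun n s ==> dfun n t ==> dfn n (%M e. istc M (s M e) (t M e))"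
proof (rule dfn_comp2[where R = istc])
 show "dfn 2 (%M e. istc M (e 0) (e 1))" unfolding istc_def by (intro dfi) simp_all
qed

text \<open>Induction on membership: the closures of the members are unique solutions of
  \<open>istc\<close>, so replacement collects them into a set of the world.\<close>

lemma tc_in: "M : K ==> x : M ==> tc x : M"
proof (induction x rule: hc_induct)
 case (step x)
 let ?t = "%M x. hun x (hunion (hset ((%y. theM M (istc M y)) ` elts x)))"
 have "dfun 1 (%M e. ?t M (e 0))" by (intro dfi dfn_istc) simp_all
 then have "?t M x : M" using dfun_in[of 1 _ M "%_. x"] step.prems by auto
 moreover have "theM M (istc M y) = tc y" if "y : elts x" for y
  using step.IH[OF that] step.prems K_trans[OF _ _ that] by (intro theM_eq) (auto simp: tc_istc istc_tc)
 then have "?t M x = tc x" by (intro elts_eqI) (subst elts_tc, simp)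
 ultimately show ?case by simp
qed

lemma dfun_tc [dfi]: "dfun n s ==> dfun n (%M e. tc (s M e))"
proof (rule dfun_comp1[where F = "%M. tc"])
 have "dfun 1 (%M e. theM M (istc M (e 0)))" by (intro dfi dfn_istc) simp_all
 then show "dfun 1 (%M e. tc (e 0))"
 proof (rule dfun_cong)
  fix M and e :: "nat => hc" assume "M : K" "range e \<subseteq> M"
  then have "tc (e 0) : M" using tc_in by auto
  then show "theM M (istc M (e 0)) = tc (e 0)" by (intro theM_eq) (auto simp: tc_istc istc_tc)
 qed
qed

text \<open>Values are read off attempts, that is, set functions obeying the recursion equation on a
  set closed under predecessors. Attempts agree by well-founded induction, and one exists at each
  point by induction. The predecessor function \<open>pr\<close> is arbitrary, so that the theorem
  also covers transitive closures, pairs of names, and the relation coded by a real;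
  \<open>z\<close> is a parameter.\<close>

theorem dfun_rec:
 assumes H: "dfun 3 (%M e. H M (e 0) (e 1) (e 2))" and pr: "dfun 2 (%M e. pr M (e 0) (e 1))"
  and wf: "!!M z. M : K ==> z : M ==> wf {(y, x). x : M & y : elts (pr M z x)}"
  and cl: "!!M z x. M : K ==> z : M ==> x : M ==>
   EX c:M. x : elts c & (ALL y:elts c. elts (pr M z y) \<subseteq> elts c)"
  and F: "!!M z x. M : K ==> z : M ==> x : M ==> F M z x = H M z x (lam (pr M z x) (F M z))"
 shows "dfun 2 (%M e. F M (e 0) (e 1))"
proof -
 note [dfi] = dfun_comp3[OF H] dfun_comp2[OF pr]
 define att where "att M z f d <-> (ALL u:elts d. elts (pr M z u) \<subseteq> elts d &
  app f u = H M z u (lam (pr M z u) (app f)))" for M z f d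
 define G where "G M z x y <-> (EX f:M. EX d:M. att M z f d & x : elts d & y = app f x)" for M z x y
 have "dfn 4 (%M e. G M (e 0) (e 1) (e 2))"
  unfolding G_def att_def by (intro dfi) simp_all
 have "dfn 3 (%M e. G M (e 0) (e 1) (e 2))"
  unfolding G_def att_def by (intro dfi) simp_all
 note [dfi] = dfn_comp3[OF this]
 have attF: "app f u = F M z u" if "M : K" "z : M" "f : M" "d : M" "att M z f d" "u : elts d" for M z f d u
  using that(6)
 proof (induction u rule: wf_induct_rule[OF wf[OF that(1,2)]])
  case (1 u)
  have u: "u : M" using 1 that K_trans by blast
  have "app f u = H M z u (lam (pr M z u) (app f))" using 1 that(5) unfolding att_def by blast
  also have "lam (pr M z u) (app f) = lam (pr M z u) (F M z)"
   using 1 u that(5) unfolding att_def by (intro lam_cong) blast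
  finally show ?case using F that u by simp
 qed
 have GF: "y = F M z x" if "M : K" "z : M" "G M z x y" for M z x y
  using that attF unfolding G_def by blast
 have ex: "EX y:M. G M z x y" if M: "M : K" "z : M" and "x : M" for M z x
  using that(3)
 proof (induction x rule: wf_induct_rule[OF wf[OF M]])
  case (1 x)
  obtain c where c: "c : M" "x : elts c" "ALL y:elts c. elts (pr M z y) \<subseteq> elts c" using cl M 1 by blast
  define env where "env i = (if i = 0 then z else if i = 1 then x else c)" for i :: nat
  have env: "range env \<subseteq> M" using c M 1 unfolding env_def by auto
  have env_simps: "env 0 = z" "env 1 = x" "env 2 = c" by (simp_all add: env_def)
  \<comment> \<open>The points of the closed set \<open>c\<close> that already have a value form a
    predecessor-closed set. With \<open>x\<close> added it becomes the domain of an attempt at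
    \<open>x\<close>.\<close>
  let ?d = "%M z c. hset {y : elts c. EX v:M. G M z y v}"
  let ?d' = "%M z x c. hun (?d M z c) (upair x x)"
  let ?g = "%M z u. theM M (%v. G M z u v)"
  let ?f = "%M z x c. lam (?d' M z x c) (%u. if u = x then H M z x (lam (pr M z x) (%w. ?g M z w)) else ?g M z u)"
  have "dfun 3 (%M e. ?d' M (e 0) (e 1) (e 2))" by (intro dfi) simp_all
  from dfun_in[OF this M(1) env] have d': "?d' M z x c : M" by (simp only: env_simps)
  have "dfun 3 (%M e. ?f M (e 0) (e 1) (e 2))" by (intro dfi) simp_all
  from dfun_in[OF this M(1) env] have f: "?f M z x c : M" by (simp only: env_simps)
  have gF: "?g M z u = F M z u" "F M z u : M" if "v : M" "G M z u v" for u v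
  proof -
   have v: "v = F M z u" using GF[OF M that(2)] .
   have "theM M (%v. G M z u v) = v" by (rule theM_eq) (use that GF[OF M] v in blast)+
   then show "?g M z u = F M z u" "F M z u : M" using v that by simp_all
  qed
  have dcl: "elts (pr M z u) \<subseteq> elts (?d M z c)" if "u : elts (?d M z c)" for u
  proof
   fix w assume w: "w : elts (pr M z u)"
   have "u : elts c" and "EX v:M. G M z u v" using that by simp_all
   then obtain f d where "f : M" "d : M" "att M z f d" "u : elts d" unfolding G_def by blast
   then have "w : elts d" "w : M" using w K_trans[OF M(1)] unfolding att_def by blast+
   have "app f w : M" using dfun_in[OF dfun_app[OF dfun_var dfun_var, of 0 2 1] M(1), of "%i. if i = 0 then f else w"]
    \<open>f : M\<close> \<open>w : M\<close> by auto
   then have "EX v:M. G M z w v" unfolding G_def using \<open>f : M\<close> \<open>d : M\<close> \<open>att M z f d\<close> \<open>w : elts d\<close> by blast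
   then show "w : elts (?d M z c)" using c(3) \<open>u : elts c\<close> w by auto
  qed
  have prx: "elts (pr M z x) \<subseteq> elts (?d M z c)"
  proof
   fix w assume w: "w : elts (pr M z x)"
   then have "w : elts c" using c by blast
   then show "w : elts (?d M z c)" using 1 w K_trans[OF M(1) c(1)] by auto
  qed
  have appF: "app (?f M z x c) u = F M z u" if "u : elts (?d' M z x c)" for u
  proof (cases "u = x")
   case True
   have "lam (pr M z x) (%w. ?g M z w) = lam (pr M z x) (F M z)"
    using prx gF by (intro lam_cong) auto
   then show ?thesis using True that F[OF M 1(2)] by simp
  next
   case False
   then show ?thesis using that gF by auto
  qed
  have "att M z (?f M z x c) (?d' M z x c)" unfolding att_def
  proof
   fix u assume u: "u : elts (?d' M z x c)"
   then have *: "elts (pr M z u) \<subseteq> elts (?d' M z x c)" using dcl prx by auto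
   have "u : M" using u d' K_trans M by blast
   then have "app (?f M z x c) u = H M z u (lam (pr M z u) (F M z))" using appF[OF u] F[OF M] by simp
   also have "lam (pr M z u) (F M z) = lam (pr M z u) (app (?f M z x c))"
   proof (rule lam_cong)
    fix a assume "a : elts (pr M z u)"
    then have "a : elts (?d' M z x c)" using * by blast
    then show "F M z a = app (?f M z x c) a" by (rule appF[symmetric])
   qed
   finally show "elts (pr M z u) \<subseteq> elts (?d' M z x c) &
    app (?f M z x c) u = H M z u (lam (pr M z u) (app (?f M z x c)))" using * by blast
  qed
  moreover have "app (?f M z x c) x : M"
   using dfun_in[OF dfun_app[OF dfun_var dfun_var, of 0 2 1] M(1), of "%i. if i = 0 then ?f M z x c else x"] f 1 by auto
  moreover have "x : elts (?d' M z x c)" by simp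
  ultimately show ?case using d' f unfolding G_def by blast
 qed
 have "dfun 2 (%M e. theM M (%v. G M (e 0) (e 1) v))" by (intro dfi) simp_all
 then show ?thesis
 proof (rule dfun_cong)
  fix M and e :: "nat => hc" assume M: "M : K" "range e \<subseteq> M"
  then have e: "e 0 : M" "e 1 : M" by auto
  obtain y where y: "y : M" "G M (e 0) (e 1) y" using ex[OF M(1) e] by blast
  then show "theM M (%v. G M (e 0) (e 1) v) = F M (e 0) (e 1)"
   using GF[OF M(1) e(1)] by (intro theM_eq) auto
 qed
qed

lemma dfun_mem_rec:
 assumes H: "dfun 3 (%M e. H M (e 0) (e 1) (e 2))"
  and F: "!!M z x. M : K ==> z : M ==> x : M ==> F M z x = H M z x (lam x (F M z))"
 shows "dfun 2 (%M e. F M (e 0) (e 1))"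
proof (rule dfun_rec[where pr = "%M z x. x", OF H])
 show "dfun 2 (%M e. e 1)" by (intro dfi) simp
 show "wf {(y, x). x : M & y : elts x}" for M by (rule wf_subset[OF wf_elts]) auto
 fix M x assume *: "M : K" "x : M"
 have "dfun 1 (%M e. hun (upair (e 0) (e 0)) (tc (e 0)))" by (intro dfi) simp_all
 then have "hun (upair x x) (tc x) : M" using dfun_in[of 1 _ M "%_. x"] * by auto
 then show "EX c:M. x : elts c & (ALL y:elts c. elts y \<subseteq> elts c)"
  using htrans_tc[of x] tc_sub[of x] unfolding htrans_def by (intro bexI[of _ "hun (upair x x) (tc x)"]) auto
qed (rule F)

lemma dfun_tc_rec:
 assumes H: "dfun 3 (%M e. H M (e 0) (e 1) (e 2))"
  and F: "!!M z x. M : K ==> z : M ==> x : M ==> F M z x = H M z x (lam (tc x) (F M z))"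
 shows "dfun 2 (%M e. F M (e 0) (e 1))"
proof (rule dfun_rec[where pr = "%M z x. tc x", OF H])
 show "dfun 2 (%M e. tc (e 1))" by (intro dfi) simp
 show "wf {(y, x). x : M & y : elts (tc x)}" for M by (rule wf_subset[OF wf_tc]) auto
 fix M x assume *: "M : K" "x : M"
 have "dfun 1 (%M e. hun (upair (e 0) (e 0)) (tc (e 0)))" by (intro dfi) simp_all
 then have "hun (upair x x) (tc x) : M" using dfun_in[of 1 _ M "%_. x"] * by auto
 then show "EX c:M. x : elts c & (ALL y:elts c. elts (tc y) \<subseteq> elts c)"
  using tc_trans by (intro bexI[of _ "hun (upair x x) (tc x)"]) auto
qed (rule F)

end

section \<open>Ordinals, rank and collection\<close>

definition hord :: "hc => bool" where
 "hord x <-> htrans x & (ALL y:elts x. htrans y)"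

lemma hord_mem: "hord x ==> y : elts x ==> hord y"
 unfolding hord_def htrans_def by blast

lemma hord_trans: "hord x ==> y : elts x ==> z : elts y ==> z : elts x"
 unfolding hord_def using htransD by blast

lemma hord_linear: "hord x ==> hord y ==> x : elts y \<or> x = y \<or> y : elts x"
proof (induction x arbitrary: y rule: hc_induct)
 case (step x)
 note IHx = step.IH and px = step.prems(1)
 show ?case using step.prems(2)
 proof (induction y rule: hc_induct)
  case (step y)
  show ?case
  proof (rule ccontr)
   assume n: "\<not> (x : elts y \<or> x = y \<or> y : elts x)"
   have "u : elts y" if "u : elts x" for u
    using IHx[OF that hord_mem[OF px that] step.prems] n hord_trans[OF px that] that by blast
   moreover have "u : elts x" if "u : elts y" for u
    using step.IH[OF that hord_mem[OF step.prems that]] n hord_trans[OF step.prems that] that by blast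
   ultimately have "x = y" by (intro elts_eqI) blast
   then show False using n by blast
  qed
 qed
qed

lemma hord_hempty [simp]: "hord hempty"
 by (simp add: hord_def htrans_def)

lemma hord_hsuc: "hord x ==> hord (hsuc x)"
 unfolding hord_def htrans_def by auto

lemma hord_hunion: "(!!y. y : elts x ==> hord y) ==> hord (hunion x)"
 unfolding hord_def htrans_def by fastforce

lemma hord_hc_nat: "hord (hc_nat n)"
 by (induction n) (auto intro: hord_hsuc)

lemma hord_subset: "hord x ==> hord y ==> elts x \<subseteq> elts y <-> x = y \<or> x : elts y"
 using hord_linear[of x y] hord_trans[of y x] mem_irrefl by blast

function rk :: "hc => hc" where
 "rk x = hunion (hset ((%y. hsuc (rk y)) ` elts x))"
 by auto
termination by (relation "{(x, y). x : elts y}") (auto simp: wf_elts)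

declare rk.simps [simp del]

lemma elts_rk: "elts (rk x) = (\<Union>y\<in>elts x. insert (rk y) (elts (rk y)))"
 by (subst rk.simps) simp

lemma hord_rk: "hord (rk x)"
proof (induction x rule: hc_induct)
 case (step x)
 show ?case by (subst rk.simps, rule hord_hunion) (use step hord_hsuc in auto)
qed

lemma rk_mem: "y : elts x ==> rk y : elts (rk x)"
 using elts_rk[of x] by auto

lemma rk_hord: "hord x ==> rk x = x"
proof (induction x rule: hc_induct)
 case (step x)
 have "elts (rk x) = (\<Union>y\<in>elts x. insert y (elts y))"
  using step hord_mem by (subst elts_rk) auto
 also have "\<dots> = elts x" using hord_trans[OF step.prems] by auto
 finally show ?case by (simp add: elts_inject)
qed

text \<open>The cumulative hierarchy on top of \<open>z\<close>, with power sets taken in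
  \<open>N\<close>. Over \<open>hempty\<close> it bounds ranks; its stage \<open>omega\<close> is
  the closure from which the levels are built.\<close>

function VB :: "hc set => hc => hc => hc" where
 "VB N z x = hun z (hunion (hset ((%y. pow N (VB N z y)) ` elts x)))"
 by auto
termination by (relation "inv_image {(x, y). x : elts y} (%(N, z, x). x)") (auto simp: wf_elts)

declare VB.simps [simp del]

lemma elts_pow: "countable N ==> elts (pow N x) = {y : N. elts y \<subseteq> elts x}"
 unfolding pow_def by (rule elts_hset) (auto intro: countable_subset)

lemma elts_VB: "countable N ==> elts (VB N z x) = elts z \<union> (\<Union>y\<in>elts x. {u : N. elts u \<subseteq> elts (VB N z y)})"
 by (subst VB.simps) (simp add: elts_pow)

context zfmodels
begin

lemma dfn_hord [dfi]: "dfun n s ==> dfn n (%M e. hord (s M e))"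
proof (rule dfn_comp1[where R = "%M. hord"])
 show "dfn 1 (%M e. hord (e 0))" unfolding hord_def by (intro dfi) simp_all
qed

lemma dfun_rk [dfi]: "dfun n s ==> dfun n (%M e. rk (s M e))"
proof (rule dfun_comp1[where F = "%M. rk"])
 have "dfun 2 (%M e. rk (e 1))"
 proof (rule dfun_mem_rec[where H = "%M z x f. hunion (hset ((%y. hsuc (app f y)) ` elts x))"])
  show "dfun 3 (%M e. hunion (hset ((%y. hsuc (app (e 2) y)) ` elts (e 1))))" by (intro dfi) simp_all
  show "rk x = hunion (hset ((%y. hsuc (app (lam x rk) y)) ` elts x))" for x
   by (subst rk.simps) simp
 qed
 from dfun_comp2[OF this dfun_var[of 0 1] dfun_var[of 0 1]]
 show "dfun 1 (%M e. rk (e 0))" by simp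
qed

lemma dfun_VB_gen:
 assumes P: "dfun 1 (%M e. pow (N M) (e 0))"
 shows "dfun n s ==> dfun n t ==> dfun n (%M e. VB (N M) (s M e) (t M e))"
proof (rule dfun_comp2[where F = "%M. VB (N M)"])
 note [dfi] = dfun_comp1[OF P]
 show "dfun 2 (%M e. VB (N M) (e 0) (e 1))"
 proof (rule dfun_mem_rec[where H = "%M z x f. hun z (hunion (hset ((%y. pow (N M) (app f y)) ` elts x)))"])
  show "dfun 3 (%M e. hun (e 0) (hunion (hset ((%y. pow (N M) (app (e 2) y)) ` elts (e 1)))))"
   by (intro dfi) simp_all
  show "VB (N M) z x = hun z (hunion (hset ((%y. pow (N M) (app (lam x (VB (N M) z)) y)) ` elts x)))" for M z x
   by (subst VB.simps) simp
 qed
qed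

lemma dfun_VB [dfi]: "dfun n s ==> dfun n t ==> dfun n (%M e. VB M (s M e) (t M e))"
 by (rule dfun_VB_gen) (intro dfi, simp)

end

lemma rk_VB:
 assumes M: "M : zfm" and a: "hord a"
 shows "y : M ==> rk y : elts a ==> y : elts (VB M hempty a)"
proof (induction y arbitrary: a rule: hc_induct)
 case (step y)
 have "z : elts (VB M hempty (rk y))" if "z : elts y" for z
  using step.IH[OF that zfm_trans[OF M step.prems(1) that] rk_mem[OF that]] .
 then show ?case using step.prems zfm_countable[OF M] by (subst elts_VB) auto
qed

text \<open>Minimal ranks: for each \<open>a\<close> the least rank of a witness is unique, so
  replacement applies to these ranks, and the corresponding stages of the hierarchy contain
  witnesses.\<close>

lemma zfm_collection:
 assumes M: "M : zfm" and R: "zfmodels.dfn {M} M 2 (%M e. R M (e 0) (e 1))" and x: "x : M"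
 shows "EX B:M. ALL a:elts x. (EX y:M. R M a y) --> (EX y:elts B. R M a y)"
proof -
 interpret D: zfmodels "{M}" M using M by (rule zfm_zfmodels)
 note [dfi] = D.dfn_comp2[OF R]
 define Q where "Q M a \<alpha> <-> (EX y:M. R M a y & \<alpha> = rk y) & (ALL y:M. R M a y --> \<not> rk y : elts \<alpha>)" for M a \<alpha>
 define B where "B M = hunion (hset ((%a. VB M hempty (hsuc (theM M (Q M a)))) ` elts x))" for M
 have "D.dfn 2 (%M e. Q M (e 0) (e 1))" unfolding Q_def by (intro dfi) simp_all
 note [dfi] = D.dfn_comp2[OF this]
 have "D.dfun 0 (%M e. B M)" unfolding B_def using x by (intro dfi) simp_all
 then have "B M : M" using D.dfun_in[of 0 _ M "%_. x"] x by auto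
 moreover have "EX y:elts (B M). R M a y" if a: "a : elts x" and y: "y : M" "R M a y" for a y
 proof -
  obtain \<alpha> where al: "EX y:M. R M a y & \<alpha> = rk y"
   and min: "!!\<beta>. \<beta> : elts \<alpha> ==> \<not> (EX y:M. R M a y & \<beta> = rk y)"
   by (rule hmin[of "%\<alpha>. EX y:M. R M a y & \<alpha> = rk y" "rk y"]) (use y in auto)
  then obtain y where y: "y : M" "R M a y" "\<alpha> = rk y" by blast
  have Qa: "Q M a \<alpha>" unfolding Q_def using al min by blast
  have "\<alpha> : M" using D.dfun_in[OF D.dfun_rk[OF D.dfun_var], of 0 1 M "%_. y"] y by auto
  moreover have "\<beta> = \<alpha>" if "Q M a \<beta>" for \<beta>
   using that Qa hord_linear[of \<alpha> \<beta>] hord_rk unfolding Q_def by blast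
  ultimately have "theM M (Q M a) = \<alpha>" using Qa theM_eq[of \<alpha> M "Q M a"] by blast
  moreover have "y : elts (VB M hempty (hsuc \<alpha>))"
   by (rule rk_VB[OF M]) (use y hord_rk hord_hsuc in auto)
  ultimately have "y : elts (B M)" unfolding B_def using a by auto
  then show ?thesis using y by blast
 qed
 ultimately show ?thesis by blast
qed

section \<open>Absolute codings: reals, satisfaction and relative constructibility\<close>

section \<open>Coding by reals\<close>

text \<open>Enumerates all pairs along the antidiagonals. Each step uses only successor and
  predecessor, so that \<open>hwalk\<close> can repeat it on sets.\<close>

primrec walk :: "nat => nat \<times> nat" where
 "walk 0 = (0, 0)"
| "walk (Suc n) = (case snd (walk n) of 0 => (0, Suc (fst (walk n))) | Suc b => (Suc (fst (walk n)), b))"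

lemma walk_surj: "EX n. walk n = (a, b)"
proof -
 have "EX n. walk n = (a, b)" if "a + b = s" for s a b
  using that
 proof (induction s arbitrary: a b)
  case 0 then show ?case by (auto intro: exI[of _ 0])
 next
  case (Suc s)
  show ?case using Suc.prems
  proof (induction a arbitrary: b)
   case 0
   obtain n where "walk n = (s, 0)" using Suc.IH[of s 0] by auto
   then show ?case using 0 by (intro exI[of _ "Suc n"]) auto
  next
   case (Suc a)
   obtain n where "walk n = (a, Suc b)" using Suc.IH[of "Suc b"] Suc.prems by auto
   then show ?case by (intro exI[of _ "Suc n"]) auto
  qed
 qed
 then show ?thesis by blast
qed

lemma walk_le: "fst (walk n) + snd (walk n) \<le> n"
 by (induction n) (auto split: nat.splits)

definition hnext :: "hc => hc" where
 "hnext p = (if hsnd p = hempty then opair hempty (hsuc (hfst p)) else opair (hsuc (hfst p)) (hunion (hsnd p)))"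

text \<open>The recursive call needs the predecessor of \<open>x\<close>. In the union over all
  members of \<open>x\<close> every other member contributes \<open>hempty\<close>, so only the
  predecessor counts.\<close>

function hwalk :: "hc => hc" where
 "hwalk x = (if x = hempty then opair hempty hempty
   else hunion (hset ((%y. if x = hsuc y then hnext (hwalk y) else hempty) ` elts x)))"
 by auto
termination by (relation "{(x, y). x : elts y}") (auto simp: wf_elts)

declare hwalk.simps [simp del]

lemma hunion_hsuc: "hord x ==> hunion (hsuc x) = x"
 by (rule elts_eqI) (auto dest: hord_trans)

lemma hsuc_inject: "hord x ==> hord y ==> hsuc x = hsuc y <-> x = y"
 by (metis hunion_hsuc)

lemma hsuc_neq_hempty [simp]: "hsuc x ~= hempty" "hempty ~= hsuc x"
 by (metis elts_hempty elts_hsuc insert_not_empty)+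

lemma hunion_single:
 assumes "y : elts x" "!!u. u : elts x ==> F u = (if u = y then w else hempty)"
 shows "hunion (hset (F ` elts x)) = w"
 by (rule elts_eqI) (use assms in \<open>auto split: if_splits\<close>)

lemma hwalk_nat: "hwalk (hc_nat n) = opair (hc_nat (fst (walk n))) (hc_nat (snd (walk n)))"
proof (induction n)
 case 0 then show ?case by (subst hwalk.simps) simp
next
 case (Suc n)
 let ?x = "hc_nat (Suc n)"
 have "hwalk ?x = hunion (hset ((%y. if ?x = hsuc y then hnext (hwalk y) else hempty) ` elts ?x))"
  by (subst hwalk.simps) simp
 also have "\<dots> = hnext (hwalk (hc_nat n))"
 proof (rule hunion_single[of "hc_nat n"])
  fix u assume "u : elts ?x"
  then have "hord u" using hord_mem hord_hc_nat by blast
  then show "(if ?x = hsuc u then hnext (hwalk u) else hempty) = (if u = hc_nat n then hnext (hwalk (hc_nat n)) else hempty)"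
   by (auto simp: hsuc_inject hord_hc_nat)
 qed simp
 also have "\<dots> = opair (hc_nat (fst (walk (Suc n)))) (hc_nat (snd (walk (Suc n))))"
  unfolding Suc hnext_def by (auto split: nat.splits simp: hunion_hsuc hord_hc_nat)
 finally show ?case .
qed

context zfmodels
begin

lemma dfun_hwalk [dfi]: "dfun n s ==> dfun n (%M e. hwalk (s M e))"
proof (rule dfun_comp1[where F = "%M. hwalk"])
 have "dfun 2 (%M e. hwalk (e 1))"
 proof (rule dfun_mem_rec[where H = "%M z x f. if x = hempty then opair hempty hempty
   else hunion (hset ((%y. if x = hsuc y then hnext (app f y) else hempty) ` elts x))"])
  show "dfun 3 (%M e. if e 1 = hempty then opair hempty hempty
   else hunion (hset ((%y. if e 1 = hsuc y then hnext (app (e 2) y) else hempty) ` elts (e 1))))"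
   unfolding hnext_def by (intro dfi) simp_all
  show "hwalk x = (if x = hempty then opair hempty hempty
   else hunion (hset ((%y. if x = hsuc y then hnext (app (lam x hwalk) y) else hempty) ` elts x)))" for x
  proof -
   have "(%y. if x = hsuc y then hnext (app (lam x hwalk) y) else hempty) ` elts x =
    (%y. if x = hsuc y then hnext (hwalk y) else hempty) ` elts x" by (intro image_cong) auto
   then show ?thesis by (subst hwalk.simps) (simp only:)
  qed
 qed
 from dfun_comp2[OF this dfun_var[of 0 1] dfun_var[of 0 1]]
 show "dfun 1 (%M e. hwalk (e 0))" by simp
qed

end

lemma is_real_iff: "is_real x <-> elts x \<subseteq> elts omega"
 by (simp add: is_real_def)

text \<open>\<open>c\<close> enumerates \<open>u\<close> together with its transitive closure, and
  \<open>x\<close> collects the codes of the pairs with \<open>c m\<close> a member of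
  \<open>c n\<close>. The coded relation mirrors membership, so it is well-founded and any world
  containing \<open>x\<close> can collapse it by recursion, recovering \<open>u\<close>.\<close>

theorem real_codes: "EX x. is_real x & (ALL M:zfm. x : M --> u : M)"
proof -
 let ?T = "insert u (elts (tc u))"
 define c where "c = from_nat_into ?T"
 have cnt: "countable ?T" by simp
 then have c: "range c = ?T" unfolding c_def by (intro range_from_nat_into) auto
 define x where "x = hset {hc_nat n | n. c (fst (walk n)) : elts (c (snd (walk n)))}"
 have ex: "elts x = {hc_nat n | n. c (fst (walk n)) : elts (c (snd (walk n)))}"
 proof -
  have "{hc_nat n | n. c (fst (walk n)) : elts (c (snd (walk n)))} \<subseteq> range hc_nat" by auto
  then have "countable {hc_nat n | n. c (fst (walk n)) : elts (c (snd (walk n)))}" by (rule countable_subset) simp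
  then show ?thesis unfolding x_def by (rule elts_hset)
 qed
 have T: "v : ?T ==> w : elts v ==> w : ?T" for v w
  using htrans_tc[of u] tc_sub[of u] unfolding htrans_def by auto
 have "u : M" if M: "M : zfm" and xM: "x : M" for M
 proof -
  interpret D: zfmodels "{M}" M using M by (rule zfm_zfmodels)
  define F where "F y = (if y : elts omega then c (THE n. y = hc_nat n) else hempty)" for y
  have F: "F (hc_nat n) = c n" for n unfolding F_def by auto
  let ?pr = "%y. hset {m : elts omega. y : elts omega & opair m y : elts (hset (hwalk ` elts x))}"
  have pr: "elts (?pr (hc_nat n)) = {hc_nat m | m. c m : elts (c n)}" for n
  proof -
   have "opair (hc_nat m) (hc_nat n) : hwalk ` elts x <-> c m : elts (c n)" for m
   proof
    assume "opair (hc_nat m) (hc_nat n) : hwalk ` elts x"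
    then show "c m : elts (c n)" by (auto simp: ex hwalk_nat)
   next
    assume *: "c m : elts (c n)"
    obtain N where "walk N = (m, n)" using walk_surj by blast
    then have "hc_nat N : elts x" "hwalk (hc_nat N) = opair (hc_nat m) (hc_nat n)"
     using * unfolding ex hwalk_nat by auto
    then show "opair (hc_nat m) (hc_nat n) : hwalk ` elts x" by (metis image_eqI)
   qed
   then show ?thesis by auto
  qed
  have "D.dfun 2 (%M e. F (e 1))"
  proof (rule D.dfun_rec[where H = "%M z x f. hset ((%m. app f m) ` elts (?pr x))" and pr = "%M z. ?pr"])
   show "D.dfun 3 (%M e. hset ((%m. app (e 2) m) ` elts (?pr (e 1))))"
    using xM by (intro dfi) simp_all
   show "D.dfun 2 (%M e. ?pr (e 1))" using xM by (intro dfi) simp_all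
   show "wf {(y, x). x : M' & y : elts (?pr x)}" for M'
   proof (rule wf_subset)
    show "wf (inv_image {(x, y). x : elts y} F)" using wf_elts by simp
    show "{(y, x). x : M' & y : elts (?pr x)} \<subseteq> inv_image {(x, y). x : elts y} F"
    proof clarify
     fix y z assume yz: "y : elts (?pr z)"
     then obtain n where "z = hc_nat n" by auto
     then show "(y, z) : inv_image {(x, y). x : elts y} F" using yz unfolding \<open>z = hc_nat n\<close> pr
      by (auto simp: F)
    qed
   qed
   show "EX c:M'. x : elts c & (ALL y:elts c. elts (?pr y) \<subseteq> elts c)" if "M' : {M}" "x : M'" for M' x
   proof -
    have "D.dfun 1 (%M e. hun omega (upair (e 0) (e 0)))" by (intro dfi) simp_all
    then have "hun omega (upair x x) : M" using D.dfun_in[of 1 _ M "%_. x"] that by auto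
    then show ?thesis using that by (intro bexI[of _ "hun omega (upair x x)"]) auto
   qed
   show "F y = hset (app (lam (?pr y) F) ` elts (?pr y))" for y
   proof (cases "y : elts omega")
    case True
    then obtain n where y: "y = hc_nat n" by auto
    have "app (lam (?pr y) F) ` elts (?pr y) = F ` elts (?pr y)" by (intro image_cong) auto
    also have "\<dots> = elts (c n)" unfolding y pr
    proof
     show "F ` {hc_nat m |m. c m : elts (c n)} \<subseteq> elts (c n)" by (auto simp: F)
     show "elts (c n) \<subseteq> F ` {hc_nat m |m. c m : elts (c n)}"
     proof
      fix v assume v: "v : elts (c n)"
      then have "v : range c" using T[of "c n" v] c by blast
      then obtain m where "v = c m" by blast
      then show "v : F ` {hc_nat m |m. c m : elts (c n)}" using v F[of m] by (metis (mono_tags, lifting) image_eqI mem_Collect_eq)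
     qed
    qed
    finally show ?thesis using y F by simp
   next
    case False
    then show ?thesis unfolding F_def by (simp add: hempty_def)
   qed
  qed
  moreover obtain n where n: "c n = u" using c by (metis insertI1 rangeE)
  moreover have "hc_nat n : M" using D.dfun_in[OF D.dfun_hc_nat[of 0 n], of M "%_. x"] xM by auto
  ultimately show ?thesis using D.dfun_in[of 2 "%M e. F (e 1)" M "%_. hc_nat n"] F[of n] by auto
 qed
 then show ?thesis by (intro exI[of _ x]) (auto simp: is_real_def ex)
qed

section \<open>Criterion for being a model\<close>

text \<open>Weak forms are enough: pairing, union and power set only ask for a superset and
  replacement comes from collection, since separation cuts out the exact sets.\<close>

lemma zfmI:
 assumes "countable N" and ne: "hempty : N" and tr: "!!x y. x : N ==> y : elts x ==> y : N"
  and sep: "!!p e v x. wf_fm {} {} p ==> range e \<subseteq> N ==> x : N ==> hset {z : elts x. sat (\<S> N) (e(v := z)) p} : N"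
  and pair: "!!x y. x : N ==> y : N ==> EX b:N. x : elts b & y : elts b"
  and union: "!!x. x : N ==> EX b:N. ALL y:elts x. elts y \<subseteq> elts b"
  and power: "!!x. x : N ==> EX b:N. ALL y:N. elts y \<subseteq> elts x --> y : elts b"
  and inf: "omega : N"
  and coll: "!!p e x. wf_fm {} {} p ==> range e \<subseteq> N ==> x : N ==>
   EX b:N. ALL z:elts x. (EX y:N. sat (\<S> N) (e(0 := z, 1 := y)) p) --> (EX y:elts b. sat (\<S> N) (e(0 := z, 1 := y)) p)"
 shows "N : zfm"
proof -
 have sepf: "EX y:N. ALL z:N. z : elts y <-> z : elts x & sat (\<S> N) (e(v := z)) p"
  if "wf_fm {} {} p" "range e \<subseteq> N" "x : N" for p e v x
  using sep[OF that, of v] by (intro bexI) auto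
 have ext: "x = y" if "x : N" "y : N" "ALL z:N. z : elts x <-> z : elts y" for x y
  using that tr by (intro elts_eqI) blast
 have m_ext: "models (\<S> N) ax_ext"
  unfolding models_def ax_ext_def sat_conn eps_struc_simps
  using ext by (simp add: hmem_elts)
 have m_found: "models (\<S> N) ax_found"
 proof -
  have "EX y:N. y : elts x & (ALL z:N. z : elts x --> z ~: elts y)" if xy: "x : N" "y : elts x" for x y
  proof -
   obtain m where "m : elts x" "!!z. z : elts m ==> z ~: elts x"
    by (rule hmin[of "%z. z : elts x" y]) (use xy in auto)
   then show ?thesis using tr[OF xy(1)] by blast
  qed
  then show ?thesis unfolding models_def ax_found_def by (simp add: hmem_elts) blast
 qed
 have m_pair: "models (\<S> N) ax_pair"
  unfolding models_def ax_pair_def eps_struc_simps(1)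
 proof (intro allI impI)
  fix e :: "nat => hc" assume e: "range e \<subseteq> N"
  have "EX c:N. ALL z:N. z : elts c <-> z = x \<or> z = y" if "x : N" "y : N" for x y
  proof -
   obtain b where b: "b : N" "x : elts b" "y : elts b" using pair[OF \<open>x : N\<close> \<open>y : N\<close>] by blast
   have "EX c:N. ALL z:N. z : elts c <-> z : elts b & sat (\<S> N) ((%i. if i = 1 then x else y)(0 := z)) (Disj (veq 0 1) (veq 0 2))"
    by (rule sepf) (use that b in auto)
   then show ?thesis unfolding sat_Disj using b by (simp add: image_subset_iff) blast
  qed
  then show "sat (\<S> N) e (Forall 0 (Forall 1 (Exists 2 (Forall 3 (Iff (vmem 3 2) (Disj (veq 3 0) (veq 3 1)))))))"
   unfolding sat_conn eps_struc_simps by (simp add: hmem_elts disj_imp)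
 qed
 have m_union: "models (\<S> N) ax_union"
  unfolding models_def ax_union_def eps_struc_simps(1)
 proof (intro allI impI)
  fix e :: "nat => hc" assume e: "range e \<subseteq> N"
  have "EX c:N. ALL z:N. z : elts c <-> (EX y:N. y : elts x & z : elts y)" if "x : N" for x
  proof -
   obtain b where b: "b : N" "ALL y:elts x. elts y \<subseteq> elts b" using union[OF \<open>x : N\<close>] by blast
   have "EX c:N. ALL z:N. z : elts c <-> z : elts b & sat (\<S> N) ((%i. x)(0 := z)) (Exists 2 (Conj (vmem 2 1) (vmem 0 2)))"
    by (rule sepf) (use that b in auto)
   then show ?thesis unfolding sat_Exists using b by (simp add: hmem_elts) blast
  qed
  then show "sat (\<S> N) e (Forall 0 (Exists 1 (Forall 2 (Iff (vmem 2 1) (Exists 3 (Conj (vmem 3 0) (vmem 2 3)))))))"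
   unfolding sat_conn eps_struc_simps sat.simps(5)[of _ _ "vmem _ _" "vmem _ _"] by (simp add: hmem_elts disj_imp)
 qed
 have m_power: "models (\<S> N) ax_power"
  unfolding models_def ax_power_def eps_struc_simps(1)
 proof (intro allI impI)
  fix e :: "nat => hc" assume e: "range e \<subseteq> N"
  have "EX c:N. ALL z:N. z : elts c <-> (ALL y:N. y : elts z --> y : elts x)" if "x : N" for x
  proof -
   obtain b where b: "b : N" "ALL y:N. elts y \<subseteq> elts x --> y : elts b" using power[OF \<open>x : N\<close>] by blast
   have "EX c:N. ALL z:N. z : elts c <-> z : elts b & sat (\<S> N) ((%i. x)(0 := z)) (Forall 2 (Impl (vmem 2 0) (vmem 2 1)))"
    by (rule sepf) (use that b in auto)
   then obtain c where c: "c : N" "ALL z:N. z : elts c <-> z : elts b & (ALL y:N. y : elts z --> y : elts x)"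
    unfolding sat_conn eps_struc_simps by (auto simp: hmem_elts)
   then show ?thesis using b tr by (intro bexI[of _ c]) blast+
  qed
  then show "sat (\<S> N) e (Forall 0 (Exists 1 (Forall 2 (Iff (vmem 2 1) (Forall 3 (Impl (vmem 3 2) (vmem 3 0)))))))"
   unfolding sat_conn eps_struc_simps by (simp add: hmem_elts disj_imp)
 qed
 have m_inf: "models (\<S> N) ax_inf"
  unfolding models_def ax_inf_def eps_struc_simps(1)
 proof (intro allI impI)
  fix e :: "nat => hc" assume e: "range e \<subseteq> N"
  have nat: "hc_nat n : N" for n using tr[OF inf] by auto
  have "EX s:N. s : elts omega & (ALL b:N. b : elts s <-> b : elts x \<or> b = x)" if "x : elts omega" for x
  proof -
   from that obtain n where "x = hc_nat n" by auto
   then show ?thesis using nat[of "Suc n"] rangeI[of hc_nat "Suc n"] by (intro bexI[of _ "hc_nat (Suc n)"]) auto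
  qed
  then have "sat (\<S> N) (e(0 := omega)) (Forall 1 (Impl (vmem 1 0)
    (Exists 2 (Conj (vmem 2 0) (Forall 3 (Iff (vmem 3 2) (Disj (vmem 3 1) (veq 3 1))))))))"
   unfolding sat_conn eps_struc_simps sat.simps(5)[of _ _ "vmem 2 0"] by (simp add: hmem_elts disj_imp)
  moreover have "sat (\<S> N) (e(0 := omega)) (Exists 1 (Conj (vmem 1 0) (Forall 2 (Neg (vmem 2 1)))))"
   unfolding sat_Exists using nat[of 0] rangeI[of hc_nat 0] by (auto simp: hmem_elts intro!: bexI[of _ hempty])
  ultimately show "sat (\<S> N) e (Exists 0 (Conj (Exists 1 (Conj (vmem 1 0) (Forall 2 (Neg (vmem 2 1)))))
    (Forall 1 (Impl (vmem 1 0)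
     (Exists 2 (Conj (vmem 2 0) (Forall 3 (Iff (vmem 3 2) (Disj (vmem 3 1) (veq 3 1))))))))))"
   unfolding sat_Exists[of _ _ 0] sat.simps(5)[of _ _ "Exists 1 _"] eps_struc_simps using inf by blast
 qed
 have m_sep: "models (\<S> N) (ax_sep p)" if p: "wf_fm {} {} p" "1 ~: fv p" for p
  unfolding models_def ax_sep_def eps_struc_simps(1)
 proof (intro allI impI)
  fix e :: "nat => hc" assume e: "range e \<subseteq> N"
  have "EX y:N. ALL z:N. z : elts y <-> z : elts x & sat (\<S> N) (e(2 := x, 1 := y, 0 := z)) p" if x: "x : N" for x
  proof -
   have "sat (\<S> N) (e(2 := x, 1 := y, 0 := z)) p <-> sat (\<S> N) ((e(2 := x))(0 := z)) p" for y z
    by (rule sat_cong) (use p in auto)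
   moreover have "range (e(2 := x)) \<subseteq> N" using e x by auto
   ultimately show ?thesis using sepf[OF p(1) _ x, of "e(2 := x)" 0] by simp
  qed
  then show "sat (\<S> N) e (Forall 2 (Exists 1 (Forall 0 (Iff (vmem 0 1) (Conj (vmem 0 2) p)))))"
   unfolding sat_conn eps_struc_simps sat.simps(5)[of _ _ "vmem 0 2"] by (simp add: hmem_elts disj_imp)
 qed
 have m_repl: "models (\<S> N) (ax_repl p)" if p: "wf_fm {} {} p" "3 ~: fv p" "4 ~: fv p" for p
  unfolding models_def ax_repl_def eps_struc_simps(1)
 proof (intro allI impI)
  fix e :: "nat => hc" assume e: "range e \<subseteq> N"
  have main: "EX Y:N. ALL b:N. b : elts Y <-> (EX a:N. a : elts x & sat (\<S> N) (e(2 := x, 4 := Y, 1 := b, 0 := a)) p)"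
   if x: "x : N" and fn: "ALL a:N. a : elts x --> (EX c:N. ALL b:N. sat (\<S> N) (e(2 := x, 0 := a, 3 := c, 1 := b)) p <-> b = c)" for x
  proof -
   let ?e = "e(2 := x)"
   have e': "range ?e \<subseteq> N" using e x by auto
   have 1: "sat (\<S> N) (e(2 := x, 0 := a, 3 := c, 1 := b)) p <-> sat (\<S> N) (?e(0 := a, 1 := b)) p" for a b c
    by (rule sat_cong) (use p in auto)
   have 2: "sat (\<S> N) (e(2 := x, 4 := Y, 1 := b, 0 := a)) p <-> sat (\<S> N) (?e(0 := a, 1 := b)) p" for a b Y
    by (rule sat_cong) (use p in auto)
   have 3: "sat (\<S> N) (?e(1 := b, 0 := a)) p <-> sat (\<S> N) (?e(0 := a, 1 := b)) p" for a b
    by (rule sat_cong) auto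
   obtain B where B: "B : N" "ALL z:elts x. (EX y:N. sat (\<S> N) (?e(0 := z, 1 := y)) p) --> (EX y:elts B. sat (\<S> N) (?e(0 := z, 1 := y)) p)"
    using coll[OF p(1) e' x] by blast
   obtain Y where Y: "Y : N" "ALL b:N. b : elts Y <-> b : elts B & sat (\<S> N) (?e(1 := b)) (Exists 0 (Conj (vmem 0 2) p))"
    using sepf[of "Exists 0 (Conj (vmem 0 2) p)" ?e B 1] p(1) e' B(1) by auto
   have Y': "b : elts Y <-> b : elts B & (EX a:N. a : elts x & sat (\<S> N) (?e(0 := a, 1 := b)) p)" if "b : N" for b
    using Y(2) that unfolding sat_Exists sat.simps(5) eps_struc_simps 3 by (simp add: hmem_elts)
   have "b : elts B" if ab: "a : elts x" "b : N" "sat (\<S> N) (?e(0 := a, 1 := b)) p" for a b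
   proof -
    obtain c where c: "ALL b:N. sat (\<S> N) (?e(0 := a, 1 := b)) p <-> b = c" using fn ab(1) tr[OF x ab(1)] unfolding 1 by blast
    obtain y where "y : elts B" "sat (\<S> N) (?e(0 := a, 1 := y)) p" using B(2) ab by blast
    then have "y = c" "b = c" using c tr[OF B(1)] ab by blast+
    then show ?thesis using \<open>y : elts B\<close> by simp
   qed
   then show ?thesis unfolding 2 using Y(1) Y' by (intro bexI[of _ Y]) blast+
  qed
  show "sat (\<S> N) e (Forall 2 (Impl (Forall 0 (Impl (vmem 0 2) (Exists 3 (Forall 1 (Iff p (veq 1 3))))))
    (Exists 4 (Forall 1 (Iff (vmem 1 4) (Exists 0 (Conj (vmem 0 2) p)))))))"
   unfolding sat_conn eps_struc_simps sat.simps(5)[of _ _ "vmem 0 2"] using main by (simp add: hmem_elts)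
 qed
 show ?thesis unfolding zfm_def
  using assms(1) ne tr m_ext m_found m_pair m_union m_power m_inf m_sep m_repl by auto
qed

section \<open>Satisfaction inside a model\<close>

text \<open>Every number codes a formula: a positive code splits into a tag and two arguments, every
  tag above 3 means a quantifier, and code 0 is a dummy. Arguments are smaller than the code by
  \<open>walk_le\<close>, so satisfaction can be defined by recursion on membership in
  \<open>omega\<close>.\<close>

function dec :: "nat => set_fm" where
 "dec 0 = veq 0 0"
| "dec (Suc n) = (let t = fst (walk n); u = fst (walk (snd (walk n))); v = snd (walk (snd (walk n))) in
   if t = 0 then veq u v else if t = 1 then vmem u v else if t = 2 then Neg (dec u)
   else if t = 3 then Conj (dec u) (dec v) else Forall u (dec v))"
 by pat_completeness auto
termination
proof (relation "measure id")
 have *: "fst (walk (snd (walk n))) < Suc n & snd (walk (snd (walk n))) < Suc n" for n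
  using walk_le[of n] walk_le[of "snd (walk n)"] by linarith
 show "!!n x xa xb. x = fst (walk n) ==> xa = fst (walk (snd (walk n))) ==> xb = snd (walk (snd (walk n))) ==>
    x ~= 0 ==> x ~= 1 ==> x = 2 ==> (xa, Suc n) : measure id" using * by auto
qed (use walk_le in \<open>auto simp: less_Suc_eq_le, (metis add_leE le_trans walk_le)+\<close>)

lemma dec_wf: "wf_fm {} {} (dec m)"
 by (induction m rule: dec.induct) (auto simp: Let_def)

lemma dec_surj: "wf_fm {} {} p ==> EX m. dec m = p"
proof (induction p)
 have w: "EX n. fst (walk n) = t & fst (walk (snd (walk n))) = u & snd (walk (snd (walk n))) = v" for t u v
  using walk_surj[of u v] walk_surj[of t] by (metis fst_conv snd_conv)
 have trm: "EX i. s = Var i" if "wf_trm {} s" for s :: "unit trm" using that by (cases s) auto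
 { case (Eq s t)
  from trm[of s] trm[of t] Eq obtain i j where st: "s = Var i" "t = Var j" by auto
  obtain n where "fst (walk n) = 0 & fst (walk (snd (walk n))) = i & snd (walk (snd (walk n))) = j" using w by blast
  then show ?case unfolding st by (intro exI[of _ "Suc n"]) (simp add: Let_def) }
 { case (Mem s t)
  from trm[of s] trm[of t] Mem obtain i j where st: "s = Var i" "t = Var j" by auto
  obtain n where "fst (walk n) = 1 & fst (walk (snd (walk n))) = i & snd (walk (snd (walk n))) = j" using w by blast
  then show ?case unfolding st by (intro exI[of _ "Suc n"]) (simp add: Let_def) }
 { case (Neg p)
  then obtain i where i: "dec i = p" by auto
  obtain n where "fst (walk n) = 2 & fst (walk (snd (walk n))) = i & snd (walk (snd (walk n))) = i" using w by blast
  then show ?case using i by (intro exI[of _ "Suc n"]) (simp add: Let_def) }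
 { case (Conj p q)
  then obtain i j where i: "dec i = p" "dec j = q" by auto
  obtain n where "fst (walk n) = 3 & fst (walk (snd (walk n))) = i & snd (walk (snd (walk n))) = j" using w by blast
  then show ?case using i by (intro exI[of _ "Suc n"]) (simp add: Let_def) }
 { case (Forall k p)
  then obtain i where i: "dec i = p" by auto
  obtain n where "fst (walk n) = 4 & fst (walk (snd (walk n))) = k & snd (walk (snd (walk n))) = i" using w by blast
  then show ?case using i by (intro exI[of _ "Suc n"]) (simp add: Let_def) }
qed auto

text \<open>Assignments are coded as finite partial functions, because these belong to every world
  containing \<open>A\<close>, which infinite sequences need not do. Variables without a value are
  read as \<open>hempty\<close> through \<open>app\<close>.\<close>

definition isfenv :: "hc => hc => bool" where
 "isfenv A f <-> fnl f & elts f \<subseteq> elts (times omega A) & (EX k:elts omega. elts (hdom f) \<subseteq> elts k)"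

definition Fenv :: "hc => hc" where "Fenv A = hset (Collect (isfenv A))"

lemma isfenv_finite: "isfenv A f ==> finite (elts f)"
proof -
 assume f: "isfenv A f"
 then obtain k where k: "elts (hdom f) \<subseteq> elts (hc_nat k)" unfolding isfenv_def by auto
 have "elts f \<subseteq> (%x. opair x (app f x)) ` elts (hc_nat k)"
 proof
  fix p assume p: "p : elts f"
  then obtain x y where xy: "p = opair x y" using f unfolding isfenv_def by auto
  then have "x : elts (hc_nat k)" using p k by (auto simp: elts_hdom)
  moreover have "app f x = y" using p xy f app_eq unfolding isfenv_def by blast
  ultimately show "p : (%x. opair x (app f x)) ` elts (hc_nat k)" using xy by auto
 qed
 then show ?thesis by (rule finite_subset) (simp add: elts_hc_nat)
qed

lemma elts_Fenv: "f : elts (Fenv A) <-> isfenv A f"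
proof -
 have "Collect (isfenv A) \<subseteq> hset ` {S. finite S & S \<subseteq> elts (times omega A)}"
 proof
  fix f assume "f : Collect (isfenv A)"
  then have "finite (elts f)" "elts f \<subseteq> elts (times omega A)" using isfenv_finite isfenv_def by auto
  then show "f : hset ` {S. finite S & S \<subseteq> elts (times omega A)}" by (intro image_eqI[of _ _ "elts f"]) simp_all
 qed
 moreover have "countable {S. finite S & S \<subseteq> elts (times omega A)}"
  by (rule countable_Collect_finite_subset) (rule countable_elts)
 ultimately have "countable (Collect (isfenv A))" by (meson countable_image countable_subset)
 then show ?thesis by (simp add: Fenv_def)
qed

definition fenv :: "hc => nat => hc" where "fenv f i = app f (hc_nat i)"

definition hupd :: "hc => hc => hc => hc" where
 "hupd f i a = hun (hset {p : elts f. hfst p ~= i}) (upair (opair i a) (opair i a))"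

definition SatS :: "hc => hc => hc" where
 "SatS A m = (if m : elts omega then hset {f : elts (Fenv A). sat (\<S> (elts A)) (fenv f) (dec (THE n. m = hc_nat n))} else hempty)"

lemma SatS_nat: "f : elts (SatS A (hc_nat m)) <-> isfenv A f & sat (\<S> (elts A)) (fenv f) (dec m)"
proof -
 have "SatS A (hc_nat m) = hset {f : elts (Fenv A). sat (\<S> (elts A)) (fenv f) (dec m)}"
  by (simp add: SatS_def)
 then have "f : elts (SatS A (hc_nat m)) <-> f : elts (Fenv A) & sat (\<S> (elts A)) (fenv f) (dec m)"
  by (simp only: elts_hset[OF countable_Collect_elts] mem_Collect_eq)
 then show ?thesis by (simp only: elts_Fenv)
qed

lemma hupd_Fenv:
 assumes "isfenv A f" "a : elts A" shows "isfenv A (hupd f (hc_nat i) a)"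
proof -
 have fn: "fnl f" and sub: "elts f \<subseteq> elts (times omega A)" using assms unfolding isfenv_def by auto
 obtain k where k: "elts (hdom f) \<subseteq> elts (hc_nat k)" using assms unfolding isfenv_def by auto
 have 1: "fnl (hupd f (hc_nat i) a)" using fn unfolding fnl_iff hupd_def by auto
 have 2: "elts (hupd f (hc_nat i) a) \<subseteq> elts (times omega A)" using sub assms(2) unfolding hupd_def by auto
 have "elts (hdom (hupd f (hc_nat i) a)) \<subseteq> elts (hc_nat (max k (Suc i)))"
 proof
  fix x assume "x : elts (hdom (hupd f (hc_nat i) a))"
  then have "x : elts (hdom f) \<or> x = hc_nat i" unfolding elts_hdom hupd_def by auto
  then show "x : elts (hc_nat (max k (Suc i)))" using k unfolding elts_hc_nat by force
 qed
 then show ?thesis using 1 2 unfolding isfenv_def by (auto simp del: elts_times)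
qed

lemma fenv_hupd: "isfenv A f ==> fenv (hupd f (hc_nat i) a) = (fenv f)(i := a)"
proof
 fix j assume f: "isfenv A f"
 then have fn: "fnl f" unfolding isfenv_def by simp
 then have fn': "fnl (hupd f (hc_nat i) a)" unfolding fnl_iff hupd_def by auto
 show "fenv (hupd f (hc_nat i) a) j = ((fenv f)(i := a)) j"
 proof (cases "j = i")
  case True
  have "app (hupd f (hc_nat i) a) (hc_nat i) = a" by (rule app_eq[OF fn']) (simp add: hupd_def)
  then show ?thesis using True by (simp add: fenv_def)
 next
  case False
  then have iff: "opair (hc_nat j) y : elts (hupd f (hc_nat i) a) <-> opair (hc_nat j) y : elts f" for y
   unfolding hupd_def by auto
  have "app (hupd f (hc_nat i) a) (hc_nat j) = app f (hc_nat j)"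
  proof (cases "EX y. opair (hc_nat j) y : elts f")
   case True then show ?thesis using iff app_eq[OF fn] app_eq[OF fn'] by metis
  next
   case False then show ?thesis using iff app_none by metis
  qed
  then show ?thesis using False by (simp add: fenv_def)
 qed
qed

lemma fenv_approx:
 assumes "range e \<subseteq> elts A" "finite I"
 shows "EX f. isfenv A f & (ALL i:I. fenv f i = e i)"
proof -
 obtain k where k: "I \<subseteq> {..<k}" using finite_nat_iff_bounded assms(2) by blast
 define f where "f = lam (hc_nat k) (%x. e (THE n. x = hc_nat n))"
 have er: "e i : elts A" for i using assms(1) by auto
 have "isfenv A f" unfolding isfenv_def f_def
  using er by (auto simp: elts_hdom elts_hc_nat intro!: exI[of _ k])
 moreover have "fenv f i = e i" if "i : I" for i
  unfolding fenv_def f_def using that k by (subst app_lam) (auto simp: hc_nat_less)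
 ultimately show ?thesis by blast
qed

lemma fenv_range: "isfenv A f ==> hempty : elts A ==> range (fenv f) \<subseteq> elts A"
proof clarify
 fix i assume f: "isfenv A f" "hempty : elts A"
 show "fenv f i : elts A"
 proof (cases "EX y. opair (hc_nat i) y : elts f")
  case True
  then obtain y where y: "opair (hc_nat i) y : elts f" by blast
  then have "app f (hc_nat i) = y" "y : elts A" using f(1) app_eq unfolding isfenv_def by (blast, auto)
  then show ?thesis by (simp add: fenv_def)
 next
  case False then show ?thesis using f(2) app_none unfolding fenv_def by metis
 qed
qed

context zfmodels
begin

lemma finite_in:
 assumes M: "M : K" and "finite S" "S \<subseteq> M" shows "hset S : M"
 using assms(2,3)
proof (induction S rule: finite_induct)
 case empty
 then show ?case using zfm_hempty[OF K_zfm[OF M]] by (simp add: hempty_def)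
next
 case (insert x S)
 then have "hset S : M" "x : M" by auto
 have d: "dfun 2 (%M e. hun (e 0) (upair (e 1) (e 1)))" by (intro dfi) simp_all
 have "hun (hset S) (upair x x) : M"
  using dfun_in[OF d M, of "%i. if i = 0 then hset S else x"] \<open>hset S : M\<close> \<open>x : M\<close> by (auto simp: image_subset_iff)
 moreover have "hun (hset S) (upair x x) = hset (insert x S)"
  using insert by (intro elts_eqI) (auto simp: countable_finite)
 ultimately show ?case by simp
qed

lemma dfn_isfenv [dfi]: "dfun n s ==> dfun n t ==> dfn n (%M e. isfenv (s M e) (t M e))"
proof (rule dfn_comp2[where R = "%M. isfenv"])
 show "dfn 2 (%M e. isfenv (e 0) (e 1))" unfolding isfenv_def by (intro dfi) simp_all
qed

lemma dfun_Fenv [dfi]: "dfun n s ==> dfun n (%M e. Fenv (s M e))"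
proof (rule dfun_comp1[where F = "%M. Fenv"])
 have "dfun 1 (%M e. hset {f : elts (pow M (times omega (e 0))). isfenv (e 0) f})" by (intro dfi) simp_all
 then show "dfun 1 (%M e. Fenv (e 0))"
 proof (rule dfun_cong)
  fix M and e :: "nat => hc" assume M: "M : K" "range e \<subseteq> M"
  have cM: "countable M" using K_zfm M zfm_countable by blast
  have t: "times omega (e 0) : M" using dfun_in[OF dfun_times[OF dfun_omega dfun_var, of 0 1] M] by simp
  have "f : M" if "isfenv (e 0) f" for f
  proof -
   have "elts f \<subseteq> M" using that K_trans[OF M(1) t] unfolding isfenv_def by blast
   then show ?thesis using finite_in[OF M(1) isfenv_finite[OF that]] by simp
  qed
  then have "{f : elts (pow M (times omega (e 0))). isfenv (e 0) f} = Collect (isfenv (e 0))"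
   unfolding elts_pow[OF cM] using isfenv_def by blast
  then show "hset {f : elts (pow M (times omega (e 0))). isfenv (e 0) f} = Fenv (e 0)"
   by (simp only: Fenv_def)
 qed
qed

lemma dfun_hupd [dfi]: "dfun n s ==> dfun n t ==> dfun n u ==> dfun n (%M e. hupd (s M e) (t M e) (u M e))"
proof (rule dfun_comp3[where F = "%M. hupd"])
 show "dfun 3 (%M e. hupd (e 0) (e 1) (e 2))" unfolding hupd_def by (intro dfi) simp_all
qed

end

text \<open>One step of Tarski's recursion in terms of set operations. It decodes \<open>m\<close>
  just as \<open>dec\<close> does; \<open>hunion m\<close> is the predecessor of
  \<open>m\<close>.\<close>

definition SatH :: "hc => hc => hc => hc" where
 "SatH A m S = (let w = hwalk (hunion m); t = hfst w; w' = hwalk (hsnd w); u = hfst w'; v = hsnd w' in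
   if m ~: elts omega then hempty else if m = hempty then Fenv A
   else if t = hc_nat 0 then hset {f : elts (Fenv A). app f u = app f v}
   else if t = hc_nat 1 then hset {f : elts (Fenv A). app f u : elts (app f v)}
   else if t = hc_nat 2 then hset {f : elts (Fenv A). f ~: elts (app S u)}
   else if t = hc_nat 3 then hset {f : elts (Fenv A). f : elts (app S u) & f : elts (app S v)}
   else hset {f : elts (Fenv A). ALL a:elts A. hupd f u a : elts (app S v)})"

lemma SatS_rec: "SatS A m = SatH A m (lam m (SatS A))"
proof (cases "m : elts omega")
 case True
 then obtain n where m: "m = hc_nat n" by auto
 show ?thesis
 proof (cases n)
  case 0
  then show ?thesis unfolding m by (intro elts_eqI) (simp add: SatS_nat[of _ A 0, simplified] SatH_def elts_Fenv exI[of _ 0] rangeI[of hc_nat 0, simplified])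
 next
  case (Suc k)
  define t where "t = fst (walk k)"
  define u where "u = fst (walk (snd (walk k)))"
  define v where "v = snd (walk (snd (walk k)))"
  have lt: "u < n" "v < n" using walk_le[of k] walk_le[of "snd (walk k)"] Suc unfolding u_def v_def by linarith+
  have w: "hfst (hwalk (hunion m)) = hc_nat t" "hfst (hwalk (hsnd (hwalk (hunion m)))) = hc_nat u"
   "hsnd (hwalk (hsnd (hwalk (hunion m)))) = hc_nat v"
   unfolding m Suc hc_nat_Suc hunion_hsuc[OF hord_hc_nat] t_def u_def v_def by (simp_all add: hwalk_nat)
  have ap: "app (lam m (SatS A)) (hc_nat u) = SatS A (hc_nat u)" "app (lam m (SatS A)) (hc_nat v) = SatS A (hc_nat v)"
   using lt unfolding m by (simp_all add: hc_nat_less)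
  have d: "dec n = (if t = 0 then veq u v else if t = 1 then vmem u v else if t = 2 then Neg (dec u)
   else if t = 3 then Conj (dec u) (dec v) else Forall u (dec v))"
   unfolding Suc t_def u_def v_def by (simp add: Let_def)
  have m0: "m ~= hempty" unfolding m Suc by simp
  show ?thesis
  proof (rule elts_eqI)
   fix f
   have "f : elts (SatS A m) <-> isfenv A f & sat (\<S> (elts A)) (fenv f) (dec n)" unfolding m by (rule SatS_nat)
   also have "\<dots> <-> f : elts (SatH A m (lam m (SatS A)))"
    unfolding d SatH_def Let_def w ap hc_nat_inject
    using True m0 hupd_Fenv[of A f _ u]
    by (simp only: elts_hset[OF countable_Collect_elts] mem_Collect_eq if_distrib[of elts] if_distrib[of "(:) f"])
     (auto simp: elts_Fenv SatS_nat hmem_elts fenv_hupd simp del: hc_nat_simps, simp_all add: fenv_def)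
   finally show "f : elts (SatS A m) <-> f : elts (SatH A m (lam m (SatS A)))" .
  qed
 qed
qed (simp add: SatS_def SatH_def)

text \<open>The definable power set. The defined element is the value of variable 0, and
  \<open>hempty\<close> in \<open>hupd\<close> is that number.\<close>

definition Def :: "hc => hc" where
 "Def A = hunion (hset ((%m. hset ((%f. hset {a : elts A. hupd f hempty a : elts (SatS A m)}) ` elts (Fenv A))) ` elts omega))"

lemma elts_Def: "elts (Def A) = (\<Union>m. (%f. hset {a : elts A. hupd f hempty a : elts (SatS A (hc_nat m))}) ` elts (Fenv A))"
 by (simp add: Def_def)

lemma Def_iff:
 assumes "hempty : elts A"
 shows "y : elts (Def A) <-> (EX p e. wf_fm {} {} p & range e \<subseteq> elts A & elts y = {a : elts A. sat (\<S> (elts A)) (e(0 := a)) p})"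
proof
 have up: "hupd f hempty a : elts (SatS A (hc_nat m)) <-> sat (\<S> (elts A)) ((fenv f)(0 := a)) (dec m)"
  if "isfenv A f" "a : elts A" for f a m
  using hupd_Fenv[OF that, of 0] fenv_hupd[OF that(1), of 0 a] by (simp add: SatS_nat)
 assume "y : elts (Def A)"
 then obtain m f where mf: "isfenv A f" "y = hset {a : elts A. hupd f hempty a : elts (SatS A (hc_nat m))}"
  unfolding elts_Def using elts_Fenv by blast
 have "elts y = {a : elts A. sat (\<S> (elts A)) ((fenv f)(0 := a)) (dec m)}"
  unfolding mf(2) using up[OF mf(1)] by auto
 then show "EX p e. wf_fm {} {} p & range e \<subseteq> elts A & elts y = {a : elts A. sat (\<S> (elts A)) (e(0 := a)) p}"
  using dec_wf fenv_range[OF mf(1) assms] by blast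
next
 have up: "hupd f hempty a : elts (SatS A (hc_nat m)) <-> sat (\<S> (elts A)) ((fenv f)(0 := a)) (dec m)"
  if "isfenv A f" "a : elts A" for f a m
  using hupd_Fenv[OF that, of 0] fenv_hupd[OF that(1), of 0 a] by (simp add: SatS_nat)
 assume "EX p e. wf_fm {} {} p & range e \<subseteq> elts A & elts y = {a : elts A. sat (\<S> (elts A)) (e(0 := a)) p}"
 then obtain p e where pe: "wf_fm {} {} p" "range e \<subseteq> elts A" "elts y = {a : elts A. sat (\<S> (elts A)) (e(0 := a)) p}" by blast
 obtain m where m: "dec m = p" using dec_surj[OF pe(1)] by blast
 obtain f where f: "isfenv A f" "ALL i:fv p. fenv f i = e i" using fenv_approx[OF pe(2) fv_finite] by blast
 have "sat (\<S> (elts A)) (e(0 := a)) p <-> sat (\<S> (elts A)) ((fenv f)(0 := a)) p" for a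
  by (rule sat_cong) (use f(2) in auto)
 then have "y = hset {a : elts A. hupd f hempty a : elts (SatS A (hc_nat m))}"
  using pe(3) up[OF f(1)] m by (intro elts_eqI) auto
 then show "y : elts (Def A)" unfolding elts_Def using f(1) elts_Fenv by blast
qed

context zfmodels
begin

lemma dfun_SatS [dfi]: "dfun n s ==> dfun n t ==> dfun n (%M e. SatS (s M e) (t M e))"
proof (rule dfun_comp2[where F = "%M. SatS"])
 show "dfun 2 (%M e. SatS (e 0) (e 1))"
 proof (rule dfun_mem_rec[where H = "%M. SatH"])
  show "dfun 3 (%M e. SatH (e 0) (e 1) (e 2))" unfolding SatH_def Let_def by (intro dfi) simp_all
 qed (rule SatS_rec)
qed

lemma dfun_Def [dfi]: "dfun n s ==> dfun n (%M e. Def (s M e))"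
proof (rule dfun_comp1[where F = "%M. Def"])
 show "dfun 1 (%M e. Def (e 0))" unfolding Def_def by (intro dfi) simp_all
qed

end

section \<open>Relative constructibility\<close>

lemma zfm_closed: "M : zfm ==> zfmodels.dfun {M} M 0 t ==> t M (%_. hempty) : M"
proof -
 assume M: "M : zfm" and t: "zfmodels.dfun {M} M 0 t"
 interpret D: zfmodels "{M}" M using M by (rule zfm_zfmodels)
 show ?thesis using D.dfun_in[OF t] D.zfm_hempty[OF M] by auto
qed

text \<open>Starting from omega + 1 and \<open>a\<close> puts \<open>hempty\<close>,
  \<open>omega\<close> and \<open>a\<close> into every stage at once. The set is transitive because
  \<open>a\<close> will be a real.\<close>

definition Lbase :: "hc => hc" where "Lbase a = hun (hsuc omega) (upair a a)"

text \<open>Stages are indexed by arbitrary sets, although only the rank of the index matters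
  (\<open>Lx_rk\<close>). This keeps the recursion on membership, and a common bound of the stages
  \<open>u\<close> and \<open>v\<close> is simply the stage \<open>upair u v\<close>.\<close>

function Lx :: "hc => hc => hc" where
 "Lx a x = hun (Lbase a) (hunion (hset ((%y. Def (Lx a y)) ` elts x)))"
 by auto
termination by (relation "inv_image {(x, y). x : elts y} snd") (auto simp: wf_elts)

declare Lx.simps [simp del]

lemma elts_Lx: "elts (Lx a x) = elts (Lbase a) \<union> (\<Union>y\<in>elts x. elts (Def (Lx a y)))"
 by (subst Lx.simps) simp

lemma hempty_Lbase: "hempty : elts (Lbase a)"
 using rangeI[of hc_nat 0] by (simp add: Lbase_def)

lemma hempty_Lx [simp]: "hempty : elts (Lx a x)"
 using hempty_Lbase by (simp add: elts_Lx)

lemma Def_self: "hempty : elts A ==> A : elts (Def A)"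
 by (subst Def_iff) (auto intro!: exI[of _ "veq 0 0"] exI[of _ "%_. hempty"])

lemma Def_sub: "hempty : elts A ==> htrans A ==> elts A \<subseteq> elts (Def A)"
proof
 fix x assume A: "hempty : elts A" "htrans A" "x : elts A"
 then have "elts x = {b : elts A. sat (\<S> (elts A)) ((%_. x)(0 := b)) (vmem 0 1)}"
  using htransD by (auto simp: hmem_elts)
 then show "x : elts (Def A)"
  unfolding Def_iff[OF A(1)] using A(3) by (intro exI[of _ "vmem 0 1"] exI[of _ "%_. x"]) auto
qed

lemma Def_subset: "hempty : elts A ==> y : elts (Def A) ==> elts y \<subseteq> elts A"
 by (subst (asm) Def_iff) auto

lemma htrans_Lbase: "is_real a ==> htrans (Lbase a)"
 unfolding htrans_def Lbase_def is_real_def by (auto simp: elts_hc_nat)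

lemma htrans_Lx: assumes a: "is_real a" shows "htrans (Lx a x)"
proof (induction x rule: hc_induct)
 case (step x)
 have "elts u \<subseteq> elts (Lx a x)" if "u : elts (Lx a x)" for u
 proof (cases "u : elts (Lbase a)")
  case True
  then show ?thesis using htrans_Lbase[OF a] unfolding htrans_def elts_Lx by blast
 next
  case False
  with that obtain y where y: "y : elts x" "u : elts (Def (Lx a y))" unfolding elts_Lx by blast
  have "elts u \<subseteq> elts (Def (Lx a y))"
   using Def_subset[OF hempty_Lx y(2)] Def_sub[OF hempty_Lx step[OF y(1)]] by blast
  then show ?thesis using y(1) unfolding elts_Lx by blast
 qed
 then show ?case by (auto simp: htrans_def)
qed

lemma Lx_mem: "y : elts x ==> Lx a y : elts (Lx a x)"
 using Def_self[OF hempty_Lx] by (auto simp: elts_Lx[of a x])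

lemma Lx_sub: "is_real a ==> y : elts x ==> elts (Lx a y) \<subseteq> elts (Lx a x)"
 using Def_sub[OF hempty_Lx htrans_Lx] by (auto simp: elts_Lx[of a x])

lemma Lx_rk: assumes a: "is_real a" shows "Lx a (rk x) = Lx a x"
proof (induction x rule: hc_induct)
 case (step x)
 have 1: "elts (Def (Lx a y)) \<subseteq> elts (Lx a (rk x))" if "y : elts x" for y
  unfolding elts_Lx[of a "rk x"] step[OF that, symmetric] using rk_mem[OF that] by blast
 have 2: "elts (Def (Lx a b)) \<subseteq> elts (Lx a x)" if "b : elts (rk x)" for b
 proof -
  from that elts_rk[of x] obtain y where y: "y : elts x" "b = rk y \<or> b : elts (rk y)" by blast
  have "elts (Def (Lx a b)) \<subseteq> elts (Def (Lx a (rk y)))"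
  proof (cases "b = rk y")
   case False
   then have "elts (Def (Lx a b)) \<subseteq> elts (Lx a (rk y))" using y(2) unfolding elts_Lx[of a "rk y"] by blast
   then show ?thesis using Def_sub[OF hempty_Lx htrans_Lx[OF a]] by blast
  qed simp
  then show ?thesis unfolding step[OF y(1)] elts_Lx[of a x] using y(1) by blast
 qed
 have "elts (Lx a (rk x)) = elts (Lx a x)"
 proof
  show "elts (Lx a (rk x)) \<subseteq> elts (Lx a x)" using 2 elts_Lx[of a "rk x"] elts_Lx[of a x] by blast
  show "elts (Lx a x) \<subseteq> elts (Lx a (rk x))" using 1 elts_Lx[of a "rk x"] elts_Lx[of a x] by blast
 qed
 then show ?case by (simp only: elts_inject)
qed

definition LL :: "hc => hc set => hc set" where "LL a U = (\<Union>x\<in>U. elts (Lx a x))"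

context zfmodels
begin

lemma dfun_Lbase [dfi]: "dfun n s ==> dfun n (%M e. Lbase (s M e))"
 unfolding Lbase_def by (intro dfi)

lemma dfun_Lx [dfi]: "dfun n s ==> dfun n t ==> dfun n (%M e. Lx (s M e) (t M e))"
proof (rule dfun_comp2[where F = "%M. Lx"])
 show "dfun 2 (%M e. Lx (e 0) (e 1))"
 proof (rule dfun_mem_rec[where H = "%M a x f. hun (Lbase a) (hunion (hset ((%y. Def (app f y)) ` elts x)))"])
  show "dfun 3 (%M e. hun (Lbase (e 0)) (hunion (hset ((%y. Def (app (e 2) y)) ` elts (e 1)))))"
   by (intro dfi) simp_all
  show "Lx a x = hun (Lbase a) (hunion (hset ((%y. Def (app (lam x (Lx a)) y)) ` elts x)))" for a x
   by (subst Lx.simps) (simp cong: image_cong_simp)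
 qed
qed

lemma dfn_LL [dfi]: "dfun n s ==> dfun n t ==> dfn n (%M e. t M e : LL (s M e) M)"
proof (rule dfn_comp2[where R = "%M a x. x : LL a M"])
 have "dfn 2 (%M e. EX x:M. e 1 : elts (Lx (e 0) x))" by (intro dfi) simp_all
 then show "dfn 2 (%M e. e 1 : LL (e 0) M)" by (simp add: LL_def)
qed

text \<open>For one fixed formula truth in a definable class is obtained by relativizing its
  quantifiers. The induction on \<open>p\<close> takes place outside, so no truth predicate is
  involved.\<close>

lemma dfn_sat:
 assumes NN: "dfn 1 (%M e. e 0 : NN M)" "!!M. M : K ==> NN M \<subseteq> M"
 shows "wf_fm {} {} p ==> (!!i. dfun n (v i)) ==> dfn n (%M e. sat (\<S> (NN M)) (%i. v i M e) p)"
proof (induction p arbitrary: n v)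
 have trm: "EX i. s = Var i" if "wf_trm {} s" for s :: "unit trm" using that by (cases s) auto
 { case (Eq s t)
  from trm[of s] trm[of t] Eq(1) obtain i j where st: "s = Var i" "t = Var j" by auto
  show ?case unfolding st using dfn_eq[OF Eq(2) Eq(2)] by simp }
 { case (Mem s t)
  from trm[of s] trm[of t] Mem(1) obtain i j where st: "s = Var i" "t = Var j" by auto
  show ?case unfolding st using dfn_mem[OF Mem(2) Mem(2)] by (simp add: hmem_elts) }
 { case (Neg p) then show ?case using dfn_not by simp }
 { case (Conj p q) then show ?case using dfn_conj by simp }
 { case (Forall k p)
  note [dfi] = dfn_comp1[OF NN(1)]
  have "dfun (Suc n) (%M e. if i = k then e n else v i M e)" for i
   using dfun_mono[OF Forall(3)[of i], of "Suc n"] dfun_var[of n "Suc n"] by (cases "i = k") auto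
  then have "dfn (Suc n) (%M e. sat (\<S> (NN M)) (%i. if i = k then e n else v i M e) p)"
   by (intro Forall(1)) (use Forall(2) in simp_all)
  then have "dfn (Suc n) (%M e. e n : NN M --> sat (\<S> (NN M)) (%i. if i = k then e n else v i M e) p)"
   by (intro dfn_imp dfn_comp1[OF NN(1)] dfun_var) auto
  from dfn_all[OF this] show ?case
  proof (rule dfn_cong)
   fix M and e :: "nat => hc" assume M: "M : K" "range e \<subseteq> M"
   have "(%i. if i = k then (e(n := b)) n else v i M (e(n := b))) = (%i. v i M e)(k := b)" if "b : M" for b
    by (rule ext) (simp add: dfun_upd[OF Forall(3) M that order_refl])
   then show "(ALL b:M. (e(n := b)) n : NN M --> sat (\<S> (NN M)) (%i. if i = k then (e(n := b)) n else v i M (e(n := b))) p) =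
    sat (\<S> (NN M)) (%i. v i M e) (Forall k p)"
    using NN(2)[OF M(1)] by auto
  qed }
qed simp

end

definition mixp :: "(nat => 'a) => (nat => 'a) => nat => 'a" where
 "mixp e g i = (if even i then e (i div 2) else g (i div 2))"

lemma mixp_simps [simp]: "mixp e g (2 * i) = e i" "mixp e g (Suc (2 * i)) = g i"
 by (simp_all add: mixp_def)

lemma mixp_upd: "(mixp e g)(2 * n := y) = mixp (e(n := y)) g"
 by (auto simp: mixp_def fun_eq_iff elim!: evenE)

locale constructible =
 fixes U a assumes U: "U : zfm" and a: "a : U" and real: "is_real a"
begin

sublocale D: zfmodels "{U}" U using U by (rule zfm_zfmodels)

abbreviation N :: "hc set" where "N \<equiv> LL a U"

lemma Lx_in: "x : U ==> Lx a x : U"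
 using zfm_closed[OF U, of "%M e. Lx a x"] a by (simp add: D.dfun_Lx D.dfun_const)

lemma LL_sub: "N \<subseteq> U"
 unfolding LL_def using Lx_in zfm_trans[OF U] by blast

lemma Lx_sub_LL: "x : U ==> elts (Lx a x) \<subseteq> N"
 by (auto simp: LL_def)

lemma upair_U: "x : U ==> y : U ==> upair x y : U"
 by (rule zfm_upair[OF U])

lemma Lx_LL: "x : U ==> Lx a x : N"
 using Lx_mem[of x "upair x x"] Lx_sub_LL[OF upair_U[of x x]] by auto

lemma LL_trans: "x : N ==> y : elts x ==> y : N"
 unfolding LL_def using htransD[OF htrans_Lx[OF real]] by blast

text \<open>The set \<open>B\<close> bounding the indices is itself used as an index: the stage
  \<open>Lx a B\<close> includes all stages with index in \<open>B\<close>.\<close>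

lemma LL_collection:
 assumes R: "D.dfn 2 (%M e. R M (e 0) (e 1))" and x: "x : U"
 shows "EX w:U. ALL z:elts x. (EX y:N. R U z y) --> (EX y:elts (Lx a w). R U z y)"
proof -
 note [dfi] = D.dfn_comp2[OF R]
 have "D.dfn 2 (%M e. EX y:elts (Lx a (e 1)). R M (e 0) y)" by (intro dfi) (use a in simp_all)
 from zfm_collection[OF U this x] obtain B where B: "B : U"
  "ALL z:elts x. (EX w:U. EX y:elts (Lx a w). R U z y) --> (EX w:elts B. EX y:elts (Lx a w). R U z y)" by blast
 show ?thesis
 proof (intro bexI[OF _ B(1)] ballI impI)
  fix z assume z: "z : elts x" "EX y:N. R U z y"
  then have "EX w:U. EX y:elts (Lx a w). R U z y" unfolding LL_def by blast
  then obtain w y where "w : elts B" "y : elts (Lx a w)" "R U z y" using B(2) z(1) by blast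
  then show "EX y:elts (Lx a B). R U z y" using Lx_sub[OF real] by blast
 qed
qed

lemma LL_bound: assumes "x : U" "elts x \<subseteq> N" shows "EX w:U. elts x \<subseteq> elts (Lx a w)"
proof -
 have "D.dfn 2 (%M e. e 0 = e 1)" by (intro dfi) simp_all
 from LL_collection[OF this assms(1)] obtain w where
  "w : U" "ALL z:elts x. (EX y:N. z = y) --> (EX y:elts (Lx a w). z = y)" by blast
 then show ?thesis using assms(2) by blast
qed

lemma dfn_sat_LL: "wf_fm {} {} p ==> (!!i. D.dfun n (v i)) ==> D.dfn n (%M e. sat (\<S> (LL a M)) (%i. v i M e) p)"
proof (rule D.dfn_sat)
 show "D.dfn 1 (%M e. e 0 : LL a M)" by (intro dfi) (use a in simp_all)
qed (use LL_sub in auto)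

text \<open>Collection in \<open>U\<close> bounds the quantifiers of \<open>p\<close>, so that truth in the class \<open>N\<close> becomes truth in a stage.\<close>

lemma LL_bounded_form:
 "wf_fm {} {} p ==> w : U ==> EX w':U. EX q g. wf_fm {} {} q & range g \<subseteq> elts (Lx a w') &
   elts (Lx a w) \<subseteq> elts (Lx a w') & (ALL T. elts (Lx a w') \<subseteq> T --> (ALL e. range e \<subseteq> elts (Lx a w) -->
    (sat (\<S> T) (mixp e g) q <-> sat (\<S> N) e p)))"
proof (induction p arbitrary: w)
 have trm: "EX i. s = Var i" if "wf_trm {} s" for s :: "unit trm" using that by (cases s) auto
 { case (Eq s t)
  from trm[of s] trm[of t] Eq(1) obtain i j where st: "s = Var i" "t = Var j" by auto
  show ?case unfolding st
   by (intro bexI[OF _ Eq(2)] exI[of _ "veq (2 * i) (2 * j)"] exI[of _ "%_. hempty"]) auto }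
 { case (Mem s t)
  from trm[of s] trm[of t] Mem(1) obtain i j where st: "s = Var i" "t = Var j" by auto
  show ?case unfolding st
   by (intro bexI[OF _ Mem(2)] exI[of _ "vmem (2 * i) (2 * j)"] exI[of _ "%_. hempty"]) auto }
 { case (Neg p)
  then obtain w' q g where *: "w' : U" "wf_fm {} {} q" "range g \<subseteq> elts (Lx a w')" "elts (Lx a w) \<subseteq> elts (Lx a w')"
   "ALL T. elts (Lx a w') \<subseteq> T --> (ALL e. range e \<subseteq> elts (Lx a w) --> (sat (\<S> T) (mixp e g) q <-> sat (\<S> N) e p))"
   by (metis wf_fm.simps(4))
  then show ?case by (intro bexI[OF _ *(1)] exI[of _ "Neg q"] exI[of _ g]) simp }
 { case (Conj p1 p2)
  obtain w1 q1 g1 where 1: "w1 : U" "wf_fm {} {} q1" "range g1 \<subseteq> elts (Lx a w1)" "elts (Lx a w) \<subseteq> elts (Lx a w1)"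
   "!!T e. elts (Lx a w1) \<subseteq> T ==> range e \<subseteq> elts (Lx a w) ==> (sat (\<S> T) (mixp e g1) q1 <-> sat (\<S> N) e p1)"
   using Conj.IH(1)[of w] Conj.prems by (metis wf_fm.simps(5))
  obtain w2 q2 g2 where 2: "w2 : U" "wf_fm {} {} q2" "range g2 \<subseteq> elts (Lx a w2)" "elts (Lx a w) \<subseteq> elts (Lx a w2)"
   "!!T e. elts (Lx a w2) \<subseteq> T ==> range e \<subseteq> elts (Lx a w) ==> (sat (\<S> T) (mixp e g2) q2 <-> sat (\<S> N) e p2)"
   using Conj.IH(2)[of w] Conj.prems by (metis wf_fm.simps(5))
  \<comment> \<open>Original variables sit at even places and stage parameters at odd ones. The two
    parameter sequences are interleaved: \<open>g1 i\<close> goes to place 4i + 1 and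
    \<open>g2 i\<close> to place 4i + 3.\<close>
  define f1 :: "nat => nat" where "f1 i = (if even i then i else 2 * i - 1)" for i
  define f2 :: "nat => nat" where "f2 i = (if even i then i else 2 * i + 1)" for i
  have f: "inj f1" "inj f2" unfolding f1_def f2_def inj_def by (auto split: if_splits)
  have m: "mixp e (mixp g1 g2) \<circ> f1 = mixp e g1" "mixp e (mixp g1 g2) \<circ> f2 = mixp e g2" for e
   unfolding f1_def f2_def fun_eq_iff
   by (auto simp: mixp_def elim!: oddE, (drule arg_cong[of _ _ even]; simp)+)
  let ?w = "upair w1 w2"
  have sub: "elts (Lx a w1) \<subseteq> elts (Lx a ?w)" "elts (Lx a w2) \<subseteq> elts (Lx a ?w)"
   by (rule Lx_sub[OF real], simp)+
  have g: "range (mixp g1 g2) \<subseteq> elts (Lx a ?w)"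
   using 1(3) 2(3) sub by (auto simp: mixp_def image_subset_iff)
  show ?case
  proof (intro bexI[of _ ?w] exI[of _ "Conj (ren f1 q1) (ren f2 q2)"] exI[of _ "mixp g1 g2"] conjI allI impI)
   fix T and e :: "nat => hc" assume T: "elts (Lx a ?w) \<subseteq> T" "range e \<subseteq> elts (Lx a w)"
   show "sat (\<S> T) (mixp e (mixp g1 g2)) (Conj (ren f1 q1) (ren f2 q2)) = sat (\<S> N) e (Conj p1 p2)"
    using 1(5)[of T e] 2(5)[of T e] T sub by (simp add: sat_ren[OF f(1)] sat_ren[OF f(2)] m)
  qed (use 1 2 sub g upair_U in \<open>auto simp: wf_ren\<close>) }
 { case (Forall n p)
  \<comment> \<open>Collection must range over a set of assignments. The finite ones into the stage
    \<open>w\<close> form the set \<open>Fenv (Lx a w)\<close>, and they suffice because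
    \<open>p\<close> has finitely many free variables.\<close>
  have "D.dfun 2 (%M e. if i = n then e 1 else app (e 0) (hc_nat i))" for i
   by (cases "i = n") (simp_all, (intro dfi, simp_all)+)
  then have d: "D.dfn 2 (%M e. sat (\<S> (LL a M)) (%i. if i = n then e 1 else app (e 0) (hc_nat i)) p)"
   by (intro dfn_sat_LL[of p 2 "%i M e. if i = n then e 1 else app (e 0) (hc_nat i)"]) (use Forall in simp_all)
  have "D.dfn 2 (%M e. \<not> sat (\<S> (LL a M)) (%i. if i = n then e 1 else app (e 0) (hc_nat i)) p)"
   by (rule D.dfn_not[OF d])
  moreover have "Fenv (Lx a w) : U"
   using zfm_closed[OF U D.dfun_Fenv[OF D.dfun_const[OF Lx_in[OF Forall(3)]]]] by simp
  ultimately obtain w1 where w1: "w1 : U" "ALL f:elts (Fenv (Lx a w)).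
    (EX y:N. \<not> sat (\<S> N) (%i. if i = n then y else app f (hc_nat i)) p) -->
    (EX y:elts (Lx a w1). \<not> sat (\<S> N) (%i. if i = n then y else app f (hc_nat i)) p)"
   using LL_collection[of "%M f y. \<not> sat (\<S> (LL a M)) (%i. if i = n then y else app f (hc_nat i)) p" "Fenv (Lx a w)"]
   by blast
  let ?w2 = "upair w w1"
  have w2: "?w2 : U" "elts (Lx a w) \<subseteq> elts (Lx a ?w2)" "elts (Lx a w1) \<subseteq> elts (Lx a ?w2)"
   using upair_U[OF Forall(3) w1(1)] Lx_sub[OF real, of w ?w2] Lx_sub[OF real, of w1 ?w2] by simp_all
  have full: "(ALL y:elts (Lx a ?w2). sat (\<S> N) (e(n := y)) p) <-> (ALL y:N. sat (\<S> N) (e(n := y)) p)"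
   if e: "range e \<subseteq> elts (Lx a w)" for e
  proof
   assume l: "ALL y:elts (Lx a ?w2). sat (\<S> N) (e(n := y)) p"
   obtain f where f: "isfenv (Lx a w) f" "ALL i:fv p. fenv f i = e i" using fenv_approx[OF e fv_finite] by blast
   have c: "sat (\<S> N) (%i. if i = n then y else app f (hc_nat i)) p <-> sat (\<S> N) (e(n := y)) p" for y
    by (rule sat_cong) (use f(2) in \<open>auto simp: fenv_def\<close>)
   have "f : elts (Fenv (Lx a w))" using f(1) by (simp only: elts_Fenv)
   with w1(2) have "(EX y:N. \<not> sat (\<S> N) (e(n := y)) p) --> (EX y:elts (Lx a w1). \<not> sat (\<S> N) (e(n := y)) p)"
    unfolding c[symmetric] by blast
   then show "ALL y:N. sat (\<S> N) (e(n := y)) p" using l w2(3) by blast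
  next
   assume "ALL y:N. sat (\<S> N) (e(n := y)) p"
   then show "ALL y:elts (Lx a ?w2). sat (\<S> N) (e(n := y)) p" using Lx_sub_LL[OF w2(1)] by blast
  qed
  obtain w' q g where *: "w' : U" "wf_fm {} {} q" "range g \<subseteq> elts (Lx a w')" "elts (Lx a ?w2) \<subseteq> elts (Lx a w')"
   "!!T e. elts (Lx a w') \<subseteq> T ==> range e \<subseteq> elts (Lx a ?w2) ==> (sat (\<S> T) (mixp e g) q <-> sat (\<S> N) e p)"
   using Forall.IH[of ?w2] Forall.prems w2(1) by (metis wf_fm.simps(6))
  \<comment> \<open>All stage parameters move up by one, so that variable 1 can hold the stage
    \<open>Lx a ?w2\<close> that bounds the quantifier.\<close>
  define f :: "nat => nat" where "f i = (if even i then i else i + 2)" for i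
  define g' where "g' j = (if j = 0 then Lx a ?w2 else g (j - 1))" for j
  have f: "inj f" unfolding f_def inj_def by (auto split: if_splits)
  have m: "(mixp e g')(2 * n := y) \<circ> f = mixp (e(n := y)) g" for e y
   unfolding mixp_upd by (auto simp: fun_eq_iff f_def mixp_def g'_def elim!: oddE)
  let ?w = "upair w' ?w2"
  have w: "?w : U" using upair_U[OF *(1) w2(1)] .
  have sub: "elts (Lx a w') \<subseteq> elts (Lx a ?w)" "Lx a ?w2 : elts (Lx a ?w)" "elts (Lx a ?w2) \<subseteq> elts (Lx a ?w)"
   using Lx_sub[OF real, of w' ?w] Lx_mem[of ?w2 ?w a] Lx_sub[OF real, of ?w2 ?w] by simp_all
  have g': "range g' \<subseteq> elts (Lx a ?w)" unfolding g'_def using sub *(3) by (auto simp: image_subset_iff)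
  show ?case
  proof (intro bexI[OF _ w] exI[of _ "Forall (2 * n) (Impl (vmem (2 * n) 1) (ren f q))"] exI[of _ g'] conjI allI impI)
   fix T and e :: "nat => hc" assume T: "elts (Lx a ?w) \<subseteq> T" "range e \<subseteq> elts (Lx a w)"
   have 1: "mixp e g' 1 = Lx a ?w2" by (simp add: mixp_def g'_def)
   have 2: "sat (\<S> T) ((mixp e g')(2 * n := y)) (ren f q) <-> sat (\<S> N) (e(n := y)) p" if "y : elts (Lx a ?w2)" for y
    unfolding sat_ren[OF f] m by (rule *(5)) (use T sub w2(2) that in \<open>auto simp: image_subset_iff\<close>)
   have "sat (\<S> T) (mixp e g') (Forall (2 * n) (Impl (vmem (2 * n) 1) (ren f q))) <->
    (ALL y:T. y : elts (Lx a ?w2) --> sat (\<S> T) ((mixp e g')(2 * n := y)) (ren f q))"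
    unfolding sat.simps(6) sat_Impl using 1 by (simp add: hmem_elts del: mixp_simps)
   also have "\<dots> <-> (ALL y:elts (Lx a ?w2). sat (\<S> N) (e(n := y)) p)" using 2 sub(3) T(1) by blast
   also have "\<dots> <-> sat (\<S> N) e (Forall n p)" using full[OF T(2)] by simp
   finally show "sat (\<S> T) (mixp e g') (Forall (2 * n) (Impl (vmem (2 * n) 1) (ren f q))) = sat (\<S> N) e (Forall n p)" .
  next
   show "wf_fm {} {} (Forall (2 * n) (Impl (vmem (2 * n) 1) (ren f q)))" using *(2) by (simp add: wf_ren)
  qed (use sub w2(2) g' in blast)+ }
qed simp

lemma LL_separation:
 assumes p: "wf_fm {} {} p" and e: "range e \<subseteq> N" and x: "x : N"
 shows "hset {z : elts x. sat (\<S> N) (e(v := z)) p} : N"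
proof -
 have fin: "finite (insert x (e ` fv p))" by (simp add: fv_finite)
 have sub: "insert x (e ` fv p) \<subseteq> N" using e x by auto
 have "hset (insert x (e ` fv p)) : U" by (rule D.finite_in[OF _ fin]) (use sub LL_sub in auto)
 then obtain w where w: "w : U" "insert x (e ` fv p) \<subseteq> elts (Lx a w)"
  using LL_bound[of "hset (insert x (e ` fv p))"] sub fin by (auto simp: countable_finite)
 define e' where "e' i = (if i : fv p then e i else hempty)" for i
 have e': "range e' \<subseteq> elts (Lx a w)" unfolding e'_def using w(2) by auto
 have ee: "sat (\<S> N) (e(v := z)) p <-> sat (\<S> N) (e'(v := z)) p" for z
  by (rule sat_cong) (simp add: e'_def)
 obtain w' q g where *: "w' : U" "wf_fm {} {} q" "range g \<subseteq> elts (Lx a w')" "elts (Lx a w) \<subseteq> elts (Lx a w')"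
   "!!T e. elts (Lx a w') \<subseteq> T ==> range e \<subseteq> elts (Lx a w) ==> (sat (\<S> T) (mixp e g) q <-> sat (\<S> N) e p)"
  using LL_bounded_form[OF p w(1)] by metis
 let ?A = "Lx a w'"
 \<comment> \<open>In \<open>Def\<close> the defined element is variable 0, and variable 1 holds
   \<open>x\<close>; so \<open>q\<close> is shifted by 2. Its variable \<open>v\<close> thereby
   becomes 2v + 2, which is bound and equated with variable 0.\<close>
 define q' where "q' = Exists (2 * v + 2) (Conj (veq (2 * v + 2) 0) (Conj (vmem 0 1) (ren (%i. i + 2) q)))"
 define E where "E i = (if i = 1 then x else mixp e' g (i - 2))" for i
 have xA: "x : elts ?A" using w(2) *(4) by blast
 have xs: "elts x \<subseteq> elts (Lx a w)" using w(2) htransD[OF htrans_Lx[OF real]] by blast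
 have E: "range E \<subseteq> elts ?A" unfolding E_def using xA e' *(3,4) by (auto simp: mixp_def image_subset_iff)
 have "sat (\<S> (elts ?A)) (E(0 := z)) q' <-> z : elts x & sat (\<S> N) (e(v := z)) p" if z: "z : elts ?A" for z
 proof -
  have c: "(E(0 := z, 2 * v + 2 := z)) \<circ> (%i. i + 2) = mixp (e'(v := z)) g"
   unfolding mixp_upd[symmetric] by (auto simp: fun_eq_iff E_def)
  have "sat (\<S> (elts ?A)) (E(0 := z)) q' <-> z : elts x & sat (\<S> (elts ?A)) (E(0 := z, 2 * v + 2 := z)) (ren (%i. i + 2) q)"
   unfolding q'_def sat_Exists using z by (simp add: hmem_elts E_def del: fun_upd_apply) (auto simp: E_def)
  also have "\<dots> <-> z : elts x & sat (\<S> (elts ?A)) (mixp (e'(v := z)) g) q"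
   by (simp only: sat_ren[OF inj_onI] c add_right_cancel)
  also have "\<dots> <-> z : elts x & sat (\<S> N) (e'(v := z)) p"
  proof -
   have "range (e'(v := z)) \<subseteq> elts (Lx a w)" if "z : elts x" using e' xs that by auto
   then show ?thesis using *(5)[of "elts ?A" "e'(v := z)"] by blast
  qed
  finally show ?thesis unfolding ee .
 qed
 then have "{z : elts x. sat (\<S> N) (e(v := z)) p} = {z : elts ?A. sat (\<S> (elts ?A)) (E(0 := z)) q'}"
  using xs *(4) by blast
 then have eq: "elts (hset {z : elts x. sat (\<S> N) (e(v := z)) p}) = {z : elts ?A. sat (\<S> (elts ?A)) (E(0 := z)) q'}"
  by (simp only: elts_hset[OF countable_Collect_elts])
 have "wf_fm {} {} q'" unfolding q'_def using *(2) by (simp add: wf_ren)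
 then have "hset {z : elts x. sat (\<S> N) (e(v := z)) p} : elts (Def ?A)"
  unfolding Def_iff[OF hempty_Lx] using E eq by blast
 then have "hset {z : elts x. sat (\<S> N) (e(v := z)) p} : elts (Lx a (upair w' w'))"
  unfolding elts_Lx[of a "upair w' w'"] by auto
 then show ?thesis using Lx_sub_LL[OF upair_U[OF *(1) *(1)]] by blast
qed

theorem LL_zfm: "N : zfm"
proof (rule zfmI)
 show "countable N" using LL_sub zfm_countable[OF U] by (rule countable_subset)
 show "hempty : N" using Lx_sub_LL[OF a] hempty_Lx by blast
 show "y : N" if "x : N" "y : elts x" for x y using LL_trans that .
 show "hset {z : elts x. sat (\<S> N) (e(v := z)) p} : N" if "wf_fm {} {} p" "range e \<subseteq> N" "x : N" for p e v x
  using LL_separation that .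
 show "EX b:N. x : elts b & y : elts b" if xy: "x : N" "y : N" for x y
 proof -
  from xy obtain u v where uv: "u : U" "v : U" "x : elts (Lx a u)" "y : elts (Lx a v)" unfolding LL_def by blast
  show ?thesis
   using Lx_LL[OF upair_U[OF uv(1,2)]] Lx_sub[OF real, of u "upair u v"] Lx_sub[OF real, of v "upair u v"] uv(3,4)
   by (intro bexI[of _ "Lx a (upair u v)"]) auto
 qed
 show "EX b:N. ALL y:elts x. elts y \<subseteq> elts b" if x: "x : N" for x
 proof -
  from x obtain u where "u : U" "x : elts (Lx a u)" unfolding LL_def by blast
  then show ?thesis using htrans_Lx[OF real, of u] Lx_LL unfolding htrans_def by (intro bexI[of _ "Lx a u"]) blast+
 qed
 show "EX b:N. ALL y:N. elts y \<subseteq> elts x --> y : elts b" if x: "x : N" for x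
 proof -
  have "pow U x : U" using zfm_pow[OF U] x LL_sub by blast
  moreover have "D.dfn 2 (%M e. e 0 = e 1)" by (intro dfi) simp_all
  ultimately obtain w where "w : U" "ALL z:elts (pow U x). (EX y:N. z = y) --> (EX y:elts (Lx a w). z = y)"
   using LL_collection[of "%M z y. z = y"] by blast
  then show ?thesis using LL_sub Lx_LL by (intro bexI[of _ "Lx a w"]) (auto simp: elts_pow[OF zfm_countable[OF U]])
 qed
 show "omega : N" using Lx_sub_LL[OF a] unfolding elts_Lx Lbase_def by auto
 show "EX b:N. ALL z:elts x. (EX y:N. sat (\<S> N) (e(0 := z, 1 := y)) p) --> (EX y:elts b. sat (\<S> N) (e(0 := z, 1 := y)) p)"
  if p: "wf_fm {} {} p" and e: "range e \<subseteq> N" and x: "x : N" for p e x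
 proof -
  have upd: "(%i. if i = 0 then z else if i = 1 then y else e i) = e(0 := z, 1 := y)" for z y :: hc by auto
  have "D.dfun 2 (%M f. if i = 0 then f 0 else if i = 1 then f 1 else e i)" for i
   using e LL_sub by (cases "i = 0"; cases "i = 1") (auto intro!: D.dfun_var D.dfun_const)
  then have "D.dfn 2 (%M f. sat (\<S> (LL a M)) (%i. if i = 0 then f 0 else if i = 1 then f 1 else e i) p)"
   by (intro dfn_sat_LL[of p 2 "%i M f. if i = 0 then f 0 else if i = 1 then f 1 else e i"]) (use p in simp_all)
  from LL_collection[of "%M z y. sat (\<S> (LL a M)) (%i. if i = 0 then z else if i = 1 then y else e i) p", OF this, of x]
  obtain w where "w : U" "ALL z:elts x. (EX y:N. sat (\<S> N) (e(0 := z, 1 := y)) p) -->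
    (EX y:elts (Lx a w). sat (\<S> N) (e(0 := z, 1 := y)) p)"
   using x LL_sub unfolding upd by blast
  then show ?thesis using Lx_LL by blast
 qed
qed

sublocale L: zfmodels "{N}" N using LL_zfm by (rule zfm_zfmodels)

lemma a_LL: "a : N"
 using Lx_sub_LL[OF a] unfolding elts_Lx Lbase_def by auto

text \<open>For a least ordinal \<open>b\<close> of \<open>U\<close> outside \<open>N\<close>, some
  stage covers its members. Then \<open>b\<close> is exactly the set of ordinals of that stage,
  hence an element of \<open>N\<close>.\<close>

lemma LL_hord: assumes "hord x" "x : U" shows "x : N"
proof (rule ccontr)
 assume "x ~: N"
 then obtain b where b: "hord b & b : U & b ~: N" "!!z. z : elts b ==> \<not> (hord z & z : U & z ~: N)"
  by (rule_tac hmin[of "%b. hord b & b : U & b ~: N" x]) (use assms in auto)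
 have "elts b \<subseteq> N" using b hord_mem zfm_trans[OF U] by blast
 then obtain w where w: "w : U" "elts b \<subseteq> elts (Lx a w)" using LL_bound b(1) by blast
 have "z : elts b <-> z : elts (Lx a w) & hord z" for z
 proof
  assume z: "z : elts (Lx a w) & hord z"
  then have zN: "z : N" using Lx_sub_LL[OF w(1)] by blast
  consider "z : elts b" | "b = z" | "b : elts z" using hord_linear[of z b] z b(1) by blast
  then show "z : elts b" using LL_trans[OF zN] zN b(1) by cases auto
 qed (use w(2) b(1) hord_mem in blast)
 then have "b = hset {z : elts (Lx a w). hord z}" by (intro elts_eqI) simp
 moreover have "L.dfun 0 (%M e. hset {z : elts (Lx a w). hord z})" by (intro dfi) (use Lx_LL[OF w(1)] in simp_all)
 from zfm_closed[OF LL_zfm this] have "hset {z : elts (Lx a w). hord z} : N" .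
 ultimately show False using b(1) by simp
qed

lemma rk_in: "x : U ==> rk x : U"
 using zfm_closed[OF U D.dfun_rk[OF D.dfun_const]] .

lemma LL_hord_iff: "y : N <-> (EX b:U. hord b & y : elts (Lx a b))"
 unfolding LL_def using rk_in hord_rk Lx_rk[OF real] by (metis UN_iff)

text \<open>Both worlds compute the same stages and have the same ordinals, and stages at ordinals
  exhaust the class.\<close>

lemma LL_absolute: assumes "b : N" "is_real b" shows "LL b N = LL b U" "LL b U \<subseteq> N"
proof -
 interpret B: constructible U b using U assms LL_sub by unfold_locales auto
 have in_N: "Lx b x : N" if "x : N" for x
  using zfm_closed[OF LL_zfm L.dfun_Lx[OF L.dfun_const[OF assms(1)] L.dfun_const[OF that]]] .
 show "LL b N = LL b U"
 proof
  show "LL b N \<subseteq> LL b U" using LL_sub unfolding LL_def[of b] by blast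
  show "LL b U \<subseteq> LL b N" using B.LL_hord_iff LL_hord unfolding LL_def[of b N] by blast
 qed
 moreover have "LL b N \<subseteq> N"
 proof
  fix y assume "y : LL b N"
  then obtain x where "x : N" "y : elts (Lx b x)" unfolding LL_def[of b N] by blast
  then show "y : N" using LL_trans[OF in_N] by blast
 qed
 ultimately show "LL b U \<subseteq> N" by simp
qed

end

lemma LL_same_ordinals:
 assumes "U : zfm" "U' : zfm" "a : U" "a : U'" "is_real a" "!!x. hord x ==> x : U <-> x : U'"
 shows "LL a U = LL a U'"
proof -
 interpret A: constructible U a using assms by unfold_locales
 interpret B: constructible U' a using assms by unfold_locales
 show ?thesis using A.LL_hord_iff B.LL_hord_iff assms(6) by blast
qed

section \<open>Choice in the constructible worlds, and well-orders from choice\<close>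

section \<open>Choice\<close>

lemma choice_iff:
 assumes M: "M : zfm"
 shows "models (\<S> M) ax_choice <-> (ALL x:M. (ALL y:elts x. elts y ~= {}) -->
  (ALL y:elts x. ALL y':elts x. elts y \<inter> elts y' ~= {} --> y = y') -->
  (EX c:M. ALL y:elts x. EX u. elts y \<inter> elts c = {u}))"
proof -
 let ?P = "%x. (ALL y:M. y : elts x --> (EX z:M. z : elts y)) &
   (ALL y:M. ALL y':M. y' : elts x --> y : elts x --> (ALL z:M. z : elts y --> z ~: elts y') \<or> y = y') -->
   (EX c:M. ALL y:M. y : elts x --> (EX u:M. ALL z:M. (z : elts y & z : elts c) <-> z = u))"
 let ?Q = "%x. (ALL y:elts x. elts y ~= {}) -->
  (ALL y:elts x. ALL y':elts x. elts y \<inter> elts y' ~= {} --> y = y') -->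
  (EX c:M. ALL y:elts x. EX u. elts y \<inter> elts c = {u})"
 have s: "sat (\<S> M) e ax_choice <-> (ALL x:M. ?P x)" for e
  unfolding ax_choice_def sat_conn by (simp add: hmem_elts)
 obtain b where "b : M" using zfm_nonempty[OF M] by blast
 then have "range (%_::nat. b) \<subseteq> M" by auto
 then have m: "models (\<S> M) ax_choice <-> (ALL x:M. ?P x)" unfolding models_def s eps_struc_simps by blast
 have pq: "?P x <-> ?Q x" if x: "x : M" for x
 proof -
  have s: "y : M & elts y \<subseteq> M" if "y : elts x" for y
   using zfm_trans[OF M x that] zfm_trans[OF M zfm_trans[OF M x that]] by auto
  have 1: "(ALL y:M. y : elts x --> (EX z:M. z : elts y)) <-> (ALL y:elts x. elts y ~= {})"
  proof (intro iffI ballI impI)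
   fix y assume "ALL y:M. y : elts x --> (EX z:M. z : elts y)" "y : elts x"
   then show "elts y ~= {}" using s[of y] by auto
  next
   fix y assume "ALL y:elts x. elts y ~= {}" "y : elts x"
   then obtain z where "z : elts y" by auto
   then show "EX z:M. z : elts y" using s[OF \<open>y : elts x\<close>] by auto
  qed
  have s': "ALL y:elts x. y : M & elts y \<subseteq> M" using s by blast
  have 2: "(ALL y:M. ALL y':M. y' : elts x --> y : elts x --> (ALL z:M. z : elts y --> z ~: elts y') \<or> y = y') <->
   (ALL y:elts x. ALL y':elts x. elts y \<inter> elts y' ~= {} --> y = y')"
  proof (intro iffI ballI impI)
   fix y y' assume L: "ALL y:M. ALL y':M. y' : elts x --> y : elts x --> (ALL z:M. z : elts y --> z ~: elts y') \<or> y = y'"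
    and y: "y : elts x" "y' : elts x" "elts y \<inter> elts y' ~= {}"
   from y(3) obtain z where z: "z : elts y" "z : elts y'" by blast
   have "(ALL z:M. z : elts y --> z ~: elts y') \<or> y = y'" by (rule L[rule_format]) (use s y in auto)
   then show "y = y'" using z s[OF y(1)] by blast
  next
   fix y y' assume R: "ALL y:elts x. ALL y':elts x. elts y \<inter> elts y' ~= {} --> y = y'"
    and y: "y : M" "y' : M" "y' : elts x" "y : elts x"
   show "(ALL z:M. z : elts y --> z ~: elts y') \<or> y = y'" using R[rule_format, OF y(4,3)] by blast
  qed
  have e: "(EX u:M. ALL z:M. (z : elts y & z : elts c) <-> z = u) <-> (EX u. elts y \<inter> elts c = {u})"
   if "y : elts x" for y c
  proof
   assume "EX u:M. ALL z:M. (z : elts y & z : elts c) <-> z = u"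
   then obtain u where "u : M" "!!z. z : M ==> (z : elts y & z : elts c) <-> z = u" by blast
   then have "elts y \<inter> elts c = {u}" using s[OF that] by blast
   then show "EX u. elts y \<inter> elts c = {u}" by blast
  next
   assume "EX u. elts y \<inter> elts c = {u}"
   then obtain u where "elts y \<inter> elts c = {u}" by blast
   then show "EX u:M. ALL z:M. (z : elts y & z : elts c) <-> z = u" using s[OF that] by (intro bexI[of _ u]) blast+
  qed
  have 3: "(EX c:M. ALL y:M. y : elts x --> (EX u:M. ALL z:M. (z : elts y & z : elts c) <-> z = u)) <->
   (EX c:M. ALL y:elts x. EX u. elts y \<inter> elts c = {u})"    proof (rule bex_cong[OF refl])
   fix c
   have "(ALL y:M. y : elts x --> Q y) <-> (ALL y:elts x. Q y)" for Q using s' by blast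
   then show "(ALL y:M. y : elts x --> (EX u:M. ALL z:M. (z : elts y & z : elts c) <-> z = u)) <->
    (ALL y:elts x. EX u. elts y \<inter> elts c = {u})" by (simp only: e cong: ball_cong)
  qed
  show ?thesis unfolding 1 2 3 by (rule imp_conjL)
 qed
 show ?thesis unfolding m by (rule ball_cong[OF refl pq])
qed

text \<open>The transversal collects the \<open>r\<close>-least element of each member of the
  family. Well-foundedness of \<open>r\<close> is required from outside, which is what the concrete
  orders satisfy.\<close>

lemma choice_of_wellorders:
 assumes M: "M : zfm" and wo: "!!x. x : M ==> EX r:M. wf {(y, z). opair y z : elts r} &
  (ALL y:elts x. ALL z:elts x. y ~= z --> opair y z : elts r \<or> opair z y : elts r)"
 shows "models (\<S> M) ax_choice"
 unfolding choice_iff[OF M]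
proof (intro ballI impI)
 fix x assume x: "x : M" and ne: "ALL y:elts x. elts y ~= {}"
  and dj: "ALL y:elts x. ALL y':elts x. elts y \<inter> elts y' ~= {} --> y = y'"
 interpret D: zfmodels "{M}" M using M by (rule zfm_zfmodels)
 have hx: "hunion x : M" using zfm_union[OF M x] .
 obtain r where r: "r : M" "wf {(y, z). opair y z : elts r}"
  "ALL y:elts (hunion x). ALL z:elts (hunion x). y ~= z --> opair y z : elts r \<or> opair z y : elts r"
  using wo[OF hx] by blast
 let ?P = "%z. EX y:elts x. z : elts y & (ALL z':elts y. z' ~= z --> opair z z' : elts r)"
 have "D.dfun 0 (%M e. hset {z : elts (hunion x). ?P z})" by (intro dfi) (use x r hx in simp_all)
 then have c: "hset {z : elts (hunion x). ?P z} : M" using zfm_closed[OF M] by blast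
 show "EX c:M. ALL y:elts x. EX u. elts y \<inter> elts c = {u}"
 proof (intro bexI[OF _ c] ballI)
  fix y assume y: "y : elts x"
  obtain z where z: "z : elts y" "!!z'. opair z' z : elts r ==> z' ~: elts y"
  proof -
   from ne y obtain z0 where z0: "z0 : elts y" by blast
   show ?thesis by (rule wfE_min[OF r(2) z0]) (use that in blast)
  qed
  have zz: "opair z z' : elts r" if "z' : elts y" "z' ~= z" for z'
   using that z y r(3) by (metis UN_I elts_hunion)
  have uz: "u = z" if u: "u : elts y" "?P u" for u
  proof (rule ccontr)
   assume "u ~= z"
   obtain y' where y': "y' : elts x" "u : elts y'" "ALL z':elts y'. z' ~= u --> opair u z' : elts r" using u(2) by blast
   have "y' = y" using dj y y'(1,2) u(1) by blast
   then have "opair u z : elts r" using y'(3) z(1) \<open>u ~= z\<close> by auto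
   then show False using z(2) u(1) by blast
  qed
  have pz: "?P z" using y z(1) zz by blast
  have hu: "z : elts (hunion x)" using y z(1) by auto
  have "elts y \<inter> {z : elts (hunion x). ?P z} = {z}"
  proof (intro equalityI subsetI)
   fix v assume v: "v : elts y \<inter> {z : elts (hunion x). ?P z}"
   then have "?P v" using conjunct2[OF CollectD[OF IntD2[OF v]]] by simp
   then show "v : {z}" using uz[OF IntD1[OF v]] by simp
  next
   fix v assume "v : {z}"
   moreover have "z : elts y \<inter> {z : elts (hunion x). ?P z}"         by (intro IntI CollectI conjI; (rule z(1) | rule hu | rule pz))
   ultimately show "v : elts y \<inter> {z : elts (hunion x). ?P z}" by (simp only: singleton_iff)
  qed
  then show "EX u. elts y \<inter> elts (hset {z : elts (hunion x). ?P z}) = {u}"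
   by (simp only: elts_hset[OF countable_Collect_elts]) blast
 qed
qed

text \<open>Elements of the image are compared by their least preimages. The stated formula does so
  without naming them: some preimage of \<open>y\<close> lies below all preimages of
  \<open>y'\<close>.\<close>

lemma wellorder_image:
 fixes K :: "'k => 'k => bool"
 assumes wf: "wf {(k, k'). k : D & k' : D & K k k'}"
  and tot: "!!k k'. k : D ==> k' : D ==> k ~= k' ==> K k k' \<or> K k' k" and sur: "E \<subseteq> g ` D"
 shows "wf {(y, y'). y : E & y' : E & (EX k:D. g k = y & (ALL k':D. g k' = y' --> K k k'))}" (is ?wf)
  and "!!y y'. y : E ==> y' : E ==> y ~= y' ==> (EX k:D. g k = y & (ALL k':D. g k' = y' --> K k k')) \<or>
   (EX k:D. g k = y' & (ALL k':D. g k' = y --> K k k'))" (is "!!y y'. _ ==> _ ==> _ ==> ?tot y y'")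
proof -
 let ?R = "{(k, k'). k : D & k' : D & K k k'}"
 have tr: "K a c" if abc: "a : D" "b : D" "c : D" "K a b" "K b c" for a b c
 proof (rule ccontr)
  assume "\<not> K a c"
  then have "a = c \<or> K c a" using tot abc by blast
  moreover have "(a, b) : ?R\<^sup>+" "(b, c) : ?R\<^sup>+" "K c a ==> (c, a) : ?R\<^sup>+" using abc by auto
  ultimately have "(a, a) : ?R\<^sup>+" by (meson trancl_trans)
  then show False using wf_not_refl[OF wf_trancl[OF wf]] by blast
 qed
 have "EX k. k : D & g k = y & (ALL k':D. g k' = y --> k' = k \<or> K k k')" if y: "y : E" for y
 proof -
  obtain k0 where k0: "k0 : {k : D. g k = y}" using sur y by blast
  obtain k where k: "k : {k : D. g k = y}" "!!k'. (k', k) : ?R ==> k' ~: {k : D. g k = y}"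
   by (rule wfE_min[OF wf k0]) blast
  then show ?thesis using tot by blast
 qed
 then obtain m where m: "!!y. y : E ==> m y : D & g (m y) = y & (ALL k':D. g k' = y --> k' = m y \<or> K (m y) k')"
  by metis
 have "{(y, y'). y : E & y' : E & (EX k:D. g k = y & (ALL k':D. g k' = y' --> K k k'))} \<subseteq> inv_image ?R m"
 proof clarsimp
  fix y y' k assume *: "g k : E" "y' : E" "k : D" "ALL k':D. g k' = y' --> K k k'"
  then have "K k (m y')" using m by blast
  moreover have "k = m (g k) \<or> K (m (g k)) k" using m[OF *(1)] *(3) by blast
  ultimately have "K (m (g k)) (m y')"
   using m[OF *(1)] m[OF *(2)] tr[OF _ *(3), of "m (g k)" "m y'"] by metis
  then show "m (g k) : D & m y' : D & K (m (g k)) (m y')" using m[OF *(1)] m[OF *(2)] by simp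
 qed
 then show ?wf using wf_inv_image[OF wf] wf_subset by blast
 have w: "EX k:D. g k = y & (ALL k':D. g k' = y' --> K k k')" if y: "y : E" "y' : E" "K (m y) (m y')" for y y'
 proof (intro bexI[of _ "m y"] conjI ballI impI)
  fix k' assume "k' : D" "g k' = y'"
  then have "k' = m y' \<or> K (m y') k'" using m[OF y(2)] by blast
  then show "K (m y) k'" using tr[of "m y" "m y'" k'] m[OF y(1)] m[OF y(2)] y(3) \<open>k' : D\<close> by blast
 qed (use m[OF y(1)] in blast)+
 fix y y' assume y: "y : E" "y' : E" "y ~= y'"
 then have "m y ~= m y'" using m by metis
 then have "K (m y) (m y') \<or> K (m y') (m y)" using tot m y by blast
 then show "?tot y y'" using w y by blast
qed

section \<open>Well-order of the constructible stages\<close>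

definition pless :: "hc => hc => hc => bool" where
 "pless r q p <-> hfst q : elts (hfst p) \<or> hfst q = hfst p & opair (hsnd q) (hsnd p) : elts r"

text \<open>Finite sets are compared by the largest element in which they differ; as a suborder of the
 multiset order this is well-founded.\<close>

definition fless :: "hc => hc => hc => bool" where
 "fless r f f' <-> (EX p:elts f'. p ~: elts f & (ALL q:elts f. q ~: elts f' --> pless r q p))"

lemma wf_pless: "wf {(y, z). opair y z : elts r} ==> wf {(q, p). pless r q p}"
proof -
 assume r: "wf {(y, z). opair y z : elts r}"
 have "{(q, p). pless r q p} \<subseteq>
  inv_image ({(x, y). x : elts y} <*lex*> {(y, z). opair y z : elts r}) (%p. (hfst p, hsnd p))"
  by (auto simp: pless_def)
 then show ?thesis by (rule wf_subset[OF wf_inv_image[OF wf_lex_prod[OF wf_elts r]]])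
qed

lemma wf_fless:
 assumes "wf {(y, z). opair y z : elts r}"
 shows "wf {(f, f'). isfenv A f & isfenv A f' & fless r f f'}"
proof -
 let ?R = "{(q, p). pless r q p}"
 have "{(f, f'). isfenv A f & isfenv A f' & fless r f f'} \<subseteq> inv_image (mult ?R) (%f. mset_set (elts f))"
 proof clarsimp
  fix f f' assume f: "isfenv A f" "isfenv A f'" "fless r f f'"
  note fin = isfenv_finite[OF f(1)] isfenv_finite[OF f(2)]
  let ?I = "mset_set (elts f \<inter> elts f')" and ?J = "mset_set (elts f' - elts f)" and ?K = "mset_set (elts f - elts f')"
  have "mset_set (elts f) = ?I + ?K" "mset_set (elts f') = ?I + ?J"
   using fin by (subst mset_set_Union[symmetric]; auto intro!: arg_cong[of _ _ mset_set])+
  moreover have "(?I + ?K, ?I + ?J) : mult ?R"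
   by (rule one_step_implies_mult) (use f(3) fin in \<open>auto simp: fless_def mset_set_empty_iff\<close>)
  ultimately show "(mset_set (elts f), mset_set (elts f')) : mult ?R" by simp
 qed
 then show ?thesis by (rule wf_subset[OF wf_inv_image[OF wf_mult[OF wf_pless[OF assms]]]])
qed

text \<open>The symmetric difference is finite, so the converse of \<open>pless\<close> is
  well-founded on it and there is a largest element \<open>p\<close>. Whichever set contains
  \<open>p\<close> is the larger one.\<close>

lemma fless_total:
 assumes wf: "wf {(y, z). opair y z : elts r}"
  and tot: "ALL y:elts A. ALL z:elts A. y ~= z --> opair y z : elts r \<or> opair z y : elts r"
  and f: "isfenv A f" "isfenv A f'" "f ~= f'"
 shows "fless r f f' \<or> fless r f' f"
proof -
 let ?D = "(elts f - elts f') \<union> (elts f' - elts f)"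
 let ?R = "{(q, p). q : ?D & p : ?D & pless r q p}"
 have fin: "finite ?D" using isfenv_finite[OF f(1)] isfenv_finite[OF f(2)] by simp
 have ne: "?D ~= {}" using f(3) elts_inject by blast
 have D: "q : elts (times omega A)" if "q : ?D" for q using that f(1,2) unfolding isfenv_def by blast
 have "wf ?R" by (rule wf_subset[OF wf_pless[OF wf]]) auto
 moreover have "finite ?R" by (rule finite_subset[of _ "?D \<times> ?D"]) (use fin in auto)
 ultimately have "wf (?R\<inverse>)" by (intro finite_acyclic_wf_converse wf_acyclic)
 then have wfc: "wf (?R\<inverse>)" .
 obtain p0 where p0: "p0 : ?D" using ne by blast
 obtain p where p: "p : ?D" "!!q. (q, p) : ?R\<inverse> ==> q ~: ?D"
  by (rule wfE_min[OF wfc p0]) blast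
 have less: "pless r q p" if q: "q : ?D" "q ~= p" for q
 proof -
  have n: "\<not> pless r p q" using p q(1) by blast
  obtain i y j z where qp: "q = opair (hc_nat i) y" "p = opair (hc_nat j) z" "y : elts A" "z : elts A"
   using D[OF q(1)] D[OF p(1)] by auto
  show ?thesis using n q(2) tot qp(3,4) hord_linear[OF hord_hc_nat hord_hc_nat, of i j]
   unfolding qp(1,2) pless_def by auto
 qed
 show ?thesis
 proof (cases "p : elts f'")
  case True
  then have "fless r f f'" unfolding fless_def using p(1) less by (intro bexI[of _ p]) blast+
  then show ?thesis by simp
 next
  case False
  then have "fless r f' f" unfolding fless_def using p(1) less by (intro bexI[of _ p]) blast+
  then show ?thesis by simp
 qed
qed

text \<open>A key consists of a stage index \<open>b\<close>, the code of a formula and a finite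
  assignment into \<open>Lx a b\<close>. It names the subset of the stage that they define, and
  every element outside \<open>Lbase a\<close> has such a key.\<close>

definition Keys :: "hc => hc => hc" where
 "Keys a x = hunion (hset ((%b. times (upair b b) (times omega (Fenv (Lx a b)))) ` elts x))"

definition kval :: "hc => hc => hc" where
 "kval a k = hset {z : elts (Lx a (hfst k)).
   hupd (hsnd (hsnd k)) hempty z : elts (SatS (Lx a (hfst k)) (hfst (hsnd k)))}"

definition kless :: "hc => hc => hc => bool" where
 "kless S k k' <-> hfst k : elts (hfst k') \<or> hfst k = hfst k' &
   (hfst (hsnd k) : elts (hfst (hsnd k')) \<or> hfst (hsnd k) = hfst (hsnd k') &
    fless (app S (hfst k)) (hsnd (hsnd k)) (hsnd (hsnd k')))"

text \<open>Apart from \<open>a\<close>, the members of \<open>Lbase a\<close> are ordinals ordered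
  by membership; \<open>a\<close> is placed on top.\<close>

definition bless :: "hc => hc => hc => bool" where
 "bless a y y' <-> y ~= a & (y' = a \<or> y : elts y')"

definition Lless :: "hc => hc => hc => hc => hc => bool" where
 "Lless a x S y y' <-> (y : elts (Lbase a) & (y' : elts (Lbase a) --> bless a y y')) \<or>
   (y ~: elts (Lbase a) & y' ~: elts (Lbase a) &
    (EX k:elts (Keys a x). kval a k = y & (ALL k':elts (Keys a x). kval a k' = y' --> kless S k k')))"

text \<open>Shows the termination proof of \<open>Lwo\<close> that its recursive calls under
  \<open>lam x\<close> are made at members of \<open>x\<close> only.\<close>

lemma lam_fundef_cong [fundef_cong]: "d = d' ==> (!!a. a : elts d' ==> F a = F' a) ==> lam d F = lam d' F'"
 using lam_cong by blast

function Lwo :: "hc => hc => hc" where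
 "Lwo a x = hset {p : elts (times (Lx a x) (Lx a x)). Lless a x (lam x (%y. Lwo a y)) (hfst p) (hsnd p)}"
 by auto
termination by (relation "inv_image {(x, y). x : elts y} snd") (auto simp: wf_elts)

declare Lwo.simps [simp del]

lemma elts_Lwo: "opair y y' : elts (Lwo a x) <->
  y : elts (Lx a x) & y' : elts (Lx a x) & Lless a x (lam x (Lwo a)) y y'"
 by (subst Lwo.simps, subst elts_hset[OF countable_Collect_elts]) simp

lemma wf_bless: "wf {(y, y'). bless a y y'}"
proof -
 have "{(y, y'). bless a y y'} \<subseteq> inv_image (less_than <*lex*> {(x, y). x : elts y}) (%y. (if y = a then 1 else 0, y))"
  by (auto simp: bless_def)
 then show ?thesis by (rule wf_subset[rotated]) (intro wf_inv_image wf_lex_prod wf_less_than wf_elts)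
qed

lemma hord_omega: "hord omega"
 using htrans_hc_nat hord_hc_nat by (auto simp: hord_def htrans_def elts_hc_nat)

lemma bless_total: "y : elts (Lbase a) ==> y' : elts (Lbase a) ==> y ~= y' ==> bless a y y' \<or> bless a y' y"
proof -
 assume *: "y : elts (Lbase a)" "y' : elts (Lbase a)" "y ~= y'"
 have "hord z \<or> z = a" if "z : elts (Lbase a)" for z
  using that hord_omega hord_hc_nat unfolding Lbase_def by auto
 then show ?thesis using * hord_linear[of y y'] unfolding bless_def by metis
qed

lemma Lwo_wellorder:
 assumes a: "is_real a"
 shows "hord x ==> wf {(y, z). opair y z : elts (Lwo a x)} &
  (ALL y:elts (Lx a x). ALL z:elts (Lx a x). y ~= z --> opair y z : elts (Lwo a x) \<or> opair z y : elts (Lwo a x))"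
proof (induction x rule: hc_induct)
 case (step x)
 let ?B = "elts (Lbase a)" let ?D = "elts (Keys a x)" let ?E = "elts (Lx a x) - ?B" let ?S = "lam x (Lwo a)"
 have IH: "wf {(y, z). opair y z : elts (Lwo a b)}"
  "ALL y:elts (Lx a b). ALL z:elts (Lx a b). y ~= z --> opair y z : elts (Lwo a b) \<or> opair z y : elts (Lwo a b)"
  if "b : elts x" for b using step.IH[OF that hord_mem[OF step.prems that]] by auto
 have D: "k : ?D <-> (EX b m f. k = opair b (opair (hc_nat m) f) & b : elts x & isfenv (Lx a b) f)" for k
  unfolding Keys_def by (auto simp: elts_Fenv)
 have wfK: "wf {(k, k'). k : ?D & k' : ?D & kless ?S k k'}"
 proof (rule wf_subset)
  let ?el = "{(x, y). x : elts y}"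
  \<comment> \<open>The order on assignments depends on the stage, so the last component is compared
    only between keys of the same stage.\<close>
  let ?F = "same_fst (%b. b : elts x) (%b. {(f, f'). isfenv (Lx a b) f & isfenv (Lx a b) f' & fless (Lwo a b) f f'})"
  have "wf ?F" by (rule wf_same_fst) (rule wf_fless[OF IH(1)])
  then show "wf (inv_image (?el <*lex*> (?el <*lex*> ?F)) (%k. (hfst k, (hfst (hsnd k), (hfst k, hsnd (hsnd k))))))"
   by (intro wf_inv_image wf_lex_prod wf_elts)
  show "{(k, k'). k : ?D & k' : ?D & kless ?S k k'} \<subseteq>
   inv_image (?el <*lex*> (?el <*lex*> ?F)) (%k. (hfst k, (hfst (hsnd k), (hfst k, hsnd (hsnd k)))))"
  proof clarify
   fix k k' assume k: "k : ?D" "k' : ?D" "kless ?S k k'"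
   obtain b m f where k1: "k = opair b (opair (hc_nat m) f)" "b : elts x" "isfenv (Lx a b) f" using k(1) D by blast
   obtain b' m' f' where k2: "k' = opair b' (opair (hc_nat m') f')" "b' : elts x" "isfenv (Lx a b') f'" using k(2) D by blast
   show "(k, k') : inv_image (?el <*lex*> (?el <*lex*> ?F)) (%k. (hfst k, (hfst (hsnd k), (hfst k, hsnd (hsnd k)))))"
    using k(3) k1(2,3) k2(2,3) unfolding kless_def k1(1) k2(1) by (auto simp: same_fst_def)
  qed
 qed
 have totK: "kless ?S k k' \<or> kless ?S k' k" if k: "k : ?D" "k' : ?D" "k ~= k'" for k k'
 proof -
  obtain b m f where k1: "k = opair b (opair (hc_nat m) f)" "b : elts x" "isfenv (Lx a b) f" using k(1) D by blast
  obtain b' m' f' where k2: "k' = opair b' (opair (hc_nat m') f')" "b' : elts x" "isfenv (Lx a b') f'" using k(2) D by blast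
  consider "b : elts b' \<or> b' : elts b" | "b = b'" "m ~= m'" | "b = b'" "m = m'" "f ~= f'"
   using hord_linear[OF hord_mem[OF step.prems k1(2)] hord_mem[OF step.prems k2(2)]] k(3) k1(1) k2(1) by auto
  then show ?thesis
  proof cases
   case 2
   then show ?thesis unfolding kless_def k1(1) k2(1) by (auto simp: hc_nat_less)
  next
   case 3
   have "fless (Lwo a b) f f' \<or> fless (Lwo a b) f' f"
    by (rule fless_total[OF IH(1)[OF k1(2)] IH(2)[OF k1(2)]]) (use k1(3) k2(3) 3 in simp_all)
   then show ?thesis unfolding kless_def k1(1) k2(1) using 3 k1(2) by auto
  qed (auto simp: kless_def k1(1) k2(1))
 qed
 have sur: "?E \<subseteq> kval a ` ?D"
 proof
  fix y assume "y : ?E"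
  then obtain b where b: "b : elts x" "y : elts (Def (Lx a b))" unfolding elts_Lx by blast
  then obtain m f where "isfenv (Lx a b) f" "y = hset {z : elts (Lx a b). hupd f hempty z : elts (SatS (Lx a b) (hc_nat m))}"
   unfolding elts_Def by (auto simp only: elts_Fenv)
  then show "y : kval a ` ?D"
   using b(1) unfolding image_iff D by (intro bexI[of _ "opair b (opair (hc_nat m) f)"]) (auto simp: kval_def D)
 qed
 let ?less = "%y y'. EX k:?D. kval a k = y & (ALL k':?D. kval a k' = y' --> kless ?S k k')"
 have wE: "wf {(y, y'). y : ?E & y' : ?E & ?less y y'}" by (rule wellorder_image(1)[OF wfK totK sur])
 have tE: "?less y y' \<or> ?less y' y" if "y : ?E" "y' : ?E" "y ~= y'" for y y'
  by (rule wellorder_image(2)[OF wfK totK sur that])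
 have "wf (?B \<times> ?E)"
  by (rule wf_subset[OF wf_inv_image[OF wf_less_than], of _ "%y. if y : ?B then 0 else 1"]) auto
 then have w2: "wf (?B \<times> ?E \<union> {(y, y'). y : ?E & y' : ?E & ?less y y'})" by (rule wf_Un[OF _ wE]) auto
 have "wf {(y, y'). y : ?B & y' : ?B & bless a y y'}" by (rule wf_subset[OF wf_bless[of a]]) auto
 then have w3: "wf ({(y, y'). y : ?B & y' : ?B & bless a y y'} \<union> (?B \<times> ?E \<union> {(y, y'). y : ?E & y' : ?E & ?less y y'}))"
  by (rule wf_Un[OF _ w2]) auto
 have "wf {(y, z). opair y z : elts (Lwo a x)}"
  by (rule wf_subset[OF w3]) (unfold elts_Lwo Lless_def, blast)
 moreover have "opair y z : elts (Lwo a x) \<or> opair z y : elts (Lwo a x)"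
  if yz: "y : elts (Lx a x)" "z : elts (Lx a x)" "y ~= z" for y z
  using yz bless_total[of y a z] tE[of y z] unfolding elts_Lwo Lless_def by blast
 ultimately show ?case by blast
qed

context zfmodels
begin

lemma dfn_pless [dfi]: "dfun n r ==> dfun n s ==> dfun n t ==> dfn n (%M e. pless (r M e) (s M e) (t M e))"
 unfolding pless_def by (intro dfi)

lemma dfn_fless [dfi]: "dfun n r ==> dfun n s ==> dfun n t ==> dfn n (%M e. fless (r M e) (s M e) (t M e))"
proof (rule dfn_comp3[where R = "%M. fless"])
 show "dfn 3 (%M e. fless (e 0) (e 1) (e 2))" unfolding fless_def by (intro dfi) simp_all
qed

lemma dfun_Keys [dfi]: "dfun n r ==> dfun n s ==> dfun n (%M e. Keys (r M e) (s M e))"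
proof (rule dfun_comp2[where F = "%M. Keys"])
 show "dfun 2 (%M e. Keys (e 0) (e 1))" unfolding Keys_def by (intro dfi) simp_all
qed

lemma dfun_kval [dfi]: "dfun n r ==> dfun n s ==> dfun n (%M e. kval (r M e) (s M e))"
proof (rule dfun_comp2[where F = "%M. kval"])
 show "dfun 2 (%M e. kval (e 0) (e 1))" unfolding kval_def by (intro dfi) simp_all
qed

lemma dfn_kless [dfi]: "dfun n r ==> dfun n s ==> dfun n t ==> dfn n (%M e. kless (r M e) (s M e) (t M e))"
 unfolding kless_def by (intro dfi)

lemma dfun_Lwo [dfi]: "dfun n r ==> dfun n s ==> dfun n (%M e. Lwo (r M e) (s M e))"
proof (rule dfun_comp2[where F = "%M. Lwo"])
 show "dfun 2 (%M e. Lwo (e 0) (e 1))"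
 proof (rule dfun_mem_rec[where H = "%M a x S. hset {p : elts (times (Lx a x) (Lx a x)). Lless a x S (hfst p) (hsnd p)}"])
  show "dfun 3 (%M e. hset {p : elts (times (Lx (e 0) (e 1)) (Lx (e 0) (e 1))). Lless (e 0) (e 1) (e 2) (hfst p) (hsnd p)})"
   unfolding Lless_def bless_def by (intro dfi) simp_all
 qed (rule Lwo.simps)
qed

end

context constructible
begin

lemma LL_choice: "models (\<S> N) ax_choice"
proof (rule choice_of_wellorders[OF LL_zfm])
 fix x assume "x : N"
 then obtain w where w: "w : U" "hord w" "x : elts (Lx a w)" using LL_hord_iff by blast
 have "Lwo a w : N"
  using zfm_closed[OF LL_zfm L.dfun_Lwo[OF L.dfun_const[OF a_LL] L.dfun_const[OF LL_hord[OF w(2,1)]]]] .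
 moreover have "elts x \<subseteq> elts (Lx a w)" using w(3) htransD[OF htrans_Lx[OF real]] by blast
 ultimately show "EX r:N. wf {(y, z). opair y z : elts r} &
  (ALL y:elts x. ALL z:elts x. y ~= z --> opair y z : elts r \<or> opair z y : elts r)"
  using Lwo_wellorder[OF real w(2)] by blast
qed

theorem LL_ctms: "N : ctms"
 using LL_zfm LL_choice ctms_zfm by blast

end

section \<open>Well-ordering from choice\<close>

text \<open>Transfinite enumeration of \<open>x\<close> by the choice function \<open>c\<close>. The
  value \<open>x\<close>, which is not a member of \<open>x\<close>, signals that nothing is
  left.\<close>

function wenum :: "hc => hc => hc => hc" where
 "wenum c x b = (if elts x \<subseteq> (%d. wenum c x d) ` elts b then x
   else app c (hset {y : elts x. y ~: (%d. wenum c x d) ` elts b}))"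
 by auto
termination by (relation "inv_image {(x, y). x : elts y} (%(c, x, b). b)") (auto simp: wf_elts)

declare wenum.simps [simp del]

locale ctm =
 fixes U assumes ctm: "U : ctms"
begin

lemma zf: "U : zfm" using ctm ctms_zfm by blast

sublocale D: zfmodels "{U}" U using zf by (rule zfm_zfmodels)

text \<open>The products of {y} with \<open>y\<close> are pairwise disjoint, and a transversal of
  them is a choice function.\<close>

lemma choice_function:
 assumes x: "x : U" shows "EX f:U. ALL y:elts x. elts y ~= {} --> app f y : elts y"
proof -
 let ?x = "hset {y : elts x. EX z:elts y. True}"
 let ?F = "hset ((%y. times (upair y y) y) ` elts ?x)"
 have "D.dfun 0 (%M e. ?F)" by (intro dfi) (use x in simp_all)
 then have F: "?F : U" using zfm_closed[OF zf] by blast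
 have m: "models (\<S> U) ax_choice" using ctm ctms_zfm by blast
 have "EX c:U. ALL y:elts ?F. EX u. elts y \<inter> elts c = {u}"
  by (rule choice_iff[OF zf, THEN iffD1, OF m, rule_format, OF F]) auto
 then obtain c where c: "c : U" "!!y. y : elts x ==> elts y ~= {} ==> EX u. elts (times (upair y y) y) \<inter> elts c = {u}"
  by (auto simp del: elts_times)
 let ?f = "hset {p : elts (hunion ?F). p : elts c}"
 have "D.dfun 0 (%M e. ?f)" by (intro dfi) (use F c in simp_all)
 then have f: "?f : U" using zfm_closed[OF zf] by blast
 have f_iff: "opair y z : elts ?f <-> y : elts x & z : elts y & opair y z : elts c" for y z
  unfolding elts_hset[OF countable_Collect_elts] mem_Collect_eq by auto
 have uniq: "z = z'" if yz: "y : elts x" "z : elts y" "z' : elts y" "opair y z : elts c" "opair y z' : elts c" for y z z'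
 proof -
  obtain u where "elts (times (upair y y) y) \<inter> elts c = {u}" using c(2)[of y] yz by blast
  moreover have "opair y z : elts (times (upair y y) y) \<inter> elts c" "opair y z' : elts (times (upair y y) y) \<inter> elts c"
   using yz by simp_all
  ultimately show ?thesis by (metis opair_inject singletonD)
 qed
 have fn: "fnl ?f" unfolding fnl_iff f_iff using uniq by blast
 show ?thesis
 proof (intro bexI[OF _ f] ballI impI)
  fix y assume y: "y : elts x" "elts y ~= {}"
  then obtain u where "elts (times (upair y y) y) \<inter> elts c = {u}" using c(2) by blast
  then have "u : elts (times (upair y y) y)" "u : elts c" by blast+
  then obtain z where "u = opair y z" "z : elts y" by auto
  then show "app ?f y : elts y" using app_eq[OF fn, of y z] f_iff y \<open>u : elts c\<close> by simp
 qed
qed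

theorem wellorder:
 assumes x: "x : U"
 obtains f b where "f : U" "b : U" "hord b" "fnl f" "!!d y. opair d y : elts f ==> d : elts b & y : elts x"
  "!!y. y : elts x ==> EX d. opair d y : elts f" "!!d. d : elts b ==> EX y. opair d y : elts f"
  "!!d d' y. opair d y : elts f ==> opair d' y : elts f ==> d = d'"
proof -
 obtain c where c: "c : U" "!!y. y : U ==> elts y \<subseteq> elts x ==> elts y ~= {} ==> app c y : elts y"
  using choice_function[OF zfm_pow[OF zf x]] by (auto simp: elts_pow[OF zfm_countable[OF zf]])
 have "D.dfun 2 (%M e. wenum c x (e 1))"
 proof (rule D.dfun_mem_rec[where F = "%M z b. wenum c x b" and H = "%M z b f. if (ALL y:elts x. EX d:elts b. y = app f d) then x
   else app c (hset {y : elts x. \<not> (EX d:elts b. y = app f d)})"])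
  show "D.dfun 3 (%M e. if (ALL y:elts x. EX d:elts (e 1). y = app (e 2) d) then x
   else app c (hset {y : elts x. \<not> (EX d:elts (e 1). y = app (e 2) d)}))" by (intro dfi) (use x c in simp_all)
  fix b
  have "(%d. wenum c x d) ` elts b = {y. EX d:elts b. y = app (lam b (wenum c x)) d}" by auto
  then show "wenum c x b = (if (ALL y:elts x. EX d:elts b. y = app (lam b (wenum c x)) d) then x
   else app c (hset {y : elts x. \<not> (EX d:elts b. y = app (lam b (wenum c x)) d)}))"
   by (subst wenum.simps) (simp add: subset_iff; blast)
 qed
 from D.dfun_comp2[OF this D.dfun_var D.dfun_var, of 0 1 0]
 have d1: "D.dfun 1 (%M e. wenum c x (e 0))" by simp
 note [dfi] = D.dfun_comp1[OF d1]
 let ?F = "wenum c x"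
 have F: "?F b : elts x & ?F b ~: ?F ` elts b" if b: "b : U" "?F b ~= x" for b
 proof -
  let ?r = "hset {y : elts x. \<not> (EX d:elts b. y = ?F d)}"
  have "D.dfun 0 (%M e. ?r)" by (intro dfi) (use x b in simp_all)
  then have r: "?r : U" using zfm_closed[OF zf] by blast
  have "{y : elts x. y ~: ?F ` elts b} = {y : elts x. \<not> (EX d:elts b. y = ?F d)}" by auto
  then have "?F b = (if elts x \<subseteq> ?F ` elts b then x else app c ?r)" by (subst wenum.simps) (simp only:)
  then have ne: "\<not> elts x \<subseteq> ?F ` elts b" and "?F b = app c ?r" using b(2) by (auto split: if_splits)
  moreover have "app c ?r : elts ?r" by (rule c(2)[OF r]) (use ne in auto)
  ultimately show ?thesis by auto
 qed
 \<comment> \<open>Otherwise the enumeration is injective on all ordinals of \<open>U\<close>. Its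
   inverse then maps \<open>x\<close> onto them, so replacement yields a set of \<open>U\<close>
   containing every ordinal of \<open>U\<close>, and in particular its own rank.\<close>
 have "EX b:U. hord b & ?F b = x"
 proof (rule ccontr)
  assume n: "\<not> ?thesis"
  have inj: "b = b'" if "b : U" "b' : U" "hord b" "hord b'" "?F b = ?F b'" for b b'
   using hord_linear[OF that(3,4)] F[OF that(1)] F[OF that(2)] n that by (metis imageI)
  let ?O = "hset ((%y. theM U (%b. hord b & ?F b = y)) ` elts x)"
  have "D.dfun 0 (%M e. hset ((%y. theM M (%b. hord b & ?F b = y)) ` elts x))" by (intro dfi) (use x in simp_all)
  then have O: "?O : U" using zfm_closed[OF zf] by blast
  have "b : elts ?O" if b: "b : U" "hord b" for b
  proof -
   have "theM U (%b'. hord b' & ?F b' = ?F b) = b" by (rule theM_eq) (use b inj in blast)+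
   moreover have "?F b : elts x" using F[OF b(1)] n b by blast
   ultimately show ?thesis by (simp add: image_iff) metis
  qed
  then have "rk ?O : elts ?O" using hord_rk zfm_closed[OF zf D.dfun_rk[OF D.dfun_const[OF _]]] O by blast
  then have "rk (rk ?O) : elts (rk ?O)" by (rule rk_mem)
  then show False using rk_hord[OF hord_rk] mem_irrefl by metis
 qed
 then obtain b0 where "b0 : U & hord b0 & ?F b0 = x" by blast
 then obtain b where b: "b : U & hord b & ?F b = x" "!!d. d : elts b ==> \<not> (d : U & hord d & ?F d = x)"
  by (rule_tac hmin[of "%b. b : U & hord b & ?F b = x" b0]) auto
 have bU: "d : U" "hord d" "?F d ~= x" if "d : elts b" for d
  using b that zfm_trans[OF zf] hord_mem by blast+
 have "D.dfun 0 (%M e. lam b ?F)" by (intro dfi) (use b(1) in simp_all)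
 then have f: "lam b ?F : U" using zfm_closed[OF zf] by blast
 have sur: "elts x \<subseteq> ?F ` elts b"
 proof (rule ccontr)
  assume n: "\<not> elts x \<subseteq> ?F ` elts b"
  let ?r = "hset {y : elts x. \<not> (EX d:elts b. y = ?F d)}"
  have "D.dfun 0 (%M e. ?r)" by (intro dfi) (use x b in simp_all)
  then have r: "?r : U" using zfm_closed[OF zf] by blast
  have "{y : elts x. y ~: ?F ` elts b} = {y : elts x. \<not> (EX d:elts b. y = ?F d)}" by auto
  then have "?F b = app c ?r" using n by (subst wenum.simps) (simp only: if_False)
  moreover have "app c ?r : elts ?r" by (rule c(2)[OF r]) (use n in auto)
  ultimately have "x : elts x" using b(1) by auto
  then show False using mem_irrefl by blast
 qed
 show ?thesis
 proof (rule that[of "lam b ?F" b])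
  show "d : elts b & y : elts x" if "opair d y : elts (lam b ?F)" for d y using that F bU by auto
  show "EX d. opair d y : elts (lam b ?F)" if "y : elts x" for y
  proof -
   from that sur obtain d where "d : elts b" "y = ?F d" by blast
   then show ?thesis by (auto intro!: exI[of _ d])
  qed
  show "d = d'" if "opair d y : elts (lam b ?F)" "opair d' y : elts (lam b ?F)" for d d' y
  proof -
   have d: "d : elts b" "d' : elts b" "?F d = ?F d'" using that by auto
   show ?thesis using hord_linear[OF bU(2)[OF d(1)] bU(2)[OF d(2)]] F[OF bU(1)[OF d(1)] bU(3)[OF d(1)]]
    F[OF bU(1)[OF d(2)] bU(3)[OF d(2)]] d(3) by (metis imageI)
  qed
 qed (use b f in auto)
qed

end

section \<open>Forcing over countable worlds\<close>

section \<open>Forcing\<close>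

lemma opair_tc: "opair x y : elts z ==> x : elts (tc z)"
proof -
 assume "opair x y : elts z"
 then have "opair x y : elts (tc z)" using tc_sub by blast
 then have "upair x x : elts (tc z)" by (rule htransD[OF htrans_tc]) (simp add: elts_opair)
 then show ?thesis by (rule htransD[OF htrans_tc]) simp
qed

lemma hdom_tc: "x : elts (hdom z) ==> x : elts (tc z)"
 using opair_tc by (auto simp: elts_hdom)

lemma opair_hdom: "opair x y : elts z ==> x : elts (hdom z)"
 by (auto simp: elts_hdom)

function val :: "hc => hc => hc" where
 "val H \<sigma> = hset ((%\<tau>. val H \<tau>) ` {\<tau> : elts (hdom \<sigma>). EX t:elts H. opair \<tau> t : elts \<sigma>})"
 by auto
termination by (relation "inv_image {(y, x). y : elts (tc x)} snd") (auto simp: wf_tc hdom_tc)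

declare val.simps [simp del]

lemma elts_val: "elts (val H \<sigma>) = {val H \<tau> | \<tau> t. t : elts H & opair \<tau> t : elts \<sigma>}"
 by (subst val.simps) (auto simp: opair_hdom)

text \<open>Conditions are ordered by reverse inclusion. \<open>feq P \<sigma> \<tau>\<close> is the set of conditions forcing
 the names \<open>\<sigma>\<close> and \<open>\<tau>\<close> to be equal.\<close>

function feq :: "hc => hc => hc => hc" where
 "feq P \<sigma> \<tau> = hset {p : elts P.
  (ALL \<pi>:elts (hdom \<sigma>). ALL t:elts P. opair \<pi> t : elts \<sigma> --> (ALL q:elts P. elts p \<subseteq> elts q --> elts t \<subseteq> elts q -->
   (EX r:elts P. elts q \<subseteq> elts r &
    (EX \<rho>:elts (hdom \<tau>). EX s:elts P. opair \<rho> s : elts \<tau> & elts s \<subseteq> elts r & r : elts (feq P \<pi> \<rho>))))) &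
  (ALL \<rho>:elts (hdom \<tau>). ALL t:elts P. opair \<rho> t : elts \<tau> --> (ALL q:elts P. elts p \<subseteq> elts q --> elts t \<subseteq> elts q -->
   (EX r:elts P. elts q \<subseteq> elts r &
    (EX \<pi>:elts (hdom \<sigma>). EX s:elts P. opair \<pi> s : elts \<sigma> & elts s \<subseteq> elts r & r : elts (feq P \<pi> \<rho>)))))}"
 by auto
termination by (relation "inv_image {(y, x). y : elts (tc x)} (%(P, \<sigma>, \<tau>). \<sigma>)") (auto simp: wf_tc hdom_tc)

declare feq.simps [simp del]

text \<open>A witness must be present at \<open>r\<close> itself; forced membership in
  \<open>frc\<close> asks for this densely. In \<open>pmem'\<close> the names enter
  \<open>feq\<close> in the same order as here, since the recursion for \<open>feq\<close> descends
  in its first name.\<close>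

definition pmem :: "hc => hc => hc => hc => bool" where
 "pmem P r \<pi> \<tau> <-> (EX \<rho>:elts (hdom \<tau>). EX s:elts P. opair \<rho> s : elts \<tau> & elts s \<subseteq> elts r & r : elts (feq P \<pi> \<rho>))"

definition pmem' :: "hc => hc => hc => hc => bool" where
 "pmem' P r \<rho> \<sigma> <-> (EX \<pi>:elts (hdom \<sigma>). EX s:elts P. opair \<pi> s : elts \<sigma> & elts s \<subseteq> elts r & r : elts (feq P \<pi> \<rho>))"

lemma elts_feq: "p : elts (feq P \<sigma> \<tau>) <-> p : elts P &
  (ALL \<pi>:elts (hdom \<sigma>). ALL t:elts P. opair \<pi> t : elts \<sigma> --> (ALL q:elts P. elts p \<subseteq> elts q --> elts t \<subseteq> elts q -->
   (EX r:elts P. elts q \<subseteq> elts r & pmem P r \<pi> \<tau>))) &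
  (ALL \<rho>:elts (hdom \<tau>). ALL t:elts P. opair \<rho> t : elts \<tau> --> (ALL q:elts P. elts p \<subseteq> elts q --> elts t \<subseteq> elts q -->
   (EX r:elts P. elts q \<subseteq> elts r & pmem' P r \<rho> \<sigma>)))"
 by (subst feq.simps) (simp only: elts_hset[OF countable_Collect_elts] mem_Collect_eq pmem_def pmem'_def)

lemma feq_mono: "p : elts (feq P \<sigma> \<tau>) ==> q : elts P ==> elts p \<subseteq> elts q ==> q : elts (feq P \<sigma> \<tau>)"
 unfolding elts_feq[of _ P \<sigma> \<tau>] by (meson order_trans)

lemma pmem_mono: "pmem P r \<pi> \<tau> ==> q : elts P ==> elts r \<subseteq> elts q ==> pmem P q \<pi> \<tau>"
 unfolding pmem_def using feq_mono order_trans by meson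

lemma feq_dense:
 assumes p: "p : elts P" and d: "!!q. q : elts P ==> elts p \<subseteq> elts q ==> EX r:elts P. elts q \<subseteq> elts r & r : elts (feq P \<sigma> \<tau>)"
 shows "p : elts (feq P \<sigma> \<tau>)"
 unfolding elts_feq[of _ P \<sigma> \<tau>]
proof (intro conjI p ballI impI)
 fix \<pi> t q assume *: "\<pi> : elts (hdom \<sigma>)" "t : elts P" "opair \<pi> t : elts \<sigma>" "q : elts P" "elts p \<subseteq> elts q" "elts t \<subseteq> elts q"
 obtain r where r: "r : elts P" "elts q \<subseteq> elts r" "r : elts (feq P \<sigma> \<tau>)" using d *(4,5) by blast
 then have "EX r':elts P. elts r \<subseteq> elts r' & pmem P r' \<pi> \<tau>" using * elts_feq[of r P \<sigma> \<tau>] by (meson order_refl order_trans)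
 then show "EX r:elts P. elts q \<subseteq> elts r & pmem P r \<pi> \<tau>" using r(2) by (meson order_trans)
next
 fix \<rho> t q assume *: "\<rho> : elts (hdom \<tau>)" "t : elts P" "opair \<rho> t : elts \<tau>" "q : elts P" "elts p \<subseteq> elts q" "elts t \<subseteq> elts q"
 obtain r where r: "r : elts P" "elts q \<subseteq> elts r" "r : elts (feq P \<sigma> \<tau>)" using d *(4,5) by blast
 then have "EX r':elts P. elts r \<subseteq> elts r' & pmem' P r' \<rho> \<sigma>" using * elts_feq[of r P \<sigma> \<tau>] by (meson order_refl order_trans)
 then show "EX r:elts P. elts q \<subseteq> elts r & pmem' P r \<rho> \<sigma>" using r(2) by (meson order_trans)
qed

text \<open>With equality, membership, negation, conjunction and universal quantifiers as the only
  cases, \<open>frc_dense\<close> holds for each of them. Quantifiers range over all of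
  \<open>U\<close>, since every set is treated as a name.\<close>

primrec frc :: "hc set => hc => hc => (nat => hc) => set_fm => bool" where
 "frc U P p e (Eq s t) <-> p : elts (feq P (trm_val (\<S> U) e s) (trm_val (\<S> U) e t))"
| "frc U P p e (Mem s t) <-> (ALL q:elts P. elts p \<subseteq> elts q -->
   (EX r:elts P. elts q \<subseteq> elts r & pmem P r (trm_val (\<S> U) e s) (trm_val (\<S> U) e t)))"
| "frc U P p e (Rel r ts) <-> False"
| "frc U P p e (Neg \<phi>) <-> (ALL q:elts P. elts p \<subseteq> elts q --> \<not> frc U P q e \<phi>)"
| "frc U P p e (Conj \<phi> \<psi>) <-> frc U P p e \<phi> & frc U P p e \<psi>"
| "frc U P p e (Forall n \<phi>) <-> (ALL \<sigma>:U. frc U P p (e(n := \<sigma>)) \<phi>)"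

lemma frc_mono: "frc U P p e \<phi> ==> q : elts P ==> elts p \<subseteq> elts q ==> frc U P q e \<phi>"
proof (induction \<phi> arbitrary: e)
 case (Eq s t) then show ?case using feq_mono by simp
next
 case (Mem s t) then show ?case unfolding frc.simps by (meson order_trans)
next
 case (Neg \<phi>) then show ?case unfolding frc.simps by (meson order_trans)
qed auto

lemma frc_dense:
 "wf_fm {} {} \<phi> ==> p : elts P ==> (!!q. q : elts P ==> elts p \<subseteq> elts q ==> EX r:elts P. elts q \<subseteq> elts r & frc U P r e \<phi>) ==>
  frc U P p e \<phi>"
proof (induction \<phi> arbitrary: e)
 case (Eq s t) then show ?case using feq_dense by simp
next
 case (Mem s t)
 show ?case unfolding frc.simps
 proof (intro ballI impI)
  fix q assume "q : elts P" "elts p \<subseteq> elts q"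
  then obtain r where r: "r : elts P" "elts q \<subseteq> elts r" "frc U P r e (Mem s t)" using Mem(3) by blast
  then obtain r' where "r' : elts P" "elts r \<subseteq> elts r'" "pmem P r' (trm_val (\<S> U) e s) (trm_val (\<S> U) e t)" by auto
  then show "EX r:elts P. elts q \<subseteq> elts r & pmem P r (trm_val (\<S> U) e s) (trm_val (\<S> U) e t)" using r(2) by blast
 qed
next
 case (Neg \<phi>)
 show ?case unfolding frc.simps
 proof (intro ballI impI notI)
  fix q assume q: "q : elts P" "elts p \<subseteq> elts q" "frc U P q e \<phi>"
  then obtain r where r: "r : elts P" "elts q \<subseteq> elts r" "frc U P r e (Neg \<phi>)" using Neg(4) by blast
  then show False using frc_mono[OF q(3) r(1,2)] by simp
 qed
next
 case (Conj \<phi> \<psi>)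
 have c: "EX r:elts P. elts q \<subseteq> elts r & frc U P r e \<phi> & frc U P r e \<psi>" if "q : elts P" "elts p \<subseteq> elts q" for q
  using Conj.prems(3)[OF that] by simp
 have w: "wf_fm {} {} \<phi>" "wf_fm {} {} \<psi>" using Conj.prems(1) by simp_all
 have "frc U P p e \<phi>" by (rule Conj.IH(1)[OF w(1) Conj.prems(2)]) (use c in meson)
 moreover have "frc U P p e \<psi>" by (rule Conj.IH(2)[OF w(2) Conj.prems(2)]) (use c in meson)
 ultimately show ?case by simp
next
 case (Forall n \<phi>)
 have "frc U P p (e(n := \<sigma>)) \<phi>" if s: "\<sigma> : U" for \<sigma>
 proof (rule Forall.IH)
  fix q assume "q : elts P" "elts p \<subseteq> elts q"
  then obtain r where "r : elts P" "elts q \<subseteq> elts r" "frc U P r e (Forall n \<phi>)" using Forall.prems(3) by blast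
  then show "EX r:elts P. elts q \<subseteq> elts r & frc U P r (e(n := \<sigma>)) \<phi>" using s by (intro bexI[of _ r]) auto
 qed (use Forall.prems in auto)
 then show ?case by simp
qed simp

function chk :: "hc => hc" where
 "chk x = hset ((%y. opair (chk y) hempty) ` elts x)"
 by auto
termination by (relation "{(x, y). x : elts y}") (auto simp: wf_elts)

declare chk.simps [simp del]

lemma val_chk: "hempty : elts H ==> val H (chk x) = x"
proof (induction x rule: hc_induct)
 case (step x)
 have "elts (chk x) = (%y. opair (chk y) hempty) ` elts x" by (subst chk.simps) simp
 then have "elts (val H (chk x)) = (%y. val H (chk y)) ` elts x" using step.prems unfolding elts_val by auto
 also have "\<dots> = elts x" using step by auto
 finally show ?case by (simp only: elts_inject)
qed

lemma rk_tc: "y : elts (tc x) ==> rk y : elts (rk x)"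
proof (induction x rule: hc_induct)
 case (step x)
 consider "y : elts x" | u where "u : elts x" "y : elts (tc u)" using step.prems elts_tc[of x] by blast
 then show ?case
 proof cases
  case 1 then show ?thesis by (rule rk_mem)
 next
  case 2 then show ?thesis using step.IH[OF 2] rk_mem[OF 2(1)] hord_trans[OF hord_rk] by blast
 qed
qed

lemma rk_val: "elts (rk (val H \<sigma>)) \<subseteq> elts (rk \<sigma>)"
proof (induction \<sigma> rule: wf_induct_rule[OF wf_tc])
 case (1 \<sigma>)
 show ?case
 proof
  fix b assume "b : elts (rk (val H \<sigma>))"
  then obtain y where y: "y : elts (val H \<sigma>)" "b = rk y \<or> b : elts (rk y)" using elts_rk[of "val H \<sigma>"] by blast
  then obtain \<tau> where t: "y = val H \<tau>" "\<tau> : elts (tc \<sigma>)" unfolding elts_val using opair_tc by blast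
  have "rk (val H \<tau>) = rk \<tau> \<or> rk (val H \<tau>) : elts (rk \<tau>)"
   using 1[of \<tau>] t(2) hord_subset[OF hord_rk hord_rk] by simp
  then have "rk y : elts (rk \<sigma>)" using rk_tc[OF t(2)] hord_trans[OF hord_rk, of "rk \<tau>" \<sigma>] unfolding t(1) by auto
  then show "b : elts (rk \<sigma>)" using y(2) hord_trans[OF hord_rk, of "rk y" \<sigma> b] by blast
 qed
qed

context zfmodels
begin

lemma dfun_val [dfi]: "dfun n s ==> dfun n t ==> dfun n (%M e. val (s M e) (t M e))"
proof (rule dfun_comp2[where F = "%M. val"])
 show "dfun 2 (%M e. val (e 0) (e 1))"
 proof (rule dfun_tc_rec[where H = "%M z x f. hset ((%y. app f y) ` elts (hset {y : elts (hdom x). EX t:elts z. opair y t : elts x}))"])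
  show "dfun 3 (%M e. hset ((%y. app (e 2) y) ` elts (hset {y : elts (hdom (e 1)). EX t:elts (e 0). opair y t : elts (e 1)})))"
   by (intro dfi) simp_all
  fix z x
  have "(%y. app (lam (tc x) (val z)) y) ` {y : elts (hdom x). EX t:elts z. opair y t : elts x} =
   (%y. val z y) ` {y : elts (hdom x). EX t:elts z. opair y t : elts x}"
   by (rule image_cong) (auto simp: hdom_tc)
  then show "val z x = hset ((%y. app (lam (tc x) (val z)) y) ` elts (hset {y : elts (hdom x). EX t:elts z. opair y t : elts x}))"
   by (subst val.simps) (simp only: elts_hset[OF countable_Collect_elts])
 qed
qed

lemma dfun_chk [dfi]: "dfun n s ==> dfun n (%M e. chk (s M e))"
proof (rule dfun_comp1[where F = "%M. chk"])
 have "dfun 2 (%M e. chk (e 1))"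
 proof (rule dfun_mem_rec[where F = "%M z x. chk x" and H = "%M z x f. hset ((%y. opair (app f y) hempty) ` elts x)"])
  show "dfun 3 (%M e. hset ((%y. opair (app (e 2) y) hempty) ` elts (e 1)))" by (intro dfi) simp_all
  show "chk x = hset ((%y. opair (app (lam x chk) y) hempty) ` elts x)" for x
   by (subst chk.simps) (simp cong: image_cong_simp)
 qed
 from dfun_comp2[where F = "%M z x. chk x", OF this dfun_hempty dfun_var, of 0 1]
 show "dfun 1 (%M e. chk (e 0))" by simp
qed

text \<open>The recursion changes both names, so it is run on pairs of names, the predecessors of a
  pair being the product of the two domains.\<close>

lemma dfun_feq [dfi]: "dfun n s ==> dfun n t ==> dfun n u ==> dfun n (%M e. feq (s M e) (t M e) (u M e))"
proof -
 assume stu: "dfun n s" "dfun n t" "dfun n u"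
 let ?F = "%P x. feq P (hfst x) (hsnd x)"
 have "dfun 2 (%M e. ?F (e 0) (e 1))"
 proof (rule dfun_rec[where F = "%M. ?F" and pr = "%M z x. times (hdom (hfst x)) (hdom (hsnd x))" and
   H = "%M P x f. hset {p : elts P.
  (ALL \<pi>:elts (hdom (hfst x)). ALL t:elts P. opair \<pi> t : elts (hfst x) --> (ALL q:elts P. elts p \<subseteq> elts q --> elts t \<subseteq> elts q -->
   (EX r:elts P. elts q \<subseteq> elts r &
    (EX \<rho>:elts (hdom (hsnd x)). EX s:elts P. opair \<rho> s : elts (hsnd x) & elts s \<subseteq> elts r & r : elts (app f (opair \<pi> \<rho>)))))) &
  (ALL \<rho>:elts (hdom (hsnd x)). ALL t:elts P. opair \<rho> t : elts (hsnd x) --> (ALL q:elts P. elts p \<subseteq> elts q --> elts t \<subseteq> elts q -->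
   (EX r:elts P. elts q \<subseteq> elts r &
    (EX \<pi>:elts (hdom (hfst x)). EX s:elts P. opair \<pi> s : elts (hfst x) & elts s \<subseteq> elts r & r : elts (app f (opair \<pi> \<rho>))))))}"])
  show "dfun 3 (%M e. hset {p : elts (e 0).
  (ALL \<pi>:elts (hdom (hfst (e 1))). ALL t:elts (e 0). opair \<pi> t : elts (hfst (e 1)) --> (ALL q:elts (e 0). elts p \<subseteq> elts q --> elts t \<subseteq> elts q -->
   (EX r:elts (e 0). elts q \<subseteq> elts r &
    (EX \<rho>:elts (hdom (hsnd (e 1))). EX s:elts (e 0). opair \<rho> s : elts (hsnd (e 1)) & elts s \<subseteq> elts r & r : elts (app (e 2) (opair \<pi> \<rho>)))))) &
  (ALL \<rho>:elts (hdom (hsnd (e 1))). ALL t:elts (e 0). opair \<rho> t : elts (hsnd (e 1)) --> (ALL q:elts (e 0). elts p \<subseteq> elts q --> elts t \<subseteq> elts q -->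
   (EX r:elts (e 0). elts q \<subseteq> elts r &
    (EX \<pi>:elts (hdom (hfst (e 1))). EX s:elts (e 0). opair \<pi> s : elts (hfst (e 1)) & elts s \<subseteq> elts r & r : elts (app (e 2) (opair \<pi> \<rho>))))))})"
   by (intro dfi) simp_all
  show "dfun 2 (%M e. times (hdom (hfst (e 1))) (hdom (hsnd (e 1))))" by (intro dfi) simp_all
  show "wf {(y, x). x : M & y : elts (times (hdom (hfst x)) (hdom (hsnd x)))}" for M
   by (rule wf_subset[OF wf_inv_image[OF wf_tc], of _ hfst]) (auto simp: hdom_tc)
  fix M x assume M: "M : K" "x : M"
  let ?c = "hun (upair x x) (times (tc x) (tc x))"
  have "dfun 1 (%M e. hun (upair (e 0) (e 0)) (times (tc (e 0)) (tc (e 0))))" by (intro dfi) simp_all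
  then have c: "?c : M" using dfun_in[of 1 _ M "%_. x"] M by auto
  have 1: "elts (hdom a) \<subseteq> elts (tc x)" if "a : elts (tc x)" for a
   using hdom_tc tc_trans[OF that] by blast
  have hd: "elts (hdom (hfst x)) \<subseteq> elts (tc x) & elts (hdom (hsnd x)) \<subseteq> elts (tc x)"
  proof (cases "EX a b. x = opair a b")
   case True
   then obtain a b where x: "x = opair a b" by blast
   have "upair a b : elts (tc x)" using tc_sub[of x] unfolding x elts_opair by blast
   then have "a : elts (tc x)" "b : elts (tc x)" using htrans_tc[of x] unfolding htrans_def by auto
   then show ?thesis using 1 unfolding x by simp
  next
   case False
   then have "hfst x = hempty" "hsnd x = hempty" unfolding hfst_def hsnd_def by (auto intro: elts_eqI)
   then show ?thesis by (auto simp: elts_hdom)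
  qed
  have "elts (times (hdom (hfst y)) (hdom (hsnd y))) \<subseteq> elts ?c" if "y : elts ?c" for y
   using that hd 1 by fastforce
  then show "EX c:M. x : elts c & (ALL y:elts c. elts (times (hdom (hfst y)) (hdom (hsnd y))) \<subseteq> elts c)"
   using c by (intro bexI[of _ ?c]) auto
 next
  fix P x
  have ap: "app (lam (times (hdom (hfst x)) (hdom (hsnd x))) (?F P)) (opair \<pi> \<rho>) = feq P \<pi> \<rho>"
   if "\<pi> : elts (hdom (hfst x))" "\<rho> : elts (hdom (hsnd x))" for \<pi> \<rho>
   using that by (subst app_lam) auto
  show "?F P x = hset {p : elts P.
  (ALL \<pi>:elts (hdom (hfst x)). ALL t:elts P. opair \<pi> t : elts (hfst x) --> (ALL q:elts P. elts p \<subseteq> elts q --> elts t \<subseteq> elts q -->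
   (EX r:elts P. elts q \<subseteq> elts r &
    (EX \<rho>:elts (hdom (hsnd x)). EX s:elts P. opair \<rho> s : elts (hsnd x) & elts s \<subseteq> elts r &
     r : elts (app (lam (times (hdom (hfst x)) (hdom (hsnd x))) (?F P)) (opair \<pi> \<rho>)))))) &
  (ALL \<rho>:elts (hdom (hsnd x)). ALL t:elts P. opair \<rho> t : elts (hsnd x) --> (ALL q:elts P. elts p \<subseteq> elts q --> elts t \<subseteq> elts q -->
   (EX r:elts P. elts q \<subseteq> elts r &
    (EX \<pi>:elts (hdom (hfst x)). EX s:elts P. opair \<pi> s : elts (hfst x) & elts s \<subseteq> elts r &
     r : elts (app (lam (times (hdom (hfst x)) (hdom (hsnd x))) (?F P)) (opair \<pi> \<rho>))))))}"
   by (subst feq.simps) (simp only: ap cong: ball_cong bex_cong conj_cong)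
 qed
 from dfun_comp2[where F = "%M. ?F", OF this stu(1) dfun_opair[OF stu(2,3)]] show ?thesis by simp
qed

lemma dfn_pmem [dfi]: "dfun n p ==> dfun n s ==> dfun n t ==> dfun n u ==> dfn n (%M e. pmem (p M e) (s M e) (t M e) (u M e))"
proof (rule dfn_comp4[where R = "%M. pmem"])
 show "dfn 4 (%M e. pmem (e 0) (e 1) (e 2) (e 3))" unfolding pmem_def by (intro dfi) simp_all
qed

lemma dfn_pmem' [dfi]: "dfun n p ==> dfun n s ==> dfun n t ==> dfun n u ==> dfn n (%M e. pmem' (p M e) (s M e) (t M e) (u M e))"
proof (rule dfn_comp4[where R = "%M. pmem'"])
 show "dfn 4 (%M e. pmem' (e 0) (e 1) (e 2) (e 3))" unfolding pmem'_def by (intro dfi) simp_all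
qed

lemma dfn_frc:
 assumes P: "!!n. dfun n (%M e. P)"
 shows "wf_fm {} {} \<phi> ==> (!!i. dfun n (v i)) ==> dfun n s ==> dfn n (%M e. frc M P (s M e) (%i. v i M e) \<phi>)"
proof (induction \<phi> arbitrary: n v s)
 have trm: "EX i. s = Var i" if "wf_trm {} s" for s :: "unit trm" using that by (cases s) auto
 note [dfi] = P
 { case (Eq t t')
  from trm[of t] trm[of t'] Eq(1) obtain i j where st: "t = Var i" "t' = Var j" by auto
  show ?case unfolding st frc.simps trm_val.simps by (intro dfi Eq) }
 { case (Mem t t')
  from trm[of t] trm[of t'] Mem(1) obtain i j where st: "t = Var i" "t' = Var j" by auto
  have "dfn 3 (%M e. ALL q:elts P. elts (e 0) \<subseteq> elts q --> (EX r:elts P. elts q \<subseteq> elts r & pmem P r (e 1) (e 2)))"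
   by (intro dfi) simp_all
  from dfn_comp3[where R = "%M p x y. ALL q:elts P. elts p \<subseteq> elts q --> (EX r:elts P. elts q \<subseteq> elts r & pmem P r x y)", OF this Mem(3) Mem(2) Mem(2)]
  show ?case unfolding st frc.simps trm_val.simps . }
 { case (Neg \<phi>)
  have "dfn (Suc n) (%M e. frc M P (e n) (%i. v i M e) \<phi>)"
   by (rule Neg.IH[where s = "%M e. e n"])         (use Neg.prems(1) dfun_mono[OF Neg.prems(2), of "Suc n"] in \<open>auto intro: dfun_var\<close>)
  then have "dfn (Suc n) (%M e. e n : elts P --> elts (s M e) \<subseteq> elts (e n) --> \<not> frc M P (e n) (%i. v i M e) \<phi>)"
   by (intro dfn_imp dfn_not dfn_mem dfn_subset P dfun_var) (use dfun_mono[OF Neg.prems(3)] in auto)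
  from dfn_all[OF this] show ?case
  proof (rule dfn_cong)
   fix M and e :: "nat => hc" assume M: "M : K" "range e \<subseteq> M"
   have PM: "P : M" using dfun_in[OF P M] .
   have 1: "(%i. v i M (e(n := b))) = (%i. v i M e)" "s M (e(n := b)) = s M e" if "b : M" for b
    using dfun_upd[OF Neg.prems(2) M that order_refl] dfun_upd[OF Neg.prems(3) M that order_refl]
    by (simp_all del: fun_upd_apply)
   have "q : M" if "q : elts P" for q using K_trans[OF M(1) PM that] .
   then show "(ALL a:M. (e(n := a)) n : elts P --> elts (s M (e(n := a))) \<subseteq> elts ((e(n := a)) n) -->
     \<not> frc M P ((e(n := a)) n) (%i. v i M (e(n := a))) \<phi>) = frc M P (s M e) (%i. v i M e) (Neg \<phi>)"
    by (auto simp: 1 simp del: fun_upd_apply, auto simp: fun_upd_same)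
  qed }
 { case (Conj \<phi> \<psi>) then show ?case using dfn_conj by simp }
 { case (Forall k \<phi>)
  have "dfun (Suc n) (%M e. if i = k then e n else v i M e)" for i
   using dfun_mono[OF Forall(3)[of i], of "Suc n"] dfun_var[of n "Suc n"] by (cases "i = k") auto
  then have "dfn (Suc n) (%M e. frc M P (s M e) (%i. if i = k then e n else v i M e) \<phi>)"
   by (intro Forall(1)) (use Forall(2,4) in \<open>auto intro: dfun_mono\<close>)
  from dfn_all[OF this] show ?case
  proof (rule dfn_cong)
   fix M and e :: "nat => hc" assume M: "M : K" "range e \<subseteq> M"
   have "(%i. if i = k then (e(n := b)) n else v i M (e(n := b))) = (%i. v i M e)(k := b)" if "b : M" for b
    by (rule ext) (simp add: dfun_upd[OF Forall(3) M that order_refl])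
   moreover have "s M (e(n := b)) = s M e" if "b : M" for b
    using dfun_upd[OF Forall(4) M that order_refl] .
   ultimately show "(ALL b:M. frc M P (s M (e(n := b))) (%i. if i = k then (e(n := b)) n else v i M (e(n := b))) \<phi>) =
    frc M P (s M e) (%i. v i M e) (Forall k \<phi>)"
    by (simp cong: ball_cong del: fun_upd_apply)
  qed }
qed simp

end

section \<open>Generic extensions and their properties\<close>

locale poset = ctm +
 fixes P assumes P: "P : U" and one: "hempty : elts P"

locale generic = poset +
 fixes H assumes H_sub: "elts H \<subseteq> elts P" and H_one: "hempty : elts H"
  and H_up: "q : elts H ==> p : elts P ==> elts p \<subseteq> elts q ==> p : elts H"
  and H_dir: "p : elts H ==> q : elts H ==> EX r:elts H. elts p \<subseteq> elts r & elts q \<subseteq> elts r"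
  and H_gen: "D : U ==> elts D \<subseteq> elts P ==> (!!p. p : elts P ==> EX q:elts D. elts p \<subseteq> elts q) ==> EX p:elts D. p : elts H"
begin

lemma P_U: "p : elts P ==> p : U"
 using zfm_trans[OF zf P] .

text \<open>Density is asked only below a condition \<open>q\<close> of the filter. Adding the
  conditions incompatible with \<open>q\<close> makes the set dense everywhere, and none of those
  can belong to \<open>H\<close>.\<close>

lemma H_gen_dfn:
 assumes D: "D.dfn 1 (%M e. Q M (e 0))" and q: "q : elts H"
  and d: "!!p. p : elts P ==> elts q \<subseteq> elts p ==> EX r:elts P. elts p \<subseteq> elts r & Q U r"
 shows "EX p:elts H. Q U p"
proof -
 have qP: "q : elts P" using q H_sub by blast
 note [dfi] = D.dfn_comp1[OF D]
 let ?D = "hset {p : elts P. Q U p \<or> \<not> (EX r:elts P. elts p \<subseteq> elts r & elts q \<subseteq> elts r)}"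
 have "D.dfun 0 (%M e. hset {p : elts P. Q M p \<or> \<not> (EX r:elts P. elts p \<subseteq> elts r & elts q \<subseteq> elts r)})"
  by (intro dfi) (use P P_U[OF qP] in simp_all)
 from zfm_closed[OF zf this] have D: "?D : U" .
 have eD: "elts ?D = {p : elts P. Q U p \<or> \<not> (EX r:elts P. elts p \<subseteq> elts r & elts q \<subseteq> elts r)}"
  by (rule elts_hset[OF countable_Collect_elts])
 have "EX p:elts ?D. p : elts H"
 proof (rule H_gen[OF D])
  show "elts ?D \<subseteq> elts P" unfolding eD by blast
  fix p assume p: "p : elts P"
  show "EX q:elts ?D. elts p \<subseteq> elts q"
  proof (cases "EX r:elts P. elts p \<subseteq> elts r & elts q \<subseteq> elts r")
   case True
   then obtain r where r: "r : elts P" "elts p \<subseteq> elts r" "elts q \<subseteq> elts r" by blast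
   then obtain r' where "r' : elts P" "elts r \<subseteq> elts r'" "Q U r'" using d by blast
   then show ?thesis unfolding eD using r by blast
  next
   case False
   then show ?thesis unfolding eD using p by blast
  qed
 qed
 then obtain p where p: "p : elts H" "Q U p \<or> \<not> (EX r:elts P. elts p \<subseteq> elts r & elts q \<subseteq> elts r)" unfolding eD by blast
 obtain r where "r : elts H" "elts p \<subseteq> elts r" "elts q \<subseteq> elts r" using H_dir[OF p(1) q] by blast
 then show ?thesis using p H_sub by blast
qed

lemma feq_truth:
 "\<sigma> : U ==> \<tau> : U ==> val H \<sigma> = val H \<tau> <-> (EX p:elts H. p : elts (feq P \<sigma> \<tau>))"
proof (induction \<sigma> arbitrary: \<tau> rule: wf_induct_rule[OF wf_tc])
 case (1 \<sigma>)
 have inU: "\<pi> : U" if "opair \<pi> t : elts x" "x : U" for \<pi> t x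
  using zfm_trans[OF zf D.tc_in[OF _ that(2)] opair_tc[OF that(1)]] by simp
 have IH: "val H \<pi> = val H \<rho> <-> (EX p:elts H. p : elts (feq P \<pi> \<rho>))"
  if "opair \<pi> t : elts \<sigma>" "opair \<rho> s : elts \<tau>" for \<pi> t \<rho> s
  using 1(1)[of \<pi> \<rho>] opair_tc[OF that(1)] inU[OF that(1) 1(2)] inU[OF that(2) 1(3)] by simp
 show ?case
 proof
  assume "EX p:elts H. p : elts (feq P \<sigma> \<tau>)"
  then obtain p where p: "p : elts H" "p : elts (feq P \<sigma> \<tau>)" by blast
  have sub1: "val H \<pi> : elts (val H \<tau>)" if t: "opair \<pi> t : elts \<sigma>" "t : elts H" for \<pi> t
  proof -
   obtain q where q: "q : elts H" "elts p \<subseteq> elts q" "elts t \<subseteq> elts q" using H_dir[OF p(1) t(2)] by blast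
   have "EX r:elts H. pmem P r \<pi> \<tau>"
   proof (rule H_gen_dfn[OF _ q(1)])
    show "D.dfn 1 (%M e. pmem P (e 0) \<pi> \<tau>)" by (intro dfi) (use P inU[OF t(1) 1(2)] 1(3) in simp_all)
    fix q' assume "q' : elts P" "elts q \<subseteq> elts q'"
    then show "EX r:elts P. elts q' \<subseteq> elts r & pmem P r \<pi> \<tau>"
     using p(2)[unfolded elts_feq[of p P \<sigma> \<tau>]] opair_hdom[OF t(1)] t H_sub q(2,3) by (meson order_trans subsetD)
   qed
   then obtain r \<rho> s where r: "r : elts H" "s : elts P" "opair \<rho> s : elts \<tau>" "elts s \<subseteq> elts r" "r : elts (feq P \<pi> \<rho>)"
    unfolding pmem_def by blast
   then have "s : elts H" "val H \<pi> = val H \<rho>" using H_up IH[OF t(1) r(3)] by blast+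
   then show ?thesis unfolding elts_val using r(3) by blast
  qed
  have sub2: "val H \<rho> : elts (val H \<sigma>)" if t: "opair \<rho> t : elts \<tau>" "t : elts H" for \<rho> t
  proof -
   obtain q where q: "q : elts H" "elts p \<subseteq> elts q" "elts t \<subseteq> elts q" using H_dir[OF p(1) t(2)] by blast
   have "EX r:elts H. pmem' P r \<rho> \<sigma>"
   proof (rule H_gen_dfn[OF _ q(1)])
    show "D.dfn 1 (%M e. pmem' P (e 0) \<rho> \<sigma>)" by (intro dfi) (use P inU[OF t(1) 1(3)] 1(2) in simp_all)
    fix q' assume "q' : elts P" "elts q \<subseteq> elts q'"
    then show "EX r:elts P. elts q' \<subseteq> elts r & pmem' P r \<rho> \<sigma>"
     using p(2)[unfolded elts_feq[of p P \<sigma> \<tau>]] opair_hdom[OF t(1)] t H_sub q(2,3) by (meson order_trans subsetD)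
   qed
   then obtain r \<pi> s where r: "r : elts H" "s : elts P" "opair \<pi> s : elts \<sigma>" "elts s \<subseteq> elts r" "r : elts (feq P \<pi> \<rho>)"
    unfolding pmem'_def by blast
   then have "s : elts H" "val H \<pi> = val H \<rho>" using H_up IH[OF r(3) t(1)] by blast+
   moreover from this(1) have "val H \<pi> : elts (val H \<sigma>)" unfolding elts_val[of H \<sigma>] using r(3) by blast
   ultimately show ?thesis by simp
  qed
  have "elts (val H \<sigma>) = elts (val H \<tau>)"
  proof (intro equalityI subsetI)
   fix y assume "y : elts (val H \<sigma>)"
   then obtain \<pi> t where "y = val H \<pi>" "t : elts H" "opair \<pi> t : elts \<sigma>" unfolding elts_val[of H \<sigma>] by blast
   then show "y : elts (val H \<tau>)" using sub1 by simp
  next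
   fix y assume "y : elts (val H \<tau>)"
   then obtain \<rho> t where "y = val H \<rho>" "t : elts H" "opair \<rho> t : elts \<tau>" unfolding elts_val[of H \<tau>] by blast
   then show "y : elts (val H \<sigma>)" using sub2 by simp
  qed
  then show "val H \<sigma> = val H \<tau>" by (simp only: elts_inject)
 next
  assume eq: "val H \<sigma> = val H \<tau>"
  \<comment> \<open>A condition failing to force equality has an extension that commits to a
    counterexample: a name put into one side that no further extension matches on the other.
    Genericity decides between the three alternatives, and equal values exclude the last
    two.\<close>
  let ?Q1 = "%p. EX \<pi>:elts (hdom \<sigma>). EX t:elts P. opair \<pi> t : elts \<sigma> & elts t \<subseteq> elts p & (ALL r:elts P. elts p \<subseteq> elts r --> \<not> pmem P r \<pi> \<tau>)"
  let ?Q2 = "%p. EX \<rho>:elts (hdom \<tau>). EX t:elts P. opair \<rho> t : elts \<tau> & elts t \<subseteq> elts p & (ALL r:elts P. elts p \<subseteq> elts r --> \<not> pmem' P r \<rho> \<sigma>)"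
  have "EX p:elts H. p : elts (feq P \<sigma> \<tau>) \<or> ?Q1 p \<or> ?Q2 p"
  proof (rule H_gen_dfn[OF _ H_one])
   show "D.dfn 1 (%M e. e 0 : elts (feq P \<sigma> \<tau>) \<or> ?Q1 (e 0) \<or> ?Q2 (e 0))" by (intro dfi) (use P 1(2,3) in simp_all)
   fix p assume p: "p : elts P"
   show "EX r:elts P. elts p \<subseteq> elts r & (r : elts (feq P \<sigma> \<tau>) \<or> ?Q1 r \<or> ?Q2 r)"
   proof (rule ccontr)
    assume n: "\<not> ?thesis"
    then have "p ~: elts (feq P \<sigma> \<tau>)" using p by blast
    then consider \<pi> t q where "\<pi> : elts (hdom \<sigma>)" "t : elts P" "opair \<pi> t : elts \<sigma>" "q : elts P" "elts p \<subseteq> elts q" "elts t \<subseteq> elts q"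
      "\<not> (EX r:elts P. elts q \<subseteq> elts r & pmem P r \<pi> \<tau>)"
     | \<rho> t q where "\<rho> : elts (hdom \<tau>)" "t : elts P" "opair \<rho> t : elts \<tau>" "q : elts P" "elts p \<subseteq> elts q" "elts t \<subseteq> elts q"
      "\<not> (EX r:elts P. elts q \<subseteq> elts r & pmem' P r \<rho> \<sigma>)"
     unfolding elts_feq[of p P \<sigma> \<tau>] using p by blast
    then show False
    proof cases
     case 1
     then have "?Q1 q" by blast
     then show False using n 1(4,5) by blast
    next
     case 2
     then have "?Q2 q" by blast
     then show False using n 2(4,5) by blast
    qed
   qed
  qed
  then obtain p where p: "p : elts H" "p : elts (feq P \<sigma> \<tau>) \<or> ?Q1 p \<or> ?Q2 p" by blast
  have "\<not> ?Q1 p"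
  proof
   assume "?Q1 p"
   then obtain \<pi> t where t: "t : elts P" "opair \<pi> t : elts \<sigma>" "elts t \<subseteq> elts p" "ALL r:elts P. elts p \<subseteq> elts r --> \<not> pmem P r \<pi> \<tau>" by blast
   have "t : elts H" using H_up[OF p(1) t(1,3)] .
   then have "val H \<pi> : elts (val H \<tau>)" unfolding eq[symmetric] elts_val[of H \<sigma>] using t(2) by blast
   then obtain \<rho> s where s: "val H \<pi> = val H \<rho>" "s : elts H" "opair \<rho> s : elts \<tau>" unfolding elts_val[of H \<tau>] by blast
   obtain p' where p': "p' : elts H" "p' : elts (feq P \<pi> \<rho>)" using s(1) IH[OF t(2) s(3)] by blast
   obtain r0 where r0: "r0 : elts H" "elts p \<subseteq> elts r0" "elts p' \<subseteq> elts r0" using H_dir[OF p(1) p'(1)] by blast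
   obtain r where r: "r : elts H" "elts r0 \<subseteq> elts r" "elts s \<subseteq> elts r" using H_dir[OF r0(1) s(2)] by blast
   have rP: "r : elts P" "s : elts P" using r(1) s(2) H_sub by blast+
   have "r : elts (feq P \<pi> \<rho>)" using feq_mono[OF p'(2) rP(1)] r0 r by blast
   then have "pmem P r \<pi> \<tau>" unfolding pmem_def using opair_hdom[OF s(3)] s(3) r(3) rP by blast
   moreover have "elts p \<subseteq> elts r" using r0(2) r(2) by blast
   ultimately show False using t(4) rP(1) by blast
  qed
  moreover have "\<not> ?Q2 p"
  proof
   assume "?Q2 p"
   then obtain \<rho> t where t: "t : elts P" "opair \<rho> t : elts \<tau>" "elts t \<subseteq> elts p" "ALL r:elts P. elts p \<subseteq> elts r --> \<not> pmem' P r \<rho> \<sigma>" by blast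
   have "t : elts H" using H_up[OF p(1) t(1,3)] .
   then have "val H \<rho> : elts (val H \<sigma>)" unfolding eq elts_val[of H \<tau>] using t(2) by blast
   then obtain \<pi> s where s: "val H \<rho> = val H \<pi>" "s : elts H" "opair \<pi> s : elts \<sigma>" unfolding elts_val[of H \<sigma>] by blast
   obtain p' where p': "p' : elts H" "p' : elts (feq P \<pi> \<rho>)" using s(1) IH[OF s(3) t(2)] by auto
   obtain r0 where r0: "r0 : elts H" "elts p \<subseteq> elts r0" "elts p' \<subseteq> elts r0" using H_dir[OF p(1) p'(1)] by blast
   obtain r where r: "r : elts H" "elts r0 \<subseteq> elts r" "elts s \<subseteq> elts r" using H_dir[OF r0(1) s(2)] by blast
   have rP: "r : elts P" "s : elts P" using r(1) s(2) H_sub by blast+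
   have "r : elts (feq P \<pi> \<rho>)" using feq_mono[OF p'(2) rP(1)] r0 r by blast
   then have "pmem' P r \<rho> \<sigma>" unfolding pmem'_def using opair_hdom[OF s(3)] s(3) r(3) rP by blast
   moreover have "elts p \<subseteq> elts r" using r0(2) r(2) by blast
   ultimately show False using t(4) rP(1) by blast
  qed
  ultimately show "EX p:elts H. p : elts (feq P \<sigma> \<tau>)" using p by blast
 qed
qed

lemma name_U: "opair \<pi> t : elts x ==> x : U ==> \<pi> : U"
 using zfm_trans[OF zf D.tc_in opair_tc] by blast

lemma mem_truth:
 assumes "\<sigma> : U" "\<tau> : U"
 shows "val H \<sigma> : elts (val H \<tau>) <->
  (EX p:elts H. ALL q:elts P. elts p \<subseteq> elts q --> (EX r:elts P. elts q \<subseteq> elts r & pmem P r \<sigma> \<tau>))"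
proof
 assume "val H \<sigma> : elts (val H \<tau>)"
 then obtain \<rho> s where s: "val H \<sigma> = val H \<rho>" "s : elts H" "opair \<rho> s : elts \<tau>" unfolding elts_val[of H \<tau>] by blast
 obtain p where p: "p : elts H" "p : elts (feq P \<sigma> \<rho>)" using s(1) feq_truth[OF assms(1) name_U[OF s(3) assms(2)]] by blast
 obtain r where r: "r : elts H" "elts p \<subseteq> elts r" "elts s \<subseteq> elts r" using H_dir[OF p(1) s(2)] by blast
 have rP: "r : elts P" "s : elts P" using r(1) s(2) H_sub by blast+
 have "pmem P r \<sigma> \<tau>"
  unfolding pmem_def using opair_hdom[OF s(3)] s(3) r(3) rP feq_mono[OF p(2) rP(1) r(2)] by blast
 then show "EX p:elts H. ALL q:elts P. elts p \<subseteq> elts q --> (EX r:elts P. elts q \<subseteq> elts r & pmem P r \<sigma> \<tau>)"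
  using r(1) pmem_mono by blast
next
 assume "EX p:elts H. ALL q:elts P. elts p \<subseteq> elts q --> (EX r:elts P. elts q \<subseteq> elts r & pmem P r \<sigma> \<tau>)"
 then obtain p where p: "p : elts H" "!!q. q : elts P ==> elts p \<subseteq> elts q ==> EX r:elts P. elts q \<subseteq> elts r & pmem P r \<sigma> \<tau>" by blast
 have "D.dfn 1 (%M e. pmem P (e 0) \<sigma> \<tau>)" by (intro dfi) (use P assms in simp_all)
 from H_gen_dfn[where Q = "%M r. pmem P r \<sigma> \<tau>", OF this p(1) p(2)]
 obtain r \<rho> s where r: "r : elts H" "s : elts P" "opair \<rho> s : elts \<tau>" "elts s \<subseteq> elts r" "r : elts (feq P \<sigma> \<rho>)"
  unfolding pmem_def by blast
 then have "s : elts H" "val H \<sigma> = val H \<rho>" using H_up feq_truth[OF assms(1) name_U[OF r(3) assms(2)]] by blast+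
 then show "val H \<sigma> : elts (val H \<tau>)" unfolding elts_val[of H \<tau>] using r(3) by blast
qed

definition UH :: "hc set" where "UH = val H ` U"

lemma dfn_frc_const:
 assumes "wf_fm {} {} \<phi>" "range e \<subseteq> U" shows "D.dfn 1 (%M f. frc M P (f 0) e \<phi>)"
 by (rule D.dfn_frc[where v = "%i M f. e i" and s = "%M f. f 0"])
  (use assms P in \<open>auto intro!: D.dfun_const D.dfun_var\<close>)

theorem truth:
 "wf_fm {} {} \<phi> ==> range e \<subseteq> U ==> sat (\<S> UH) (val H \<circ> e) \<phi> <-> (EX p:elts H. frc U P p e \<phi>)"
proof (induction \<phi> arbitrary: e)
 have trm: "EX i. s = Var i" if "wf_trm {} s" for s :: "unit trm" using that by (cases s) auto
 { case (Eq s t)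
  from trm[of s] trm[of t] Eq(1) obtain i j where st: "s = Var i" "t = Var j" by auto
  have "e i : U" "e j : U" using Eq(2) by auto
  then show ?case unfolding st using feq_truth by simp }
 { case (Mem s t)
  from trm[of s] trm[of t] Mem(1) obtain i j where st: "s = Var i" "t = Var j" by auto
  have "e i : U" "e j : U" using Mem(2) by auto
  then show ?case unfolding st using mem_truth by (simp add: hmem_elts) }
 { case (Neg \<phi>)
  then have IH: "sat (\<S> UH) (val H \<circ> e) \<phi> <-> (EX p:elts H. frc U P p e \<phi>)" by (simp add: comp_def)
  have "D.dfn 1 (%M f. frc M P (f 0) e \<phi> \<or> frc M P (f 0) e (Neg \<phi>))"
   by (intro D.dfn_disj dfn_frc_const) (use Neg.prems in simp_all)
  then have "EX p:elts H. frc U P p e \<phi> \<or> frc U P p e (Neg \<phi>)"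
  proof (rule H_gen_dfn[where Q = "%M p. frc M P p e \<phi> \<or> frc M P p e (Neg \<phi>)", OF _ H_one])
   show "EX r:elts P. elts p \<subseteq> elts r & (frc U P r e \<phi> \<or> frc U P r e (Neg \<phi>))" if "p : elts P" for p
    using that by (cases "EX r:elts P. elts p \<subseteq> elts r & frc U P r e \<phi>") auto
  qed
  moreover have "\<not> (frc U P p e \<phi> & frc U P q e (Neg \<phi>))" if pq: "p : elts H" "q : elts H" for p q
  proof
   assume *: "frc U P p e \<phi> & frc U P q e (Neg \<phi>)"
   obtain r where r: "r : elts H" "elts p \<subseteq> elts r" "elts q \<subseteq> elts r" using H_dir[OF pq] by blast
   then have "r : elts P" using H_sub by blast
   then show False using * r frc_mono[of U P p e \<phi> r] by auto
  qed
  ultimately show ?case unfolding sat.simps IH by blast }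
 { case (Conj \<phi> \<psi>)
  have IH: "sat (\<S> UH) (val H \<circ> e) \<phi> <-> (EX p:elts H. frc U P p e \<phi>)" "sat (\<S> UH) (val H \<circ> e) \<psi> <-> (EX p:elts H. frc U P p e \<psi>)"
   using Conj.IH[of e] Conj.prems by (simp_all add: comp_def)
  have "EX r:elts H. frc U P r e \<phi> & frc U P r e \<psi>"
   if pq: "p : elts H" "q : elts H" "frc U P p e \<phi>" "frc U P q e \<psi>" for p q
  proof -
   obtain r where r: "r : elts H" "elts p \<subseteq> elts r" "elts q \<subseteq> elts r" using H_dir[OF pq(1,2)] by blast
   then have "r : elts P" using H_sub by blast
   then show ?thesis using r pq frc_mono by blast
  qed
  then show ?case unfolding sat.simps IH by auto }
 { case (Forall n \<phi>)
  have w: "wf_fm {} {} \<phi>" using Forall.prems by simp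
  have IH: "sat (\<S> UH) ((val H \<circ> e)(n := val H \<sigma>)) \<phi> <-> (EX p:elts H. frc U P p (e(n := \<sigma>)) \<phi>)" if "\<sigma> : U" for \<sigma>
  proof -
   have "range (e(n := \<sigma>)) \<subseteq> U" using Forall.prems(2) that by auto
   from Forall.IH[OF w this] show ?thesis by (simp only: fun_upd_comp)
  qed
  \<comment> \<open>Conditions with one fixed name \<open>\<sigma>\<close> that refutes
    \<open>\<phi>\<close> from there on. By \<open>frc_dense\<close> a condition not forcing the
    quantified formula has such an extension.\<close>
  let ?R = "%M p. EX \<sigma>:M. ALL q:elts P. elts p \<subseteq> elts q --> \<not> frc M P q (e(n := \<sigma>)) \<phi>"
  have "D.dfn 2 (%M f. frc M P (f 0) (%i. if i = n then f 1 else e i) \<phi>)"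
  proof (rule D.dfn_frc[where v = "%i M f. if i = n then f 1 else e i" and s = "%M f. f 0"])
   show "D.dfun 2 (%M f. if i = n then f 1 else e i)" for i
    using Forall.prems(2) by (cases "i = n") (auto intro!: D.dfun_var D.dfun_const)
  qed (use w P in \<open>auto intro!: D.dfun_const D.dfun_var\<close>)
  moreover have "(%i. if i = n then x else e i) = e(n := x)" for x by auto
  ultimately have "D.dfn 2 (%M f. frc M P (f 0) (e(n := f 1)) \<phi>)" by simp
  note [dfi] = D.dfn_comp2[where R = "%M p x. frc M P p (e(n := x)) \<phi>", OF this]
  have "D.dfn 1 (%M f. ?R M (f 0))" by (intro dfi) (use P in simp_all)
  then have "D.dfn 1 (%M f. frc M P (f 0) e (Forall n \<phi>) \<or> ?R M (f 0))"
   by (intro D.dfn_disj dfn_frc_const) (use Forall.prems in simp_all)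
  then have "EX p:elts H. frc U P p e (Forall n \<phi>) \<or> ?R U p"
  proof (rule H_gen_dfn[where Q = "%M p. frc M P p e (Forall n \<phi>) \<or> ?R M p", OF _ H_one])
   fix p assume p: "p : elts P"
   show "EX r:elts P. elts p \<subseteq> elts r & (frc U P r e (Forall n \<phi>) \<or> ?R U r)"
   proof (cases "frc U P p e (Forall n \<phi>)")
    case False
    then obtain \<sigma> where s: "\<sigma> : U" "\<not> frc U P p (e(n := \<sigma>)) \<phi>" by auto
    then obtain q where q: "q : elts P" "elts p \<subseteq> elts q" "\<not> (EX r:elts P. elts q \<subseteq> elts r & frc U P r (e(n := \<sigma>)) \<phi>)"
     using frc_dense[OF w p] by blast
    then have "?R U q" using s(1) by blast
    then show ?thesis using q by blast
   qed (use p in blast)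
  qed
  then obtain p where p: "p : elts H" "frc U P p e (Forall n \<phi>) \<or> ?R U p" by blast
  show ?case
  proof
   assume sat: "sat (\<S> UH) (val H \<circ> e) (Forall n \<phi>)"
   have "\<not> ?R U p"
   proof
    assume "?R U p"
    then obtain \<sigma> where s: "\<sigma> : U" "ALL q:elts P. elts p \<subseteq> elts q --> \<not> frc U P q (e(n := \<sigma>)) \<phi>" by blast
    have "sat (\<S> UH) ((val H \<circ> e)(n := val H \<sigma>)) \<phi>" using sat s(1) unfolding UH_def by simp
    then obtain p' where p': "p' : elts H" "frc U P p' (e(n := \<sigma>)) \<phi>" using IH[OF s(1)] by blast
    obtain r where r: "r : elts H" "elts p \<subseteq> elts r" "elts p' \<subseteq> elts r" using H_dir[OF p(1) p'(1)] by blast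
    then have "r : elts P" using H_sub by blast
    then show False using s(2) r frc_mono[OF p'(2)] by blast
   qed
   then show "EX p:elts H. frc U P p e (Forall n \<phi>)" using p by blast
  next
   assume "EX p:elts H. frc U P p e (Forall n \<phi>)"
   then show "sat (\<S> UH) (val H \<circ> e) (Forall n \<phi>)" using IH unfolding UH_def by auto
  qed }
qed simp

text \<open>Comprehension for names: each candidate in \<open>D\<close> is paired with the
  conditions forcing the formula of it. The bound \<open>times D P\<close> does not depend on the
  formula, which is what makes power set and nice names possible besides separation.\<close>

lemma name_ex:
 assumes D: "D : U" and \<phi>: "wf_fm {} {} \<phi>" and e: "range e \<subseteq> U"
 shows "EX \<tau>:U. elts \<tau> \<subseteq> elts (times D P) &
  (ALL \<pi>:elts D. (EX t:elts H. opair \<pi> t : elts \<tau>) <-> sat (\<S> UH) ((val H \<circ> e)(v := val H \<pi>)) \<phi>) &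
  elts (val H \<tau>) = {val H \<pi> | \<pi>. \<pi> : elts D & sat (\<S> UH) ((val H \<circ> e)(v := val H \<pi>)) \<phi>}"
proof -
 have "D.dfn 2 (%M f. frc M P (f 0) (%i. if i = v then f 1 else e i) \<phi>)"
 proof (rule D.dfn_frc[where v = "%i M f. if i = v then f 1 else e i" and s = "%M f. f 0"])
  show "D.dfun 2 (%M f. if i = v then f 1 else e i)" for i
   using e by (cases "i = v") (auto intro!: D.dfun_var D.dfun_const)
 qed (use \<phi> P in \<open>auto intro!: D.dfun_const D.dfun_var\<close>)
 moreover have "(%i. if i = v then x else e i) = e(v := x)" for x by auto
 ultimately have "D.dfn 2 (%M f. frc M P (f 0) (e(v := f 1)) \<phi>)" by simp
 note [dfi] = D.dfn_comp2[where R = "%M p x. frc M P p (e(v := x)) \<phi>", OF this]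
 let ?T = "hset {x : elts (times D P). frc U P (hsnd x) (e(v := hfst x)) \<phi>}"
 have "D.dfun 0 (%M f. hset {x : elts (times D P). frc M P (hsnd x) (e(v := hfst x)) \<phi>})"
  by (intro dfi) (use D P in simp_all)
 from zfm_closed[OF zf this] have T: "?T : U" .
 have iff: "opair \<pi> t : elts ?T <-> \<pi> : elts D & t : elts P & frc U P t (e(v := \<pi>)) \<phi>" for \<pi> t
  unfolding elts_hset[OF countable_Collect_elts] by simp
 have tr: "sat (\<S> UH) ((val H \<circ> e)(v := val H \<pi>)) \<phi> <-> (EX p:elts H. frc U P p (e(v := \<pi>)) \<phi>)" if "\<pi> : elts D" for \<pi>
  using truth[OF \<phi>, of "e(v := \<pi>)"] e zfm_trans[OF zf D that] by (simp add: fun_upd_comp image_subset_iff)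
 have 1: "(EX t:elts H. opair \<pi> t : elts ?T) <-> sat (\<S> UH) ((val H \<circ> e)(v := val H \<pi>)) \<phi>" if "\<pi> : elts D" for \<pi>
  unfolding tr[OF that] iff using that H_sub by blast
 have "elts (val H ?T) = {val H \<pi> | \<pi>. \<pi> : elts D & (EX t:elts H. opair \<pi> t : elts ?T)}"
  unfolding elts_val[of H ?T] using iff by blast
 then have 2: "elts (val H ?T) = {val H \<pi> | \<pi>. \<pi> : elts D & sat (\<S> UH) ((val H \<circ> e)(v := val H \<pi>)) \<phi>}" using 1 by blast
 have 3: "elts ?T \<subseteq> elts (times D P)" unfolding elts_hset[OF countable_Collect_elts] by blast
 show ?thesis by (rule bexI[OF _ T]) (use 1 2 3 in blast)
qed

lemma U_UH: "U \<subseteq> UH"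
proof
 fix x assume x: "x : U"
 have "chk x : U" using zfm_closed[OF zf D.dfun_chk[OF D.dfun_const[OF x]]] .
 then show "x : UH" unfolding UH_def using val_chk[OF H_one, of x] by (metis imageI)
qed

lemma UH_trans: "x : UH ==> y : elts x ==> y : UH"
 unfolding UH_def using name_U elts_val by fastforce

text \<open>\<open>hempty\<close> lies in the filter, so pairing each name in \<open>B\<close> with
  it produces a name for the set of all their values.\<close>

lemma const_name: assumes "B : U" shows "elts (val H (times B (upair hempty hempty))) = val H ` elts B" "val H (times B (upair hempty hempty)) : UH"
proof -
 show "elts (val H (times B (upair hempty hempty))) = val H ` elts B" unfolding elts_val using H_one by auto
 have "D.dfun 0 (%M e. times B (upair hempty hempty))" by (intro dfi) (use assms in simp_all)
 from zfm_closed[OF zf this] show "val H (times B (upair hempty hempty)) : UH" unfolding UH_def by blast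
qed

lemma UH_names:
 assumes "range e \<subseteq> UH" obtains e' where "range e' \<subseteq> U" "e = val H \<circ> e'"
proof -
 have "ALL i. EX \<sigma>. \<sigma> : U & e i = val H \<sigma>" using assms unfolding UH_def by blast
 then obtain e' where "ALL i. e' i : U & e i = val H (e' i)" by metis
 then show ?thesis by (intro that[of e']) (auto simp: fun_eq_iff)
qed

lemma hdom_U: "\<sigma> : U ==> hdom \<sigma> : U"
 using zfm_closed[OF zf D.dfun_hdom[OF D.dfun_const]] .

lemma val_hdom: "y : elts (val H \<sigma>) ==> EX \<pi>:elts (hdom \<sigma>). y = val H \<pi>"
 unfolding elts_val using opair_hdom by blast

theorem UH_zfm: "UH : zfm"
proof (rule zfmI)
 show "countable UH" unfolding UH_def using zfm_countable[OF zf] by (rule countable_image)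
 show "hempty : UH" using U_UH D.zfm_hempty[OF zf] by blast
 show "omega : UH" using U_UH zfm_omega[OF zf] by blast
 show "y : UH" if "x : UH" "y : elts x" for x y using UH_trans that .
 show "hset {z : elts x. sat (\<S> UH) (e(v := z)) p} : UH" if p: "wf_fm {} {} p" and e: "range e \<subseteq> UH" and x: "x : UH" for p e v x
 proof -
  obtain e' where e': "range e' \<subseteq> U" "e = val H \<circ> e'" using UH_names[OF e] by blast
  obtain \<sigma> where s: "\<sigma> : U" "x = val H \<sigma>" using x unfolding UH_def by blast
  have "finite (insert v (fv p))" by (simp add: fv_finite)
  then obtain n where n: "n ~= v" "n ~: fv p" using ex_new_if_finite[OF infinite_UNIV_nat] by blast
  let ?e = "e'(n := \<sigma>)"
  have "EX \<tau>:U. elts (val H \<tau>) = {val H \<pi> | \<pi>. \<pi> : elts (hdom \<sigma>) & sat (\<S> UH) ((val H \<circ> ?e)(v := val H \<pi>)) (Conj (vmem v n) p)}"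
  proof -
   have "wf_fm {} {} (Conj (vmem v n) p)" "range ?e \<subseteq> U" using p e'(1) s(1) by auto
   from name_ex[OF hdom_U[OF s(1)] this, of v] show ?thesis by blast
  qed
  then obtain \<tau> where t: "\<tau> : U"
   "elts (val H \<tau>) = {val H \<pi> | \<pi>. \<pi> : elts (hdom \<sigma>) & sat (\<S> UH) ((val H \<circ> ?e)(v := val H \<pi>)) (Conj (vmem v n) p)}" by blast
  have "sat (\<S> UH) ((val H \<circ> ?e)(v := z)) (Conj (vmem v n) p) <-> z : elts x & sat (\<S> UH) (e(v := z)) p" for z
  proof -
   have "sat (\<S> UH) ((val H \<circ> ?e)(v := z)) p <-> sat (\<S> UH) (e(v := z)) p"
    by (rule sat_cong) (use n in \<open>auto simp: e'(2)\<close>)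
   then show ?thesis using n s(2) by (simp add: hmem_elts)
  qed
  then have "elts (val H \<tau>) = {z : elts x. sat (\<S> UH) (e(v := z)) p}" unfolding t(2) using val_hdom s(2) by blast
  then have "hset {z : elts x. sat (\<S> UH) (e(v := z)) p} = val H \<tau>" by (metis hset_elts)
  then show ?thesis unfolding UH_def using t(1) by simp
 qed
 show "EX b:UH. x : elts b & y : elts b" if xy: "x : UH" "y : UH" for x y
 proof -
  obtain \<sigma> \<tau> where st: "\<sigma> : U" "x = val H \<sigma>" "\<tau> : U" "y = val H \<tau>" using xy unfolding UH_def by blast
  show ?thesis using const_name[OF zfm_upair[OF zf st(1,3)]] st by auto
 qed
 show "EX b:UH. ALL y:elts x. elts y \<subseteq> elts b" if x: "x : UH" for x
 proof -
  obtain \<sigma> where s: "\<sigma> : U" "x = val H \<sigma>" using x unfolding UH_def by blast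
  have t: "tc \<sigma> : U" using D.tc_in s(1) by simp
  have "elts y \<subseteq> val H ` elts (tc \<sigma>)" if y: "y : elts x" for y
  proof -
   obtain \<pi> where p: "\<pi> : elts (tc \<sigma>)" "y = val H \<pi>" using y val_hdom hdom_tc unfolding s(2) by blast
   show ?thesis using val_hdom[of _ \<pi>] hdom_tc tc_trans[OF p(1)] unfolding p(2) by blast
  qed
  then show ?thesis using const_name[OF t] by (intro bexI[of _ "val H (times (tc \<sigma>) (upair hempty hempty))"]) auto
 qed
 show "EX b:UH. ALL y:UH. elts y \<subseteq> elts x --> y : elts b" if x: "x : UH" for x
 proof -
  obtain \<sigma> where s: "\<sigma> : U" "x = val H \<sigma>" using x unfolding UH_def by blast
  \<comment> \<open>Every subset of \<open>x\<close> in the extension has a name among the subsets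
    of \<open>times (hdom \<sigma>) P\<close>, and these form a set in \<open>U\<close>.\<close>
  let ?B = "pow U (times (hdom \<sigma>) P)"
  have "times (hdom \<sigma>) P : U" using zfm_closed[OF zf D.dfun_times[OF D.dfun_const[OF hdom_U[OF s(1)]] D.dfun_const[OF P]]] .
  then have B: "?B : U" by (rule zfm_pow[OF zf])
  have "y : val H ` elts ?B" if y: "y : UH" "elts y \<subseteq> elts x" for y
  proof -
   obtain \<eta> where h: "\<eta> : U" "y = val H \<eta>" using y(1) unfolding UH_def by blast
   have "EX \<tau>:U. elts \<tau> \<subseteq> elts (times (hdom \<sigma>) P) & elts (val H \<tau>) = {val H \<pi> | \<pi>. \<pi> : elts (hdom \<sigma>) & sat (\<S> UH) ((val H \<circ> (%_. \<eta>))(0 := val H \<pi>)) (vmem 0 1)}"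
    using name_ex[OF hdom_U[OF s(1)], of "vmem 0 1" "%_. \<eta>" 0] h(1) by (auto simp: image_subset_iff)
   then obtain \<tau> where t: "\<tau> : U" "elts \<tau> \<subseteq> elts (times (hdom \<sigma>) P)"
    "elts (val H \<tau>) = {val H \<pi> | \<pi>. \<pi> : elts (hdom \<sigma>) & sat (\<S> UH) ((val H \<circ> (%_. \<eta>))(0 := val H \<pi>)) (vmem 0 1)}" by blast
   have "elts (val H \<tau>) = {val H \<pi> | \<pi>. \<pi> : elts (hdom \<sigma>) & val H \<pi> : elts y}"
    unfolding t(3) h(2) by (simp add: hmem_elts)
   then have "elts (val H \<tau>) = elts y"
   proof (intro equalityI subsetI)
    fix z assume "z : elts y"
    moreover then obtain \<pi> where "\<pi> : elts (hdom \<sigma>)" "z = val H \<pi>" using y(2) val_hdom[of z \<sigma>] unfolding s(2) by blast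
    moreover assume "elts (val H \<tau>) = {val H \<pi> | \<pi>. \<pi> : elts (hdom \<sigma>) & val H \<pi> : elts y}"
    ultimately show "z : elts (val H \<tau>)" by simp blast
   qed auto
   then have "y = val H \<tau>" by (simp only: elts_inject)
   moreover have "\<tau> : elts ?B" using t(1,2) by (simp only: elts_pow[OF zfm_countable[OF zf]] mem_Collect_eq)
   ultimately show ?thesis by blast
  qed
  then show ?thesis using const_name[OF B] by (intro bexI[of _ "val H (times ?B (upair hempty hempty))"]) auto
 qed
 show "EX b:UH. ALL z:elts x. (EX y:UH. sat (\<S> UH) (e(0 := z, 1 := y)) p) --> (EX y:elts b. sat (\<S> UH) (e(0 := z, 1 := y)) p)"
  if p: "wf_fm {} {} p" and e: "range e \<subseteq> UH" and x: "x : UH" for p e x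
 proof -
  obtain e' where e': "range e' \<subseteq> U" "e = val H \<circ> e'" using UH_names[OF e] by blast
  obtain \<sigma> where s: "\<sigma> : U" "x = val H \<sigma>" using x unfolding UH_def by blast
  have tp: "times (hdom \<sigma>) P : U" using zfm_closed[OF zf D.dfun_times[OF D.dfun_const[OF hdom_U[OF s(1)]] D.dfun_const[OF P]]] .
  \<comment> \<open>Collection in \<open>U\<close> is applied to pairs of a name and a condition,
    forcing \<open>p\<close> being definable. It yields a set \<open>B\<close> of names large enough
    for all witnesses.\<close>
  have "D.dfn 2 (%M f. frc M P (hsnd (f 0)) (%i. if i = 0 then hfst (f 0) else if i = 1 then f 1 else e' i) p)"
  proof (rule D.dfn_frc[where v = "%i M f. if i = 0 then hfst (f 0) else if i = 1 then f 1 else e' i" and s = "%M f. hsnd (f 0)"])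
   show "D.dfun 2 (%M f. if i = 0 then hfst (f 0) else if i = 1 then f 1 else e' i)" for i
    using e'(1) by (cases "i = 0"; cases "i = 1") (auto intro!: D.dfun_var D.dfun_const D.dfun_hfst)
  qed (use p P in \<open>auto intro!: D.dfun_const D.dfun_var D.dfun_hsnd\<close>)
  moreover have "(%i. if i = 0 then z else if i = 1 then y else e' i) = e'(0 := z, 1 := y)" for z y by auto
  ultimately have "D.dfn 2 (%M f. frc M P (hsnd (f 0)) (e'(0 := hfst (f 0), 1 := f 1)) p)" by simp
  from zfm_collection[where R = "%M x y. frc M P (hsnd x) (e'(0 := hfst x, 1 := y)) p", OF zf this tp]
  obtain B where B: "B : U" "!!x. x : elts (times (hdom \<sigma>) P) ==> (EX y:U. frc U P (hsnd x) (e'(0 := hfst x, 1 := y)) p) ==>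
   (EX y:elts B. frc U P (hsnd x) (e'(0 := hfst x, 1 := y)) p)" by blast
  have tr: "sat (\<S> UH) (e(0 := val H \<pi>, 1 := val H \<eta>)) p <-> (EX q:elts H. frc U P q (e'(0 := \<pi>, 1 := \<eta>)) p)"
   if "\<pi> : U" "\<eta> : U" for \<pi> \<eta>
   using truth[OF p, of "e'(0 := \<pi>, 1 := \<eta>)"] that e'(1) unfolding e'(2) by (simp add: fun_upd_comp image_subset_iff)
  show ?thesis
  proof (rule bexI[OF _ const_name(2)[OF B(1)]], intro ballI impI)
   fix z assume z: "z : elts x" "EX y:UH. sat (\<S> UH) (e(0 := z, 1 := y)) p"
   obtain \<pi> where pi: "\<pi> : elts (hdom \<sigma>)" "z = val H \<pi>" using val_hdom z(1) s(2) by blast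
   have pU: "\<pi> : U" using zfm_trans[OF zf hdom_U[OF s(1)] pi(1)] .
   obtain \<eta> where h: "\<eta> : U" "sat (\<S> UH) (e(0 := z, 1 := val H \<eta>)) p" using z(2) unfolding UH_def by blast
   then obtain q where q: "q : elts H" "frc U P q (e'(0 := \<pi>, 1 := \<eta>)) p" using tr[OF pU h(1)] pi(2) by blast
   have "opair \<pi> q : elts (times (hdom \<sigma>) P)" using pi(1) q(1) H_sub by auto
   from B(2)[OF this] obtain \<eta>' where h': "\<eta>' : elts B" "frc U P q (e'(0 := \<pi>, 1 := \<eta>')) p" using q(2) h(1) by auto
   have "sat (\<S> UH) (e(0 := z, 1 := val H \<eta>')) p"
    using tr[OF pU zfm_trans[OF zf B(1) h'(1)]] pi(2) h'(2) q(1) by blast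
   then show "EX y:elts (val H (times B (upair hempty hempty))). sat (\<S> UH) (e(0 := z, 1 := y)) p"
    unfolding const_name(1)[OF B(1)] using h'(1) by blast
  qed
 qed
qed

lemma H_UH: "H : UH"
proof -
 let ?n = "hset ((%p. opair (chk p) p) ` elts P)"
 have "D.dfun 0 (%M e. ?n)" by (intro dfi) (use P in simp_all)
 then have n: "?n : U" using zfm_closed[OF zf] by blast
 have i: "opair \<tau> t : elts ?n <-> t : elts P & \<tau> = chk t" for \<tau> t by auto
 have "elts (val H ?n) = {val H (chk t) | t. t : elts H & t : elts P}" unfolding elts_val[of H ?n] i by blast
 then have "elts (val H ?n) = elts H" using H_sub unfolding val_chk[OF H_one] by blast
 then have e: "val H ?n = H" by (simp only: elts_inject)
 show ?thesis unfolding UH_def by (rule image_eqI[of _ _ ?n]) (rule e[symmetric], rule n)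
qed

text \<open>The names for members of a set are well-ordered in \<open>U\<close>, and the order is
  carried to their values by \<open>wellorder_image\<close>. The extension can evaluate names
  because \<open>H\<close> is one of its elements.\<close>

theorem UH_ctms: "UH : ctms"
proof -
 interpret V: zfmodels "{UH}" UH using UH_zfm by (rule zfm_zfmodels)
 have "models (\<S> UH) ax_choice"
 proof (rule choice_of_wellorders[OF UH_zfm])
  fix x assume x: "x : UH"
  then obtain \<sigma> where s: "\<sigma> : U" "x = val H \<sigma>" unfolding UH_def by blast
  obtain f b where f: "f : U" "b : U" "hord b" "fnl f" "!!d y. opair d y : elts f ==> d : elts b & y : elts (hdom \<sigma>)"
   "!!y. y : elts (hdom \<sigma>) ==> EX d. opair d y : elts f"
   by (rule wellorder[OF hdom_U[OF s(1)]]) blast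
  let ?g = "%k. val H (app f k)" let ?E = "elts x"
  let ?less = "%y z. EX k:elts b. ?g k = y & (ALL k':elts b. ?g k' = z --> k : elts k')"
  let ?r = "hset {p : elts (times x x). ?less (hfst p) (hsnd p)}"
  have "V.dfun 0 (%M e. ?r)" by (intro dfi) (use x f(1,2) U_UH H_UH in auto)
  from zfm_closed[OF UH_zfm this] have r: "?r : UH" .
  have iff: "opair y z : elts ?r <-> y : ?E & z : ?E & ?less y z" for y z
   unfolding elts_hset[OF countable_Collect_elts] by simp
  have sur: "?E \<subseteq> ?g ` elts b"
  proof
   fix y assume "y : ?E"
   then obtain \<pi> where p: "\<pi> : elts (hdom \<sigma>)" "y = val H \<pi>" using val_hdom s(2) by blast
   then obtain d where "opair d \<pi> : elts f" using f(6) by blast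
   then show "y : ?g ` elts b" using f(5) app_eq[OF f(4)] p(2) by (metis imageI)
  qed
  have wf: "wf {(k, k'). k : elts b & k' : elts b & k : elts k'}" by (rule wf_subset[OF wf_elts]) auto
  have tot: "k : elts k' \<or> k' : elts k" if "k : elts b" "k' : elts b" "k ~= k'" for k k'
   using hord_linear[OF hord_mem[OF f(3) that(1)] hord_mem[OF f(3) that(2)]] that(3) by blast
  have "wf {(y, z). opair y z : elts ?r}" unfolding iff by (rule wellorder_image(1)[OF wf tot sur])
  moreover have "opair y z : elts ?r \<or> opair z y : elts ?r" if "y : ?E" "z : ?E" "y ~= z" for y z
   unfolding iff using wellorder_image(2)[OF wf tot sur that] that by blast
  ultimately show "EX r:UH. wf {(y, z). opair y z : elts r} &
   (ALL y:elts x. ALL z:elts x. y ~= z --> opair y z : elts r \<or> opair z y : elts r)"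
   using r by blast
 qed
 then show ?thesis using UH_zfm ctms_zfm by blast
qed

text \<open>Evaluation does not raise ranks, so an ordinal of the extension is at most the rank of
  its name.\<close>

lemma UH_hord: "hord x ==> x : UH ==> x : U"
proof -
 assume x: "hord x" "x : UH"
 then obtain \<sigma> where s: "\<sigma> : U" "x = val H \<sigma>" unfolding UH_def by blast
 have r: "rk \<sigma> : U" using zfm_closed[OF zf D.dfun_rk[OF D.dfun_const[OF s(1)]]] .
 have "elts x \<subseteq> elts (rk \<sigma>)" using rk_val[of H \<sigma>] rk_hord[OF x(1)] s(2) by simp
 then have "x = rk \<sigma> \<or> x : elts (rk \<sigma>)" using hord_subset[OF x(1) hord_rk] by blast
 then show "x : U" using r zfm_trans[OF zf r] by blast
qed

text \<open>For subsets of a set of \<open>U\<close> the elements themselves can replace their check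
  names, so \<open>\<tau>\<close> is read directly and not through \<open>val\<close>.\<close>

theorem nice_name:
 assumes A: "A : U" and y: "y : UH" "elts y \<subseteq> elts A"
 shows "EX \<tau>:U. elts \<tau> \<subseteq> elts (times A P) & elts y = {u : elts A. EX t:elts H. opair u t : elts \<tau>}"
proof -
 let ?D = "hset (chk ` elts A)"
 have "D.dfun 0 (%M e. hset ((%x. chk x) ` elts A))" by (intro dfi) (use A in simp_all)
 then have D: "?D : U" using zfm_closed[OF zf] by blast
 obtain \<eta> where h: "\<eta> : U" "y = val H \<eta>" using y(1) unfolding UH_def by blast
 obtain \<tau> where t: "\<tau> : U" "ALL \<pi>:elts ?D. (EX t:elts H. opair \<pi> t : elts \<tau>) <-> sat (\<S> UH) ((val H \<circ> (%_. \<eta>))(0 := val H \<pi>)) (vmem 0 1)"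
  using name_ex[OF D, of "vmem 0 1" "%_. \<eta>" 0] h(1) by (auto simp: image_subset_iff)
 let ?T = "hset {x : elts (times A P). opair (chk (hfst x)) (hsnd x) : elts \<tau>}"
 have "D.dfun 0 (%M e. ?T)" by (intro dfi) (use A P t in simp_all)
 then have T: "?T : U" using zfm_closed[OF zf] by blast
 have iff: "opair u s : elts ?T <-> u : elts A & s : elts P & opair (chk u) s : elts \<tau>" for u s
  unfolding elts_hset[OF countable_Collect_elts] by simp
 have "u : elts y <-> (EX s:elts H. opair u s : elts ?T)" if u: "u : elts A" for u
 proof -
  have "chk u : elts ?D" using u by simp
  then have "(EX s:elts H. opair (chk u) s : elts \<tau>) <-> u : elts y"
   using t(2)[rule_format, OF \<open>chk u : elts ?D\<close>] h(2) by (simp add: hmem_elts val_chk[OF H_one])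
  then show ?thesis unfolding iff using u H_sub by blast
 qed
 then have "elts y = {u : elts A. EX s:elts H. opair u s : elts ?T}" using y(2) by blast
 moreover have "elts ?T \<subseteq> elts (times A P)" unfolding elts_hset[OF countable_Collect_elts] by blast
 ultimately show ?thesis using T by blast
qed

end

context poset
begin

text \<open>\<open>U\<close> is countable, so its dense sets can be met one after the other along an
  increasing sequence of conditions, which generates the filter.\<close>

theorem generic_exists: "EX H. generic U P H"
proof -
 let ?DD = "{D : U. elts D \<subseteq> elts P & (ALL p:elts P. EX q:elts D. elts p \<subseteq> elts q)}"
 have cD: "countable ?DD" using zfm_countable[OF zf] by (rule countable_subset[rotated]) auto
 have PD: "P : ?DD" using P by auto
 define D where "D = from_nat_into ?DD"
 have rD: "range D = ?DD" unfolding D_def using range_from_nat_into[OF _ cD] PD by blast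
 then have D: "D n : ?DD" for n by blast
 define s where "s = rec_nat hempty (%n p. SOME q. q : elts (D n) & elts p \<subseteq> elts q)"
 have s0: "s 0 = hempty" and sS: "s (Suc n) = (SOME q. q : elts (D n) & elts (s n) \<subseteq> elts q)" for n by (simp_all add: s_def)
 have step: "s (Suc n) : elts (D n) & elts (s n) \<subseteq> elts (s (Suc n))" if "s n : elts P" for n
 proof -
  have "EX q. q : elts (D n) & elts (s n) \<subseteq> elts q" using D[of n] that by blast
  then show ?thesis unfolding sS by (rule someI_ex)
 qed
 have sP: "s n : elts P" for n
 proof (induction n)
  case (Suc n) then show ?case using step[OF Suc] D[of n] by blast
 qed (simp add: s0 one)
 have mono: "elts (s m) \<subseteq> elts (s n)" if "m \<le> n" for m n
  using that by (induction n rule: dec_induct) (use step sP in blast)+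
 let ?H = "hset {p : elts P. EX n. elts p \<subseteq> elts (s n)}"
 have H: "p : elts ?H <-> p : elts P & (EX n. elts p \<subseteq> elts (s n))" for p
  unfolding elts_hset[OF countable_Collect_elts] by simp
 have "generic U P ?H"
 proof (unfold_locales)
  show "elts ?H \<subseteq> elts P" using H by blast
  show "hempty : elts ?H" using H one by auto
  show "p : elts ?H" if "q : elts ?H" "p : elts P" "elts p \<subseteq> elts q" for p q using that unfolding H by blast
  show "EX r:elts ?H. elts p \<subseteq> elts r & elts q \<subseteq> elts r" if pq: "p : elts ?H" "q : elts ?H" for p q
  proof -
   obtain m n where "elts p \<subseteq> elts (s m)" "elts q \<subseteq> elts (s n)" using pq unfolding H by blast
   then have "elts p \<subseteq> elts (s (max m n))" "elts q \<subseteq> elts (s (max m n))"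
    using mono[of m "max m n"] mono[of n "max m n"] by auto
   moreover have "s (max m n) : elts ?H" using H sP by blast
   ultimately show ?thesis by blast
  qed
  show "EX p:elts E. p : elts ?H" if "E : U" "elts E \<subseteq> elts P" "!!p. p : elts P ==> EX q:elts E. elts p \<subseteq> elts q" for E
  proof -
   have "E : ?DD" using that by blast
   then have "E : range D" using rD by blast
   then obtain n where "E = D n" by blast
   then have "s (Suc n) : elts E" using step[OF sP] by blast
   then show ?thesis using H sP by blast
  qed
 qed
 then show ?thesis by blast
qed

end

section \<open>Collapsing one level, and its effect on all levels\<close>

section \<open>Comparing sizes inside a model\<close>

text \<open>Sizes are compared by surjections from part of \<open>b\<close> onto \<open>a\<close>. A
  generic collapse provides just such a map, and diagonalization refutes it. Further pairs in
  \<open>f\<close> are allowed, so nothing has to be trimmed when \<open>a\<close> shrinks or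
  \<open>b\<close> grows.\<close>

definition le :: "hc set => hc => hc => bool" where
 "le U a b <-> (EX f:U. fnl f & (ALL x:elts a. EX y:elts b. opair y x : elts f))"

lemma (in zfmodels) dfn_le [dfi]: "dfun n s ==> dfun n t ==> dfn n (%M e. le M (s M e) (t M e))"
proof (rule dfn_comp2[where R = le])
 show "dfn 2 (%M e. le M (e 0) (e 1))" unfolding le_def by (intro dfi) simp_all
qed

lemma le_mono: "le U a b ==> U \<subseteq> U' ==> elts a' \<subseteq> elts a ==> elts b \<subseteq> elts b' ==> le U' a' b'"
 unfolding le_def by (meson subsetD)

definition Fn :: "hc set => hc => hc => hc" where
 "Fn U x z = hset {f : elts (pow U (times x z)). fnl f}"

definition hran :: "hc => hc" where
 "hran f = hset {y : elts (hunion (hunion f)). EX x:elts (hunion (hunion f)). opair x y : elts f}"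

lemma elts_hran: "elts (hran f) = {y. EX x. opair x y : elts f}"
 unfolding hran_def elts_hset[OF countable_Collect_elts] using opair_field by blast

text \<open>Closure under pairs absorbs products, and the tags 0 and 1 absorb disjoint unions. This
  replaces cardinal arithmetic for the levels.\<close>

definition mul_closed :: "hc => bool" where
 "mul_closed x <-> (ALL a:elts x. ALL b:elts x. opair a b : elts x) & hc_nat 0 : elts x & hc_nat 1 : elts x"

lemma mul_closed_times: "mul_closed x ==> elts (times x x) \<subseteq> elts x"
 unfolding mul_closed_def by auto

context zfmodels
begin

lemma dfun_Fn [dfi]: "dfun n s ==> dfun n t ==> dfun n (%M e. Fn M (s M e) (t M e))"
proof (rule dfun_comp2[where F = Fn])
 show "dfun 2 (%M e. Fn M (e 0) (e 1))" unfolding Fn_def by (intro dfi) simp_all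
qed

lemma dfun_hran [dfi]: "dfun n s ==> dfun n (%M e. hran (s M e))"
proof (rule dfun_comp1[where F = "%M. hran"])
 show "dfun 1 (%M e. hran (e 0))" unfolding hran_def by (intro dfi) simp_all
qed

end

context ctm
begin

lemma closed: "D.dfun 0 t ==> t U (%_. hempty) : U"
 by (rule zfm_closed[OF zf])

lemma tr: "x : U ==> y : elts x ==> y : U"
 by (rule zfm_trans[OF zf])

lemma times_U: "x : U ==> y : U ==> times x y : U"
 using closed[OF D.dfun_times[OF D.dfun_const D.dfun_const]] .

lemma opair_U: "x : U ==> y : U ==> opair x y : U"
 using closed[OF D.dfun_opair[OF D.dfun_const D.dfun_const]] .

lemma hun_U: "x : U ==> y : U ==> hun x y : U"
 using closed[OF D.dfun_hun[OF D.dfun_const D.dfun_const]] .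

lemma elts_powU: "elts (pow U x) = {y : U. elts y \<subseteq> elts x}"
 by (rule elts_pow[OF zfm_countable[OF zf]])

lemma Fn_U: "x : U ==> z : U ==> Fn U x z : U"
 using closed[OF D.dfun_Fn[OF D.dfun_const D.dfun_const]] .

lemma powU_I: "y : U ==> elts y \<subseteq> elts x ==> y : elts (pow U x)"
 by (simp add: elts_powU)

lemma elts_sub_pow: "f : elts (hset {y : elts (pow U x). Q y}) <-> f : U & elts f \<subseteq> elts x & Q f"
 by (subst elts_hset[OF countable_Collect_elts]) (simp only: mem_Collect_eq elts_powU conj_assoc)

lemma elts_Fn: "f : elts (Fn U x z) <-> f : U & fnl f & elts f \<subseteq> elts (times x z)"
 unfolding Fn_def elts_sub_pow by blast

lemma leI:
 assumes a: "a : U" and b: "b : U" and R: "D.dfn 2 (%M e. R (e 0) (e 1))"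
  and fn: "!!y x x'. y : elts b ==> x : elts a ==> x' : elts a ==> R y x ==> R y x' ==> x = x'"
  and on: "!!x. x : elts a ==> EX y:elts b. R y x"
 shows "le U a b"
proof -
 note [dfi] = D.dfn_comp2[where R = "%M. R", OF R]
 let ?f = "hset {p : elts (times b a). R (hfst p) (hsnd p)}"
 have "D.dfun 0 (%M e. ?f)" by (intro dfi) (use a b in simp_all)
 then have f: "?f : U" using closed by blast
 have iff: "opair y x : elts ?f <-> y : elts b & x : elts a & R y x" for y x
  unfolding elts_hset[OF countable_Collect_elts] by simp
 show ?thesis unfolding le_def
 proof (intro bexI[OF _ f] conjI ballI)
  show "fnl ?f" unfolding fnl_iff iff using fn by blast
  show "EX y:elts b. opair y x : elts ?f" if "x : elts a" for x unfolding iff using on that by blast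
 qed
qed

lemma le_subset: "a : U ==> b : U ==> elts a \<subseteq> elts b ==> le U a b"
 by (rule leI[where R = "%y x. y = x"]) (auto intro!: dfi)

lemma le_trans:
 assumes "a : U" "b : U" "c : U" "le U a b" "le U b c" shows "le U a c"
proof -
 obtain f where f: "f : U" "fnl f" "ALL x:elts a. EX y:elts b. opair y x : elts f" using assms(4) unfolding le_def by blast
 obtain g where g: "g : U" "fnl g" "ALL x:elts b. EX y:elts c. opair y x : elts g" using assms(5) unfolding le_def by blast
 show ?thesis
 proof (rule leI[where R = "%y x. EX u:elts b. opair y u : elts g & opair u x : elts f"])
  show "D.dfn 2 (%M e. EX u:elts b. opair (e 0) u : elts g & opair u (e 1) : elts f)"
   by (intro dfi) (use f g assms in simp_all)
  show "x = x'" if "EX u:elts b. opair y u : elts g & opair u x : elts f" "EX u:elts b. opair y u : elts g & opair u x' : elts f" for y x x'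
   using that f(2) g(2) unfolding fnl_iff by blast
  show "EX y:elts c. EX u:elts b. opair y u : elts g & opair u x : elts f" if "x : elts a" for x
   using that f(3) g(3) by blast
 qed (use assms in auto)
qed

lemma le_total:
 assumes a: "a : U" and b: "b : U" shows "le U a b \<or> le U b a"
proof -
 obtain f o1 where f: "f : U" "o1 : U" "hord o1" "fnl f" "!!d y. opair d y : elts f ==> d : elts o1 & y : elts a"
  "!!y. y : elts a ==> EX d. opair d y : elts f" "!!d. d : elts o1 ==> EX y. opair d y : elts f"
  "!!d d' y. opair d y : elts f ==> opair d' y : elts f ==> d = d'" by (rule wellorder[OF a]) blast
 obtain g o2 where g: "g : U" "o2 : U" "hord o2" "fnl g" "!!d y. opair d y : elts g ==> d : elts o2 & y : elts b"
  "!!y. y : elts b ==> EX d. opair d y : elts g" "!!d. d : elts o2 ==> EX y. opair d y : elts g"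
  "!!d d' y. opair d y : elts g ==> opair d' y : elts g ==> d = d'" by (rule wellorder[OF b]) blast
 have sub: "elts o1 \<subseteq> elts o2 \<or> elts o2 \<subseteq> elts o1"
  using hord_linear[OF f(3) g(3)] hord_subset[OF f(3) g(3)] hord_subset[OF g(3) f(3)] by blast
 have 1: "le U a b" if s: "elts o1 \<subseteq> elts o2"
 proof (rule leI[OF a b, where R = "%y x. EX d:elts o1. opair d y : elts g & opair d x : elts f"])
  show "D.dfn 2 (%M e. EX d:elts o1. opair d (e 0) : elts g & opair d (e 1) : elts f)"
   by (intro dfi) (use f(1,2) g(1) in simp_all)
  show "x = x'" if "EX d:elts o1. opair d y : elts g & opair d x : elts f" "EX d:elts o1. opair d y : elts g & opair d x' : elts f" for y x x'
   using that f(4) g(8) unfolding fnl_iff by metis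
  show "EX y:elts b. EX d:elts o1. opair d y : elts g & opair d x : elts f" if x: "x : elts a" for x
  proof -
   obtain d where d: "opair d x : elts f" using f(6) x by blast
   then have "d : elts o1" using f(5) by blast
   then obtain y where "opair d y : elts g" using g(7) s by blast
   then show ?thesis using d \<open>d : elts o1\<close> g(5) by blast
  qed
 qed
 have 2: "le U b a" if s: "elts o2 \<subseteq> elts o1"
 proof (rule leI[OF b a, where R = "%y x. EX d:elts o2. opair d y : elts f & opair d x : elts g"])
  show "D.dfn 2 (%M e. EX d:elts o2. opair d (e 0) : elts f & opair d (e 1) : elts g)"
   by (intro dfi) (use f(1) g(1,2) in simp_all)
  show "x = x'" if "EX d:elts o2. opair d y : elts f & opair d x : elts g" "EX d:elts o2. opair d y : elts f & opair d x' : elts g" for y x x'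
   using that g(4) f(8) unfolding fnl_iff by metis
  show "EX y:elts a. EX d:elts o2. opair d y : elts f & opair d x : elts g" if x: "x : elts b" for x
  proof -
   obtain d where d: "opair d x : elts g" using g(6) x by blast
   then have "d : elts o2" using g(5) by blast
   then obtain y where "opair d y : elts f" using f(7) s by blast
   then show ?thesis using d \<open>d : elts o2\<close> f(5) by blast
  qed
 qed
 show ?thesis using sub 1 2 by blast
qed

lemma le_times:
 assumes "a : U" "b : U" "c : U" "d : U" "le U a b" "le U c d" shows "le U (times a c) (times b d)"
proof -
 obtain f where f: "f : U" "fnl f" "ALL x:elts a. EX y:elts b. opair y x : elts f" using assms(5) unfolding le_def by blast
 obtain g where g: "g : U" "fnl g" "ALL x:elts c. EX y:elts d. opair y x : elts g" using assms(6) unfolding le_def by blast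
 show ?thesis
 proof (rule leI[where R = "%y x. opair (hfst y) (hfst x) : elts f & opair (hsnd y) (hsnd x) : elts g"])
  show "D.dfn 2 (%M e. opair (hfst (e 0)) (hfst (e 1)) : elts f & opair (hsnd (e 0)) (hsnd (e 1)) : elts g)"
   by (intro dfi) (use f g in simp_all)
  show "x = x'" if "x : elts (times a c)" "x' : elts (times a c)" "opair (hfst y) (hfst x) : elts f & opair (hsnd y) (hsnd x) : elts g"
   "opair (hfst y) (hfst x') : elts f & opair (hsnd y) (hsnd x') : elts g" for y x x'
  proof -
   have "hfst x = hfst x'" "hsnd x = hsnd x'" using that(3,4) f(2) g(2) unfolding fnl_iff by blast+
   then show ?thesis using that(1,2) by auto
  qed
  fix x assume "x : elts (times a c)"
  then obtain u v where x: "x = opair u v" "u : elts a" "v : elts c" by auto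
  obtain u' v' where "u' : elts b" "v' : elts d" "opair u' u : elts f" "opair v' v : elts g" using f(3) g(3) x by blast
  then show "EX y:elts (times b d). opair (hfst y) (hfst x) : elts f & opair (hsnd y) (hsnd x) : elts g"
   using x(1) by (intro bexI[of _ "opair u' v'"]) simp_all
 qed (use assms times_U in auto)
qed

lemma le_hun:
 assumes "a : U" "b : U" "c : U" "mul_closed c" "le U a c" "le U b c" shows "le U (hun a b) c"
proof -
 obtain f where f: "f : U" "fnl f" "ALL x:elts a. EX y:elts c. opair y x : elts f" using assms(5) unfolding le_def by blast
 obtain g where g: "g : U" "fnl g" "ALL x:elts b. EX y:elts c. opair y x : elts g" using assms(6) unfolding le_def by blast
 let ?R = "%y x. hfst y = hc_nat 0 & opair (hsnd y) x : elts f \<or> hfst y = hc_nat 1 & opair (hsnd y) x : elts g"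
 show ?thesis
 proof (rule leI[where R = ?R])
  show "D.dfn 2 (%M e. ?R (e 0) (e 1))" by (intro dfi) (use f g in simp_all)
  have 01: "hc_nat 0 ~= hc_nat 1" by (simp only: hc_nat_inject)
  show "x = x'" if "?R y x" "?R y x'" for y x x'
   using that f(2) g(2) 01 unfolding fnl_iff by metis
  fix x assume "x : elts (hun a b)"
  then consider "x : elts a" | "x : elts b" by auto
  then show "EX y:elts c. ?R y x"
  proof cases
   case 1
   then obtain y where "y : elts c" "opair y x : elts f" using f(3) by blast
   then show ?thesis using assms(4) unfolding mul_closed_def by (intro bexI[of _ "opair (hc_nat 0) y"]) auto
  next
   case 2
   then obtain y where "y : elts c" "opair y x : elts g" using g(3) by blast
   then show ?thesis using assms(4) unfolding mul_closed_def by (intro bexI[of _ "opair (hc_nat 1) y"]) auto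
  qed
 qed (use assms hun_U in auto)
qed

lemma le_single: "x : U ==> c : U ==> y : elts c ==> le U (upair x x) c"
 by (rule leI[where R = "%y x. True"]) (auto intro!: dfi zfm_upair[OF zf])

text \<open>A surjection from \<open>X\<close> is chosen for each member of the family, and a pair
  in \<open>X\<close> codes an index together with an argument for the map chosen at that
  index.\<close>

lemma le_union:
 assumes i: "i : U" and X: "X : U" "mul_closed X" and le_i: "le U i X" and G: "D.dfun 1 (%M e. G (e 0))"
  and le_G: "!!j. j : elts i ==> le U (G j) X"
 shows "le U (hunion (hset (G ` elts i))) X" "hunion (hset (G ` elts i)) : U"
proof -
 note [dfi] = D.dfun_comp1[where F = "%M. G", OF G]
 let ?u = "hunion (hset (G ` elts i))"
 have "D.dfun 0 (%M e. hunion (hset ((%j. G j) ` elts i)))" by (intro dfi) (use i in simp_all)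
 then show u: "?u : U" using closed by blast
 have eu: "elts ?u = (\<Union>j\<in>elts i. elts (G j))" by simp
 let ?E = "%j. hset {h : elts (pow U (times X ?u)). fnl h & (ALL x:elts (G j). EX y:elts X. opair y x : elts h)}"
 have "D.dfun 0 (%M e. pow M (pow M (times X ?u)))" by (intro dfi) (use X u in simp_all)
 then have pp: "pow U (pow U (times X ?u)) : U" using closed by blast
 obtain c where c: "c : U" "ALL y:elts (pow U (pow U (times X ?u))). elts y ~= {} --> app c y : elts y"
  using choice_function[OF pp] by blast
 have dE: "D.dfun 1 (%M e. hset {h : elts (pow M (times X ?u)). fnl h & (ALL x:elts (G (e 0)). EX y:elts X. opair y x : elts h)})"
  by (intro dfi) (use X u in simp_all)
 have E_U: "?E j : U" if "j : elts i" for j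
  using D.dfun_in[OF dE, of U "%_. j"] tr[OF i that] by (simp add: image_subset_iff)
 have cE: "app c (?E j) : elts (?E j)" if j: "j : elts i" for j
 proof -
  obtain h where h: "h : U" "fnl h" "ALL x:elts (G j). EX y:elts X. opair y x : elts h" using le_G[OF j] unfolding le_def by blast
  let ?h = "hset {p : elts (times X ?u). p : elts h}"
  have "D.dfun 0 (%M e. ?h)" by (intro dfi) (use X u h in simp_all)
  then have hU: "?h : U" using closed by blast
  have hi: "p : elts ?h <-> p : elts (times X ?u) & p : elts h" for p
   unfolding elts_hset[OF countable_Collect_elts] by simp
  have "?h : elts (?E j)" unfolding elts_sub_pow
  proof (intro conjI hU subsetI ballI)
   show "fnl ?h" using h(2) unfolding fnl_iff hi by blast
   show "p : elts (times X ?u)" if "p : elts ?h" for p using that unfolding hi by blast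
   fix x assume x: "x : elts (G j)"
   then obtain y where "y : elts X" "opair y x : elts h" using h(3) by blast
   moreover have "x : elts ?u" unfolding eu using x j by blast
   ultimately show "EX y:elts X. opair y x : elts ?h" unfolding hi by auto
  qed
  moreover have "elts (?E j) \<subseteq> elts (pow U (times X ?u))" by (subst elts_hset[OF countable_Collect_elts]) blast
  then have "?E j : elts (pow U (pow U (times X ?u)))" by (rule powU_I[OF E_U[OF j]])
  ultimately show ?thesis using c(2) by blast
 qed
 have cE': "fnl (app c (?E j))" "ALL x:elts (G j). EX y:elts X. opair y x : elts (app c (?E j))" if "j : elts i" for j
  using cE[OF that] unfolding elts_hset[OF countable_Collect_elts] by blast+
 obtain f where f: "f : U" "fnl f" "ALL x:elts i. EX y:elts X. opair y x : elts f" using le_i unfolding le_def by blast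
 have "D.dfun 0 (%M e. lam i (%j. app c (hset {h : elts (pow M (times X ?u)). fnl h & (ALL x:elts (G j). EX y:elts X. opair y x : elts h)})))"
  by (intro dfi) (use X u i c in simp_all)
 then have k: "lam i (%j. app c (?E j)) : U" using closed by blast
 define k where "k = lam i (%j. app c (?E j))"
 have kj: "app k j = app c (?E j)" if "j : elts i" for j unfolding k_def using that by simp
 have kU: "k : U" using k unfolding k_def .
 let ?R = "%y x. EX j:elts i. opair (hfst y) j : elts f & opair (hsnd y) x : elts (app k j)"
 show "le U ?u X"
 proof (rule leI[OF u X(1), where R = ?R])
  show "D.dfn 2 (%M e. ?R (e 0) (e 1))" by (intro dfi) (use f i kU in simp_all)
  show "x = x'" if R: "?R y x" "?R y x'" for y x x'
  proof -
   obtain j j' where j: "j : elts i" "j' : elts i" "opair (hfst y) j : elts f" "opair (hfst y) j' : elts f"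
    "opair (hsnd y) x : elts (app k j)" "opair (hsnd y) x' : elts (app k j')" using R by blast
   then have "j = j'" using f(2) unfolding fnl_iff by blast
   then show ?thesis using j(5,6) cE'(1)[OF j(1)] kj[OF j(1)] unfolding fnl_iff by metis
  qed
  fix x assume "x : elts ?u"
  then obtain j where j: "j : elts i" "x : elts (G j)" unfolding eu by blast
  obtain y where y: "y : elts X" "opair y j : elts f" using f(3) j(1) by blast
  obtain y' where y': "y' : elts X" "opair y' x : elts (app k j)" using cE'(2)[OF j(1)] j(2) kj[OF j(1)] by metis
  show "EX y:elts X. ?R y x"
  proof (rule bexI)
   show "?R (opair y y') x" unfolding hfst_opair hsnd_opair using y(2) y'(2) j(1) by blast
   show "opair y y' : elts X" using X(2) y(1) y'(1) unfolding mul_closed_def by blast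
  qed
 qed
qed

text \<open>Two partial functions on \<open>x\<close> are coded by one, using tagged arguments.\<close>

lemma le_Fn_square:
 assumes x: "x : U" "mul_closed x" and z: "z : U"
 shows "le U (times (Fn U x z) (Fn U x z)) (Fn U x z)"
proof -
 define t where "t i h = hset {w : elts (times x z). opair (opair (hc_nat i) (hfst w)) (hsnd w) : elts h}" for i h
 have ti: "opair u v : elts (t i h) <-> u : elts x & v : elts z & opair (opair (hc_nat i) u) v : elts h" for i h u v
  unfolding t_def elts_hset[OF countable_Collect_elts] by simp
 have dt: "D.dfun 1 (%M e. t i (e 0))" for i unfolding t_def by (intro dfi) (use x z in simp_all)
 note [dfi] = D.dfun_comp1[where F = "%M. t _", OF dt]
 show ?thesis
 proof (rule leI[where R = "%h p. p = opair (t 0 h) (t 1 h)"])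
  show "D.dfn 2 (%M e. e 1 = opair (t 0 (e 0)) (t 1 (e 0)))" by (intro dfi) simp_all
  fix p assume "p : elts (times (Fn U x z) (Fn U x z))"
  then obtain f g where p: "p = opair f g" "f : elts (Fn U x z)" "g : elts (Fn U x z)" by auto
  note fg = p(2,3)[unfolded elts_Fn]
  let ?h = "hset {w : elts (times x z). EX u:elts x. EX v:elts z. (w = opair (opair (hc_nat 0) u) v & opair u v : elts f) \<or>
   (w = opair (opair (hc_nat 1) u) v & opair u v : elts g)}"
  have "D.dfun 0 (%M e. ?h)" by (intro dfi) (use x z fg in simp_all)
  then have h: "?h : U" using closed by blast
  have hi: "opair w v : elts ?h <-> w : elts x & v : elts z & (EX u:elts x. (w = opair (hc_nat 0) u & opair u v : elts f) \<or> (w = opair (hc_nat 1) u & opair u v : elts g))" for w v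
   unfolding elts_hset[OF countable_Collect_elts] by auto
  have 01: "hc_nat 0 ~= hc_nat 1" by (simp only: hc_nat_inject)
  have "fnl ?h" using fg unfolding fnl_iff hi by (metis 01 opair_inject)
  moreover have "elts ?h \<subseteq> elts (times x z)" unfolding elts_hset[OF countable_Collect_elts] by blast
  ultimately have hF: "?h : elts (Fn U x z)" unfolding elts_Fn using h by blast
  have i: "opair (opair (hc_nat 0) u) v : elts ?h <-> opair u v : elts f" "opair (opair (hc_nat 1) u) v : elts ?h <-> opair u v : elts g"
   if "u : elts x" "v : elts z" for u v
   unfolding hi using that x(2) 01 unfolding mul_closed_def by (metis opair_inject)+
  have eq: "t k ?h = q" if q: "elts q \<subseteq> elts (times x z)"
   and iq: "!!u v. u : elts x ==> v : elts z ==> opair (opair (hc_nat k) u) v : elts ?h <-> opair u v : elts q" for k q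
  proof (rule elts_eqI)
   fix w
   have "w : elts (t k ?h) ==> EX u v. w = opair u v" "w : elts q ==> EX u v. w = opair u v"
    using q unfolding t_def elts_hset[OF countable_Collect_elts] by auto
   moreover have "opair u v : elts (t k ?h) <-> opair u v : elts q" for u v
   proof (cases "u : elts x & v : elts z")
    case True then show ?thesis unfolding ti using iq by blast
   next
    case False then show ?thesis unfolding ti using subsetD[OF q, of "opair u v"] by auto
   qed
   ultimately show "w : elts (t k ?h) <-> w : elts q" by blast
  qed
  have "t 0 ?h = f" "t 1 ?h = g" using eq[of f 0] eq[of g 1] i fg by blast+
  then show "EX h:elts (Fn U x z). p = opair (t 0 h) (t 1 h)" using hF p(1) by (intro bexI[of _ ?h]) simp_all
 qed (use Fn_U times_U x z in auto)
qed

lemma le_Fn_self: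
 assumes x: "x : U" "mul_closed x" and z: "z : U" "elts x \<subseteq> elts z"
 shows "le U x (Fn U x z)"
proof (rule leI[where R = "%h y. h = upair (opair hempty y) (opair hempty y)"])
 show "D.dfn 2 (%M e. e 0 = upair (opair hempty (e 1)) (opair hempty (e 1)))" by (intro dfi) simp_all
 show "y = y'" if "h = upair (opair hempty y) (opair hempty y)" "h = upair (opair hempty y') (opair hempty y')" for h y y'
  using that by (simp add: upair_inject)
 fix y assume y: "y : elts x"
 have "upair (opair hempty y) (opair hempty y) : elts (Fn U x z)"
  unfolding elts_Fn using y x(2) z tr[OF x(1) y]
  by (auto simp: fnl_iff mul_closed_def intro!: zfm_upair[OF zf] opair_U D.zfm_hempty[OF zf])
 then show "EX h:elts (Fn U x z). h = upair (opair hempty y) (opair hempty y)" by blast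
qed (use x z Fn_U in auto)

theorem cantor:
 assumes X: "X : U" and sub: "!!y. y : U ==> elts y \<subseteq> elts X ==> y : elts Y"
 shows "\<not> le U Y X"
proof
 assume "le U Y X"
 then obtain f where f: "f : U" "fnl f" "ALL y:elts Y. EX x:elts X. opair x y : elts f" unfolding le_def by blast
 let ?d = "hset {x : elts X. x ~: elts (app f x)}"
 have "D.dfun 0 (%M e. ?d)" by (intro dfi) (use X f in simp_all)
 then have d: "?d : U" using closed by blast
 have di: "x : elts ?d <-> x : elts X & x ~: elts (app f x)" for x
  unfolding elts_hset[OF countable_Collect_elts] by simp
 have "?d : elts Y" by (rule sub[OF d]) (use di in blast)
 then obtain x where x: "x : elts X" "opair x ?d : elts f" using f(3) by blast
 then have e: "app f x = ?d" using app_eq[OF f(2)] by blast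
 have "x : elts ?d <-> x : elts X & x ~: elts ?d" using di[of x] unfolding e .
 then show False using x(1) by blast
qed

end

section \<open>Forcing over a model without new short sequences\<close>

text \<open>For a nice name no forcing relation is needed: \<open>u\<close> is put in as soon as the
  condition extends some \<open>t\<close> paired with \<open>u\<close>, and kept out when no further
  extension does so.\<close>

definition forces_lit :: "hc => hc => hc => hc => bool" where
 "forces_lit P \<tau> q u <-> (EX t:elts P. elts t \<subseteq> elts q & opair u t : elts \<tau>)"

definition refutes_lit :: "hc => hc => hc => hc => bool" where
 "refutes_lit P \<tau> q u <-> (ALL r:elts P. elts q \<subseteq> elts r --> \<not> forces_lit P \<tau> r u)"

context zfmodels
begin

lemma dfn_forces_lit [dfi]: "dfun n p ==> dfun n s ==> dfun n t ==> dfun n u ==> dfn n (%M e. forces_lit (p M e) (s M e) (t M e) (u M e))"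
proof (rule dfn_comp4[where R = "%M. forces_lit"])
 show "dfn 4 (%M e. forces_lit (e 0) (e 1) (e 2) (e 3))" unfolding forces_lit_def by (intro dfi) simp_all
qed

lemma dfn_refutes_lit [dfi]: "dfun n p ==> dfun n s ==> dfun n t ==> dfun n u ==> dfn n (%M e. refutes_lit (p M e) (s M e) (t M e) (u M e))"
proof (rule dfn_comp4[where R = "%M. refutes_lit"])
 show "dfn 4 (%M e. refutes_lit (e 0) (e 1) (e 2) (e 3))" unfolding refutes_lit_def by (intro dfi) simp_all
qed

end

context generic
begin

sublocale V: ctm UH by (unfold_locales) (rule UH_ctms)

lemma lit_name:
 assumes A: "A : U" and y: "y : UH" "elts y \<subseteq> elts A"
 obtains \<tau> where "\<tau> : U" "!!u p. u : elts A ==> p : elts H ==> forces_lit P \<tau> p u ==> u : elts y"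
  "!!u p. u : elts y ==> p : elts H ==> refutes_lit P \<tau> p u ==> False"
proof -
 obtain \<tau> where t: "\<tau> : U" "elts y = {u : elts A. EX t:elts H. opair u t : elts \<tau>}" using nice_name[OF A y] by blast
 show ?thesis
 proof (rule that[OF t(1)])
  show "u : elts y" if "u : elts A" "p : elts H" "forces_lit P \<tau> p u" for u p
   using that H_up unfolding forces_lit_def t(2) by blast
  show False if u: "u : elts y" "p : elts H" "refutes_lit P \<tau> p u" for u p
  proof -
   obtain t where tt: "t : elts H" "opair u t : elts \<tau>" using u(1) t(2) by blast
   obtain r where "r : elts H" "elts p \<subseteq> elts r" "elts t \<subseteq> elts r" using H_dir[OF u(2) tt(1)] by blast
   then show False using u(3) tt H_sub unfolding refutes_lit_def forces_lit_def by blast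
  qed
 qed
qed

text \<open>\<open>g\<close> sends an argument and a condition to the only value that this condition
  settles. All values of the new function are thus covered by an old one on
  \<open>times b P\<close>.\<close>

lemma function_name:
 assumes a: "a : U" and b: "b : U" and f: "f : UH" "fnl f" "elts f \<subseteq> elts (times b a)"
 obtains g where "g : U" "fnl g" "elts g \<subseteq> elts (times (times b P) a)"
  "!!y x. opair y x : elts f <-> (EX p:elts H. opair (opair y p) x : elts g)"
proof -
 obtain \<tau> where t: "\<tau> : U" "!!u p. u : elts (times b a) ==> p : elts H ==> forces_lit P \<tau> p u ==> u : elts f"
  "!!u p. u : elts f ==> p : elts H ==> refutes_lit P \<tau> p u ==> False"
  by (rule lit_name[OF times_U[OF b a] f(1,3)]) blast
 \<comment> \<open>The condition settles one value and refutes every other one; the second half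
   makes \<open>g\<close> single-valued.\<close>
 let ?Q = "%p y x. forces_lit P \<tau> p (opair y x) & (ALL x':elts a. x' ~= x --> refutes_lit P \<tau> p (opair y x'))"
 let ?g = "hset {w : elts (times (times b P) a). ?Q (hsnd (hfst w)) (hfst (hfst w)) (hsnd w)}"
 have "D.dfun 0 (%M e. ?g)" by (intro dfi) (use a b P t(1) in simp_all)
 then have g: "?g : U" using closed by blast
 have gi: "opair (opair y p) x : elts ?g <-> y : elts b & p : elts P & x : elts a & ?Q p y x" for y p x
  unfolding elts_hset[OF countable_Collect_elts] by simp
 show ?thesis
 proof (rule that[OF g])
  show sub: "elts ?g \<subseteq> elts (times (times b P) a)" unfolding elts_hset[OF countable_Collect_elts] by blast
  show "fnl ?g" unfolding fnl_iff
  proof (intro allI impI)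
   fix w x x' assume w: "opair w x : elts ?g" "opair w x' : elts ?g"
   then obtain y p where wy: "w = opair y p" "p : elts P" using sub by fastforce
   have q: "?Q p y x" "?Q p y x'" "x' : elts a" using w unfolding wy(1) gi by blast+
   show "x = x'"
   proof (rule ccontr)
    assume "x ~= x'"
    then have "x' ~= x" by blast
    then have "refutes_lit P \<tau> p (opair y x')" using q(1,3) by blast
    then have "\<not> forces_lit P \<tau> p (opair y x')" unfolding refutes_lit_def using wy(2) by blast
    then show False using q(2) by blast
   qed
  qed
  fix y x
  show "opair y x : elts f <-> (EX p:elts H. opair (opair y p) x : elts ?g)"
  proof
   assume yx: "opair y x : elts f"
   then have yx': "y : elts b" "x : elts a" using f(3) by auto
   \<comment> \<open>Densely often \<open>x\<close> is settled as the value, another value is put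
     in, or \<open>x\<close> is refuted. As \<open>opair y x\<close> is in the function
     \<open>f\<close>, a condition of the filter can only do the first.\<close>
   have "EX p:elts H. ?Q p y x \<or> (EX x':elts a. x' ~= x & forces_lit P \<tau> p (opair y x')) \<or> refutes_lit P \<tau> p (opair y x)"
   proof (rule H_gen_dfn[OF _ H_one])
    show "D.dfn 1 (%M e. ?Q (e 0) y x \<or> (EX x':elts a. x' ~= x & forces_lit P \<tau> (e 0) (opair y x')) \<or> refutes_lit P \<tau> (e 0) (opair y x))"
     by (intro dfi) (use P t(1) a tr[OF b yx'(1)] tr[OF a yx'(2)] in simp_all)
    fix p assume p: "p : elts P"
    show "EX r:elts P. elts p \<subseteq> elts r & (?Q r y x \<or> (EX x':elts a. x' ~= x & forces_lit P \<tau> r (opair y x')) \<or> refutes_lit P \<tau> r (opair y x))"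
    proof (cases "refutes_lit P \<tau> p (opair y x)")
     case False
     then obtain r where r: "r : elts P" "elts p \<subseteq> elts r" "forces_lit P \<tau> r (opair y x)" unfolding refutes_lit_def by blast
     show ?thesis
     proof (cases "ALL x':elts a. x' ~= x --> refutes_lit P \<tau> r (opair y x')")
      case True then show ?thesis using r by blast
     next
      case False
      then obtain x' where x': "x' : elts a" "x' ~= x" "\<not> refutes_lit P \<tau> r (opair y x')" by blast
      then obtain r' where "r' : elts P" "elts r \<subseteq> elts r'" "forces_lit P \<tau> r' (opair y x')" unfolding refutes_lit_def by blast
      then show ?thesis using r(2) x'(1,2) by blast
     qed
    qed (use p in blast)
   qed
   then obtain p where p: "p : elts H" "?Q p y x \<or> (EX x':elts a. x' ~= x & forces_lit P \<tau> p (opair y x')) \<or> refutes_lit P \<tau> p (opair y x)" by blast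
   have "\<not> (EX x':elts a. x' ~= x & forces_lit P \<tau> p (opair y x'))"
   proof
    assume "EX x':elts a. x' ~= x & forces_lit P \<tau> p (opair y x')"
    then obtain x' where x': "x' : elts a" "x' ~= x" "forces_lit P \<tau> p (opair y x')" by blast
    have "opair y x' : elts f" by (rule t(2)[OF _ p(1) x'(3)]) (use yx'(1) x'(1) in simp)
    then show False using yx x'(2) f(2) unfolding fnl_iff by blast
   qed
   then have "?Q p y x" using p t(3)[OF yx p(1)] by blast
   then show "EX p:elts H. opair (opair y p) x : elts ?g" unfolding gi using p(1) yx' H_sub by blast
  next
   assume "EX p:elts H. opair (opair y p) x : elts ?g"
   then obtain p where p: "p : elts H" "y : elts b" "x : elts a" "forces_lit P \<tau> p (opair y x)" unfolding gi by blast
   show "opair y x : elts f" by (rule t(2)[OF _ p(1,4)]) (use p in simp)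
  qed
 qed
qed

lemma le_restrict:
 assumes "le UH a b" "a : U" "b : U"
 obtains f where "f : UH" "fnl f" "elts f \<subseteq> elts (times b a)" "!!x. x : elts a ==> EX y:elts b. opair y x : elts f"
proof -
 obtain f where f: "f : UH" "fnl f" "ALL x:elts a. EX y:elts b. opair y x : elts f" using assms(1) unfolding le_def by blast
 let ?f = "hset {p : elts (times b a). p : elts f}"
 have "a : UH" "b : UH" using assms U_UH by blast+
 then have "V.D.dfun 0 (%M e. ?f)" by (intro dfi) (use f in simp_all)
 then have "?f : UH" using V.closed by blast
 moreover have i: "p : elts ?f <-> p : elts (times b a) & p : elts f" for p
  unfolding elts_hset[OF countable_Collect_elts] by simp
 moreover have "fnl ?f" using f(2) unfolding fnl_iff i by blast
 moreover have "EX y:elts b. opair y x : elts ?f" if "x : elts a" for x using f(3) that unfolding i by auto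
 ultimately show ?thesis using that by blast
qed

text \<open>Each argument takes at most one value per condition, so in \<open>U\<close> the pairs of
  an argument and a condition already suffice to reach all of \<open>a\<close>.\<close>

lemma le_small:
 assumes "le UH a b" "a : U" "b : U" shows "le U a (times b P)"
proof -
 obtain f where f: "f : UH" "fnl f" "elts f \<subseteq> elts (times b a)" "!!x. x : elts a ==> EX y:elts b. opair y x : elts f"
  by (rule le_restrict[OF assms]) blast
 obtain g where g: "g : U" "fnl g" "elts g \<subseteq> elts (times (times b P) a)"
  "!!y x. opair y x : elts f <-> (EX p:elts H. opair (opair y p) x : elts g)"
  by (rule function_name[OF assms(2,3) f(1,2,3)]) blast
 show ?thesis unfolding le_def
 proof (intro bexI[OF _ g(1)] conjI g(2) ballI)
  fix x assume "x : elts a"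
  then obtain y p where yp: "opair (opair y p) x : elts g" using f(4) g(4) by blast
  then have "opair y p : elts (times b P)" using subsetD[OF g(3) yp] by auto
  then show "EX y:elts (times b P). opair y x : elts g" using yp by blast
 qed
qed

end

text \<open>The union of the chain is a bound for it; \<open>X\<close> measures how short chains have to be.\<close>

locale closed_generic = generic +
 fixes X assumes X: "X : U" "mul_closed X"
  and P_fnl: "p : elts P ==> fnl p & le U p X"
  and P_I: "p : U ==> fnl p ==> le U p X ==> EX C. C \<subseteq> elts P & elts p = \<Union> (elts ` C) ==> p \<in> elts P"
begin

text \<open>Transfinite construction along a well-order of \<open>X\<close>: each step chooses an
  extension deciding the value at one more argument. The union of the earlier choices is again a
  condition, because it is a chain of length at most \<open>X\<close>.\<close>

lemma decide_all:
 assumes A: "A : U" and t: "\<tau> : U" and p0: "p0 : elts P"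
 shows "EX q:elts P. elts p0 \<subseteq> elts q & (ALL x:elts X. (EX a:elts A. forces_lit P \<tau> q (opair x a)) \<or>
  (ALL a:elts A. refutes_lit P \<tau> q (opair x a)))"
proof -
 let ?dec = "%q x. (EX a:elts A. forces_lit P \<tau> q (opair x a)) \<or> (ALL a:elts A. refutes_lit P \<tau> q (opair x a))"
 have dec_mono: "?dec r x" if q: "?dec q x" "r : elts P" "elts q \<subseteq> elts r" for q r x
  using q unfolding forces_lit_def refutes_lit_def by (meson order_trans)
 have dec_ex: "EX r:elts P. elts q \<subseteq> elts r & ?dec r x" if "q : elts P" for q x
  using that unfolding refutes_lit_def by blast
 obtain e i where e: "e : U" "i : U" "hord i" "fnl e" "!!d y. opair d y : elts e ==> d : elts i & y : elts X"
  "!!y. y : elts X ==> EX d. opair d y : elts e" "!!d. d : elts i ==> EX y. opair d y : elts e"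
  "!!d d' y. opair d y : elts e ==> opair d' y : elts e ==> d = d'" by (rule wellorder[OF X(1)]) blast
 obtain c where c: "c : U" "ALL y:elts (pow U P). elts y ~= {} --> app c y : elts y"
  using choice_function[OF zfm_pow[OF zf P]] by blast
 define step where "step j u = app c (hset {q : elts P. elts p0 \<subseteq> elts q & elts u \<subseteq> elts q & ?dec q (app e j)})" for j u
 \<comment> \<open>\<open>G\<close> is obtained by recursion outside \<open>U\<close>. Its
   definability in \<open>U\<close>, proved next as \<open>dG\<close>, makes the unions of its
   initial segments sets of \<open>U\<close>.\<close>
 have "EX G. ALL j. G j = step j (hunion (hset (G ` elts j)))"
 proof -
  define G where "G = wfrec {(x, y). x : elts y} (%G j. step j (hunion (hset (G ` elts j))))"
  have "G j = step j (hunion (hset (G ` elts j)))" for j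
   unfolding G_def by (subst wfrec[OF wf_elts]) (auto simp: cut_apply intro!: arg_cong[where f = "step j"] arg_cong[where f = hunion] arg_cong[where f = hset] image_cong)
  then show ?thesis by blast
 qed
 then obtain G where G: "!!j. G j = step j (hunion (hset (G ` elts j)))" by blast
 have p0U: "p0 : U" using P_U[OF p0] .
 have dstep: "D.dfun 2 (%M f. step (f 0) (f 1))"
  unfolding step_def by (intro dfi) (use c P p0U A t e in simp_all)
 have "D.dfun 2 (%M f. G (f 1))"
 proof (rule D.dfun_mem_rec[where F = "%M z j. G j" and H = "%M z j f. step j (hunion (hset ((%k. app f k) ` elts j)))"])
  note [dfi] = D.dfun_comp2[where F = "%M. step", OF dstep]
  show "D.dfun 3 (%M f. step (f 1) (hunion (hset ((%k. app (f 2) k) ` elts (f 1)))))" by (intro dfi) simp_all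
  show "G j = step j (hunion (hset ((%k. app (lam j G) k) ` elts j)))" for j
   by (subst G) (simp cong: image_cong_simp)
 qed
 from D.dfun_comp2[OF this D.dfun_var D.dfun_var, of 0 1 0]
 have dG: "D.dfun 1 (%M f. G (f 0))" by simp
 have leX: "le U j X" if "elts j \<subseteq> elts i" "j : U" for j
 proof (rule leI[where R = "%x d. opair d x : elts e"])
  show "D.dfn 2 (%M f. opair (f 1) (f 0) : elts e)" by (intro dfi) (use e in simp_all)
  show "x = x'" if "opair x y : elts e" "opair x' y : elts e" for y x x' using e(8) that .
  show "EX y:elts X. opair x y : elts e" if "x : elts j" for x using that \<open>elts j \<subseteq> elts i\<close> e(5,7) by blast
 qed (use that X in auto)
 let ?W = "%j. hun p0 (hunion (hset (G ` elts j)))"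
 have W: "?W j : elts P" if j: "j : U" "elts j \<subseteq> elts i" "hord j"
  and IH: "!!k. k : elts j ==> G k : elts P & elts p0 \<subseteq> elts (G k) & (ALL l:elts k. elts (G l) \<subseteq> elts (G k))" for j
 proof -
  have chain: "elts (G k) \<subseteq> elts (G l) \<or> elts (G l) \<subseteq> elts (G k)" if "k : elts j" "l : elts j" for k l
   using hord_linear[OF hord_mem[OF j(3) that(1)] hord_mem[OF j(3) that(2)]] IH that by blast
  have u: "le U (hunion (hset (G ` elts j))) X" "hunion (hset (G ` elts j)) : U"
   by (rule le_union[OF j(1) X leX[OF j(2,1)] dG]; use IH P_fnl in blast)+
  have l: "le U (?W j) X" by (rule le_hun[OF p0U u(2) X _ u(1)]) (use P_fnl[OF p0] in blast)
  have eW: "elts (?W j) = elts p0 \<union> (\<Union>k\<in>elts j. elts (G k))" by simp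
  have "fnl (?W j)"
  proof (cases "elts j = {}")
   case True then show ?thesis using P_fnl[OF p0] unfolding fnl_iff eW by blast
  next
   case False
   then have e2: "elts (?W j) = (\<Union>k\<in>elts j. elts (G k))" unfolding eW using IH by blast
   show ?thesis unfolding fnl_iff e2
   proof (intro allI impI)
    fix x y y' assume "opair x y : (\<Union>k\<in>elts j. elts (G k))" "opair x y' : (\<Union>k\<in>elts j. elts (G k))"
    then obtain k l where kl: "k : elts j" "l : elts j" "opair x y : elts (G k)" "opair x y' : elts (G l)" by blast
    then have "(opair x y : elts (G l) & fnl (G l)) \<or> (opair x y' : elts (G k) & fnl (G k))" using chain[OF kl(1,2)] IH P_fnl by blast
    then show "y = y'" using kl unfolding fnl_iff by blast
   qed
  qed
  moreover have "EX C. C \<subseteq> elts P & elts (?W j) = \<Union> (elts ` C)"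
   using IH p0 unfolding eW by (intro exI[of _ "insert p0 (G ` elts j)"]) auto
  ultimately show ?thesis using P_I[OF hun_U[OF p0U u(2)] _ l] by blast
 qed
 have Gj: "j \<in> elts i --> G j : elts P & elts p0 \<subseteq> elts (G j) & (ALL l:elts j. elts (G l) \<subseteq> elts (G j)) & ?dec (G j) (app e j)" for j
 proof (induction j rule: hc_induct)
  case (step j)
  show ?case
  proof
   assume j: "j : elts i"
   have ji: "elts j \<subseteq> elts i" using hord_trans[OF e(3) j] by blast
   have IH: "G k : elts P & elts p0 \<subseteq> elts (G k) & (ALL l:elts k. elts (G l) \<subseteq> elts (G k))" if "k : elts j" for k
    using step[OF that] ji that by blast
   have w: "?W j : elts P" by (rule W[OF tr[OF e(2) j] ji hord_mem[OF e(3) j] IH])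
   obtain q where q: "q : elts P" "elts (?W j) \<subseteq> elts q" "?dec q (app e j)" using dec_ex[OF w] by blast
   let ?u = "hunion (hset (G ` elts j))"
   let ?E = "hset {q : elts P. elts p0 \<subseteq> elts q & elts ?u \<subseteq> elts q & ?dec q (app e j)}"
   have eE: "elts ?E = {q : elts P. elts p0 \<subseteq> elts q & elts ?u \<subseteq> elts q & ?dec q (app e j)}" by (rule elts_hset[OF countable_Collect_elts])
   have "elts (?W j) = elts p0 \<union> elts ?u" by (rule elts_hun)
   then have "q : elts ?E" unfolding eE using q by blast
   have uU: "?u : U" by (rule le_union(2)[OF tr[OF e(2) j] X leX[OF ji tr[OF e(2) j]] dG]) (use IH P_fnl in blast)
   have "D.dfun 0 (%M f. ?E)" by (intro dfi) (use c P p0U A t e uU tr[OF e(2) j] in simp_all)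
   then have "?E : U" using closed by blast
   moreover have "elts ?E \<subseteq> elts P" unfolding eE by blast
   ultimately have "?E : elts (pow U P)" by (rule powU_I)
   then have "app c ?E : elts ?E" using c(2) \<open>q : elts ?E\<close> by blast
   moreover have "G j = app c ?E" by (subst G) (simp only: step_def)
   ultimately have g: "G j : elts P" "elts p0 \<subseteq> elts (G j)" "elts ?u \<subseteq> elts (G j)" "?dec (G j) (app e j)" unfolding eE by auto
   have "elts ?u = (\<Union>k\<in>elts j. elts (G k))" by simp
   then show "G j : elts P & elts p0 \<subseteq> elts (G j) & (ALL l:elts j. elts (G l) \<subseteq> elts (G j)) & ?dec (G j) (app e j)"
    using g by blast
  qed
 qed
 have w: "?W i : elts P" by (rule W[OF e(2) _ e(3)]) (use Gj in blast)+
 have eW: "elts (?W i) = elts p0 \<union> (\<Union>k\<in>elts i. elts (G k))" by simp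
 show ?thesis
 proof (intro bexI[OF _ w] conjI ballI)
  show "elts p0 \<subseteq> elts (?W i)" unfolding eW by blast
  fix x assume "x : elts X"
  then obtain d where d: "opair d x : elts e" using e(6) by blast
  then have "d : elts i" "app e d = x" using e(5) app_eq[OF e(4)] by blast+
  then have "?dec (G d) x" "elts (G d) \<subseteq> elts (?W i)" using Gj[of d] unfolding eW by blast+
  then show "?dec (?W i) x" using dec_mono[OF _ w] by blast
 qed
qed

lemma no_new_functions_X:
 assumes A: "A : U" and f: "f : UH" "fnl f" "elts f \<subseteq> elts (times X A)"
 shows "f : U"
proof -
 obtain \<tau> where t: "\<tau> : U" "!!u p. u : elts (times X A) ==> p : elts H ==> forces_lit P \<tau> p u ==> u : elts f"
  "!!u p. u : elts f ==> p : elts H ==> refutes_lit P \<tau> p u ==> False"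
  by (rule lit_name[OF times_U[OF X(1) A] f(1,3)]) blast
 let ?Q = "%q. ALL x:elts X. (EX a:elts A. forces_lit P \<tau> q (opair x a)) \<or> (ALL a:elts A. refutes_lit P \<tau> q (opair x a))"
 have "EX q:elts H. ?Q q"
 proof (rule H_gen_dfn[OF _ H_one])
  show "D.dfn 1 (%M e. ?Q (e 0))" by (intro dfi) (use A P t(1) X in simp_all)
  show "EX r:elts P. elts p \<subseteq> elts r & ?Q r" if "p : elts P" for p using decide_all[OF A t(1) that] .
 qed
 then obtain q where q: "q : elts H" "?Q q" by blast
 have "u : elts f <-> u : elts (times X A) & forces_lit P \<tau> q u" for u
 proof
  assume u: "u : elts f"
  then obtain x a where ux: "u = opair x a" "x : elts X" "a : elts A" using f(3) by auto
  then consider a' where "a' : elts A" "forces_lit P \<tau> q (opair x a')" | "refutes_lit P \<tau> q u" using q(2) by blast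
  then show "u : elts (times X A) & forces_lit P \<tau> q u"
  proof cases
   case 1
   have "opair x a' : elts f" by (rule t(2)[OF _ q(1) 1(2)]) (use ux 1 in simp)
   then have "a' = a" using u f(2) unfolding ux(1) fnl_iff by blast
   then show ?thesis using 1 ux u f(3) by blast
  next
   case 2 then show ?thesis using t(3)[OF u q(1)] by blast
  qed
 qed (use t(2) q(1) in blast)
 then have "f = hset {u : elts (times X A). forces_lit P \<tau> q u}"
  by (intro elts_eqI) (simp only: elts_hset[OF countable_Collect_elts] mem_Collect_eq)
 moreover have "D.dfun 0 (%M e. hset {u : elts (times X A). forces_lit P \<tau> q u})"
  by (intro dfi) (use A P t(1) X P_U q(1) H_sub in auto)
 ultimately show ?thesis using closed by metis
qed

theorem no_new_functions:
 assumes A: "A : U" and b: "b : U" "le U b X" and f: "f : UH" "fnl f" "elts f \<subseteq> elts (times b A)"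
 shows "f : U"
proof -
 obtain e where e: "e : U" "fnl e" "ALL x:elts b. EX y:elts X. opair y x : elts e" using b(2) unfolding le_def by blast
 \<comment> \<open>Composition with the surjection \<open>e\<close> from \<open>X\<close> onto
   \<open>b\<close> pulls \<open>f\<close> back to a function on \<open>X\<close>, which is not new;
   \<open>f\<close> is recovered from it and \<open>e\<close>.\<close>
 let ?g = "hset {w : elts (times X A). EX y:elts b. opair (hfst w) y : elts e & opair y (hsnd w) : elts f}"
 have in_UH: "A : UH" "b : UH" "e : UH" "X : UH" using A b e X U_UH by blast+
 then have "V.D.dfun 0 (%M d. ?g)" by (intro dfi) (use f in simp_all)
 then have g: "?g : UH" using V.closed by blast
 have gi: "opair u a : elts ?g <-> u : elts X & a : elts A & (EX y:elts b. opair u y : elts e & opair y a : elts f)" for u a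
  unfolding elts_hset[OF countable_Collect_elts] by simp
 have "?g : U"
 proof (rule no_new_functions_X[OF A g])
  show "fnl ?g" unfolding fnl_iff gi using e(2) f(2) unfolding fnl_iff by metis
  show "elts ?g \<subseteq> elts (times X A)" unfolding elts_hset[OF countable_Collect_elts] by blast
 qed
 let ?f = "hset {w : elts (times b A). EX u:elts X. opair u (hfst w) : elts e & opair u (hsnd w) : elts ?g}"
 have "D.dfun 0 (%M d. ?f)" by (intro dfi) (use A b e X \<open>?g : U\<close> in simp_all)
 then have "?f : U" using closed by blast
 moreover have "?f = f"
 proof (rule elts_eqI)
  fix w
  have "opair y a : elts ?f <-> opair y a : elts f" if ya: "y : elts b" "a : elts A" for y a
  proof -
   obtain u where u: "u : elts X" "opair u y : elts e" using e(3) ya by blast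
   have "opair y a : elts ?f <-> (EX u:elts X. opair u y : elts e & opair u a : elts ?g)"
    unfolding elts_hset[OF countable_Collect_elts] using ya by simp
   also have "\<dots> <-> opair y a : elts f" unfolding gi using u ya e(2) unfolding fnl_iff by blast
   finally show ?thesis .
  qed
  moreover have "w : elts ?f ==> EX y a. w = opair y a & y : elts b & a : elts A"
   unfolding elts_hset[OF countable_Collect_elts] by auto
  moreover have "w : elts f ==> EX y a. w = opair y a & y : elts b & a : elts A" using f(3) by auto
  ultimately show "w : elts ?f <-> w : elts f" by blast
 qed
 ultimately show ?thesis by simp
qed

end

section \<open>Collapsing one level at a time\<close>

definition lev_ok :: "(nat => hc) => (nat => hc) => (nat => hc) => bool" where
 "lev_ok X Y Z <-> (ALL n. mul_closed (X n) & mul_closed (Y n) & mul_closed (Z n) &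
   elts (X n) \<subseteq> elts (Y n) & elts (Y n) \<subseteq> elts (Z n) & elts (Z n) \<subseteq> elts (X (Suc n)))"

definition pushed :: "hc set => (nat => hc) => (nat => hc) => nat set" where
 "pushed U Y Z = {n. le U (Z n) (Y n)}"

text \<open>Loss of the two gaps that a collapse relies on: the first keeps a condition from
  exhausting \<open>Y n\<close>, the second keeps the forcing of level \<open>n\<close> small
  compared with all later levels. Both losses persist in extensions.\<close>

definition corrupt :: "hc set => (nat => hc) => (nat => hc) => (nat => hc) => bool" where
 "corrupt U X Y Z <-> (EX n. le U (Y n) (X n) \<or> le U (X (Suc n)) (Fn U (X n) (Z n)))"

lemma Fn_mono:
 assumes "U : ctms" "U' : ctms" "U \<subseteq> U'" shows "elts (Fn U x z) \<subseteq> elts (Fn U' x z)"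
proof -
 interpret A: ctm U using assms by unfold_locales
 interpret B: ctm U' using assms by unfold_locales
 show ?thesis using assms(3) A.elts_Fn B.elts_Fn by blast
qed

lemma corrupt_mono: "U : ctms ==> U' : ctms ==> U \<subseteq> U' ==> corrupt U X Y Z ==> corrupt U' X Y Z"
proof -
 assume U: "U : ctms" "U' : ctms" "U \<subseteq> U'" and "corrupt U X Y Z"
 then obtain n where "le U (Y n) (X n) \<or> le U (X (Suc n)) (Fn U (X n) (Z n))" unfolding corrupt_def by blast
 then have "le U' (Y n) (X n) \<or> le U' (X (Suc n)) (Fn U' (X n) (Z n))"
  using le_mono[OF _ U(3) order_refl order_refl] le_mono[OF _ U(3) order_refl Fn_mono[OF U]] by blast
 then show ?thesis unfolding corrupt_def by blast
qed

locale collapse = ctm U for U +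
 fixes X Y Z :: "nat => hc" and n :: nat
 assumes ok: "lev_ok X Y Z" and in_U: "X i : U" "Y i : U" "Z i : U" and ncor: "\<not> corrupt U X Y Z"
begin

lemma mul: "mul_closed (X i)" "mul_closed (Y i)" "mul_closed (Z i)"
 using ok unfolding lev_ok_def by blast+

lemma sub: "elts (X i) \<subseteq> elts (Y i)" "elts (Y i) \<subseteq> elts (Z i)" "elts (Z i) \<subseteq> elts (X (Suc i))"
 using ok unfolding lev_ok_def by blast+

lemma X_mono: "i \<le> j ==> elts (X i) \<subseteq> elts (X j)"
proof -
 have "elts (X k) \<subseteq> elts (X (Suc k))" for k using sub[of k] by blast
 then show "i \<le> j ==> elts (X i) \<subseteq> elts (X j)" by (rule lift_Suc_mono_le)
qed

lemma Y_X: "i < j ==> elts (Y i) \<subseteq> elts (X j)"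
 using X_mono[of "Suc i" j] sub[of i] by auto

lemma no_le: "\<not> le U (Y i) (X i)" "\<not> le U (X (Suc i)) (Fn U (X i) (Z i))"
 using ncor unfolding corrupt_def by blast+

definition P :: hc where "P = hset {p : elts (pow U (times (Y n) (Z n))). fnl p & le U p (X n)}"

lemma elts_P: "p : elts P <-> p : U & elts p \<subseteq> elts (times (Y n) (Z n)) & fnl p & le U p (X n)"
 unfolding P_def elts_sub_pow by blast

lemma Pn_U: "P : U"
proof -
 have "D.dfun 0 (%M e. hset {p : elts (pow M (times (Y n) (Z n))). fnl p & le M p (X n)})"
  by (intro dfi) (use in_U in simp_all)
 from closed[OF this] show ?thesis unfolding P_def .
qed

lemma hempty_P: "hempty : elts P"
 unfolding elts_P using D.zfm_hempty[OF zf]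
 by (auto simp: fnl_iff le_def intro!: bexI[of _ hempty])

sublocale poset U P
 using Pn_U hempty_P by unfold_locales

lemma le_sq: "le U (times x x) x" if "x : U" "mul_closed x" for x
 by (rule le_subset) (use that times_U mul_closed_times in auto)

text \<open>A condition is the range of a partial function on \<open>X n\<close>. Its members are
  pairs from \<open>Y n\<close> and \<open>Z n\<close>, and these lie in \<open>Z n\<close> because
  \<open>Z n\<close> is closed under pairing.\<close>

lemma le_P_Fn: "le U P (Fn U (X n) (Z n))"
proof (rule leI[where R = "%h p. p = hran h"])
 show "D.dfn 2 (%M e. e 1 = hran (e 0))" by (intro dfi) simp_all
 fix p assume p: "p : elts P"
 then obtain f where f: "f : U" "fnl f" "ALL x:elts p. EX y:elts (X n). opair y x : elts f"
  unfolding elts_P le_def by blast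
 have pZ: "elts p \<subseteq> elts (Z n)"
 proof
  fix w assume "w : elts p"
  then obtain y z where "w = opair y z" "y : elts (Y n)" "z : elts (Z n)" using p unfolding elts_P by auto
  then show "w : elts (Z n)" using sub(2)[of n] mul(3)[of n] unfolding mul_closed_def by blast
 qed
 let ?h = "hset {w : elts (times (X n) p). w : elts f}"
 have "D.dfun 0 (%M e. ?h)" by (intro dfi) (use in_U f(1) p elts_P in simp_all)
 then have h: "?h : U" using closed by blast
 have hi: "opair y x : elts ?h <-> y : elts (X n) & x : elts p & opair y x : elts f" for y x
  unfolding elts_hset[OF countable_Collect_elts] by simp
 have "elts ?h \<subseteq> elts (times (X n) p)" unfolding elts_hset[OF countable_Collect_elts] by blast
 moreover have "elts (times (X n) p) \<subseteq> elts (times (X n) (Z n))" using pZ by auto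
 ultimately have "elts ?h \<subseteq> elts (times (X n) (Z n))" by (rule order_trans)
 moreover have "fnl ?h" using f(2) unfolding fnl_iff hi by blast
 ultimately have "?h : elts (Fn U (X n) (Z n))" unfolding elts_Fn using h by blast
 moreover have "p = hran ?h"
 proof (rule elts_eqI)
  show "x : elts p <-> x : elts (hran ?h)" for x unfolding elts_hran mem_Collect_eq hi using f(3) by blast
 qed
 ultimately show "EX h:elts (Fn U (X n) (Z n)). p = hran h" by (rule rev_bexI)
qed (use Pn_U Fn_U in_U in auto)

lemma le_Fn_X: "le U (Fn U (X i) (Z i)) (X (Suc i))"
 using le_total[OF in_U(1) Fn_U[OF in_U(1,3)], of "Suc i" i i] no_le(2)[of i] by blast

lemma le_P_X: "n < j ==> le U P (X j)"
proof -
 assume j: "n < j"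
 have "le U P (X (Suc n))" by (rule le_trans[OF Pn_U Fn_U[OF in_U(1,3)] in_U(1) le_P_Fn le_Fn_X])
 moreover have "le U (X (Suc n)) (X j)" by (rule le_subset[OF in_U(1) in_U(1) X_mono]) (use j in simp)
 ultimately show ?thesis by (rule le_trans[OF Pn_U in_U(1) in_U(1)])
qed

end

locale collapsed = collapse U X Y Z n + generic U "collapse.P U X Y Z n" H for U X Y Z n H
begin

sublocale closed_generic U P H "X n"
proof (unfold_locales)
 show "X n : U" "mul_closed (X n)" using in_U mul by blast+
 show "fnl p & le U p (X n)" if "p : elts P" for p using that unfolding elts_P by blast
 show "p : elts P" if "p : U" "fnl p" "le U p (X n)" "EX C. C \<subseteq> elts P & elts p = \<Union> (elts ` C)" for p
 proof -
  from that(4) obtain C where C: "C \<subseteq> elts P" "elts p = \<Union> (elts ` C)" by blast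
  have "elts q \<subseteq> elts (times (Y n) (Z n))" if "q \<in> C" for q using C(1) that elts_P by blast
  then have "elts p \<subseteq> elts (times (Y n) (Z n))" unfolding C(2) by (rule UN_least)
  then show ?thesis unfolding elts_P using that by blast
 qed
qed

text \<open>Preservation for sets at least as large as the forcing: \<open>le_small\<close>
  multiplies by \<open>P\<close>, and \<open>b\<close> absorbs this factor.\<close>

lemma le_absorb:
 assumes "a : U" "b : U" "le U (times b b) b" "le U P b" "le UH a b" shows "le U a b"
proof -
 have "le U a (times b P)" by (rule le_small[OF assms(5,1,2)])
 moreover have "le U (times b P) (times b b)"
  by (rule le_times[OF assms(2,2) Pn_U assms(2) le_subset[OF assms(2,2) order_refl] assms(4)])
 ultimately have "le U a (times b b)" by (rule le_trans[OF assms(1) times_U[OF assms(2) Pn_U] times_U[OF assms(2,2)]])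
 then show ?thesis using assms(3) by (rule le_trans[OF assms(1) times_U[OF assms(2,2)] assms(2)])
qed

text \<open>Preservation for small sets: a surjection defined on at most \<open>X n\<close>
  arguments is not new.\<close>

lemma le_closure:
 assumes "a : U" "b : U" "le U b (X n)" "le UH a b" shows "le U a b"
proof -
 obtain f where f: "f : UH" "fnl f" "elts f \<subseteq> elts (times b a)" "!!x. x : elts a ==> EX y:elts b. opair y x : elts f"
  by (rule le_restrict[OF assms(4,1,2)]) blast
 have "f : U" by (rule no_new_functions[OF assms(1,2,3) f(1,2,3)])
 then show ?thesis unfolding le_def using f by blast
qed

text \<open>A subset of \<open>X n\<close> is turned into the constant partial function on it, so
  that the absence of new functions applies.\<close>

lemma no_new_subsets: "y : UH ==> elts y \<subseteq> elts (X n) ==> y : U"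
proof -
 assume y: "y : UH" "elts y \<subseteq> elts (X n)"
 let ?o = "upair hempty hempty"
 have "V.D.dfun 0 (%M e. times y ?o)" by (intro dfi) (use y in simp_all)
 then have f: "times y ?o : UH" using V.closed by blast
 have "times y ?o : U"
 proof (rule no_new_functions_X[OF _ f])
  show "?o : U" by (rule zfm_upair[OF zf D.zfm_hempty[OF zf] D.zfm_hempty[OF zf]])
  show "fnl (times y ?o)" by (auto simp: fnl_iff)
  show "elts (times y ?o) \<subseteq> elts (times (X n) ?o)" using y(2) by auto
 qed
 then have "hdom (times y ?o) : U" using closed[OF D.dfun_hdom[OF D.dfun_const]] by blast
 moreover have "hdom (times y ?o) = y" by (rule elts_eqI) (auto simp: elts_hdom)
 ultimately show ?thesis by simp
qed

lemma Fn_same: assumes "i \<le> n" shows "Fn UH (X i) (Z i) = Fn U (X i) (Z i)"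
proof (rule elts_eqI)
 have l: "le U (X i) (X n)" by (rule le_subset[OF in_U(1) in_U(1) X_mono[OF assms]])
 fix f show "f : elts (Fn UH (X i) (Z i)) <-> f : elts (Fn U (X i) (Z i))"
  unfolding elts_Fn V.elts_Fn using U_UH no_new_functions[OF in_U(3) in_U(1) l, of f i] by blast
qed

lemma in_UH: "X i : UH" "Y i : UH" "Z i : UH"
 using in_U U_UH by blast+

text \<open>A new partial function is determined by \<open>H\<close> and an old function of an
  argument and a condition. As conditions are coded by elements of \<open>X j\<close> and
  \<open>X j\<close> is closed under pairing, that old function can be taken in
  \<open>Fn U (X j) (Z j)\<close>.\<close>

lemma le_Fn_new: assumes j: "n < j" shows "le UH (Fn UH (X j) (Z j)) (Fn U (X j) (Z j))"
proof -
 obtain k where k: "k : U" "fnl k" "ALL p:elts P. EX v:elts (X j). opair v p : elts k" using le_P_X[OF j] unfolding le_def by blast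
 let ?F = "%h. hset {w : elts (times (X j) (Z j)). EX v:elts (X j). EX p:elts H. opair v p : elts k & opair (opair (hfst w) v) (hsnd w) : elts h}"
 show ?thesis
 proof (rule V.leI[where R = "%h f. f = ?F h"])
  show "V.D.dfn 2 (%M e. e 1 = ?F (e 0))" by (intro dfi) (use in_UH H_UH k(1) U_UH in auto)
  show "Fn U (X j) (Z j) : UH" using Fn_U[OF in_U(1,3)] U_UH by blast
  show "Fn UH (X j) (Z j) : UH" using V.Fn_U[OF in_UH(1,3)] .
  fix f assume "f : elts (Fn UH (X j) (Z j))"
  then have f: "f : UH" "fnl f" "elts f \<subseteq> elts (times (X j) (Z j))" unfolding V.elts_Fn by blast+
  obtain g where g: "g : U" "fnl g" "elts g \<subseteq> elts (times (times (X j) P) (Z j))"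
   "!!y x. opair y x : elts f <-> (EX p:elts H. opair (opair y p) x : elts g)"
   by (rule function_name[OF in_U(3) in_U(1) f]) blast
  let ?h = "hset {w : elts (times (X j) (Z j)). EX x:elts (X j). EX v:elts (X j). EX p:elts P.
   hfst w = opair x v & opair v p : elts k & opair (opair x p) (hsnd w) : elts g}"
  have "D.dfun 0 (%M e. ?h)" by (intro dfi) (use in_U Pn_U k(1) g(1) in simp_all)
  then have h: "?h : U" using closed by blast
  have hi: "opair u z : elts ?h <-> u : elts (X j) & z : elts (Z j) &
   (EX x:elts (X j). EX v:elts (X j). EX p:elts P. u = opair x v & opair v p : elts k & opair (opair x p) z : elts g)" for u z
   unfolding elts_hset[OF countable_Collect_elts] by simp
  have "fnl ?h" unfolding fnl_iff hi
  proof (intro allI impI)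
   fix u z z'
   assume *: "u : elts (X j) & z : elts (Z j) & (EX x:elts (X j). EX v:elts (X j). EX p:elts P. u = opair x v & opair v p : elts k & opair (opair x p) z : elts g)"
    "u : elts (X j) & z' : elts (Z j) & (EX x:elts (X j). EX v:elts (X j). EX p:elts P. u = opair x v & opair v p : elts k & opair (opair x p) z' : elts g)"
   obtain x v p where 1: "u = opair x v" "opair v p : elts k" "opair (opair x p) z : elts g" using *(1) by blast
   obtain x' v' p' where 2: "u = opair x' v'" "opair v' p' : elts k" "opair (opair x' p') z' : elts g" using *(2) by blast
   have "x' = x" "v' = v" using 1(1) 2(1) by simp_all
   moreover have "p' = p" using 1(2) 2(2) k(2) \<open>v' = v\<close> unfolding fnl_iff by blast
   ultimately show "z = z'" using 1(3) 2(3) g(2) unfolding fnl_iff by blast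
  qed
  moreover have "elts ?h \<subseteq> elts (times (X j) (Z j))" unfolding elts_hset[OF countable_Collect_elts] by blast
  ultimately have hF: "?h : elts (Fn U (X j) (Z j))" unfolding elts_Fn using h by blast
  have Fi: "opair x z : elts (?F ?h) <-> x : elts (X j) & z : elts (Z j) &
    (EX v:elts (X j). EX p:elts H. opair v p : elts k & opair (opair x v) z : elts ?h)" for x z
   unfolding elts_hset[OF countable_Collect_elts, of "times (X j) (Z j)" "%w. EX v:elts (X j). EX p:elts H. opair v p : elts k & opair (opair (hfst w) v) (hsnd w) : elts ?h"]
   by simp
  have "opair x z : elts (?F ?h) <-> opair x z : elts f" for x z
  proof
   assume "opair x z : elts (?F ?h)"
   then obtain v p where vp: "p : elts H" "opair v p : elts k" "opair (opair x v) z : elts ?h" unfolding Fi by blast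
   then obtain x' v' p' where 2: "opair x v = opair x' v'" "opair v' p' : elts k" "opair (opair x' p') z : elts g" unfolding hi by blast
   have "x' = x" "v' = v" using 2(1) by simp_all
   moreover have "p' = p" using vp(2) 2(2) k(2) \<open>v' = v\<close> unfolding fnl_iff by blast
   ultimately show "opair x z : elts f" using g(4) 2(3) vp(1) by blast
  next
   assume xz: "opair x z : elts f"
   then obtain p where p: "p : elts H" "opair (opair x p) z : elts g" using g(4) by blast
   have x: "x : elts (X j)" "z : elts (Z j)" using subsetD[OF f(3) xz] by simp_all
   obtain v where v: "v : elts (X j)" "opair v p : elts k" using k(3) p(1) H_sub by blast
   have "opair x v : elts (X j)" using mul(1)[of j] x(1) v(1) unfolding mul_closed_def by blast
   then have "opair (opair x v) z : elts ?h" unfolding hi using x v p H_sub by blast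
   then show "opair x z : elts (?F ?h)" unfolding Fi using x v p(1) by blast
  qed
  moreover have "w : elts (?F ?h) ==> EX x z. w = opair x z" for w
   unfolding elts_hset[OF countable_Collect_elts, of "times (X j) (Z j)" "%w. EX v:elts (X j). EX p:elts H. opair v p : elts k & opair (opair (hfst w) v) (hsnd w) : elts ?h"]
   by auto
  moreover have "w : elts f ==> EX x z. w = opair x z" for w using f(3) by auto
  ultimately have "f = ?F ?h" by (intro elts_eqI) blast
  then show "EX h:elts (Fn U (X j) (Z j)). f = ?F h" using hF by blast
 qed simp
qed

lemma not_corrupt: "\<not> corrupt UH X Y Z"
proof
 assume "corrupt UH X Y Z"
 then obtain j where "le UH (Y j) (X j) \<or> le UH (X (Suc j)) (Fn UH (X j) (Z j))" unfolding corrupt_def by blast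
 then show False
 proof
  assume l: "le UH (Y j) (X j)"
  have "le U (Y j) (X j)"
  proof (cases "j \<le> n")
   case True
   show ?thesis by (rule le_closure[OF in_U(2) in_U(1) le_subset[OF in_U(1) in_U(1) X_mono[OF True]] l])
  next
   case False
   then show ?thesis using le_absorb[OF in_U(2) in_U(1) le_sq[OF in_U(1) mul(1)] le_P_X l] by simp
  qed
  then show False using no_le by blast
 next
  assume l: "le UH (X (Suc j)) (Fn UH (X j) (Z j))"
  have F: "Fn U (X j) (Z j) : U" by (rule Fn_U[OF in_U(1,3)])
  have sq: "le U (times (Fn U (X j) (Z j)) (Fn U (X j) (Z j))) (Fn U (X j) (Z j))"
   by (rule le_Fn_square[OF in_U(1) mul(1) in_U(3)])
  \<comment> \<open>Below \<open>n\<close> the sets are at most as large as \<open>X n\<close>, so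
    closure applies and \<open>Fn\<close> is unchanged. At \<open>n\<close> it is still unchanged
    and at least as large as the forcing. Above \<open>n\<close> it has grown, but only up to a
    surjection from the old one.\<close>
  consider "j < n" | "j = n" | "n < j" by linarith
  then have "le U (X (Suc j)) (Fn U (X j) (Z j))"
  proof cases
   case 1
   have "le U (X (Suc j)) (X n)" by (rule le_subset[OF in_U(1) in_U(1) X_mono]) (use 1 in simp)
   from le_trans[OF F in_U(1) in_U(1) le_Fn_X this] show ?thesis
    using le_closure[OF in_U(1) F] l Fn_same[of j] 1 by simp
  next
   case 2
   then show ?thesis using le_absorb[OF in_U(1) F sq] le_P_Fn l Fn_same[of j] by simp
  next
   case 3
   have "le U P (Fn U (X j) (Z j))"
    by (rule le_trans[OF Pn_U in_U(1) F le_P_X[OF 3] le_Fn_self[OF in_U(1) mul(1) in_U(3)]]) (use sub in blast)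
   moreover have "le UH (X (Suc j)) (Fn U (X j) (Z j))"
    by (rule V.le_trans[OF in_UH(1) V.Fn_U[OF in_UH(1,3)] _ l le_Fn_new[OF 3]]) (use F U_UH in blast)
   ultimately show ?thesis using le_absorb[OF in_U(1) F sq] by blast
  qed
  then show False using no_le by blast
 qed
qed

lemma pushed_n: "le UH (Z n) (Y n)"
 unfolding le_def
proof (rule bexI[of _ "hunion H"], intro conjI ballI)
 show "hunion H : UH" using V.closed[OF V.D.dfun_hunion[OF V.D.dfun_const[OF H_UH]]] .
 have eH: "elts (hunion H) = (\<Union>p\<in>elts H. elts p)" by simp
 show "fnl (hunion H)" unfolding fnl_iff eH
 proof (intro allI impI)
  fix x y y' assume "opair x y : (\<Union>p\<in>elts H. elts p)" "opair x y' : (\<Union>p\<in>elts H. elts p)"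
  then obtain p q where pq: "p : elts H" "q : elts H" "opair x y : elts p" "opair x y' : elts q" by blast
  obtain r where r: "r : elts H" "elts p \<subseteq> elts r" "elts q \<subseteq> elts r" using H_dir[OF pq(1,2)] by blast
  then have "fnl r" using H_sub P_fnl by blast
  then show "y = y'" using pq r unfolding fnl_iff by blast
 qed
 fix z assume z: "z : elts (Z n)"
 have "EX p:elts H. EX y:elts (Y n). opair y z : elts p"
 proof (rule H_gen_dfn[OF _ H_one])
  show "D.dfn 1 (%M e. EX y:elts (Y n). opair y z : elts (e 0))" by (intro dfi) (use in_U tr[OF in_U(3) z] in simp_all)
  fix p assume p: "p : elts P"
  then have p': "p : U" "fnl p" "le U p (X n)" "elts p \<subseteq> elts (times (Y n) (Z n))" unfolding elts_P by blast+
  have hd: "hdom p : U" using closed[OF D.dfun_hdom[OF D.dfun_const[OF p'(1)]]] .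
  \<comment> \<open>The domain of a condition has size at most \<open>X n\<close>, so some argument
    in \<open>Y n\<close> is still free and can be sent to \<open>z\<close>.\<close>
  have "\<not> elts (Y n) \<subseteq> elts (hdom p)"
  proof
   assume Ysub: "elts (Y n) \<subseteq> elts (hdom p)"
   have "le U (Y n) p"
   proof (rule leI[where R = "%w y. hfst w = y"])
    show "D.dfn 2 (%M e. hfst (e 0) = e 1)" by (intro dfi) simp_all
    show "EX w:elts p. hfst w = y" if "y : elts (Y n)" for y
     using subsetD[OF Ysub that] unfolding elts_hdom by force
   qed (use in_U p' in auto)
   then have "le U (Y n) (X n)" using le_trans[OF in_U(2) p'(1) in_U(1)] p'(3) by blast
   then show False using no_le by blast
  qed
  then obtain y where y: "y : elts (Y n)" "y ~: elts (hdom p)" by blast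
  let ?w = "opair y z"
  have w: "?w : U" using opair_U tr[OF in_U(2) y(1)] tr[OF in_U(3) z] by blast
  have X0: "hc_nat 0 : elts (X n)" using mul(1)[of n] unfolding mul_closed_def by blast
  have "le U (hun p (upair ?w ?w)) (X n)"
   by (rule le_hun[OF p'(1) zfm_upair[OF zf w w] in_U(1) mul(1) p'(3) le_single[OF w in_U(1) X0]])
  moreover have "fnl (hun p (upair ?w ?w))"
   using p'(2) y(2) unfolding fnl_iff elts_hdom by auto
  moreover have "elts (hun p (upair ?w ?w)) \<subseteq> elts (times (Y n) (Z n))" using p'(4) y(1) z by auto
  ultimately have "hun p (upair ?w ?w) : elts P" unfolding elts_P using hun_U[OF p'(1) zfm_upair[OF zf w w]] by blast
  moreover have "elts p \<subseteq> elts (hun p (upair ?w ?w))" "?w : elts (hun p (upair ?w ?w))" by auto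
  ultimately show "EX r:elts P. elts p \<subseteq> elts r & (EX y:elts (Y n). opair y z : elts r)" using y(1) by blast
 qed
 then show "EX y:elts (Y n). opair y z : elts (hunion H)" unfolding eH by blast
qed

lemma pushed_UH: "pushed UH Y Z = insert n (pushed U Y Z)"
proof (rule set_eqI)
 fix j
 show "j : pushed UH Y Z <-> j : insert n (pushed U Y Z)"
 proof (cases "j = n")
  case True then show ?thesis using pushed_n by (simp add: pushed_def)
 next
  case False
  have "le U (Z j) (Y j)" if l: "le UH (Z j) (Y j)"
  proof (cases "j < n")
   case True
   show ?thesis by (rule le_closure[OF in_U(3) in_U(2) le_subset[OF in_U(2) in_U(1) Y_X[OF True]] l])
  next
   case F: False
   have "le U P (Y j)"
    by (rule le_trans[OF Pn_U in_U(1) in_U(2) le_P_X le_subset[OF in_U(1) in_U(2) sub(1)]]) (use F False in simp)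
   then show ?thesis using le_absorb[OF in_U(3) in_U(2) le_sq[OF in_U(2) mul(2)] _ l] by blast
  qed
  moreover have "le UH (Z j) (Y j)" if "le U (Z j) (Y j)" using le_mono[OF that U_UH order_refl order_refl] .
  ultimately show ?thesis using False by (auto simp: pushed_def)
 qed
qed

end

text \<open>The last two clauses keep the surroundings of the collapse fixed. Without new ordinals
  every \<open>L[x]\<close> stays the same; without new subsets of \<open>X 0\<close>, which
  includes \<open>omega\<close> for the levels of a world, there are no new reals.\<close>

theorem push:
 assumes "U : ctms" "lev_ok X Y Z" "!!i. X i : U & Y i : U & Z i : U" "\<not> corrupt U X Y Z"
 shows "EX U':ctms. U \<subseteq> U' & pushed U' Y Z = insert n (pushed U Y Z) & \<not> corrupt U' X Y Z &
  (ALL x. hord x --> x : U' --> x : U) & (ALL y:U'. elts y \<subseteq> elts (X 0) --> y : U)"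
proof -
 interpret C: collapse U X Y Z n using assms by unfold_locales auto
 obtain H where H: "generic U C.P H" using C.generic_exists by blast
 interpret G: collapsed U X Y Z n H
  by (intro collapsed.intro C.collapse_axioms H)
 show ?thesis
  using G.UH_ctms G.U_UH G.pushed_UH G.not_corrupt G.UH_hord G.no_new_subsets C.X_mono[of 0 n]
  by (intro bexI[of _ G.UH]) auto
qed

section \<open>Levels of a model\<close>

definition clo :: "hc set => hc => hc" where "clo N z = VB N z omega"

text \<open>A new \<open>X\<close> is the closure of the union of all earlier \<open>Z\<close>;
  \<open>Y\<close> and \<open>Z\<close> are the next two closures of \<open>X\<close>.\<close>

function XL :: "hc set => hc => hc" where
 "XL N x = clo N (hunion (hset ((%y. clo N (clo N (XL N y))) ` elts x)))"
 by auto
termination by (relation "inv_image {(x, y). x : elts y} snd") (auto simp: wf_elts)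

declare XL.simps [simp del]

text \<open>The whole sequence of levels is one set, so a single parameter, or a single definable
  term, gives access to all of them.\<close>

definition levs :: "hc set => hc" where
 "levs N = lam omega (%m. opair (XL N m) (opair (clo N (XL N m)) (clo N (clo N (XL N m)))))"

definition sX :: "hc => nat => hc" where "sX s n = hfst (app s (hc_nat n))"
definition sY :: "hc => nat => hc" where "sY s n = hfst (hsnd (app s (hc_nat n)))"
definition sZ :: "hc => nat => hc" where "sZ s n = hsnd (hsnd (app s (hc_nat n)))"

lemma levs_simps: "sX (levs N) n = XL N (hc_nat n)" "sY (levs N) n = clo N (XL N (hc_nat n))"
 "sZ (levs N) n = clo N (clo N (XL N (hc_nat n)))"
 unfolding sX_def sY_def sZ_def levs_def by simp_all

context zfmodels
begin

lemma dfun_levs_gen: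
 assumes P: "dfun 2 (%M e. pow (N M (e 0)) (e 1))" and s: "dfun n s"
 shows "dfun n (%M e. levs (N M (s M e)))"
proof -
 note [dfi] = dfun_comp2[where F = "%M z. pow (N M z)", OF P]
 \<comment> \<open>The recursion theorem has one place for a parameter; the index of
   \<open>N\<close> and the base set therefore travel as a pair.\<close>
 have "dfun 2 (%M e. VB (N M (hfst (e 0))) (hsnd (e 0)) (e 1))"
 proof (rule dfun_mem_rec[where F = "%M p x. VB (N M (hfst p)) (hsnd p) x" and
    H = "%M p x f. hun (hsnd p) (hunion (hset ((%y. pow (N M (hfst p)) (app f y)) ` elts x)))"])
  show "dfun 3 (%M e. hun (hsnd (e 0)) (hunion (hset ((%y. pow (N M (hfst (e 0))) (app (e 2) y)) ` elts (e 1)))))"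
   by (intro dfi) simp_all
  show "VB (N M (hfst p)) (hsnd p) x = hun (hsnd p) (hunion (hset ((%y. pow (N M (hfst p)) (app (lam x (VB (N M (hfst p)) (hsnd p))) y)) ` elts x)))"
   for M p x by (subst VB.simps) (simp cong: image_cong_simp)
 qed
 from dfun_comp2[where F = "%M p x. VB (N M (hfst p)) (hsnd p) x", OF this]
 have VBd: "dfun n (%M e. VB (N M (s M e)) (t M e) (u M e))" if "dfun n s" "dfun n t" "dfun n u" for n s t u
  using dfun_opair[OF that(1,2)] that(3) by fastforce
 have clod: "dfun n (%M e. clo (N M (s M e)) (t M e))" if "dfun n s" "dfun n t" for n s t
  unfolding clo_def by (rule VBd[OF that dfun_omega])
 note [dfi] = clod
 have "dfun 2 (%M e. XL (N M (e 0)) (e 1))"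
 proof (rule dfun_mem_rec[where F = "%M z x. XL (N M z) x" and
    H = "%M z x f. clo (N M z) (hunion (hset ((%y. clo (N M z) (clo (N M z) (app f y))) ` elts x)))"])
  show "dfun 3 (%M e. clo (N M (e 0)) (hunion (hset ((%y. clo (N M (e 0)) (clo (N M (e 0)) (app (e 2) y))) ` elts (e 1)))))"
   by (intro dfi) simp_all
  show "XL (N M z) x = clo (N M z) (hunion (hset ((%y. clo (N M z) (clo (N M z) (app (lam x (XL (N M z))) y))) ` elts x)))" for M z x
   by (subst XL.simps) (simp cong: image_cong_simp)
 qed
 note [dfi] = dfun_comp2[where F = "%M z. XL (N M z)", OF this]
 have "dfun 1 (%M e. levs (N M (e 0)))" unfolding levs_def by (intro dfi) simp_all
 from dfun_comp1[where F = "%M z. levs (N M z)", OF this s] show ?thesis .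
qed

lemma dfun_levs: "dfun n (%M e. levs M)"
 by (rule dfun_levs_gen[where N = "%M z. M" and s = "%M e. hempty"]) (intro dfi; simp)+

lemma dfun_levs_LL [dfi]: "dfun n s ==> dfun n (%M e. levs (LL (s M e) M))"
proof (rule dfun_levs_gen[where N = "%M z. LL z M"])
 have "dfun 2 (%M e. hset {v : elts (pow M (e 1)). v : LL (e 0) M})" by (intro dfi) simp_all
 then show "dfun 2 (%M e. pow (LL (e 0) M) (e 1))"
 proof (rule dfun_cong)
  fix M and e :: "nat => hc" assume M: "M : K" "range e \<subseteq> M"
  have cM: "countable M" using zfm_countable[OF K_zfm[OF M(1)]] .
  have "Lx (e 0) x : M" if x: "x : M" for x
   using dfun_in[OF dfun_Lx[OF dfun_var dfun_var, of 0 2 1] M(1), of "%i. if i = 0 then e 0 else x"] M(2) x by auto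
  then have "LL (e 0) M \<subseteq> M" unfolding LL_def using K_trans[OF M(1)] by blast
  then show "hset {v : elts (pow M (e 1)). v : LL (e 0) M} = pow (LL (e 0) M) (e 1)"
   unfolding elts_pow[OF cM] pow_def[of "LL (e 0) M"] by (intro arg_cong[where f = hset]) blast
 qed
qed

end


text \<open>The third fact brings in families of subsets of \<open>z\<close>. It is what puts all
  subsets of \<open>Fn\<close> at one level into the next \<open>X\<close>.\<close>

lemma clo_facts:
 assumes N: "N : zfm" and z: "z : N"
 shows "elts z \<subseteq> elts (clo N z)" "u : N ==> elts u \<subseteq> elts z ==> u : elts (clo N z)"
  "u : N ==> (!!v. v : elts u ==> elts v \<subseteq> elts z) ==> u : elts (clo N z)"
  "mul_closed (clo N z)" "elts omega \<subseteq> elts (clo N z)"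
proof -
 let ?V = "%k. elts (VB N z (hc_nat k))"
 note E = elts_VB[OF zfm_countable[OF N], of z]
 have eV: "?V k = elts z \<union> (\<Union>i\<in>{..<k}. {u : N. elts u \<subseteq> ?V i})" for k
  unfolding E[of "hc_nat k"] elts_hc_nat by (simp only: image_image UN_simps)
 have ec: "elts (clo N z) = elts z \<union> (\<Union>i. {u : N. elts u \<subseteq> ?V i})"
  unfolding clo_def E[of omega] elts_omega by (simp only: image_image UN_simps)
 have mono: "?V i \<subseteq> ?V j" if "i \<le> j" for i j
 proof
  fix u assume "u : ?V i"
  then consider "u : elts z" | l where "l < i" "u : N" "elts u \<subseteq> ?V l" unfolding eV[of i] by blast
  then show "u : ?V j"
  proof cases
   case 1 then show ?thesis unfolding eV[of j] by blast
  next
   case 2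
   then have "l : {..<j}" using that by simp
   then show ?thesis unfolding eV[of j] using 2 by blast
  qed
 qed
 have suc: "u : ?V (Suc k)" if "u : N" "elts u \<subseteq> ?V k" for u k
  unfolding eV[of "Suc k"] using that by blast
 have Vc: "?V k \<subseteq> elts (clo N z)" for k unfolding eV[of k] ec by blast
 have zV: "elts z \<subseteq> ?V k" for k unfolding eV[of k] by blast
 have cV: "EX k. u : ?V k" if "u : elts (clo N z)" for u
 proof -
  from that consider "u : elts z" | l where "u : N" "elts u \<subseteq> ?V l" unfolding ec by blast
  then show ?thesis
  proof cases
   case 1 then show ?thesis using zV by blast
  next
   case 2 then show ?thesis using suc by blast
  qed
 qed
 have cN: "u : N" if "u : elts (clo N z)" for u
  using that zfm_trans[OF N z, of u] unfolding ec by blast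
 show "elts z \<subseteq> elts (clo N z)" unfolding ec by blast
 have one: "u : ?V 1" if "u : N" "elts u \<subseteq> elts z" for u using suc[of u 0] that zV[of 0] by auto
 show "u : elts (clo N z)" if "u : N" "elts u \<subseteq> elts z" using one[OF that] Vc by blast
 show "u : elts (clo N z)" if u: "u : N" "!!v. v : elts u ==> elts v \<subseteq> elts z"
 proof -
  have "elts u \<subseteq> ?V 1"
  proof
   fix v assume v: "v : elts u"
   show "v : ?V 1" by (rule one[OF zfm_trans[OF N u(1) v] u(2)[OF v]])
  qed
  then show ?thesis using suc[of u 1] u(1) Vc by blast
 qed
 have natN: "hc_nat n : N" for n using zfm_trans[OF N zfm_omega[OF N], of "hc_nat n"] by simp
 have nat: "hc_nat n : ?V (Suc n)" for n
 proof (induction n rule: less_induct)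
  case (less n)
  have "hc_nat i : ?V n" if "i < n" for i using less[OF that] mono[of "Suc i" n] that by auto
  then have "elts (hc_nat n) \<subseteq> ?V n" unfolding elts_hc_nat by auto
  then show ?case by (rule suc[OF natN])
 qed
 show "elts omega \<subseteq> elts (clo N z)"
 proof
  fix u assume "u : elts omega"
  then obtain n where "u = hc_nat n" by auto
  then show "u : elts (clo N z)" using nat[of n] Vc by blast
 qed
 have op: "opair x y : elts (clo N z)" if xy: "x : elts (clo N z)" "y : elts (clo N z)" for x y
 proof -
  note xN = cN[OF xy(1)] and yN = cN[OF xy(2)]
  obtain i where i: "x : ?V i" using cV[OF xy(1)] by blast
  obtain j where j: "y : ?V j" using cV[OF xy(2)] by blast
  have m: "x : ?V (max i j)" "y : ?V (max i j)" using i j mono[of i "max i j"] mono[of j "max i j"] by auto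
  have "upair x x : ?V (Suc (max i j))" by (rule suc[OF zfm_upair[OF N xN xN]]) (use m in simp)
  moreover have "upair x y : ?V (Suc (max i j))" by (rule suc[OF zfm_upair[OF N xN yN]]) (use m in simp)
  ultimately have "elts (opair x y) \<subseteq> ?V (Suc (max i j))" unfolding elts_opair by blast
  moreover have "opair x y : N" unfolding opair_def by (intro zfm_upair[OF N] xN yN)
  ultimately show ?thesis using suc Vc by blast
 qed
 have "hc_nat 0 : elts (clo N z)" "hc_nat 1 : elts (clo N z)" using nat Vc by blast+
 then show "mul_closed (clo N z)" unfolding mul_closed_def using op by blast
qed

lemma levs_in: "N : zfm ==> levs N : N"
proof -
 assume N: "N : zfm"
 interpret D: zfmodels "{N}" N using N by (rule zfm_zfmodels)
 show ?thesis using zfm_closed[OF N D.dfun_levs] .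
qed

lemma lev_parts_in:
 assumes N: "N : zfm" and s: "s : N" shows "sX s n : N" "sY s n : N" "sZ s n : N"
proof -
 interpret D: zfmodels "{N}" N using N by (rule zfm_zfmodels)
 have "D.dfun 0 (%M e. sX s n)" "D.dfun 0 (%M e. sY s n)" "D.dfun 0 (%M e. sZ s n)"
  unfolding sX_def sY_def sZ_def by (intro dfi; use s in simp)+
 then show "sX s n : N" "sY s n : N" "sZ s n : N" using zfm_closed[OF N] by blast+
qed

lemma XL_base:
 assumes N: "N : zfm"
 obtains b where "b : N" "XL N (hc_nat n) = clo N b" "!!m. m < n ==> elts (sZ (levs N) m) \<subseteq> elts b"
proof -
 interpret D: zfmodels "{N}" N using N by (rule zfm_zfmodels)
 let ?b = "hunion (hset ((%y. hsnd (hsnd (app (levs N) y))) ` elts (hc_nat n)))"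
 have eq: "clo N (clo N (XL N y)) = hsnd (hsnd (app (levs N) y))" if "y : elts (hc_nat n)" for y
 proof -
  have "y : elts omega" using that unfolding elts_hc_nat by auto
  then show ?thesis unfolding levs_def by (subst app_lam) simp_all
 qed
 have "D.dfun 0 (%M e. ?b)" by (intro dfi) (use levs_in[OF N] in simp_all)
 then have b: "?b : N" using zfm_closed[OF N] by blast
 have "(%y. clo N (clo N (XL N y))) ` elts (hc_nat n) = (%y. hsnd (hsnd (app (levs N) y))) ` elts (hc_nat n)"
  using eq by (rule image_cong[OF refl])
 then have x: "XL N (hc_nat n) = clo N ?b" by (subst XL.simps) (simp only:)
 have "elts (sZ (levs N) m) \<subseteq> elts ?b" if "m < n" for m
 proof -
  have "hc_nat m : elts (hc_nat n)" using that by (simp only: hc_nat_less)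
  then show ?thesis unfolding sZ_def elts_hunion by (subst elts_hset) auto
 qed
 then show ?thesis using that b x by blast
qed

lemma lev_ok_levs:
 assumes N: "N : zfm" shows "lev_ok (sX (levs N)) (sY (levs N)) (sZ (levs N))"
 unfolding lev_ok_def
proof (intro allI)
 fix n
 obtain b where b: "b : N" "XL N (hc_nat n) = clo N b" "!!m. m < n ==> elts (sZ (levs N) m) \<subseteq> elts b" by (rule XL_base[OF N]) blast
 obtain b' where b': "b' : N" "XL N (hc_nat (Suc n)) = clo N b'" "!!m. m < Suc n ==> elts (sZ (levs N) m) \<subseteq> elts b'"
  by (rule XL_base[OF N]) blast
 note i = lev_parts_in[OF N levs_in[OF N], of n]
 have e: "sX (levs N) n = clo N b" "sY (levs N) n = clo N (sX (levs N) n)" "sZ (levs N) n = clo N (sY (levs N) n)"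
  "sX (levs N) (Suc n) = clo N b'"
  by (simp_all only: levs_simps b(2) b'(2))
 have "elts (sZ (levs N) n) \<subseteq> elts (sX (levs N) (Suc n))" unfolding e(4) using clo_facts(1)[OF N b'(1)] b'(3)[of n] by auto
 moreover have "elts (sX (levs N) n) \<subseteq> elts (sY (levs N) n)" "elts (sY (levs N) n) \<subseteq> elts (sZ (levs N) n)"
  using clo_facts(1)[OF N i(1)] clo_facts(1)[OF N i(2)] e by auto
 moreover have "mul_closed (sX (levs N) n)" "mul_closed (sY (levs N) n)" "mul_closed (sZ (levs N) n)"
  using clo_facts(4)[OF N b(1)] clo_facts(4)[OF N i(1)] clo_facts(4)[OF N i(2)] e by simp_all
 ultimately show "mul_closed (sX (levs N) n) & mul_closed (sY (levs N) n) & mul_closed (sZ (levs N) n) &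
   elts (sX (levs N) n) \<subseteq> elts (sY (levs N) n) & elts (sY (levs N) n) \<subseteq> elts (sZ (levs N) n) &
   elts (sZ (levs N) n) \<subseteq> elts (sX (levs N) (Suc n))" by blast
qed

lemma omega_levs: assumes N: "N : zfm" shows "elts omega \<subseteq> elts (sX (levs N) 0)"
proof -
 obtain b where "b : N" "XL N (hc_nat 0) = clo N b" by (rule XL_base[OF N]) blast
 then show ?thesis unfolding levs_simps using clo_facts(5)[OF N] by simp
qed

text \<open>Every gap is an instance of Cantor's theorem, because each closure contains the power
  set, taken in \<open>N\<close>, of the set it must exceed.\<close>

theorem levs_initial:
 assumes "N : ctms"
 shows "\<not> corrupt N (sX (levs N)) (sY (levs N)) (sZ (levs N))" "pushed N (sY (levs N)) (sZ (levs N)) = {}"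
proof -
 interpret A: ctm N using assms by unfold_locales
 note N = A.zf
 note i = lev_parts_in[OF N levs_in[OF N]]
 note ok = lev_ok_levs[OF N, unfolded lev_ok_def]
 have e: "sY (levs N) n = clo N (sX (levs N) n)" "sZ (levs N) n = clo N (sY (levs N) n)" for n
  by (simp_all only: levs_simps)
 have 1: "\<not> le N (sY (levs N) n) (sX (levs N) n)" for n
  by (rule A.cantor[OF i(1)]) (simp add: e clo_facts(2)[OF N i(1)])
 have 2: "\<not> le N (sZ (levs N) n) (sY (levs N) n)" for n
  by (rule A.cantor[OF i(2)]) (use clo_facts(2)[OF N i(2)] e(2) in simp)
 have 3: "\<not> le N (sX (levs N) (Suc n)) (Fn N (sX (levs N) n) (sZ (levs N) n))" for n
 proof (rule A.cantor[OF A.Fn_U[OF i(1,3)]])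
  fix y assume y: "y : N" "elts y \<subseteq> elts (Fn N (sX (levs N) n) (sZ (levs N) n))"
  obtain b where b: "b : N" "XL N (hc_nat (Suc n)) = clo N b" "!!m. m < Suc n ==> elts (sZ (levs N) m) \<subseteq> elts b"
   by (rule XL_base[OF N]) blast
  have "elts v \<subseteq> elts b" if "v : elts y" for v
  proof -
   have "elts v \<subseteq> elts (times (sX (levs N) n) (sZ (levs N) n))" using y(2) that unfolding A.elts_Fn[abs_def] using A.elts_Fn by blast
   also have "\<dots> \<subseteq> elts (times (sZ (levs N) n) (sZ (levs N) n))"
   proof -
    have "elts (sX (levs N) n) \<subseteq> elts (sZ (levs N) n)" using ok by blast
    then show ?thesis by auto
   qed
   also have "\<dots> \<subseteq> elts (sZ (levs N) n)" using ok by (intro mul_closed_times) blast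
   finally show ?thesis using b(3)[of n] by simp
  qed
  then show "y : elts (sX (levs N) (Suc n))" unfolding levs_simps b(2) by (rule clo_facts(3)[OF N b(1) y(1)])
 qed
 show "\<not> corrupt N (sX (levs N)) (sY (levs N)) (sZ (levs N))" unfolding corrupt_def using 1 3 by blast
 show "pushed N (sY (levs N)) (sZ (levs N)) = {}" unfolding pushed_def using 2 by blast
qed

section \<open>Finite frames for the modal logics, and transfer to potentialist systems\<close>

section \<open>Finite models for S4.2 and S5\<close>

primrec ev :: "'w set => ('w => 'w => bool) => ('w => nat => bool) => 'w => nat modal => bool" where
 "ev F R V x (Atom n) <-> V x n"
| "ev F R V x Falsity <-> False"
| "ev F R V x (Imp p q) <-> (ev F R V x p --> ev F R V x q)"
| "ev F R V x (Box p) <-> (ALL y:F. R x y --> ev F R V y p)"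

primrec subfms :: "nat modal => nat modal set" where
 "subfms (Atom n) = {Atom n}"
| "subfms Falsity = {Falsity}"
| "subfms (Imp p q) = insert (Imp p q) (subfms p \<union> subfms q)"
| "subfms (Box p) = insert (Box p) (subfms p)"

lemma subfms_refl: "p : subfms p"
 by (cases p) auto

lemma subfms_finite: "finite (subfms p)"
 by (induction p) auto

lemma subfms_closed:
 "Imp a b : subfms p ==> a : subfms p & b : subfms p" "Box a : subfms p ==> a : subfms p"
 by (induction p) (auto simp: subfms_refl)

abbreviation Not :: "nat modal => nat modal" where "Not p \<equiv> Imp p Falsity"

definition boolean :: "(nat modal => bool) => bool" where
 "boolean v <-> \<not> v Falsity & (ALL q r. v (Imp q r) <-> (v q --> v r))"

lemma tautology_boolean: "tautology p <-> (ALL v. boolean v --> v p)"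
 unfolding tautology_def boolean_def by simp

lemma boolean_foldr: "boolean v ==> v (foldr Imp ps p) <-> ((ALL q:set ps. v q) --> v p)"
 by (induction ps) (auto simp: boolean_def)

locale s4logic =
 fixes L :: "nat modal set"
 assumes taut: "tautology p ==> p : L"
  and K: "Imp (Box (Imp p q)) (Imp (Box p) (Box q)) : L"
  and mp: "Imp p q : L ==> p : L ==> q : L"
  and nec: "p : L ==> Box p : L"
  and T: "Imp (Box p) p : L"
  and four: "Imp (Box p) (Box (Box p)) : L"
begin

lemma mps: "foldr Imp ps p : L ==> set ps \<subseteq> L ==> p : L"
 by (induction ps) (auto intro: mp)

lemma conseq: "set ps \<subseteq> L ==> (!!v. boolean v ==> (ALL q:set ps. v q) ==> v p) ==> p : L"
 by (rule mps[of ps]) (auto intro!: taut simp: tautology_boolean boolean_foldr)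

text \<open>Local derivability: hypotheses are used by implication only and never under
  necessitation, so the deduction theorem holds.\<close>

definition der :: "nat modal set => nat modal => bool" where
 "der \<Gamma> p <-> (EX ps. set ps \<subseteq> \<Gamma> & foldr Imp ps p : L)"

lemma der_conseq:
 assumes "!!q. q : set qs ==> der \<Gamma> q" "!!v. boolean v ==> (ALL q:set qs. v q) ==> v p"
 shows "der \<Gamma> p"
proof -
 have "EX ps. set ps \<subseteq> \<Gamma> & (ALL q:set qs. foldr Imp ps q : L)"
  using assms(1)
 proof (induction qs)
  case Nil then show ?case by (auto intro: exI[of _ "[]"])
 next
  case (Cons q qs)
  then obtain ps where ps: "set ps \<subseteq> \<Gamma>" "ALL q:set qs. foldr Imp ps q : L" by auto
  obtain rs where rs: "set rs \<subseteq> \<Gamma>" "foldr Imp rs q : L" using Cons.prems[of q] unfolding der_def by auto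
  have "foldr Imp (ps @ rs) r : L" if "r : set (q # qs)" for r
  proof (cases "r = q")
   case True
   then show ?thesis using rs by (intro conseq[of "[foldr Imp rs q]"]) (auto simp: boolean_foldr simp del: foldr_append)
  next
   case False
   then show ?thesis using ps that
    by (intro conseq[of "[foldr Imp ps r]"]) (auto simp: boolean_foldr simp del: foldr_append)
  qed
  then show ?case using ps rs by (intro exI[of _ "ps @ rs"]) (auto simp del: foldr_append)
 qed
 then obtain ps where ps: "set ps \<subseteq> \<Gamma>" "ALL q:set qs. foldr Imp ps q : L" by blast
 have "foldr Imp ps p : L"
  by (rule conseq[of "map (foldr Imp ps) qs"]) (use ps assms(2) in \<open>auto simp: boolean_foldr\<close>)
 then show ?thesis using ps unfolding der_def by blast
qed

lemma der_in: "p : \<Gamma> ==> der \<Gamma> p"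
 unfolding der_def by (intro exI[of _ "[p]"]) (auto intro!: taut simp: tautology_boolean boolean_def)

lemma der_L: "p : L ==> der \<Gamma> p"
 unfolding der_def by (intro exI[of _ "[]"]) auto

lemma deduction: "der (insert p \<Gamma>) q ==> der \<Gamma> (Imp p q)"
proof -
 assume "der (insert p \<Gamma>) q"
 then obtain ps where ps: "set ps \<subseteq> insert p \<Gamma>" "foldr Imp ps q : L" unfolding der_def by blast
 have "foldr Imp (filter (%r. r ~= p) ps) (Imp p q) : L"
  by (rule conseq[of "[foldr Imp ps q]"]) (use ps in \<open>auto simp: boolean_foldr boolean_def\<close>)
 then show ?thesis unfolding der_def using ps(1) by (intro exI[of _ "filter (%r. r ~= p) ps"]) auto
qed

definition cons :: "nat modal set => bool" where "cons \<Gamma> <-> \<not> der \<Gamma> Falsity"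

definition mcs :: "nat modal set => bool" where
 "mcs \<Gamma> <-> cons \<Gamma> & (ALL p. p : \<Gamma> \<or> Not p : \<Gamma>)"

lemma lindenbaum:
 assumes "cons \<Gamma>" shows "EX \<Delta>. \<Gamma> \<subseteq> \<Delta> & mcs \<Delta>"
proof -
 let ?A = "{\<Delta>. \<Gamma> \<subseteq> \<Delta> & cons \<Delta>}"
 have "EX M:?A. ALL X:?A. M \<subseteq> X --> X = M"
 proof (rule subset_Zorn_nonempty)
  show "?A ~= {}" using assms by auto
  fix C assume C: "C ~= {}" "subset.chain ?A C"
  have "cons (\<Union>C)" unfolding cons_def der_def
  proof clarify
   fix ps assume ps: "set ps \<subseteq> \<Union>C" "foldr Imp ps Falsity \<in> L"
   then obtain X where "X : C" "set ps \<subseteq> X"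
    using finite_subset_Union_chain[OF finite_set ps(1) C(1)] C(2) by blast
   then have "der X Falsity" "cons X" using ps C(2) unfolding der_def subset.chain_def by auto
   then show False by (simp add: cons_def)
  qed
  moreover obtain X where "X : C" "\<Gamma> \<subseteq> X" using C unfolding subset.chain_def by blast
  ultimately show "\<Union>C \<in> ?A" by blast
 qed
 then obtain M where M: "\<Gamma> \<subseteq> M" "cons M" and max: "!!X. M \<subseteq> X ==> cons X ==> X = M" by auto
 have "p : M \<or> Not p : M" for p
 proof (rule ccontr)
  assume n: "\<not> (p : M \<or> Not p : M)"
  then have "\<not> cons (insert p M)" "\<not> cons (insert (Not p) M)" using max by blast+
  then have d: "der M (Imp p Falsity)" "der M (Imp (Not p) Falsity)" unfolding cons_def by (auto intro: deduction)
  have "der M Falsity"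
   by (rule der_conseq[of "[Imp p Falsity, Imp (Not p) Falsity]"]) (use d in \<open>auto simp: boolean_def\<close>)
  then show False using M by (simp add: cons_def)
 qed
 then show ?thesis using M unfolding mcs_def by blast
qed

lemma mcs_der: "mcs \<Gamma> ==> der \<Gamma> p ==> p : \<Gamma>"
proof (rule ccontr)
 assume *: "mcs \<Gamma>" "der \<Gamma> p" "p ~: \<Gamma>"
 then have "der \<Gamma> (Not p)" unfolding mcs_def using der_in by blast
 have "der \<Gamma> Falsity"
  by (rule der_conseq[of "[p, Not p]"]) (use * \<open>der \<Gamma> (Not p)\<close> in \<open>auto simp: boolean_def\<close>)
 then show False using * unfolding mcs_def cons_def by blast
qed

lemma mcs_Falsity: "mcs \<Gamma> ==> Falsity ~: \<Gamma>"
 unfolding mcs_def cons_def using der_in by blast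

lemma mcs_Imp: "mcs \<Gamma> ==> Imp p q : \<Gamma> <-> (p : \<Gamma> --> q : \<Gamma>)"
proof
 assume m: "mcs \<Gamma>"
 { assume "Imp p q : \<Gamma>"
  note i = this
  show "p : \<Gamma> --> q : \<Gamma>"
  proof
   assume "p : \<Gamma>"
   have "der \<Gamma> q"
    by (rule der_conseq[of "[p, Imp p q]"]) (use i \<open>p : \<Gamma>\<close> in \<open>auto simp: boolean_def intro: der_in\<close>)
   then show "q : \<Gamma>" by (rule mcs_der[OF m])
  qed }
 assume *: "p : \<Gamma> --> q : \<Gamma>"
 show "Imp p q : \<Gamma>"
 proof (cases "p : \<Gamma>")
  case True
  have "der \<Gamma> (Imp p q)"
   by (rule der_conseq[of "[q]"]) (use * True in \<open>auto simp: boolean_def intro: der_in\<close>)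
  then show ?thesis by (rule mcs_der[OF m])
 next
  case False
  then have "Not p : \<Gamma>" using m unfolding mcs_def by blast
  have "der \<Gamma> (Imp p q)"
   by (rule der_conseq[of "[Not p]"]) (use \<open>Not p : \<Gamma>\<close> in \<open>auto simp: boolean_def intro: der_in\<close>)
  then show ?thesis by (rule mcs_der[OF m])
 qed
qed

lemma mcs_L: "mcs \<Gamma> ==> p : L ==> p : \<Gamma>"
 using mcs_der der_L by blast

definition acc :: "nat modal set => nat modal set => bool" where
 "acc \<Gamma> \<Delta> <-> (ALL p. Box p : \<Gamma> --> p : \<Delta>)"

lemma box_foldr: "mcs \<Gamma> ==> foldr Imp qs p : L ==> (!!q. q : set qs ==> Box q : \<Gamma>) ==> Box p : \<Gamma>"
proof -
 assume m: "mcs \<Gamma>" and "foldr Imp qs p : L" and q: "!!q. q : set qs ==> Box q : \<Gamma>"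
 then have "Box (foldr Imp qs p) : \<Gamma>" using nec mcs_L by blast
 then show ?thesis using q
 proof (induction qs)
  case (Cons a qs)
  then have "Box (Imp a (foldr Imp qs p)) : \<Gamma>" by simp
  then have "Box (foldr Imp qs p) : \<Gamma>"
   using mcs_L[OF m K] Cons.prems(2)[of a] mcs_Imp[OF m] by (metis list.set_intros(1))
  then show ?case using Cons by simp
 qed simp
qed

lemma acc_ex: "mcs \<Gamma> ==> Box p ~: \<Gamma> ==> EX \<Delta>. mcs \<Delta> & acc \<Gamma> \<Delta> & p ~: \<Delta>"
proof -
 assume m: "mcs \<Gamma>" "Box p ~: \<Gamma>"
 have "cons (insert (Not p) {q. Box q : \<Gamma>})"
 proof (rule ccontr)
  assume "\<not> ?thesis"
  then have d: "der {q. Box q : \<Gamma>} (Imp (Not p) Falsity)" unfolding cons_def using deduction by blast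
  have "der {q. Box q : \<Gamma>} p"
   by (rule der_conseq[of "[Imp (Not p) Falsity]"]) (use d in \<open>auto simp: boolean_def\<close>)
  then show False using box_foldr[OF m(1)] m(2) unfolding der_def by blast
 qed
 then obtain \<Delta> where D: "insert (Not p) {q. Box q : \<Gamma>} \<subseteq> \<Delta>" "mcs \<Delta>" using lindenbaum by blast
 then have "p ~: \<Delta>" using mcs_Imp[OF D(2), of p Falsity] mcs_Falsity by blast
 then show ?thesis using D unfolding acc_def by blast
qed

lemma acc_refl: "mcs \<Gamma> ==> acc \<Gamma> \<Gamma>"
 unfolding acc_def using mcs_L[OF _ T] mcs_Imp by blast

lemma acc_box: "mcs \<Gamma> ==> acc \<Gamma> \<Delta> ==> Box p : \<Gamma> ==> Box p : \<Delta>"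
 unfolding acc_def using mcs_L[OF _ four] mcs_Imp by blast

lemma acc_trans: "mcs \<Gamma> ==> acc \<Gamma> \<Delta> ==> acc \<Delta> \<Theta> ==> acc \<Gamma> \<Theta>"
 using acc_box unfolding acc_def by blast

text \<open>Points are traces of maximal consistent sets on the subformulas of
  \<open>\<phi>\<close>, hence finitely many. The relation asks that boxes persist, which makes it
  reflexive and transitive by itself; axiom T recovers \<open>p\<close> from a persisting
  \<open>Box p\<close>.\<close>

lemma filtration:
 assumes "\<phi> ~: L"
 obtains \<Gamma> where "mcs \<Gamma>" "\<phi> ~: \<Gamma>"
  "!!\<Delta>. mcs \<Delta> ==> acc \<Gamma> \<Delta> ==> ev {\<Delta> \<inter> subfms \<phi> | \<Delta>. mcs \<Delta> & acc \<Gamma> \<Delta>}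
    (%X Y. ALL p. Box p : X --> Box p : Y) (%X n. Atom n : X) (\<Delta> \<inter> subfms \<phi>) \<phi> <-> \<phi> : \<Delta>"
proof -
 have "cons {Not \<phi>}"
 proof (rule ccontr)
  assume "\<not> ?thesis"
  then have d: "der {} (Imp (Not \<phi>) Falsity)" unfolding cons_def using deduction by blast
  have "der {} \<phi>" by (rule der_conseq[of "[Imp (Not \<phi>) Falsity]"]) (use d in \<open>auto simp: boolean_def\<close>)
  then show False using assms unfolding der_def by auto
 qed
 then obtain \<Gamma> where G: "mcs \<Gamma>" "Not \<phi> : \<Gamma>" using lindenbaum by blast
 then have nG: "\<phi> ~: \<Gamma>" using mcs_Imp[OF G(1), of \<phi> Falsity] mcs_Falsity by blast
 let ?F = "{\<Delta> \<inter> subfms \<phi> | \<Delta>. mcs \<Delta> & acc \<Gamma> \<Delta>}"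
 let ?R = "%X Y. ALL p. Box p : X --> Box p : Y"
 have main: "ev ?F ?R (%X n. Atom n : X) (\<Delta> \<inter> subfms \<phi>) \<psi> <-> \<psi> : \<Delta>"
  if "\<psi> : subfms \<phi>" "mcs \<Delta>" "acc \<Gamma> \<Delta>" for \<psi> \<Delta>
  using that
 proof (induction \<psi> arbitrary: \<Delta>)
  case Falsity then show ?case using mcs_Falsity by auto
 next
  case (Imp p q)
  then show ?case using subfms_closed(1)[OF Imp.prems(1)] mcs_Imp[OF Imp.prems(2)] by simp
 next
  case (Box p)
  have p: "p : subfms \<phi>" using subfms_closed(2) Box.prems(1) by blast
  show ?case
  proof
   assume *: "Box p : \<Delta>"
   show "ev ?F ?R (%X n. Atom n : X) (\<Delta> \<inter> subfms \<phi>) (Box p)"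
   proof (simp only: ev.simps, intro ballI impI)
    fix Y assume Y: "Y : ?F" "?R (\<Delta> \<inter> subfms \<phi>) Y"
    then obtain \<Theta> where th: "Y = \<Theta> \<inter> subfms \<phi>" "mcs \<Theta>" "acc \<Gamma> \<Theta>" by blast
    have "Box p : \<Theta>" using Y(2) * Box.prems(1) th(1) by blast
    then have "p : \<Theta>" using acc_refl[OF th(2)] unfolding acc_def by blast
    then show "ev ?F ?R (%X n. Atom n : X) Y p" using Box.IH[OF p th(2,3)] th(1) by simp
   qed
  next
   assume e: "ev ?F ?R (%X n. Atom n : X) (\<Delta> \<inter> subfms \<phi>) (Box p)"
   show "Box p : \<Delta>"
   proof (rule ccontr)
    assume "Box p ~: \<Delta>"
    then obtain \<Theta> where th: "mcs \<Theta>" "acc \<Delta> \<Theta>" "p ~: \<Theta>" using acc_ex Box.prems(2) by blast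
    have a: "acc \<Gamma> \<Theta>" using acc_trans[OF G(1) Box.prems(3) th(2)] .
    have "?R (\<Delta> \<inter> subfms \<phi>) (\<Theta> \<inter> subfms \<phi>)" using acc_box[OF Box.prems(2) th(2)] by blast
    then have "ev ?F ?R (%X n. Atom n : X) (\<Theta> \<inter> subfms \<phi>) p" using e th(1) a by (simp only: ev.simps) blast
    then show False using Box.IH[OF p th(1) a] th(3) by blast
   qed
  qed
 qed auto
 show ?thesis by (rule that[OF G(1) nG]) (rule main[OF subfms_refl])
qed

end

lemma ev_bij:
 assumes f: "bij_betw f A B"
 shows "x : A ==> ev A (%x y. R (f x) (f y)) (%x. V (f x)) x p <-> ev B R V (f x) p"
proof (induction p arbitrary: x)
 case (Box p)
 then show ?case using bij_betw_imp_surj_on[OF f] by auto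
qed auto

text \<open>The third axiom scheme gives any two sets accessible from \<open>\<Gamma>\<close> a
  common successor. There are finitely many points, so some point \<open>t\<close> lies above all of
  them. Points are renumbered to serve as remainders modulo \<open>k\<close>.\<close>

lemma S42_finite_model:
 assumes "\<phi> ~: S42"
 obtains k :: nat and R V r t where "r < k" "t < k" "!!i. i < k ==> R i i"
  "!!i j l. i < k ==> j < k ==> l < k ==> R i j ==> R j l ==> R i l"
  "!!i. i < k ==> R r i" "!!i. i < k ==> R i t" "\<not> ev {..<k} R V r \<phi>"
proof -
 interpret s4logic S42
  unfolding S42_def by unfold_locales (auto simp: S4_axioms_def intro: normal_logic.intros)
 obtain \<Gamma> where G: "mcs \<Gamma>" "\<phi> ~: \<Gamma>" and E: "!!\<Delta>. mcs \<Delta> ==> acc \<Gamma> \<Delta> ==> ev {\<Delta> \<inter> subfms \<phi> | \<Delta>. mcs \<Delta> & acc \<Gamma> \<Delta>}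
    (%X Y. ALL p. Box p : X --> Box p : Y) (%X n. Atom n : X) (\<Delta> \<inter> subfms \<phi>) \<phi> <-> \<phi> : \<Delta>"
  using filtration[OF assms] by blast
 let ?F = "{\<Delta> \<inter> subfms \<phi> | \<Delta>. mcs \<Delta> & acc \<Gamma> \<Delta>}"
 let ?R = "%X Y. ALL p. Box p : X --> Box p : Y"
 have ax: "Imp (Dia (Box p)) (Box (Dia p)) : S42" for p
  unfolding S42_def by (rule normal_logic.ax) auto
 have dir: "EX \<Theta>. mcs \<Theta> & acc \<Delta> \<Theta> & acc \<Delta>' \<Theta>"
  if D: "mcs \<Delta>" "acc \<Gamma> \<Delta>" "mcs \<Delta>'" "acc \<Gamma> \<Delta>'" for \<Delta> \<Delta>'
 proof -
  have "cons ({q. Box q : \<Delta>} \<union> {q. Box q : \<Delta>'})"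
  proof (rule ccontr)
   assume "\<not> ?thesis"
   then obtain ps where ps: "set ps \<subseteq> {q. Box q : \<Delta>} \<union> {q. Box q : \<Delta>'}" "foldr Imp ps Falsity : S42"
    unfolding cons_def der_def by blast
   \<comment> \<open>An inconsistency is split by origin. \<open>?r\<close> negates the conjunction
     of the hypotheses from \<open>\<Delta>'\<close>; it is necessary at \<open>\<Delta>\<close>, so
     the axiom makes it possible at \<open>\<Delta>'\<close>, where its negation is
     necessary.\<close>
   let ?a = "filter (%q. Box q : \<Delta>) ps" and ?b = "filter (%q. Box q ~: \<Delta>) ps"
   let ?r = "foldr Imp ?b Falsity"
   have "foldr Imp ?a ?r : S42"
    by (rule conseq[of "[foldr Imp ps Falsity]"]) (use ps(2) in \<open>auto simp: boolean_foldr boolean_def\<close>)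
   then have "Box ?r : \<Delta>" by (rule box_foldr[OF D(1)]) auto
   then have "Not (Box ?r) ~: \<Delta>" using mcs_Imp[OF D(1)] mcs_Falsity[OF D(1)] by blast
   then have "Box (Not (Box ?r)) ~: \<Gamma>" using D(2) unfolding acc_def by blast
   then have "Dia (Box ?r) : \<Gamma>" using mcs_Imp[OF G(1)] by blast
   then have "Box (Dia ?r) : \<Gamma>" using mcs_L[OF G(1) ax[of ?r]] mcs_Imp[OF G(1)] by blast
   then have 1: "Dia ?r : \<Delta>'" using D(4) unfolding acc_def by blast
   have "foldr Imp ?b (Not ?r) : S42"
    by (rule taut) (auto simp: tautology_boolean boolean_foldr, auto simp: boolean_def boolean_foldr)
   then have "Box (Not ?r) : \<Delta>'" by (rule box_foldr[OF D(3)]) (use ps(1) in auto)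
   then show False using 1 mcs_Imp[OF D(3)] mcs_Falsity[OF D(3)] by blast
  qed
  then obtain \<Theta> where "{q. Box q : \<Delta>} \<union> {q. Box q : \<Delta>'} \<subseteq> \<Theta>" "mcs \<Theta>" using lindenbaum by blast
  then show ?thesis unfolding acc_def by blast
 qed
 have finF: "finite ?F" by (rule finite_subset[of _ "Pow (subfms \<phi>)"]) (auto simp: subfms_finite)
 have "EX \<Theta>. mcs \<Theta> & acc \<Gamma> \<Theta> & (ALL X:A. ?R X \<Theta>)" if "A \<subseteq> ?F" for A
  using finite_subset[OF that finF] that
 proof (induction A)
  case empty then show ?case using G acc_refl by blast
 next
  case (insert X A)
  then obtain \<Theta> where th: "mcs \<Theta>" "acc \<Gamma> \<Theta>" "ALL X:A. ?R X \<Theta>" by blast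
  obtain \<Delta> where D: "X = \<Delta> \<inter> subfms \<phi>" "mcs \<Delta>" "acc \<Gamma> \<Delta>" using insert by blast
  obtain \<Xi> where x: "mcs \<Xi>" "acc \<Delta> \<Xi>" "acc \<Theta> \<Xi>" using dir[OF D(2,3) th(1,2)] by blast
  have "?R X \<Xi>" using acc_box[OF D(2) x(2)] D(1) by blast
  moreover have "ALL Y:A. ?R Y \<Xi>" using th(3) acc_box[OF th(1) x(3)] by blast
  ultimately show ?case using x acc_trans[OF G(1) th(2) x(3)] by blast
 qed
 then obtain \<Theta> where th: "mcs \<Theta>" "acc \<Gamma> \<Theta>" "ALL X:?F. ?R X \<Theta>" by blast
 obtain k :: nat and f where f: "bij_betw f {..<k} ?F"
  using ex_bij_betw_nat_finite[OF finF] unfolding atLeast0LessThan by blast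
 have im: "f ` {..<k} = ?F" using bij_betw_imp_surj_on[OF f] .
 have "\<Gamma> \<inter> subfms \<phi> : f ` {..<k}" unfolding im using G acc_refl by blast
 then obtain r where r: "r < k" "f r = \<Gamma> \<inter> subfms \<phi>" by auto
 have "\<Theta> \<inter> subfms \<phi> : f ` {..<k}" unfolding im using th by blast
 then obtain t where t: "t < k" "f t = \<Theta> \<inter> subfms \<phi>" by auto
 have fk: "f i : ?F" if "i < k" for i using im that by blast
 have "\<not> ev ?F ?R (%X n. Atom n : X) (f r) \<phi>" using E[OF G(1) acc_refl[OF G(1)]] G(2) r(2) by simp
 then have ne: "\<not> ev {..<k} (%i j. ?R (f i) (f j)) (%i n. Atom n : f i) r \<phi>"
  using ev_bij[OF f, of r ?R "%X n. Atom n : X" \<phi>] r(1) by simp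
 show ?thesis
 proof (rule that[OF r(1) t(1) _ _ _ _ ne])
  fix i assume "i < k"
  then obtain \<Delta> where D: "f i = \<Delta> \<inter> subfms \<phi>" "mcs \<Delta>" "acc \<Gamma> \<Delta>" using fk by blast
  show "?R (f r) (f i)" using acc_box[OF G(1) D(3)] D(1) r(2) by auto
  show "?R (f i) (f t)" using th(3) fk[OF \<open>i < k\<close>] t(2) D(1) by auto
 qed auto
qed

text \<open>The axiom makes every set accessible from \<open>\<Gamma>\<close> see
  \<open>\<Gamma>\<close> in turn, so on the points of the filtration the relation is total.\<close>

lemma S5_finite_model:
 assumes "\<phi> ~: S5"
 obtains k :: nat and V r where "r < k" "\<not> ev {..<k} (%_ _. True) V r \<phi>"
proof -
 interpret s4logic S5
  unfolding S5_def by unfold_locales (auto simp: S4_axioms_def intro: normal_logic.intros)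
 obtain \<Gamma> where G: "mcs \<Gamma>" "\<phi> ~: \<Gamma>" and E: "!!\<Delta>. mcs \<Delta> ==> acc \<Gamma> \<Delta> ==> ev {\<Delta> \<inter> subfms \<phi> | \<Delta>. mcs \<Delta> & acc \<Gamma> \<Delta>}
    (%X Y. ALL p. Box p : X --> Box p : Y) (%X n. Atom n : X) (\<Delta> \<inter> subfms \<phi>) \<phi> <-> \<phi> : \<Delta>"
  using filtration[OF assms] by blast
 let ?F = "{\<Delta> \<inter> subfms \<phi> | \<Delta>. mcs \<Delta> & acc \<Gamma> \<Delta>}"
 let ?R = "%X Y. ALL p. Box p : X --> Box p : Y"
 have ax: "Imp (Dia (Box p)) p : S5" for p
  unfolding S5_def by (rule normal_logic.ax) auto
 have sym: "acc \<Delta> \<Gamma>" if D: "mcs \<Delta>" "acc \<Gamma> \<Delta>" for \<Delta>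
  unfolding acc_def
 proof (intro allI impI)
  fix p assume "Box p : \<Delta>"
  then have "Not (Box p) ~: \<Delta>" using mcs_Imp[OF D(1)] mcs_Falsity[OF D(1)] by blast
  then have "Box (Not (Box p)) ~: \<Gamma>" using D(2) unfolding acc_def by blast
  then have "Dia (Box p) : \<Gamma>" using mcs_Imp[OF G(1)] by blast
  then show "p : \<Gamma>" using mcs_L[OF G(1) ax[of p]] mcs_Imp[OF G(1)] by blast
 qed
 have total: "?R X Y" if XY: "X : ?F" "Y : ?F" for X Y
 proof -
  obtain \<Delta> where D: "X = \<Delta> \<inter> subfms \<phi>" "mcs \<Delta>" "acc \<Gamma> \<Delta>" using XY(1) by blast
  obtain \<Theta> where T: "Y = \<Theta> \<inter> subfms \<phi>" "mcs \<Theta>" "acc \<Gamma> \<Theta>" using XY(2) by blast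
  show ?thesis using acc_box[OF D(2) sym[OF D(2,3)]] acc_box[OF G(1) T(3)] D(1) T(1) by blast
 qed
 have finF: "finite ?F" by (rule finite_subset[of _ "Pow (subfms \<phi>)"]) (auto simp: subfms_finite)
 obtain k :: nat and f where f: "bij_betw f {..<k} ?F"
  using ex_bij_betw_nat_finite[OF finF] unfolding atLeast0LessThan by blast
 have im: "f ` {..<k} = ?F" using bij_betw_imp_surj_on[OF f] .
 have "\<Gamma> \<inter> subfms \<phi> : f ` {..<k}" unfolding im using G acc_refl by blast
 then obtain r where r: "r < k" "f r = \<Gamma> \<inter> subfms \<phi>" by auto
 have cong: "ev {..<k} (%i j. ?R (f i) (f j)) V i p <-> ev {..<k} (%_ _. True) V i p" if "i < k" for V i p
  using that
 proof (induction p arbitrary: i)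
  case (Box p)
  have "?R (f i) (f j)" if "j < k" for j by (rule total) (use im Box.prems that in blast)+
  then show ?case using Box by auto
 qed auto
 have "\<not> ev ?F ?R (%X n. Atom n : X) (f r) \<phi>" using E[OF G(1) acc_refl[OF G(1)]] G(2) r(2) by simp
 then have "\<not> ev {..<k} (%i j. ?R (f i) (f j)) (%i n. Atom n : f i) r \<phi>"
  using ev_bij[OF f, of r ?R "%X n. Atom n : X" \<phi>] r(1) by simp
 then show ?thesis using cong[OF r(1)] that[OF r(1)] by blast
qed

section \<open>Transfer along labellings\<close>

text \<open>The labelling is a bounded morphism from the extensions of \<open>W\<close> to the
  frame, and the sentences of \<open>sent\<close> express the valuation through it.\<close>

lemma labelling_refutes:
 assumes "W : worlds S" "acc S W W"
  and tr: "!!U U'. U : worlds S ==> U' : worlds S ==> acc S W U ==> acc S U U' ==> acc S W U'"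
  and lt: "!!U. U : worlds S ==> acc S W U ==> lab U < k"
  and forth: "!!U U'. U : worlds S ==> U' : worlds S ==> acc S W U ==> acc S U U' ==> R (lab U) (lab U')"
  and bk: "!!U j. U : worlds S ==> acc S W U ==> j < k ==> R (lab U) j ==>
    EX U':worlds S. acc S U U' & lab U' = j"
  and sent: "!!n. EX s:L. ALL U:worlds S. acc S W U --> (models (str S U) s <-> V (lab U) n)"
  and "\<not> ev {..<k} R V (lab W) \<phi>"
 shows "\<phi> ~: Val S W L"
proof -
 obtain \<sigma> where \<sigma>: "!!n. \<sigma> n : L"
  "!!n U. U : worlds S ==> acc S W U ==> models (str S U) (\<sigma> n) <-> V (lab U) n"
  using sent by metis
 have "modal_true S U (map_modal \<sigma> p) <-> ev {..<k} R V (lab U) p" if "U : worlds S" "acc S W U" for U p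
  using that
 proof (induction p arbitrary: U)
  case (Box p)
  show ?case
  proof
   assume l: "modal_true S U (map_modal \<sigma> (Box p))"
   show "ev {..<k} R V (lab U) (Box p)"
   proof (simp only: ev.simps, intro ballI impI)
    fix j assume "j : {..<k}" "R (lab U) j"
    then obtain U' where U': "U' : worlds S" "acc S U U'" "lab U' = j" using bk Box.prems by blast
    then have "modal_true S U' (map_modal \<sigma> p)" using l by simp
    then show "ev {..<k} R V j p" using Box.IH[OF U'(1) tr[OF Box.prems(1) U'(1) Box.prems(2) U'(2)]] U'(3) by simp
   qed
  next
   assume r: "ev {..<k} R V (lab U) (Box p)"
   show "modal_true S U (map_modal \<sigma> (Box p))"
   proof (simp, intro ballI impI)
    fix U' assume U': "U' : worlds S" "acc S U U'"
    have a: "acc S W U'" using tr[OF Box.prems(1) U'(1) Box.prems(2) U'(2)] .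
    have "ev {..<k} R V (lab U') p" using r lt[OF U'(1) a] forth[OF Box.prems(1) U'(1) Box.prems(2) U'(2)] by simp
    then show "modal_true S U' (map_modal \<sigma> p)" using Box.IH[OF U'(1) a] by simp
   qed
  qed
 qed (use \<sigma> in auto)
 then show ?thesis using assms unfolding Val_def using \<sigma>(1) by blast
qed

section \<open>From definability to sentences\<close>

primrec trc :: "(nat => 'g trm) => unit trm => 'g trm" where
 "trc f (Var i) = f i"
| "trc f (Fun a ts) = Var 0"

text \<open>Free variables are replaced according to \<open>f\<close>, and a quantifier restores its
  own variable. Only variables themselves or closed constants are inserted, so nothing is captured.
  The \<open>Rel\<close> clause, like the function case of \<open>trc\<close>, is a default outside
  well-formed set formulas.\<close>

primrec cst :: "(nat => 'g trm) => set_fm => ('g, 'h) fm" where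
 "cst f (Eq s t) = Eq (trc f s) (trc f t)"
| "cst f (Mem s t) = Mem (trc f s) (trc f t)"
| "cst f (Rel r ts) = Eq (Var 0) (Var 0)"
| "cst f (Neg p) = Neg (cst f p)"
| "cst f (Conj p q) = Conj (cst f p) (cst f q)"
| "cst f (Forall n p) = Forall n (cst (f(n := Var n)) p)"

lemma set_trm_Var: "wf_trm {} (s :: unit trm) ==> EX i. s = Var i"
 by (cases s) auto

lemma sat_cst:
 "wf_fm {} {} p ==> (!!i. f i = Var i \<or> (EX c. f i = Fun c [])) ==>
  sat (eps_struc F R M) e (cst f p) <-> sat (\<S> M) (%i. trm_val (eps_struc F R M) e (f i)) p"
proof (induction p arbitrary: f e)
 case (Eq s t)
 obtain i j where "s = Var i" "t = Var j" using Eq(1) set_trm_Var[of s] set_trm_Var[of t] by auto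
 then show ?case by simp
next
 case (Mem s t)
 obtain i j where "s = Var i" "t = Var j" using Mem(1) set_trm_Var[of s] set_trm_Var[of t] by auto
 then show ?case by simp
next
 case (Forall n p)
 let ?T = "trm_val (eps_struc F R M)"
 have eq: "(%i. ?T (e(n := b)) ((f(n := Var n)) i)) = (%i. ?T e (f i))(n := b)" for b
 proof
  fix i show "?T (e(n := b)) ((f(n := Var n)) i) = ((%i. ?T e (f i))(n := b)) i"
   using Forall.prems(2)[of i] by (cases "i = n") auto
 qed
 have "sat (eps_struc F R M) (e(n := b)) (cst (f(n := Var n)) p) <-> sat (\<S> M) ((%i. ?T e (f i))(n := b)) p" for b
  unfolding eq[symmetric] by (rule Forall.IH) (use Forall.prems in auto)
 then show ?case by simp
qed auto

lemma wf_cst: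
 "wf_fm {} {} p ==> (!!i. f i = Var i \<or> (EX c. f i = Fun c [] & (c, 0) : Fs)) ==> wf_fm Fs Rs (cst f p)"
proof (induction p arbitrary: f)
 have w: "wf_trm Fs t" if "t = Var i \<or> (EX c. t = Fun c [] & (c, 0) : Fs)" for t and i :: nat using that by auto
 { case (Eq s t)
  obtain i j where "s = Var i" "t = Var j" using Eq(1) set_trm_Var[of s] set_trm_Var[of t] by auto
  then show ?case using w[of "f i" i] w[of "f j" j] Eq(2) by simp }
 { case (Mem s t)
  obtain i j where "s = Var i" "t = Var j" using Mem(1) set_trm_Var[of s] set_trm_Var[of t] by auto
  then show ?case using w[of "f i" i] w[of "f j" j] Mem(2) by simp }
 { case (Forall n p) then show ?case by simp }
qed auto

lemma fv_cst:
 "wf_fm {} {} p ==> (!!i. f i = Var i \<or> (EX c. f i = Fun c [])) ==>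
  fv (cst f p :: ('g, 'h) fm) \<subseteq> {i : fv p. f i = Var i}"
proof (induction p arbitrary: f)
 have v: "vars_trm t \<subseteq> {j. j = i & t = Var j}" if "t = Var i \<or> (EX c. t = Fun c [])" for t and i :: nat using that by auto
 { case (Eq s t)
  obtain i j where "s = Var i" "t = Var j" using Eq(1) set_trm_Var[of s] set_trm_Var[of t] by auto
  then show ?case using v[of "f i" i] v[of "f j" j] Eq(2) by auto }
 { case (Mem s t)
  obtain i j where "s = Var i" "t = Var j" using Mem(1) set_trm_Var[of s] set_trm_Var[of t] by auto
  then show ?case using v[of "f i" i] v[of "f j" j] Mem(2) by auto }
 { case (Conj p q)
  have "fv (cst f p :: ('g, 'h) fm) \<subseteq> {i : fv p. f i = Var i}"
   by (rule Conj.IH(1)) (use Conj.prems in auto)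
  moreover have "fv (cst f q :: ('g, 'h) fm) \<subseteq> {i : fv q. f i = Var i}"
   by (rule Conj.IH(2)) (use Conj.prems in auto)
  ultimately show ?case by auto }
 { case (Forall n p)
  have "fv (cst (f(n := Var n)) p :: ('g, 'h) fm) \<subseteq> {i : fv p. (f(n := Var n)) i = Var i}"
   by (rule Forall.IH) (use Forall.prems in auto)
  then show ?case by auto }
qed auto

text \<open>The parameters in \<open>C\<close> become constants. The sentence mentions no other
  symbols, so its truth does not depend on how the rest of the language is interpreted.\<close>

lemma (in zfmodels) sentence_of:
 fixes nm :: "hc => 'g" and Fs :: "('g \<times> nat) set" and Rs :: "('h \<times> nat) set"
 assumes P: "dfn 0 P" and nm: "!!c. c : C ==> (nm c, 0) : Fs"
 shows "EX s : sentences Fs Rs. ALL M:K. ALL F R. (ALL c:C. F (nm c) [] = c) -->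
  (models (eps_struc F R M) s <-> P M (%_. hempty))"
proof -
 obtain p where p: "wf_fm {} {} p" "fv p \<subseteq> vok 0"
  "!!M e. M : K ==> range e \<subseteq> M ==> sat (\<S> M) (mix e) p <-> P M e" using dfnE[OF P] by metis
 let ?e = "%_. hempty"
 define f where "f i = (if i : vok 0 then Fun (nm (mix ?e i)) [] else Var i)" for i
 have mC: "mix ?e i : C" if "i : vok 0" for i
  using that from_nat_into[of C] by (auto simp: vok_def mix_pn split: if_splits)
 have f: "f i = Var i \<or> (EX c. f i = Fun c [] & (c, 0) : Fs)" for i
  unfolding f_def using nm mC by auto
 then have f': "f i = Var i \<or> (EX c. f i = Fun c [])" for i by blast
 have "fv (cst f p :: ('g, 'h) fm) = {}" using fv_cst[OF p(1) f'] p(2) unfolding f_def by (auto split: if_splits)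
 then have s: "cst f p : sentences Fs Rs" unfolding sentences_def using wf_cst[OF p(1) f] by simp
 show ?thesis
 proof (intro bexI[OF _ s] ballI allI impI)
  fix M and F :: "'g => hc list => hc" and R :: "'h => hc list => bool" assume M: "M : K" and F: "ALL c:C. F (nm c) [] = c"
  have h: "hempty : M" using zfm_hempty[OF K_zfm[OF M]] .
  have "sat (eps_struc F R M) e (cst f p) <-> P M ?e" for e :: "nat => hc"
  proof -
   have "sat (eps_struc F R M) e (cst f p) <-> sat (\<S> M) (%i. trm_val (eps_struc F R M) e (f i)) p"
    by (rule sat_cst[OF p(1) f'])
   also have "\<dots> <-> sat (\<S> M) (mix ?e) p"
    by (rule sat_cong) (use p(2) F mC in \<open>auto simp: f_def\<close>)
   also have "\<dots> <-> P M ?e" by (rule p(3)[OF M]) (use h in auto)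
   finally show ?thesis .
  qed
  moreover have "range (%_::nat. hempty) \<subseteq> M" using h by auto
  ultimately show "models (eps_struc F R M) (cst f p) <-> P M ?e" unfolding models_def eps_struc_simps by blast
 qed
qed

lemma (in zfmodels) dfn_finite_ex [dfi]: "(!!j. j < (k::nat) ==> dfn n (P j)) ==> dfn n (%M e. EX j<k. P j M e)"
proof (induction k)
 case 0
 show ?case using dfn_bool[of n False] by simp
next
 case (Suc k)
 have "dfn n (%M e. (EX j<k. P j M e) \<or> P k M e)" by (intro dfn_disj Suc) simp_all
 then show ?case by (simp add: less_Suc_eq ex_disj_distrib conj_disj_distribR disj_commute)
qed

section \<open>Ingredients of the labels: internal worlds and dials\<close>

section \<open>Being a countable transitive model, internally\<close>

text \<open>A single formula in place of infinitely many axioms: the weak forms from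
  \<open>zfmI\<close> together with choice, the schemes being quantified over codes of formulas and
  finite assignments. Countability is automatic, as every set here is countable.\<close>

definition is_ctm :: "hc => bool" where
 "is_ctm A <-> hempty : elts A & htrans A & omega : elts A &
  (ALL x:elts A. ALL y:elts A. EX b:elts A. x : elts b & y : elts b) &
  (ALL x:elts A. EX b:elts A. ALL y:elts x. elts y \<subseteq> elts b) &
  (ALL x:elts A. EX b:elts A. ALL y:elts A. elts y \<subseteq> elts x --> y : elts b) &
  (ALL x:elts A. ALL f:elts (Fenv A). ALL m:elts omega. ALL v:elts omega. hset {z : elts x. hupd f v z : elts (SatS A m)} : elts A) &
  (ALL x:elts A. ALL f:elts (Fenv A). ALL m:elts omega. EX b:elts A. ALL z:elts x.
   (EX y:elts A. hupd (hupd f (hc_nat 0) z) (hc_nat 1) y : elts (SatS A m)) -->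
   (EX y:elts b. hupd (hupd f (hc_nat 0) z) (hc_nat 1) y : elts (SatS A m))) &
  (ALL x:elts A. (ALL y:elts x. y ~= hempty) -->
   (ALL y:elts x. ALL y':elts x. (EX z:elts y. z : elts y') --> y = y') -->
   (EX c:elts A. ALL y:elts x. EX u:elts y. ALL z:elts y. z : elts c <-> z = u))"

lemma (in zfmodels) dfn_is_ctm [dfi]: "dfun n s ==> dfn n (%M e. is_ctm (s M e))"
proof (rule dfn_comp1[where R = "%M. is_ctm"])
 have 7: "dfn 1 (%M e. ALL x:elts (e 0). ALL f:elts (Fenv (e 0)). ALL m:elts omega. ALL v:elts omega.
   hset {z : elts x. hupd f v z : elts (SatS (e 0) m)} : elts (e 0))" by (intro dfi) simp_all
 have 8: "dfn 1 (%M e. ALL x:elts (e 0). ALL f:elts (Fenv (e 0)). ALL m:elts omega. EX b:elts (e 0). ALL z:elts x.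
   (EX y:elts (e 0). hupd (hupd f (hc_nat 0) z) (hc_nat 1) y : elts (SatS (e 0) m)) -->
   (EX y:elts b. hupd (hupd f (hc_nat 0) z) (hc_nat 1) y : elts (SatS (e 0) m)))" by (intro dfi) simp_all
 have 9: "dfn 1 (%M e. ALL x:elts (e 0). (ALL y:elts x. y ~= hempty) -->
   (ALL y:elts x. ALL y':elts x. (EX z:elts y. z : elts y') --> y = y') -->
   (EX c:elts (e 0). ALL y:elts x. EX u:elts y. ALL z:elts y. z : elts c <-> z = u))" by (intro dfi) simp_all
 have 4: "dfn 1 (%M e. ALL x:elts (e 0). ALL y:elts (e 0). EX b:elts (e 0). x : elts b & y : elts b)"
  by (intro dfi) simp_all
 have 5: "dfn 1 (%M e. ALL x:elts (e 0). EX b:elts (e 0). ALL y:elts x. elts y \<subseteq> elts b)"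
  by (intro dfi) simp_all
 have 6: "dfn 1 (%M e. ALL x:elts (e 0). EX b:elts (e 0). ALL y:elts (e 0). elts y \<subseteq> elts x --> y : elts b)"
  by (intro dfi) simp_all
 show "dfn 1 (%M e. is_ctm (e 0))" unfolding is_ctm_def by (intro dfn_conj 4 5 6 7 8 9) (intro dfi; simp)+
qed

lemma zfm_env_sep:
 assumes M: "M : zfm" and p: "wf_fm {} {} p" and e: "range e \<subseteq> M" and x: "x : M"
 shows "hset {z : elts x. sat (\<S> M) (e(v := z)) p} : M"
proof -
 interpret D: zfmodels "{M}" M using M by (rule zfm_zfmodels)
 have "D.dfun 1 (%N f. if i = v then f 0 else e i)" for i
  using e by (cases "i = v") (auto intro!: D.dfun_var D.dfun_const)
 then have "D.dfn 1 (%N f. sat (\<S> N) (%i. if i = v then f 0 else e i) p)"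
  using D.dfn_sat[where NN = "%N. N" and v = "%i N f. if i = v then f 0 else e i" and n = 1, OF _ _ p]
   D.dfn_cong[OF D.dfn_bool[of 1 True], of "%N f. f 0 : N"] by auto
 moreover have "(%i. if i = v then z else e i) = e(v := z)" for z by auto
 ultimately have "D.dfn 1 (%N f. sat (\<S> N) (e(v := f 0)) p)" by simp
 note [dfi] = D.dfn_comp1[where R = "%N z. sat (\<S> N) (e(v := z)) p", OF this]
 have "D.dfun 0 (%N f. hset {z : elts x. sat (\<S> N) (e(v := z)) p})" by (intro dfi) (use x in simp_all)
 from zfm_closed[OF M this] show ?thesis .
qed

lemma zfm_env_collection:
 assumes M: "M : zfm" and p: "wf_fm {} {} p" and e: "range e \<subseteq> M" and x: "x : M"
 shows "EX b:M. ALL z:elts x. (EX y:M. sat (\<S> M) (e(0 := z, 1 := y)) p) --> (EX y:elts b. sat (\<S> M) (e(0 := z, 1 := y)) p)"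
proof -
 interpret D: zfmodels "{M}" M using M by (rule zfm_zfmodels)
 have "D.dfun 2 (%N f. if i = 0 then f 0 else if i = 1 then f 1 else e i)" for i
  using e by (cases "i = 0"; cases "i = 1") (auto intro!: D.dfun_var D.dfun_const)
 then have "D.dfn 2 (%N f. sat (\<S> N) (%i. if i = 0 then f 0 else if i = 1 then f 1 else e i) p)"
  using D.dfn_sat[where NN = "%N. N" and v = "%i N f. if i = 0 then f 0 else if i = 1 then f 1 else e i" and n = 2, OF _ _ p]
   D.dfn_cong[OF D.dfn_bool[of 1 True], of "%N f. f 0 : N"] by auto
 moreover have "(%i. if i = 0 then z else if i = 1 then y else e i) = e(0 := z, 1 := y)" for z y by auto
 ultimately have "D.dfn 2 (%N f. sat (\<S> N) (e(0 := f 0, 1 := f 1)) p)" by simp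
 from zfm_collection[where R = "%N z y. sat (\<S> N) (e(0 := z, 1 := y)) p", OF M this x] show ?thesis .
qed

lemma SatS_hupd: "isfenv A f ==> a : elts A ==>
  hupd f (hc_nat v) a : elts (SatS A (hc_nat m)) <-> sat (\<S> (elts A)) ((fenv f)(v := a)) (dec m)"
 using hupd_Fenv[of A f a v] by (simp add: SatS_nat fenv_hupd)

lemma SatS_hupd2:
 assumes "isfenv A f" "a : elts A" "b : elts A"
 shows "hupd (hupd f (hc_nat 0) a) (hc_nat 1) b : elts (SatS A (hc_nat m)) <->
  sat (\<S> (elts A)) ((fenv f)(0 := a, 1 := b)) (dec m)"
 using SatS_hupd[OF hupd_Fenv[OF assms(1,2), of 0] assms(3), of 1 m] fenv_hupd[OF assms(1), of 0 a] by simp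

lemma inter_single: "(EX u. B \<inter> D = {u}) <-> (EX u:B. ALL z:B. z : D <-> z = u)"
 by blast

lemma elts_hempty_iff: "y ~= hempty <-> elts y ~= {}"
 using elts_inject[of y hempty] by simp

theorem is_ctm_iff: "is_ctm A <-> elts A : ctms"
proof
 assume c: "elts A : ctms"
 then have M: "elts A : zfm" and ch: "models (\<S> (elts A)) ax_choice" using ctms_zfm by blast+
 interpret D: zfmodels "{elts A}" "elts A" using M by (rule zfm_zfmodels)
 note tr = zfm_trans[OF M]
 have h: "hempty : elts A" by (rule D.zfm_hempty[OF M])
 have 4: "EX b:elts A. x : elts b & y : elts b" if "x : elts A" "y : elts A" for x y
  using zfm_upair[OF M that] by (intro bexI[of _ "upair x y"]) auto
 have 5: "EX b:elts A. ALL y:elts x. elts y \<subseteq> elts b" if "x : elts A" for x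
  using zfm_union[OF M that] by (intro bexI[of _ "hunion x"]) auto
 have 6: "EX b:elts A. ALL y:elts A. elts y \<subseteq> elts x --> y : elts b" if "x : elts A" for x
  using zfm_pow[OF M that] by (intro bexI[of _ "pow (elts A) x"]) (auto simp: elts_pow)
 have 7: "hset {z : elts x. hupd f v z : elts (SatS A m)} : elts A"
  if h: "x : elts A" "f : elts (Fenv A)" "m : elts omega" "v : elts omega" for x f m v
 proof -
  obtain m' v' where mv: "m = hc_nat m'" "v = hc_nat v'" using h(3,4) by auto
  have f: "isfenv A f" using h(2) by (simp only: elts_Fenv)
  have "{z : elts x. hupd f v z : elts (SatS A m)} = {z : elts x. sat (\<S> (elts A)) ((fenv f)(v' := z)) (dec m')}"
   unfolding mv using SatS_hupd[OF f tr[OF h(1)]] by blast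
  then show ?thesis
   using zfm_env_sep[OF M dec_wf fenv_range[OF f \<open>hempty : elts A\<close>] h(1), of v' m'] by simp
 qed
 have 8: "EX b:elts A. ALL z:elts x. (EX y:elts A. hupd (hupd f (hc_nat 0) z) (hc_nat 1) y : elts (SatS A m)) -->
   (EX y:elts b. hupd (hupd f (hc_nat 0) z) (hc_nat 1) y : elts (SatS A m))"
  if h': "x : elts A" "f : elts (Fenv A)" "m : elts omega" for x f m
 proof -
  obtain m' where m: "m = hc_nat m'" using h'(3) by auto
  have f: "isfenv A f" using h'(2) by (simp only: elts_Fenv)
  obtain b where b: "b : elts A" "ALL z:elts x. (EX y:elts A. sat (\<S> (elts A)) ((fenv f)(0 := z, 1 := y)) (dec m')) -->
    (EX y:elts b. sat (\<S> (elts A)) ((fenv f)(0 := z, 1 := y)) (dec m'))"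
   using zfm_env_collection[OF M dec_wf fenv_range[OF f h] h'(1), of m'] by blast
  show ?thesis unfolding m
  proof (intro bexI[OF _ b(1)] ballI impI)
   fix z assume z: "z : elts x" "EX y:elts A. hupd (hupd f (hc_nat 0) z) (hc_nat 1) y : elts (SatS A (hc_nat m'))"
   note S = SatS_hupd2[OF f tr[OF h'(1) z(1)]]
   have "EX y:elts A. sat (\<S> (elts A)) ((fenv f)(0 := z, 1 := y)) (dec m')" using z(2) S by blast
   then obtain y where "y : elts b" "sat (\<S> (elts A)) ((fenv f)(0 := z, 1 := y)) (dec m')" using b(2) z(1) by blast
   then show "EX y:elts b. hupd (hupd f (hc_nat 0) z) (hc_nat 1) y : elts (SatS A (hc_nat m'))"
    using S tr[OF b(1)] by blast
  qed
 qed
 have 9: "EX c:elts A. ALL y:elts x. EX u:elts y. ALL z:elts y. z : elts c <-> z = u"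
  if h'': "x : elts A" "ALL y:elts x. y ~= hempty" "ALL y:elts x. ALL y':elts x. (EX z:elts y. z : elts y') --> y = y'" for x
  unfolding inter_single[symmetric]
  by (rule choice_iff[OF M, THEN iffD1, OF ch, rule_format, OF h''(1)]) (use h'' elts_hempty_iff in blast)+
 have t: "htrans A" unfolding htrans_def using tr by blast
 show "is_ctm A" unfolding is_ctm_def
  by (intro conjI ballI impI h t zfm_omega[OF M] 4 5 6 7 8 9; blast)
next
 assume "is_ctm A"
 then have h: "hempty : elts A" and t: "htrans A" and om: "omega : elts A"
  and 4: "ALL x:elts A. ALL y:elts A. EX b:elts A. x : elts b & y : elts b"
  and 5: "ALL x:elts A. EX b:elts A. ALL y:elts x. elts y \<subseteq> elts b"
  and 6: "ALL x:elts A. EX b:elts A. ALL y:elts A. elts y \<subseteq> elts x --> y : elts b"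
  and 7: "ALL x:elts A. ALL f:elts (Fenv A). ALL m:elts omega. ALL v:elts omega. hset {z : elts x. hupd f v z : elts (SatS A m)} : elts A"
  and 8: "ALL x:elts A. ALL f:elts (Fenv A). ALL m:elts omega. EX b:elts A. ALL z:elts x.
   (EX y:elts A. hupd (hupd f (hc_nat 0) z) (hc_nat 1) y : elts (SatS A m)) -->
   (EX y:elts b. hupd (hupd f (hc_nat 0) z) (hc_nat 1) y : elts (SatS A m))"
  and 9: "ALL x:elts A. (ALL y:elts x. y ~= hempty) -->
   (ALL y:elts x. ALL y':elts x. (EX z:elts y. z : elts y') --> y = y') -->
   (EX c:elts A. ALL y:elts x. EX u:elts y. ALL z:elts y. z : elts c <-> z = u)"
  unfolding is_ctm_def by blast+
 have tr: "y : elts A" if "x : elts A" "y : elts x" for x y using htransD[OF t that] .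
 have M: "elts A : zfm"
 proof (rule zfmI)
  show "hset {z : elts x. sat (\<S> (elts A)) (e(v := z)) p} : elts A"
   if p: "wf_fm {} {} p" and e: "range e \<subseteq> elts A" and x: "x : elts A" for p e v x
  proof -
   obtain m where m: "dec m = p" using dec_surj[OF p] by blast
   obtain f where f: "isfenv A f" "ALL i:fv p. fenv f i = e i" using fenv_approx[OF e fv_finite] by blast
   have "sat (\<S> (elts A)) (e(v := z)) p <-> sat (\<S> (elts A)) ((fenv f)(v := z)) p" for z
    by (rule sat_cong) (use f(2) in auto)
   then have "{z : elts x. sat (\<S> (elts A)) (e(v := z)) p} = {z : elts x. hupd f (hc_nat v) z : elts (SatS A (hc_nat m))}"
    using SatS_hupd[OF f(1) tr[OF x]] m by blast
   moreover have "hset {z : elts x. hupd f (hc_nat v) z : elts (SatS A (hc_nat m))} : elts A"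
    using 7[rule_format, OF x, of f "hc_nat m" "hc_nat v"] f(1) elts_Fenv by auto
   ultimately show ?thesis by simp
  qed
  show "EX b:elts A. ALL z:elts x. (EX y:elts A. sat (\<S> (elts A)) (e(0 := z, 1 := y)) p) -->
    (EX y:elts b. sat (\<S> (elts A)) (e(0 := z, 1 := y)) p)"
   if p: "wf_fm {} {} p" and e: "range e \<subseteq> elts A" and x: "x : elts A" for p e x
  proof -
   obtain m where m: "dec m = p" using dec_surj[OF p] by blast
   obtain f where f: "isfenv A f" "ALL i:fv p. fenv f i = e i" using fenv_approx[OF e fv_finite] by blast
   have c: "sat (\<S> (elts A)) (e(0 := z, 1 := y)) p <-> sat (\<S> (elts A)) ((fenv f)(0 := z, 1 := y)) p" for z y
    by (rule sat_cong) (use f(2) in auto)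
   have "f : elts (Fenv A)" "hc_nat m : elts omega" using f(1) by (simp_all only: elts_Fenv elts_omega rangeI)
   from 8[rule_format, OF x this] obtain b where b: "b : elts A" "ALL z:elts x.
    (EX y:elts A. hupd (hupd f (hc_nat 0) z) (hc_nat 1) y : elts (SatS A (hc_nat m))) -->
    (EX y:elts b. hupd (hupd f (hc_nat 0) z) (hc_nat 1) y : elts (SatS A (hc_nat m)))" by blast
   show ?thesis
   proof (intro bexI[OF _ b(1)] ballI impI)
    fix z assume z: "z : elts x" "EX y:elts A. sat (\<S> (elts A)) (e(0 := z, 1 := y)) p"
    note S = SatS_hupd2[OF f(1) tr[OF x z(1)], of _ m, unfolded m]
    have "EX y:elts A. hupd (hupd f (hc_nat 0) z) (hc_nat 1) y : elts (SatS A (hc_nat m))" using z(2) S unfolding c by blast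
    then obtain y where "y : elts b" "hupd (hupd f (hc_nat 0) z) (hc_nat 1) y : elts (SatS A (hc_nat m))" using b(2) z(1) by blast
    then show "EX y:elts b. sat (\<S> (elts A)) (e(0 := z, 1 := y)) p" unfolding c using S tr[OF b(1)] by blast
   qed
  qed
  show "EX b:elts A. x : elts b & y : elts b" if "x : elts A" "y : elts A" for x y using 4 that by blast
  show "EX b:elts A. ALL y:elts x. elts y \<subseteq> elts b" if "x : elts A" for x using 5 that by blast
  show "EX b:elts A. ALL y:elts A. elts y \<subseteq> elts x --> y : elts b" if "x : elts A" for x using 6 that by blast
  show "y : elts A" if "x : elts A" "y : elts x" for x y using tr that .
 qed (use h om in simp_all)
 have "models (\<S> (elts A)) ax_choice"
  unfolding choice_iff[OF M]
 proof (intro ballI impI)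
  fix x assume x: "x : elts A" "ALL y:elts x. elts y ~= {}" "ALL y:elts x. ALL y':elts x. elts y \<inter> elts y' ~= {} --> y = y'"
  show "EX c:elts A. ALL y:elts x. EX u. elts y \<inter> elts c = {u}"
   unfolding inter_single by (rule 9[rule_format, OF x(1)]) (use x(2,3) elts_hempty_iff in blast)+
 qed
 then show "elts A : ctms" using M ctms_zfm by blast
qed

section \<open>Dials\<close>

text \<open>Remainder modulo \<open>k\<close> by counting up and resetting at \<open>k\<close>. For
  a natural number, \<open>hunion x\<close> belongs to \<open>x\<close> exactly if \<open>x\<close>
  is a successor, and is then its predecessor.\<close>

function modr :: "nat => hc => hc" where
 "modr k x = (if hunion x : elts x then (if hsuc (modr k (hunion x)) = hc_nat k then hempty else hsuc (modr k (hunion x))) else hempty)"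
 by auto
termination by (relation "inv_image {(x, y). x : elts y} snd") (auto simp: wf_elts)

declare modr.simps [simp del]

lemma modr_nat: "k > 0 ==> modr k (hc_nat n) = hc_nat (n mod k)"
proof (induction n)
 case 0
 then show ?case by (subst modr.simps) simp
next
 case (Suc n)
 have u: "hunion (hc_nat (Suc n)) = hc_nat n" unfolding hc_nat_Suc by (rule hunion_hsuc[OF hord_hc_nat])
 have m: "hc_nat n : elts (hc_nat (Suc n))" by (simp only: hc_nat_less)
 have "modr k (hc_nat (Suc n)) = (if hsuc (hc_nat (n mod k)) = hc_nat k then hempty else hsuc (hc_nat (n mod k)))"
  by (subst modr.simps) (simp only: u m if_True Suc.IH[OF Suc.prems])
 also have "\<dots> = hc_nat (Suc n mod k)"
  unfolding hc_nat_Suc[symmetric] hc_nat_inject mod_Suc by simp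
 finally show ?case .
qed

definition pu :: "hc set => hc => hc => bool" where
 "pu M s x <-> le M (hsnd (hsnd (app s x))) (hfst (hsnd (app s x)))"

lemma pushed_pu: "n : pushed M (sY s) (sZ s) <-> pu M s (hc_nat n)"
 by (simp add: pushed_def pu_def sY_def sZ_def)

context zfmodels
begin

lemma dfun_modr [dfi]: "dfun n s ==> dfun n (%M e. modr k (s M e))"
proof (rule dfun_comp1[where F = "%M. modr k"])
 have "dfun 2 (%M e. modr k (e 1))"
 proof (rule dfun_mem_rec[where F = "%M z x. modr k x" and
   H = "%M z x f. if hunion x : elts x then (if hsuc (app f (hunion x)) = hc_nat k then hempty else hsuc (app f (hunion x))) else hempty"])
  show "dfun 3 (%M e. if hunion (e 1) : elts (e 1) then (if hsuc (app (e 2) (hunion (e 1))) = hc_nat k then hempty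
    else hsuc (app (e 2) (hunion (e 1)))) else hempty)" by (intro dfi) simp_all
  show "modr k x = (if hunion x : elts x then (if hsuc (app (lam x (modr k)) (hunion x)) = hc_nat k then hempty
    else hsuc (app (lam x (modr k)) (hunion x))) else hempty)" for x
   by (subst modr.simps) (cases "hunion x : elts x"; simp del: elts_hunion)
 qed
 from dfun_comp2[where F = "%M z x. modr k x", OF this dfun_hempty dfun_var, of 0 1]
 show "dfun 1 (%M e. modr k (e 0))" by simp
qed

lemma dfn_pu [dfi]: "dfun n s ==> dfun n t ==> dfn n (%M e. pu M (s M e) (t M e))"
 unfolding pu_def by (intro dfi)

end

definition dial :: "nat => hc set => nat => bool" where
 "dial k U j <-> (EX x:U. is_real x & (ALL y:U. is_real y --> y : LL x U) &
  (EX n. pu U (levs (LL x U)) (hc_nat n) & (ALL l<n. \<not> pu U (levs (LL x U)) (hc_nat l)) & n mod k = j))"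

lemma (in zfmodels) dfn_dial:
 assumes k: "k > 0" shows "dfn n (%M e. dial k M j)"
proof -
 have "dfn n (%M e. EX x:M. elts x \<subseteq> elts omega & (ALL y:M. elts y \<subseteq> elts omega --> y : LL x M) &
  (EX i:elts omega. pu M (levs (LL x M)) i & (ALL l:elts i. \<not> pu M (levs (LL x M)) l) & modr k i = hc_nat j))"
  by (intro dfi) simp_all
 moreover have "(EX i:elts omega. Q i & (ALL l:elts i. \<not> Q l) & modr k i = hc_nat j) <->
   (EX n. Q (hc_nat n) & (ALL l<n. \<not> Q (hc_nat l)) & n mod k = j)" for Q
  by (simp only: elts_omega bex_simps image_iff ball_simps elts_hc_nat modr_nat[OF k] hc_nat_inject) auto
 ultimately show ?thesis unfolding dial_def is_real_iff by (simp only:)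
qed

lemma dial_unique:
 assumes U: "U : ctms" and "dial k U i" "dial k U j" shows "i = j"
proof -
 have zf: "U : zfm" using U ctms_zfm by blast
 obtain x m where x: "x : U" "is_real x" "ALL y:U. is_real y --> y : LL x U" "pu U (levs (LL x U)) (hc_nat m)"
  "ALL l<m. \<not> pu U (levs (LL x U)) (hc_nat l)" "m mod k = i" using assms(2) unfolding dial_def by blast
 obtain x' m' where x': "x' : U" "is_real x'" "ALL y:U. is_real y --> y : LL x' U" "pu U (levs (LL x' U)) (hc_nat m')"
  "ALL l<m'. \<not> pu U (levs (LL x' U)) (hc_nat l)" "m' mod k = j" using assms(3) unfolding dial_def by blast
 interpret A: constructible U x using zf x by unfold_locales
 interpret B: constructible U x' using zf x' by unfold_locales
 have "LL x' U \<subseteq> LL x U" using A.LL_absolute(2)[of x'] x(3) x'(1,2) by blast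
 moreover have "LL x U \<subseteq> LL x' U" using B.LL_absolute(2)[of x] x'(3) x(1,2) by blast
 ultimately have eq: "LL x U = LL x' U" by blast
 have "m = m'" using x(4,5) x'(4,5) unfolding eq by (metis linorder_neqE_nat)
 then show ?thesis using x(6) x'(6) by simp
qed

locale reals_covered =
 assumes reals: "!!x. is_real x ==> EX W:ctms. x : W"
begin

text \<open>A real \<open>x\<close> coding \<open>u\<close> lies in some world. The class
  \<open>L[x]\<close> of that world is itself a world, satisfies its own \<open>L[x]\<close>
  description, and contains \<open>u\<close> since it contains the code.\<close>

lemma covered: "EX W:ctms. EX x:W. is_real x & LL x W = W & u : W"
proof -
 obtain x where x: "is_real x" "ALL M:zfm. x : M --> u : M" using real_codes[of u] by blast
 obtain V where V: "V : ctms" "x : V" using reals[OF x(1)] by blast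
 then have "V : zfm" using ctms_zfm by blast
 then interpret A: constructible V x using V x by unfold_locales
 show ?thesis using A.LL_ctms A.a_LL x A.LL_absolute(1)[OF A.a_LL x(1)] A.LL_zfm by blast
qed

lemma ctms_code: assumes "U : ctms" shows "elts (hset U) = U"
 using assms ctms_zfm zfm_countable by (intro elts_hset) blast

lemma member_sub: "W : ctms ==> U : ctms ==> hset U : W ==> U \<subseteq> W"
 using ctms_code[of U] zfm_trans[of W "hset U"] ctms_zfm by auto

lemma covered_ctm: assumes "U : ctms" shows "EX W:ctms. EX x:W. is_real x & LL x W = W & U \<subseteq> W"
 using covered[of "hset U"] member_sub[OF _ assms] by blast

lemma directed:
 assumes "U : ctms" "V : ctms" shows "EX W:ctms. U \<subseteq> W & V \<subseteq> W"
proof -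
 obtain W where W: "W : ctms" "upair (hset U) (hset V) : W" using covered[of "upair (hset U) (hset V)"] by blast
 have "W : zfm" using W ctms_zfm by blast
 then have "hset U : W" "hset V : W" using zfm_trans[OF _ W(2)] by auto
 then show ?thesis using W(1) member_sub assms by blast
qed

text \<open>In a world of the form \<open>L[x]\<close> none of its own levels is pushed. Pushing
  level \<open>j\<close> adds neither ordinals nor reals, so \<open>L[x]\<close> is unchanged and
  \<open>x\<close> still constructs all reals; \<open>j\<close> is then the least pushed
  level.\<close>

lemma dial_reach:
 assumes U: "U : ctms" and j: "j < k" shows "EX U':ctms. U \<subseteq> U' & dial k U' j"
proof -
 obtain W x where W: "W : ctms" "x : W" "is_real x" "LL x W = W" "U \<subseteq> W" using covered_ctm[OF U] by blast
 have zf: "W : zfm" using W(1) ctms_zfm by blast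
 let ?s = "levs W"
 obtain V where V: "V : ctms" "W \<subseteq> V" "pushed V (sY ?s) (sZ ?s) = insert j (pushed W (sY ?s) (sZ ?s))"
  "ALL z. hord z --> z : V --> z : W" "ALL y:V. elts y \<subseteq> elts (sX ?s 0) --> y : W"
  using push[OF W(1) lev_ok_levs[OF zf] _ levs_initial(1)[OF W(1)], of j] lev_parts_in[OF zf levs_in[OF zf]] by blast
 have zfV: "V : zfm" using V(1) ctms_zfm by blast
 have L: "LL x V = W"
  using LL_same_ordinals[of V W x] zf zfV W V(2,4) by blast
 have p: "pu V ?s (hc_nat n) <-> n = j" for n
  using V(3) levs_initial(2)[OF W(1)] unfolding pushed_pu[symmetric] by simp
 have "dial k V j" unfolding dial_def
 proof (intro bexI[of _ x] conjI exI[of _ j])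
  show "ALL y:V. is_real y --> y : LL x V" unfolding L is_real_iff using V(5) omega_levs[OF zf] by blast
 qed (use W V(2) j in \<open>auto simp: L p\<close>)
 then show ?thesis using V(1,2) W(5) by blast
qed

end

section \<open>Soundness\<close>

lemma ctm_system_simps [simp]:
 "worlds (ctm_system F R) = ctms" "acc (ctm_system F R) = (\<subseteq>)" "str (ctm_system F R) = (%W. eps_struc (F W) (R W) W)"
 by (simp_all add: ctm_system_def)

lemma modal_true_tautology: "tautology p ==> modal_true S U (map_modal \<sigma> p)"
 unfolding tautology_def by (erule allE[of _ "%q. modal_true S U (map_modal \<sigma> q)"]) simp

context reals_covered
begin

lemma S42_valid: "p : S42 ==> U : ctms ==> modal_true (ctm_system F R) U (map_modal \<sigma> p)"
 unfolding S42_def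
proof (induction p arbitrary: U rule: normal_logic.induct)
 case (ax p)
 from ax(1) consider q where "p = Imp (Box q) q" | q where "p = Imp (Box q) (Box (Box q))"
  | q where "p = Imp (Dia (Box q)) (Box (Dia q))" unfolding S4_axioms_def by blast
 then show ?case
 proof cases
  case 3
  show ?thesis unfolding 3
  proof (simp, intro impI ballI)
   fix V assume *: "EX V:ctms. U \<subseteq> V & (ALL V':ctms. V \<subseteq> V' --> modal_true (ctm_system F R) V' (map_modal \<sigma> q))" and V: "V : ctms"
   then obtain V1 where V1: "V1 : ctms" "ALL V':ctms. V1 \<subseteq> V' --> modal_true (ctm_system F R) V' (map_modal \<sigma> q)" by blast
   show "EX V':ctms. V \<subseteq> V' & modal_true (ctm_system F R) V' (map_modal \<sigma> q)"
    using directed[OF V V1(1)] V1(2) by blast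
  qed
 qed (use ax(2) in \<open>auto intro: order_trans\<close>)
next
 case (taut p) then show ?case by (intro modal_true_tautology)
qed auto

lemma S42_sub_Val: "W : ctms ==> S42 \<subseteq> Val (ctm_system F R) W L"
 unfolding Val_def using S42_valid by blast

lemma account: "potentialist_account C_sys H_omega1"
 unfolding potentialist_account_def C_sys_def H_omega1_def
proof (intro conjI ballI)
 fix W a assume "W : worlds (ctm_system (%_. no_fun) (%_. no_rel))"
 then have W: "W : ctms" by simp
 obtain V where V: "V : ctms" "upair (hset W) a : V" using covered[of "upair (hset W) a"] by blast
 then have "hset W : V" "a : V" using zfm_trans[of V "upair (hset W) a"] ctms_zfm by auto
 then show "EX U:worlds (ctm_system (%_. no_fun) (%_. no_rel)). acc (ctm_system (%_. no_fun) (%_. no_rel)) W U &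
   a : carrier (str (ctm_system (%_. no_fun) (%_. no_rel)) U)"
  using V(1) member_sub[OF V(1) W] by auto
qed (auto simp: substructure_def)

end

section \<open>Refuting formulas outside S5\<close>

text \<open>The dial restricted to the points above \<open>t\<close>, that is, to the greatest
  cluster. A dial without such a value is read as \<open>t\<close>, which makes the label
  total.\<close>

definition dl :: "nat => (nat => nat => bool) => nat => hc set => nat => bool" where
 "dl k R t U j <-> (dial k U j & R t j) \<or> (j = t & \<not> (EX i<k. R t i & dial k U i))"

lemma dl_ex1:
 assumes "U : ctms" "t < k" shows "EX! j. j < k & dl k R t U j"
proof (cases "EX i<k. R t i & dial k U i")
 case True
 then obtain i where i: "i < k" "R t i" "dial k U i" by blast
 have "dl k R t U j <-> j = i" for j unfolding dl_def using i dial_unique[OF assms(1)] by blast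
 then show ?thesis using i(1) by (intro ex1I[of _ i]) simp_all
next
 case False
 then have "j < k ==> dl k R t U j <-> j = t" for j unfolding dl_def by blast
 then show ?thesis using assms(2) by blast
qed

lemma (in zfmodels) dfn_dl: "k > 0 ==> dfn n (%M e. dl k R t M j)"
proof -
 assume "k > 0"
 note [dfi] = dfn_dial[OF this]
 show ?thesis unfolding dl_def by (intro dfi)
qed

lemma zfmodels_ctms: "K \<subseteq> ctms ==> (!!M. M : K ==> C \<subseteq> M) ==> countable C ==> zfmodels K C"
 by unfold_locales (use ctms_zfm in blast)+

lemma sentences_finite:
 fixes Fs :: "('g \<times> nat) set" and Rs :: "('h \<times> nat) set" and k :: nat
 assumes "zfmodels K C" and Q: "!!j. j < k ==> zfmodels.dfn K C 0 (%M e. Q M j)"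
  and nm: "!!c. c : C ==> (nm c, 0) : Fs" and F: "!!U c. U : K ==> c : C ==> F U (nm c) [] = c"
  and lab: "!!U j. U : K ==> j < k ==> lab U = j <-> Q U j" and lt: "!!U. U : K ==> lab U < k"
 shows "EX s:sentences Fs Rs. ALL U:K. models (eps_struc (F U) (R U) U) s <-> V (lab U)"
proof -
 interpret zfmodels K C by fact
 have "dfn 0 (%M e. EX j<k. V j & Q M j)"  by (intro dfn_finite_ex dfn_conj dfn_bool Q)
 from sentence_of[where nm = nm, OF this nm, where Rs = Rs] obtain s where s: "s : sentences Fs Rs"
  "ALL M:K. ALL F R. (ALL c:C. F (nm c) [] = c) --> (models (eps_struc F R M) s <-> (EX j<k. V j & Q M j))" by blast
 show ?thesis
 proof (intro bexI[OF _ s(1)] ballI)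
  fix U assume U: "U : K"
  then have "models (eps_struc (F U) (R U) U) s <-> (EX j<k. V j & Q U j)" using s(2) F by blast
  also have "\<dots> <-> V (lab U)" using lab[OF U] lt[OF U] by blast
  finally show "models (eps_struc (F U) (R U) U) s <-> V (lab U)" .
 qed
qed

definition sw :: "nat => nat => nat => nat" where
 "sw a b i = (if i = a then b else if i = b then a else i)"

lemma sw_simps [simp]: "sw a b (sw a b i) = i" "sw a b a = b"
 by (auto simp: sw_def)

context reals_covered
begin

text \<open>On a cluster the dial alone is a labelling. Its sentences need neither parameters nor
  additional symbols, so the bound holds at every world and for every language.\<close>

theorem Val_sub_S5:
 fixes Fs :: "('g \<times> nat) set" and Rs :: "('h \<times> nat) set"
 assumes W: "W : ctms" shows "Val (ctm_system F R) W (sentences Fs Rs) \<subseteq> S5"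
proof (rule subsetI, rule ccontr)
 fix \<phi> assume \<phi>: "\<phi> : Val (ctm_system F R) W (sentences Fs Rs)" "\<phi> ~: S5"
 obtain k :: nat and V r where k: "r < k" "\<not> ev {..<k} (%_ _. True) V r \<phi>" using S5_finite_model[OF \<phi>(2)] by blast
 let ?d = "dl k (%_ _. True) r"
 define d where "d U = (THE j. j < k & ?d U j)" for U
 have d: "d U < k" "?d U (d U)" if "U : ctms" for U
  using theI'[OF dl_ex1[OF that k(1), of "%_ _. True"]] unfolding d_def by blast+
 have d_iff: "d U = j <-> ?d U j" if "U : ctms" "j < k" for U j
  using d[OF that(1)] dl_ex1[OF that(1) k(1), of "%_ _. True"] that(2) by blast
 \<comment> \<open>All points of a cluster are alike for accessibility, so the labels may be
   permuted; this transposition gives \<open>W\<close> the label \<open>r\<close> whatever its dial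
   shows.\<close>
 define lab where "lab U = sw (d W) r (d U)" for U
 have sk: "sw (d W) r i < k" if "i < k" for i using that d(1)[OF W] k(1) by (auto simp: sw_def)
 interpret zfmodels "{U : ctms. W \<subseteq> U}" "{}" by (rule zfmodels_ctms) auto
 have "\<phi> ~: Val (ctm_system F R) W (sentences Fs Rs)"
 proof (rule labelling_refutes[where lab = lab and k = k and R = "%_ _. True" and V = V])
  show "lab U < k" if "U : worlds (ctm_system F R)" for U using that sk d(1) unfolding lab_def by simp
  show "\<not> ev {..<k} (%_ _. True) V (lab W) \<phi>" using k(2) by (simp add: lab_def)
  show "EX U':worlds (ctm_system F R). acc (ctm_system F R) U U' & lab U' = j"
   if h: "U : worlds (ctm_system F R)" "j < k" for U j
  proof -
   have "U : ctms" using h(1) by simp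
   then obtain U' where U': "U' : ctms" "U \<subseteq> U'" "dial k U' (sw (d W) r j)" using dial_reach[OF _ sk[OF h(2)]] by blast
   then have "d U' = sw (d W) r j" using d_iff[OF U'(1) sk[OF h(2)]] unfolding dl_def by blast
   then show ?thesis using U' by (intro bexI[of _ U']) (simp_all add: lab_def)
  qed
  fix n
  have "EX s:sentences Fs Rs. ALL U:{U : ctms. W \<subseteq> U}. models (eps_struc (F U) (R U) U) s <-> (%j. V j n) (lab U)"
  proof (rule sentences_finite[where Q = "%U j. EX i<k. sw (d W) r i = j & ?d U i" and C = "{}" and k = k and V = "%j. V j n"])
   show "zfmodels {U : ctms. W \<subseteq> U} {}" by unfold_locales
   have "k > 0" using k(1) by simp
   note [dfi] = dfn_dl[OF this]
   show "dfn 0 (%M e. EX i<k. sw (d W) r i = j & ?d M i)" for j by (intro dfi)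
   show "lab U < k" if "U : {U : ctms. W \<subseteq> U}" for U using that sk d(1) unfolding lab_def by simp
   show "lab U = j <-> (EX i<k. sw (d W) r i = j & ?d U i)" if "U : {U : ctms. W \<subseteq> U}" "j < k" for U j
    using that(1) d_iff[of U] d(1)[of U] unfolding lab_def by auto
  qed auto
  then show "EX s:sentences Fs Rs. ALL U:worlds (ctm_system F R). acc (ctm_system F R) W U -->
    (models (str (ctm_system F R) U) s <-> V (lab U) n)" by auto
 qed (use W in auto)
 then show False using \<phi>(1) by blast
qed

end

section \<open>Worlds with validities exactly S4.2\<close>

section \<open>Refuting formulas outside S4.2\<close>

text \<open>Everything that stops the pushed levels from spelling out a path in the frame: lost
  gaps, two levels whose remainders are not related by \<open>R\<close>, or no largest pushed level.
  Each of these is inherited by extensions.\<close>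

definition badS :: "nat => (nat => nat => bool) => hc set => hc => bool" where
 "badS k R M s <-> corrupt M (sX s) (sY s) (sZ s) \<or>
  (EX l m. m < l & pu M s (hc_nat m) & pu M s (hc_nat l) & \<not> R (m mod k) (l mod k)) \<or>
  (ALL m. EX l>m. pu M s (hc_nat l))"

text \<open>With no level pushed the label is the least point \<open>r\<close>, the label of
  \<open>W\<close> itself.\<close>

definition mx :: "nat => nat => hc set => hc => nat => bool" where
 "mx k r M s j <-> ((ALL n. \<not> pu M s (hc_nat n)) & j = r) \<or>
  (EX m. pu M s (hc_nat m) & (ALL l. pu M s (hc_nat l) --> l \<le> m) & m mod k = j)"

context zfmodels
begin

lemma dfn_badS:
 assumes k: "k > 0" shows "dfun n s ==> dfn n (%M e. badS k R M (s M e))"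
proof (rule dfn_comp1[where R = "badS k R"])
 have "dfn 1 (%M e. (EX x:elts omega. le M (hfst (hsnd (app (e 0) x))) (hfst (app (e 0) x)) \<or>
   le M (hfst (app (e 0) (hsuc x))) (Fn M (hfst (app (e 0) x)) (hsnd (hsnd (app (e 0) x))))) \<or>
  (EX l:elts omega. EX m:elts l. pu M (e 0) m & pu M (e 0) l &
   (EX i<k. EX j<k. \<not> R i j & modr k m = hc_nat i & modr k l = hc_nat j)) \<or>
  (ALL m:elts omega. EX l:elts omega. m : elts l & pu M (e 0) l))" by (intro dfi) simp_all
 then show "dfn 1 (%M e. badS k R M (e 0))"
 proof (rule dfn_cong)
  fix M and e :: "nat => hc"
  have 1: "(EX x:elts omega. le M (hfst (hsnd (app (e 0) x))) (hfst (app (e 0) x)) \<or>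
   le M (hfst (app (e 0) (hsuc x))) (Fn M (hfst (app (e 0) x)) (hsnd (hsnd (app (e 0) x))))) <->
   corrupt M (sX (e 0)) (sY (e 0)) (sZ (e 0))"
   unfolding corrupt_def sX_def sY_def sZ_def hc_nat_Suc elts_omega by blast
  have r: "(EX i<k. EX j<k. \<not> R i j & modr k (hc_nat m) = hc_nat i & modr k (hc_nat l) = hc_nat j) <-> \<not> R (m mod k) (l mod k)" for m l
   unfolding modr_nat[OF k] hc_nat_inject using mod_less_divisor[OF k] by blast
  have 2: "(EX l:elts omega. EX m:elts l. pu M (e 0) m & pu M (e 0) l &
   (EX i<k. EX j<k. \<not> R i j & modr k m = hc_nat i & modr k l = hc_nat j)) <->
   (EX l m. m < l & pu M (e 0) (hc_nat m) & pu M (e 0) (hc_nat l) & \<not> R (m mod k) (l mod k))"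
  proof -
   have "(EX l:elts omega. EX m:elts l. Q m l) <-> (EX l m. m < l & Q (hc_nat m) (hc_nat l))" for Q
    unfolding elts_omega by (auto simp: elts_hc_nat)
   then show ?thesis by (simp only: r)
  qed
  have 3: "(ALL m:elts omega. EX l:elts omega. m : elts l & pu M (e 0) l) <-> (ALL m. EX l>m. pu M (e 0) (hc_nat l))"
   unfolding elts_omega ball_simps bex_simps hc_nat_less by simp
  show "((EX x:elts omega. le M (hfst (hsnd (app (e 0) x))) (hfst (app (e 0) x)) \<or>
   le M (hfst (app (e 0) (hsuc x))) (Fn M (hfst (app (e 0) x)) (hsnd (hsnd (app (e 0) x))))) \<or>
  (EX l:elts omega. EX m:elts l. pu M (e 0) m & pu M (e 0) l &
   (EX i<k. EX j<k. \<not> R i j & modr k m = hc_nat i & modr k l = hc_nat j)) \<or>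
  (ALL m:elts omega. EX l:elts omega. m : elts l & pu M (e 0) l)) = badS k R M (e 0)"
   unfolding 1 2 3 badS_def ..
 qed
qed

lemma dfn_mx:
 assumes k: "k > 0" shows "dfun n s ==> dfn n (%M e. mx k r M (s M e) j)"
proof (rule dfn_comp1[where R = "%M s. mx k r M s j"])
 have "dfn 1 (%M e. ((ALL x:elts omega. \<not> pu M (e 0) x) & j = r) \<or>
  (EX m:elts omega. pu M (e 0) m & (ALL l:elts omega. pu M (e 0) l --> l : elts (hsuc m)) & modr k m = hc_nat j))"
  by (intro dfi) simp_all
 then show "dfn 1 (%M e. mx k r M (e 0) j)"
 proof (rule dfn_cong)
  fix M and e :: "nat => hc"
  have "hc_nat l : elts (hsuc (hc_nat m)) <-> l \<le> m" for l m
   unfolding hc_nat_Suc[symmetric] hc_nat_less by auto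
  then show "(((ALL x:elts omega. \<not> pu M (e 0) x) & j = r) \<or>
   (EX m:elts omega. pu M (e 0) m & (ALL l:elts omega. pu M (e 0) l --> l : elts (hsuc m)) & modr k m = hc_nat j)) = mx k r M (e 0) j"
   unfolding mx_def elts_omega ball_simps bex_simps modr_nat[OF k] hc_nat_inject by auto
 qed
qed

end

text \<open>Common to both cases. With a parameter, \<open>sq\<close> is constant and
  \<open>TT\<close> is false. Without one, \<open>sq\<close> computes the levels from
  \<open>L\<close> of the current world and \<open>TT\<close> says that this \<open>L\<close> can no
  longer be trusted to be \<open>W\<close>. \<open>TT_push\<close> keeps the collapse, which adds no
  ordinals, from setting \<open>TT\<close>.\<close>

locale labelled = reals_covered + zfmodels K C for K C +
 fixes W and k :: nat and R r t sq TT s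
 assumes KW: "K = {U : ctms. W \<subseteq> U}" and W: "W : ctms" and rt: "r < k" "t < k"
  and R_refl: "!!i. i < k ==> R i i"
  and R_trans: "!!i j l. i < k ==> j < k ==> l < k ==> R i j ==> R j l ==> R i l"
  and R_r: "!!i. i < k ==> R r i" and R_t: "!!i. i < k ==> R i t"
  and TT_mono: "!!U U'. U : K ==> U' : K ==> U \<subseteq> U' ==> TT U ==> TT U'"
  and sq: "!!U. U : K ==> \<not> TT U ==> sq U = s"
  and s_W: "s : W" and ok: "lev_ok (sX s) (sY s) (sZ s)"
  and TT_push: "!!U U'. U : K ==> U' : K ==> U \<subseteq> U' ==> \<not> TT U ==> (!!x. hord x ==> x : U' ==> x : U) ==> \<not> TT U'"
  and TT_W: "\<not> TT W" and ncor_W: "\<not> corrupt W (sX s) (sY s) (sZ s)" and empty_W: "pushed W (sY s) (sZ s) = {}"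
  and d_sq: "dfun 0 (%M e. sq M)" and d_TT: "dfn 0 (%M e. TT M)"
begin

definition bad :: "hc set => bool" where "bad U <-> TT U \<or> badS k R U s"

definition LB :: "hc set => nat => bool" where
 "LB U j <-> (if bad U then dl k R t U j else mx k r U s j)"

definition lab :: "hc set => nat" where "lab U = (THE j. j < k & LB U j)"

lemma k0: "k > 0" using rt by simp

lemma K_ctms: "U : K ==> U : ctms" and K_W: "U : K ==> W \<subseteq> U"
 using KW by blast+

lemma KI: "U : K ==> U' : ctms ==> U \<subseteq> U' ==> U' : K"
 using KW by blast

lemma W_K: "W : K" using KW W by blast

lemma pu_mono: "U \<subseteq> U' ==> pu U s x ==> pu U' s x"
 unfolding pu_def using le_mono order_refl by blast

lemma bad_mono: "U : K ==> U' : K ==> U \<subseteq> U' ==> bad U ==> bad U'"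
 unfolding bad_def badS_def using TT_mono corrupt_mono[OF K_ctms K_ctms] pu_mono by meson

lemma mx_ex1: assumes "\<not> bad U" shows "EX! j. j < k & mx k r U s j"
proof (cases "ALL n. \<not> pu U s (hc_nat n)")
 case True
 then have "mx k r U s j <-> j = r" for j unfolding mx_def by blast
 then show ?thesis by (intro ex1I[of _ r]) (use rt(1) in simp_all)
next
 case False
 let ?B = "{n. pu U s (hc_nat n)}"
 obtain b where b: "!!l. pu U s (hc_nat l) ==> l \<le> b" using assms unfolding bad_def badS_def by (metis not_le)
 have fin: "finite ?B" by (rule finite_subset[of _ "{..b}"]) (use b in auto)
 have ne: "?B ~= {}" using False by blast
 have m: "pu U s (hc_nat (Max ?B))" "!!l. pu U s (hc_nat l) ==> l \<le> Max ?B"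
  using Max_in[OF fin ne] Max_ge[OF fin] by blast+
 have "mx k r U s j <-> j = Max ?B mod k" for j
  unfolding mx_def using m False by (metis le_antisym)
 then show ?thesis by (intro ex1I[of _ "Max {n. pu U s (hc_nat n)} mod k"]) (use k0 in simp_all)
qed

lemma LB_ex1: "U : K ==> EX! j. j < k & LB U j"
 unfolding LB_def using dl_ex1[OF K_ctms rt(2), of U R] mx_ex1[of U] by (cases "bad U") simp_all

lemma lab: "U : K ==> lab U < k" "U : K ==> LB U (lab U)"
 using theI'[OF LB_ex1] unfolding lab_def by blast+

lemma lab_iff: "U : K ==> j < k ==> lab U = j <-> LB U j"
 using lab LB_ex1 by blast

lemma lab_bad: "U : K ==> bad U ==> R t (lab U)"
 using lab(2)[of U] R_refl[OF rt(2)] unfolding LB_def dl_def by auto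

lemma forth: assumes U: "U : K" "U' : K" "U \<subseteq> U'" shows "R (lab U) (lab U')"
proof (cases "bad U'")
 case True
 \<comment> \<open>Every label sees \<open>t\<close>, and the label of a bad world lies above
   \<open>t\<close>.\<close>
 show ?thesis using R_trans[OF lab(1)[OF U(1)] rt(2) lab(1)[OF U(2)] R_t[OF lab(1)[OF U(1)]] lab_bad[OF U(2) True]] .
next
 case nb': False
 then have nb: "\<not> bad U" using bad_mono[OF U] by blast
 have x: "mx k r U s (lab U)" "mx k r U' s (lab U')" using lab(2)[OF U(1)] lab(2)[OF U(2)] nb nb' unfolding LB_def by simp_all
 show ?thesis
 proof (cases "ALL n. \<not> pu U s (hc_nat n)")
  case True
  then have "lab U = r" using x(1) unfolding mx_def by blast
  then show ?thesis using R_r lab(1)[OF U(2)] by simp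
 next
  case False
  then obtain m where m: "pu U s (hc_nat m)" "m mod k = lab U" using x(1) unfolding mx_def by blast
  have "pu U' s (hc_nat m)" using pu_mono[OF U(3) m(1)] .
  then obtain m' where m': "pu U' s (hc_nat m')" "m \<le> m'" "m' mod k = lab U'" using x(2) unfolding mx_def by blast
  show ?thesis
  proof (cases "m = m'")
   case True then show ?thesis using m m' R_refl lab(1)[OF U(1)] by simp
  next
   case False
   then have "m < m'" using m'(2) by simp
   then have "R (m mod k) (m' mod k)" using nb' \<open>pu U' s (hc_nat m)\<close> m'(1) unfolding bad_def badS_def by blast
   then show ?thesis using m m' by simp
  qed
 qed
qed

lemma back_step:
 assumes U: "U : K" and j: "j < k" "R (lab U) j" shows "EX U':K. U \<subseteq> U' & lab U' = j"
proof (cases "bad U")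
 case True
 have "R t j" using R_trans[OF rt(2) lab(1)[OF U] j(1) lab_bad[OF U True] j(2)] .
 \<comment> \<open>A bad world keeps its label above \<open>t\<close>, so by transitivity
   \<open>j\<close> is above \<open>t\<close> too. The dial can be set to \<open>j\<close>, and the
   extension remains bad.\<close>
 obtain U' where U': "U' : ctms" "U \<subseteq> U'" "dial k U' j" using dial_reach[OF K_ctms[OF U] j(1)] by blast
 have K': "U' : K" using KI[OF U U'(1,2)] .
 have "LB U' j" unfolding LB_def using bad_mono[OF U K' U'(2) True] U'(3) \<open>R t j\<close> by (simp add: dl_def)
 then show ?thesis using lab_iff[OF K' j(1)] U'(2) K' by blast
next
 case nb: False
 obtain b where b: "!!l. pu U s (hc_nat l) ==> l \<le> b" using nb unfolding bad_def badS_def by (metis not_le)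
 \<comment> \<open>Above the bound \<open>b\<close> of all pushed levels, and congruent to
   \<open>j\<close> modulo \<open>k\<close>.\<close>
 define n where "n = k * Suc b + j"
 have nb': "b < n" unfolding n_def using k0 by (metis add_lessD1 less_add_same_cancel1 less_le_trans lessI mult.commute mult_le_mono2 nat_mult_1_right One_nat_def Suc_leI trans_le_add1)
 have nj: "n mod k = j" unfolding n_def using j(1) by (metis add.assoc mod_less mod_mult_self4 mult.right_neutral mod_mult_self2 add.commute mult.commute mod_add_self1)
 have zf: "U : zfm" using K_ctms[OF U] ctms_zfm by blast
 have sU: "s : U" using s_W K_W[OF U] by blast
 have nc: "\<not> corrupt U (sX s) (sY s) (sZ s)" using nb unfolding bad_def badS_def by blast
 obtain U' where U': "U' : ctms" "U \<subseteq> U'" "pushed U' (sY s) (sZ s) = insert n (pushed U (sY s) (sZ s))"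
  "\<not> corrupt U' (sX s) (sY s) (sZ s)" "ALL x. hord x --> x : U' --> x : U"
  using push[OF K_ctms[OF U] ok _ nc, of n] lev_parts_in[OF zf sU] by blast
 have K': "U' : K" using KI[OF U U'(1,2)] .
 have p: "pu U' s (hc_nat l) <-> l = n \<or> pu U s (hc_nat l)" for l using U'(3) unfolding pushed_pu[symmetric] by blast
 \<comment> \<open>Only pairs ending in the new level \<open>n\<close> need an argument: an older
   pushed level is related to the largest one, whose remainder is the label of \<open>U\<close>, and
   from there to \<open>j\<close>.\<close>
 have chain: "R (m mod k) (l mod k)" if h: "m < l" "pu U' s (hc_nat m)" "pu U' s (hc_nat l)" for m l
 proof (cases "l = n")
  case True
  then have mU: "pu U s (hc_nat m)" using h(1,2) p by simp
  have x: "mx k r U s (lab U)" using lab(2)[OF U] nb unfolding LB_def by simp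
  obtain m' where m': "pu U s (hc_nat m')" "m \<le> m'" "m' mod k = lab U" using x mU unfolding mx_def by blast
  have mk: "m mod k < k" "m' mod k < k" using mod_less_divisor[OF k0] by blast+
  have "R (m mod k) (m' mod k)"
  proof (cases "m = m'")
   case True then show ?thesis using R_refl mk by simp
  next
   case False then show ?thesis using nb mU m'(1,2) unfolding bad_def badS_def by (meson le_neq_implies_less)
  qed
  then show ?thesis using R_trans[OF mk j(1)] m'(3) j(2) nj True by simp
 next
  case False
  then have lU: "pu U s (hc_nat l)" using h(3) p by blast
  then have "m ~= n" using b[OF lU] h(1) nb' by simp
  then have "pu U s (hc_nat m)" using h(2) p by blast
  then show ?thesis using nb lU h(1) unfolding bad_def badS_def by blast
 qed
 have bound: "\<not> (ALL m. EX l>m. pu U' s (hc_nat l))"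
 proof
  assume "ALL m. EX l>m. pu U' s (hc_nat l)"
  then obtain l where "l > n" "pu U' s (hc_nat l)" by blast
  then have "pu U s (hc_nat l)" using p by simp
  then show False using b[of l] nb' \<open>l > n\<close> by simp
 qed
 have "\<not> TT U'" using TT_push[OF U K' U'(2)] nb U'(5) unfolding bad_def by blast
 then have nbad: "\<not> bad U'" unfolding bad_def badS_def using U'(4) chain bound by blast
 have "mx k r U' s j" unfolding mx_def
 proof (intro disjI2 exI[of _ n] conjI allI impI)
  show "pu U' s (hc_nat n)" using p by blast
  show "l \<le> n" if "pu U' s (hc_nat l)" for l using that p b[of l] nb' by auto
 qed (rule nj)
 then have "LB U' j" unfolding LB_def using nbad by simp
 then show ?thesis using lab_iff[OF K' j(1)] K' U'(2) by blast
qed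

lemma lab_W: "lab W = r"
proof -
 have e: "\<not> pu W s (hc_nat n)" for n using empty_W unfolding pushed_pu[symmetric] by blast
 have "\<not> bad W" unfolding bad_def badS_def using TT_W ncor_W e by blast
 then have "LB W r" unfolding LB_def mx_def using e by simp
 then show ?thesis using lab_iff[OF W_K rt(1)] by blast
qed

lemma dfn_LB: "dfn 0 (%M e. LB M j)"
proof -
 note [dfi] = dfn_badS[OF k0] dfn_mx[OF k0] dfn_dl[OF k0] d_TT d_sq
 have "dfn 0 (%M e. (TT M \<or> badS k R M (sq M)) & dl k R t M j \<or> \<not> (TT M \<or> badS k R M (sq M)) & mx k r M (sq M) j)"
  by (intro dfi)
 then show ?thesis
 proof (rule dfn_cong)
  fix M assume M: "M : K"
  show "((TT M \<or> badS k R M (sq M)) & dl k R t M j \<or> \<not> (TT M \<or> badS k R M (sq M)) & mx k r M (sq M) j) = LB M j"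
   unfolding LB_def bad_def using sq[OF M] by (cases "TT M") auto
 qed
qed

theorem refutes:
 fixes nm :: "hc => 'g" and Fs :: "('g \<times> nat) set" and Rs :: "('h \<times> nat) set"
 assumes nm: "!!c. c : C ==> (nm c, 0) : Fs" and F: "!!U c. U : K ==> c : C ==> F U (nm c) [] = c"
  and ne: "\<not> ev {..<k} R V r \<phi>"
 shows "\<phi> ~: Val (ctm_system F Q) W (sentences Fs Rs)"
proof (rule labelling_refutes[where lab = lab and k = k and R = R and V = V])
 have K: "U : K" if "U : worlds (ctm_system F Q)" "acc (ctm_system F Q) W U" for U using that KW by simp
 show "lab U < k" if "U : worlds (ctm_system F Q)" "acc (ctm_system F Q) W U" for U using lab(1)[OF K[OF that]] .
 show "R (lab U) (lab U')" if "U : worlds (ctm_system F Q)" "U' : worlds (ctm_system F Q)" "acc (ctm_system F Q) W U" "acc (ctm_system F Q) U U'" for U U'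
  using forth[OF K[OF that(1,3)]] KI[OF K[OF that(1,3)]] that by simp
 show "EX U':worlds (ctm_system F Q). acc (ctm_system F Q) U U' & lab U' = j"
  if "U : worlds (ctm_system F Q)" "acc (ctm_system F Q) W U" "j < k" "R (lab U) j" for U j
  using back_step[OF K[OF that(1,2)] that(3,4)] K_ctms by auto
 show "\<not> ev {..<k} R V (lab W) \<phi>" using ne lab_W by simp
 fix n
 have "EX s:sentences Fs Rs. ALL U:K. models (eps_struc (F U) (Q U) U) s <-> (%j. V j n) (lab U)"
 proof (rule sentences_finite[where Q = LB and C = C and k = k and nm = nm])
  show "zfmodels K C" by unfold_locales
 qed (use dfn_LB nm F lab_iff lab(1) in blast)+
 then show "EX s:sentences Fs Rs. ALL U:worlds (ctm_system F Q). acc (ctm_system F Q) W U -->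
   (models (str (ctm_system F Q) U) s <-> V (lab U) n)" using KW by auto
qed (use W in auto)

end

context reals_covered
begin

theorem Val_param_S42: assumes W: "W : ctms" shows "Val_param W = S42"
proof
 show "S42 \<subseteq> Val_param W" unfolding Val_param_def by (rule S42_sub_Val[OF W])
 show "Val_param W \<subseteq> S42"
 proof (rule subsetI, rule ccontr)
  fix \<phi> assume \<phi>: "\<phi> : Val_param W" "\<phi> ~: S42"
  obtain k :: nat and R V r t where F: "r < k" "t < k" "!!i. i < k ==> R i i"
   "!!i j l. i < k ==> j < k ==> l < k ==> R i j ==> R j l ==> R i l"
   "!!i. i < k ==> R r i" "!!i. i < k ==> R i t" "\<not> ev {..<k} R V r \<phi>"
   by (rule S42_finite_model[OF \<phi>(2)]) blast
  have zf: "W : zfm" using W ctms_zfm by blast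
  have s: "levs W : W" by (rule levs_in[OF zf])
  interpret Z: zfmodels "{U : ctms. W \<subseteq> U}" "{levs W}" by (rule zfmodels_ctms) (use s in auto)
  interpret labelled "{U : ctms. W \<subseteq> U}" "{levs W}" W k R r t "%_. levs W" "%_. False" "levs W"
  proof
   show "Z.dfun 0 (%M e. levs W)" by (rule Z.dfun_const) simp
   show "Z.dfn 0 (%M e. False)" by (rule Z.dfn_bool)
   show "lev_ok (sX (levs W)) (sY (levs W)) (sZ (levs W))" by (rule lev_ok_levs[OF zf])
   show "R i l" if "i < k" "j < k" "l < k" "R i j" "R j l" for i j l using F(4) that by blast
  qed (use F(1,2,3,5,6) W s levs_initial[OF W] in simp_all)
  have "\<phi> ~: Val_param W" unfolding Val_param_def
   by (rule refutes[where nm = "%c. c", OF _ _ F(7)]) (use s in auto)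
  then show False using \<phi>(1) by blast
 qed
qed

text \<open>Sentences without parameters are also sentences of the larger language. As the symbol
  types differ, \<open>cst Var\<close> copies them.\<close>

lemma Val_param_Val_set: "Val_param W \<subseteq> Val_set W"
proof
 fix p assume p: "p : Val_param W"
 let ?P = "ctm_system (%_ a _. a) (%_. no_rel) :: (hc set, hc, hc, unit) psystem"
 show "p : Val_set W" unfolding Val_set_def Val_def
 proof (clarify)
  fix \<sigma> :: "nat => set_fm" assume s: "ALL n. \<sigma> n : sentences {} {}"
  define \<tau> :: "nat => (hc, unit) fm" where "\<tau> n = cst Var (\<sigma> n)" for n
  have wf: "wf_fm {} {} (\<sigma> n)" "fv (\<sigma> n) = {}" for n using s unfolding sentences_def by blast+
  have t: "\<tau> n : sentences {(a, 0) | a. a : W} {}" for n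
  proof -
   have "fv (\<tau> n) \<subseteq> {i : fv (\<sigma> n). (Var i :: hc trm) = Var i}" unfolding \<tau>_def by (rule fv_cst[OF wf(1)]) simp
   moreover have "wf_fm {(a, 0) | a. a : W} {} (\<tau> n)" unfolding \<tau>_def by (rule wf_cst[OF wf(1)]) simp
   ultimately show ?thesis using wf(2)[of n] unfolding sentences_def by auto
  qed
  have m: "models (eps_struc (%a _. a) no_rel U) (\<tau> n) <-> models (\<S> U) (\<sigma> n)" for U n
  proof -
   have "sat (eps_struc (%a _. a) no_rel U) e (\<tau> n) <-> sat (\<S> U) e (\<sigma> n)" for e
    unfolding \<tau>_def using sat_cst[OF wf(1), of Var "%a _. a" no_rel U e n] by simp
   then show ?thesis unfolding models_def by simp
  qed
  have "modal_true ?P U (map_modal \<tau> q) <-> modal_true C_sys U (map_modal \<sigma> q)" for q U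
   by (induction q arbitrary: U) (simp_all add: m C_sys_def)
  moreover have "modal_true ?P W (map_modal \<tau> p)" using p t unfolding Val_param_def Val_def by blast
  ultimately show "modal_true C_sys W (map_modal \<sigma> p)" by blast
 qed
qed

lemma Val_set_S5: "W : ctms ==> Val_set W \<subseteq> S5"
 unfolding Val_set_def C_sys_def by (rule Val_sub_S5)

section \<open>A world with parameter-free validities S4.2\<close>

definition ords :: "hc set => hc" where "ords U = hset {x : U. hord x}"

definition tall :: "hc set => bool" where "tall U <-> (EX x:U. hord x & is_ctm (Lx hempty x))"

lemma elts_ords: "U : zfm ==> elts (ords U) = {x : U. hord x}"
 unfolding ords_def by (rule elts_hset) (rule countable_subset[OF _ zfm_countable], auto)

lemma hord_ords: "U : zfm ==> hord (ords U)"
proof -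
 assume U: "U : zfm"
 have "elts y \<subseteq> {x : U. hord x} & htrans y" if "y : U" "hord y" for y
  using zfm_trans[OF U that(1)] hord_mem[OF that(2)] that(2) hord_def by blast
 then show "hord (ords U)" unfolding hord_def[of "ords U"] htrans_def[of "ords U"] elts_ords[OF U] by blast
qed

lemma constructible_hempty: "U : zfm ==> constructible U hempty"
proof
 assume U: "U : zfm"
 interpret zfmodels "{U}" U using U by (rule zfm_zfmodels)
 show "hempty : U" by (rule zfm_hempty[OF U])
qed (auto simp: is_real_def)

theorem Val_set_S42: "EX W:ctms. Val_set W = S42"
proof -
 \<comment> \<open>Heights of worlds that equal their own \<open>L\<close>; the least one singles
   out \<open>W\<close>.\<close>
 let ?Q = "%\<alpha>. EX U:ctms. LL hempty U = U & \<alpha> = ords U"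
 have LLQ: "?Q (ords (LL hempty U))" if "U : zfm" for U
 proof -
  interpret constructible U hempty by (rule constructible_hempty[OF that])
  show ?thesis using LL_ctms LL_absolute(1)[OF a_LL real] by blast
 qed
 obtain U0 where "U0 : ctms" using covered by blast
 then have "U0 : zfm" using ctms_zfm by blast
 from LLQ[OF this] have Q0: "?Q (ords (LL hempty U0))" .
 obtain \<alpha> where al: "?Q \<alpha>" "!!z. z : elts \<alpha> ==> \<not> ?Q z" by (rule hmin[of ?Q, OF Q0]) blast
 then obtain W where W: "W : ctms" "LL hempty W = W" "\<alpha> = ords W" by blast
 have zf: "W : zfm" using W(1) ctms_zfm by blast
 interpret A: constructible W hempty by (rule constructible_hempty[OF zf])
 \<comment> \<open>A stage inside \<open>W\<close> that is a world has an \<open>L\<close> which is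
   again a world of this kind. Its height is at most the rank of the stage, hence an ordinal of
   \<open>W\<close>, against minimality.\<close>
 have ntall: "\<not> tall W"
 proof
  assume "tall W"
  then obtain x where x: "x : W" "hord x" "elts (Lx hempty x) : ctms" unfolding tall_def is_ctm_iff by blast
  let ?l = "Lx hempty x"
  have zl: "elts ?l : zfm" using x(3) ctms_zfm by blast
  interpret B: constructible "elts ?l" hempty by (rule constructible_hempty[OF zl])
  have q: "?Q (ords (LL hempty (elts ?l)))" by (rule LLQ[OF zl])
  have r: "rk ?l : W" by (rule A.rk_in[OF A.Lx_in[OF x(1)]])
  have "elts (ords (LL hempty (elts ?l))) \<subseteq> elts (rk ?l)"
  proof
   fix y assume "y : elts (ords (LL hempty (elts ?l)))"
   then have "y : elts ?l" "hord y" unfolding elts_ords[OF B.LL_zfm] using B.LL_sub by blast+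
   then show "y : elts (rk ?l)" using rk_mem[of y ?l] rk_hord[of y] by simp
  qed
  then have "ords (LL hempty (elts ?l)) = rk ?l \<or> ords (LL hempty (elts ?l)) : elts (rk ?l)"
   using hord_subset[OF hord_ords[OF B.LL_zfm] hord_rk] by blast
  then have "ords (LL hempty (elts ?l)) : W" using r zfm_trans[OF zf r] by metis
  then have "ords (LL hempty (elts ?l)) : elts \<alpha>" unfolding W(3) elts_ords[OF zf] using hord_ords[OF B.LL_zfm] by blast
  then show False using al(2) q by blast
 qed
 \<comment> \<open>\<open>W\<close> is the stage indexed by its own height. An extension containing
   that ordinal therefore has \<open>W\<close> as one of its stages.\<close>
 have LW: "elts (Lx hempty (ords W)) = W"
 proof
  show "elts (Lx hempty (ords W)) \<subseteq> W"
  proof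
   fix u assume "u : elts (Lx hempty (ords W))"
   then consider "u : elts (Lbase hempty)" | y where "y : W" "u : elts (Def (Lx hempty y))"
    unfolding elts_Lx[of hempty "ords W"] elts_ords[OF zf] by blast
   then have "u : LL hempty W"
   proof cases
    case 1
    then have "u : elts (Lx hempty hempty)" unfolding elts_Lx[of hempty hempty] by blast
    then show ?thesis using A.Lx_sub_LL[OF A.a] by blast
   next
    case 2
    then have "u : elts (Lx hempty (upair y y))" unfolding elts_Lx[of hempty "upair y y"] by simp
    then show ?thesis using A.Lx_sub_LL[OF A.upair_U[OF 2(1) 2(1)]] by blast
   qed
   then show "u : W" using W(2) by simp
  qed
  show "W \<subseteq> elts (Lx hempty (ords W))"
  proof
   fix u assume "u : W"
   then obtain b where b: "b : W" "hord b" "u : elts (Lx hempty b)" using A.LL_hord_iff W(2) by blast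
   then have "b : elts (ords W)" unfolding elts_ords[OF zf] by blast
   then show "u : elts (Lx hempty (ords W))" using Lx_sub[OF A.real] b(3) by blast
  qed
 qed
 \<comment> \<open>An ordinal of \<open>U\<close> outside \<open>W\<close> would put
   \<open>ords W\<close> into \<open>U\<close>, and the stage at \<open>ords W\<close> is the world
   \<open>W\<close>; so \<open>U\<close> would be tall. With the same ordinals both worlds have the
   same \<open>L\<close>.\<close>
 have same: "LL hempty U = W" if U: "U : ctms" "W \<subseteq> U" "\<not> tall U" for U
 proof -
  have zU: "U : zfm" using U(1) ctms_zfm by blast
  have "x : W" if x: "hord x" "x : U" for x
  proof (rule ccontr)
   assume n: "x ~: W"
   have "elts (ords W) \<subseteq> elts x"
   proof
    fix y assume "y : elts (ords W)"
    then have y: "y : W" "hord y" unfolding elts_ords[OF zf] by blast+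
    then show "y : elts x" using hord_linear[OF y(2) x(1)] n zfm_trans[OF zf y(1)] by blast
   qed
   then have "ords W = x \<or> ords W : elts x" using hord_subset[OF hord_ords[OF zf] x(1)] by blast
   then have "ords W : U" using x(2) zfm_trans[OF zU x(2)] by blast
   then have "tall U" unfolding tall_def is_ctm_iff using hord_ords[OF zf] LW W(1) by auto
   then show False using U(3) by blast
  qed
  then have "LL hempty U = LL hempty W"
   using LL_same_ordinals[OF zU zf, of hempty] A.a A.real U(2) by blast
  then show ?thesis using W(2) by simp
 qed
 have "Val_set W \<subseteq> S42"
 proof (rule subsetI, rule ccontr)
  fix \<phi> assume \<phi>: "\<phi> : Val_set W" "\<phi> ~: S42"
  obtain k :: nat and R V r t where F: "r < k" "t < k" "!!i. i < k ==> R i i"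
   "!!i j l. i < k ==> j < k ==> l < k ==> R i j ==> R j l ==> R i l"
   "!!i. i < k ==> R r i" "!!i. i < k ==> R i t" "\<not> ev {..<k} R V r \<phi>"
   by (rule S42_finite_model[OF \<phi>(2)]) blast
  interpret Z: zfmodels "{U : ctms. W \<subseteq> U}" "{}" by (rule zfmodels_ctms) auto
  interpret labelled "{U : ctms. W \<subseteq> U}" "{}" W k R r t "%U. levs (LL hempty U)" tall "levs W"
  proof
   show "Z.dfun 0 (%M e. levs (LL hempty M))" by (intro dfi)
   show "Z.dfn 0 (%M e. tall M)" unfolding tall_def by (intro dfi) simp_all
   show "lev_ok (sX (levs W)) (sY (levs W)) (sZ (levs W))" by (rule lev_ok_levs[OF zf])
   show "R i l" if "i < k" "j < k" "l < k" "R i j" "R j l" for i j l using F(4) that by blast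
   show "tall U'" if "U : {U : ctms. W \<subseteq> U}" "U' : {U : ctms. W \<subseteq> U}" "U \<subseteq> U'" "tall U" for U U'
    using that unfolding tall_def by blast
   show "levs (LL hempty U) = levs W" if "U : {U : ctms. W \<subseteq> U}" "\<not> tall U" for U using same that by simp
   show "\<not> tall U'" if "U : {U : ctms. W \<subseteq> U}" "\<not> tall U" "!!x. hord x ==> x : U' ==> x : U" for U U'
    using that unfolding tall_def by blast
  qed (use F(1,2,3,5,6) W ntall levs_in[OF zf] levs_initial[OF W(1)] in simp_all)
  have "\<phi> ~: Val_set W" unfolding Val_set_def C_sys_def
   by (rule refutes[where nm = "%_. ()", OF _ _ F(7)]) auto
  then show False using \<phi>(1) by blast
 qed
 moreover have "S42 \<subseteq> Val_set W" unfolding Val_set_def C_sys_def by (rule S42_sub_Val[OF W(1)])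
 ultimately show ?thesis using W(1) by blast
qed

end

section \<open>A world with validities S5\<close>

instance trm :: (countable) countable by countable_datatype
instance fm :: (countable, countable) countable by countable_datatype
instance modal :: (countable) countable by countable_datatype

lemma wf_trm_symbols: "wf_trm Fs t ==> set_trm t \<subseteq> fst ` Fs"
proof (induction t)
 case (Fun f ts)
 then have "f : fst ` Fs" "!!t. t : set ts ==> set_trm t \<subseteq> fst ` Fs" by (auto intro: rev_image_eqI)
 then show ?case by auto
qed simp

lemma wf_fm_symbols: "wf_fm Fs Rs p ==> set1_fm p \<subseteq> fst ` Fs & set2_fm p \<subseteq> fst ` Rs"
 by (induction p) (use wf_trm_symbols in \<open>force+\<close>)

text \<open>The symbol types may be uncountable. Numbering the symbols that occur in the signature
  exhibits all assertions as images of assertions over the symbol type \<open>nat\<close>.\<close>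

lemma countable_assertions:
 assumes "countable Fs" "countable Rs"
 shows "countable {\<psi> :: ('f, 'r) fm modal. set_modal \<psi> \<subseteq> sentences Fs Rs}"
proof -
 let ?A = "fst ` Fs" and ?B = "fst ` Rs"
 have cA: "countable ?A" "countable ?B" using assms by auto
 let ?f = "map_fm (from_nat_into ?A) (from_nat_into ?B)" and ?g = "map_fm (to_nat_on ?A) (to_nat_on ?B)"
 have inv: "?f (?g p) = p" if "p : sentences Fs Rs" for p
 proof -
  have s: "set1_fm p \<subseteq> ?A" "set2_fm p \<subseteq> ?B" using that wf_fm_symbols unfolding sentences_def by blast+
  have "map_fm (from_nat_into ?A \<circ> to_nat_on ?A) (from_nat_into ?B \<circ> to_nat_on ?B) p = map_fm id id p"
   by (intro fm.map_cong0) (simp_all add: cA subsetD[OF s(1)] subsetD[OF s(2)])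
  then show ?thesis by (simp add: fm.map_comp fm.map_id)
 qed
 have "\<psi> = map_modal ?f (map_modal ?g \<psi>)" if "set_modal \<psi> \<subseteq> sentences Fs Rs" for \<psi>
 proof -
  have "map_modal (?f \<circ> ?g) \<psi> = map_modal id \<psi>" using that inv by (intro modal.map_cong0) auto
  then show ?thesis by (simp add: modal.map_comp modal.map_id)
 qed
 then have "{\<psi>. set_modal \<psi> \<subseteq> sentences Fs Rs} \<subseteq> range (map_modal ?f)" by blast
 then show ?thesis by (rule countable_subset) simp
qed

context reals_covered
begin

theorem Val_S5:
 fixes Fs :: "('f \<times> nat) set" and Rs :: "('r \<times> nat) set"
 assumes c: "countable Fs" "countable Rs"
 shows "EX W:ctms. Val (ctm_system F R) W (sentences Fs Rs) = S5"
proof -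
 let ?S = "ctm_system F R" and ?\<Psi> = "{\<psi> :: ('f, 'r) fm modal. set_modal \<psi> \<subseteq> sentences Fs Rs}"
 define E where "E = from_nat_into ?\<Psi>"
 have "Falsity : ?\<Psi>" by simp
 then have rE: "range E = ?\<Psi>" unfolding E_def using range_from_nat_into[OF _ countable_assertions[OF c]] by blast
 let ?box = "%V n. ALL V':ctms. V \<subseteq> V' --> modal_true ?S V' (E n)"
 \<comment> \<open>The next world makes the \<open>n\<close>-th assertion necessary whenever some
   extension does.\<close>
 let ?step = "%n U V. V : ctms & U \<subseteq> V & ((EX V:ctms. U \<subseteq> V & ?box V n) --> ?box V n)"
 have ex: "EX V. ?step n U V" if "U : ctms" for n U
 proof (cases "EX V:ctms. U \<subseteq> V & ?box V n")
  case True
  then obtain V where "V : ctms" "U \<subseteq> V" "?box V n" by blast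
  then show ?thesis by (intro exI[of _ V]) simp
 next
  case False
  then show ?thesis using that by (intro exI[of _ U] conjI impI) blast+
 qed
 obtain U0 where U0: "U0 : ctms" using covered by blast
 define w where "w = rec_nat U0 (%n U. SOME V. ?step n U V)"
 have wS: "w (Suc n) = (SOME V. ?step n (w n) V)" for n by (simp add: w_def)
 have wc: "w n : ctms" for n
 proof (induction n)
  case 0 then show ?case using U0 by (simp add: w_def)
 next
  case (Suc n) then show ?case using someI_ex[OF ex[OF Suc, of n]] unfolding wS by blast
 qed
 have st: "?step n (w n) (w (Suc n))" for n using someI_ex[OF ex[OF wc, of n n]] unfolding wS by blast
 obtain W where W: "W : ctms" "hset (range (%n. hset (w n))) : W" using covered by blast
 have "hset (w n) : W" for n
  using zfm_trans[of W, OF _ W(2), of "hset (w n)"] W(1) ctms_zfm by auto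
 then have wW: "w n \<subseteq> W" for n using member_sub[OF W(1) wc] by blast
 \<comment> \<open>An assertion that is possibly necessary above \<open>W\<close> was so at
   \<open>w n\<close>, hence it became necessary at \<open>w (Suc n)\<close> and holds in all
   extensions of \<open>W\<close>.\<close>
 have five: "modal_true ?S U \<psi>" if U: "U : ctms" "W \<subseteq> U" "\<psi> : ?\<Psi>" "V : ctms" "U \<subseteq> V"
   "ALL V':ctms. V \<subseteq> V' --> modal_true ?S V' \<psi>" for U V \<psi>
 proof -
  have "\<psi> : range E" using rE U(3) by blast
  then obtain n where n: "\<psi> = E n" by blast
  have "w n \<subseteq> V" using wW[of n] U(2,5) by blast
  then have "EX V:ctms. w n \<subseteq> V & ?box V n" using U(4,6) unfolding n by blast
  then have "?box (w (Suc n)) n" using st[of n] by blast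
  then show ?thesis using U(1,2) wW[of "Suc n"] unfolding n by blast
 qed
 have "S5 \<subseteq> Val ?S W (sentences Fs Rs)"
 proof
  fix p assume p: "p : S5"
  show "p : Val ?S W (sentences Fs Rs)" unfolding Val_def
  proof (clarify)
   fix \<sigma> :: "nat => ('f, 'r) fm" assume s: "ALL n. \<sigma> n : sentences Fs Rs"
   \<comment> \<open>Necessitation forces the induction to cover all extensions of \<open>W\<close>
     simultaneously.\<close>
   have "modal_true ?S U (map_modal \<sigma> p)" if "U : ctms" "W \<subseteq> U" for U
    using p[unfolded S5_def] that
   proof (induction p arbitrary: U rule: normal_logic.induct)
    case (ax p)
    from ax(1) consider q where "p = Imp (Box q) q" | q where "p = Imp (Box q) (Box (Box q))"
     | q where "p = Imp (Dia (Box q)) q" unfolding S4_axioms_def by blast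
    then show ?case
    proof cases
     case 3
     have "map_modal \<sigma> q : ?\<Psi>" using s by (auto simp: modal.set_map)
     then show ?thesis unfolding 3 using five[OF ax(2,3)] by auto
    qed (use ax(2) in \<open>auto intro: order_trans\<close>)
   next
    case (taut p) then show ?case by (intro modal_true_tautology)
   qed auto
   then show "modal_true ?S W (map_modal \<sigma> p)" using W(1) by blast
  qed
 qed
 then show ?thesis using Val_sub_S5[OF W(1), of F R Fs Rs] W(1) by blast
qed

end

theorem theorem32:
  assumes reals_in_ctms: "\<forall>x. is_real x \<longrightarrow> (\<exists>W\<in>ctms. x \<in> W)"
  shows
    "potentialist_account C_sys H_omega1 \<and>
     (\<forall>W\<in>ctms. S42 = Val_param W \<and> Val_param W \<subseteq> Val_set W \<and> Val_set W \<subseteq> S5) \<and>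
     (\<exists>W\<in>ctms. S42 = Val_param W \<and> Val_param W = Val_set W) \<and>
     (\<forall>(Fs :: ('f \<times> nat) set) (Rs :: ('r \<times> nat) set) F R.
        countable Fs \<and> countable Rs \<and> interpreted_in_ctms Fs F \<longrightarrow>
        (\<exists>W\<in>ctms. Val (ctm_system F R) W (sentences Fs Rs) = S5))"
proof -
 interpret reals_covered using reals_in_ctms by unfold_locales blast
 show ?thesis
  using account Val_param_S42 Val_param_Val_set Val_set_S5 Val_set_S42 Val_S5 by metis
qed

end
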